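(* The characters of the indecomposable tilting modules over $U_q(\mathfrak{sl}_2)$ are $$\mathrm{ch}_{T(k_1l+k_0)}(x)=\begin{cases}\dfrac{x^{k_0+1}-x^{-(k_0+1)}}{x-x^{-1}},&\text{if }0\le k_0\le l-1\text{ and }k_1=0,\\[2mm]\dfrac{x^{(k_1+1)l}-x^{-(k_1+1)l}}{x-x^{-1}},&\text{if }k_0=l-1\text{ and }k_1\in\mathbb{Z}_{>0},\\[2mm](x^{k_0+1}+x^{-(k_0+1)})\dfrac{x^{k_1l}-x^{-k_1l}}{x-x^{-1}},&\text{if }0\le k_0\le l-2\text{ and }k_1\in\mathbb{Z}_{>0}.\end{cases}$$
   Context: Let $l\ge 3$ be an odd integer, $a$ an integer coprime to $l$, and $q=e^{\pi i a/l}$, assumed to be a primitive $2l$-th root of unity (so $q^l=-1$). For a formal variable $v$, $U_v(\mathfrak{sl}_2)$ is the Hopf algebra over $\mathbb{Q}(v)$ generated by $E,F,K^{\pm1}$ with $KK^{-1}=K^{-1}K=1$, $KE=v^2EK$, $KF=v^{-2}FK$, $EF-FE=\frac{K-K^{-1}}{v-v^{-1}}$, coproduct $\Delta E=E\otimes 1+K\otimes E$, $\Delta F=F\otimes K^{-1}+1\otimes F$, $\Delta K^{\pm1}=K^{\pm1}\otimes K^{\pm1}$, counit $\varepsilon(E)=\varepsilon(F)=0$, $\varepsilon(K^{\pm1})=1$, antipode $S(E)=-K^{-1}E$, $S(F)=-FK$, $S(K)=K^{-1}$. Put $[n]=\frac{v^n-v^{-n}}{v-v^{-1}}$, $[n]!=\prod_{s=1}^n[s]$,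 ${n\brack r}=\prod_{s=1}^r\frac{v^{n-s+1}-v^{-n+s-1}}{v^s-v^{-s}}$ for $n\in\mathbb{Z}$, $r\ge 0$, and ${K;c\brack t}=\prod_{s=1}^t\frac{Kv^{c-s+1}-K^{-1}v^{-c+s-1}}{v^s-v^{-s}}$. Let $\mathcal{A}=\mathbb{Z}[v,v^{-1}]$, let $U_{\mathcal{A}}$ be the $\mathcal{A}$-subalgebra generated by $K^{\pm1}$, $E^{(n)}=E^n/[n]!$, $F^{(n)}=F^n/[n]!$ ($n\ge0$), and $U_q(\mathfrak{sl}_2)=U_{\mathcal{A}}\otimes_{\mathcal{A}}\mathbb{Q}(q)$, $v\mapsto q$ (quantum integers and binomials are then evaluated at $q$). For $n\ge 0$ the Weyl module $W(n)$ has basis $x,F^{(1)}x,\dots,F^{(n)}x$ with (setting $F^{(t)}x=0$ for $t<0$ or $t>n$) $K F^{(t)}x=q^{n-2t}F^{(t)}x$, ${K;0\brack l}F^{(t)}x={n-2t\brack l}F^{(t)}x$, $FF^{(t)}x=[t+1]F^{(t+1)}x$, $EF^{(t)}x=[n-t+1]F^{(t-1)}x$, $F^{(l)}F^{(t)}x={l+t\brack l}F^{(l+t)}x$, $E^{(l)}F^{(t)}x={n+l-t\brack l}F^{(t-l)}x$. The dual Weyl module is $W^*(n)=\mathrm{Hom}(W(n),\mathbb{Q}(q))$. A tilting module (of type $\mathbf{1}$) is a finite dimensional module having both a filtration with subquotients Weyl modules and a filtration with subquotients dual Weyl modules. For each $k\ge 0$, $T(k)$ is the unique indecomposable tilting module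 in which $W(k)$ occurs exactly once in a Weyl filtration and $W(k')$ does not occur for $k'>k$. The character of a module $V$ is the Laurent polynomial $\mathrm{ch}_V(x)=\sum_j\dim V_j\,x^j$, the sum over weights $j\in\mathbb{Z}$ of $V$, where $y$ has weight $j$ if $Ky=q^jy$ and ${K;0\brack l}y={j\brack l}y$. *)

theory Defs
  imports
    Complex_Main
    "HOL-Library.Poly_Mapping"
    "HOL-Library.Function_Algebras"
    "HOL-Computational_Algebra.Polynomial"
    "HOL-Computational_Algebra.Fraction_Field"
    "HOL-Algebra.QuotRing"
begin

section \<open>Laurent polynomials and quantum numbers\<close>

type_synonym Qv = "rat poly fract"

text \<open>The indeterminate of the field of rational functions. It plays the role of \<open>v\<close> in
  \<open>\<rat>(v)\<close>, and of \<open>x\<close> when the values of characters are compared in \<open>\<rat>(x)\<close>.\<close>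

definition indet :: Qv where
  "indet = Fract [:0, 1:] 1"

abbreviation vv :: Qv where "vv \<equiv> indet"

lemma indet_nonzero: "vv \<noteq> 0"
  by (simp add: indet_def Zero_fract_def eq_fract)

text \<open>\<open>\<A> = \<int>[v, v\<^sup>-\<^sup>1]\<close> is the group ring of \<open>\<int>\<close>, i.e. \<^typ>\<open>int \<Rightarrow>\<^sub>0 int\<close> with its
  convolution product. Evaluation at \<^const>\<open>indet\<close> is the embedding into \<open>\<rat>(v)\<close>.\<close>

definition laurent_eval :: "'a::field \<Rightarrow> (int \<Rightarrow>\<^sub>0 int) \<Rightarrow> 'a" where
  "laurent_eval y p =
     (\<Sum>j\<in>Poly_Mapping.keys p. of_int (Poly_Mapping.lookup p j) * y powi j)"

text \<open>The specialisation \<open>v \<mapsto> q\<close>, for elements of \<open>\<A> \<subseteq> \<rat>(v)\<close>. It cannot be applied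
  factor by factor to a quotient of elements of \<open>\<A>\<close>, whose denominator may vanish at \<open>q\<close>.\<close>

definition specialise :: "'k::field \<Rightarrow> Qv \<Rightarrow> 'k" where
  "specialise q f = laurent_eval q (THE p. laurent_eval vv p = f)"

definition qint :: "int \<Rightarrow> Qv" where
  "qint n = (vv powi n - vv powi (- n)) / (vv - inverse vv)"

definition qfact :: "nat \<Rightarrow> Qv" where
  "qfact n = (\<Prod>s\<in>{1..n}. qint (int s))"

definition qbinom :: "int \<Rightarrow> nat \<Rightarrow> Qv" where
  "qbinom n r =
     (\<Prod>s\<in>{1..r}. (vv powi (n - int s + 1) - vv powi (- n + int s - 1)) /
                  (vv powi int s - vv powi (- int s)))"

section \<open>The algebra \<open>U\<^sub>v(sl\<^sub>2)\<close>\<close>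

datatype gen = GenE | GenF | GenK | GenK_inv

datatype gen_word = Word (letters: "gen list")

text \<open>The free monoid, written additively so that \<^typ>\<open>gen_word \<Rightarrow>\<^sub>0 Qv\<close>, with its
  convolution product, is the free associative algebra on the generators.\<close>

instantiation gen_word :: monoid_add
begin
definition zero_gen_word :: gen_word where "0 = Word []"
definition plus_gen_word :: "gen_word \<Rightarrow> gen_word \<Rightarrow> gen_word" where
  "w + w' = Word (letters w @ letters w')"
instance
  by standard (simp_all add: zero_gen_word_def plus_gen_word_def)
end

lemma letters_simps [simp]: "letters 0 = []" "letters (w + w') = letters w @ letters w'"
  by (simp_all add: zero_gen_word_def plus_gen_word_def)

type_synonym free_alg = "gen_word \<Rightarrow>\<^sub>0 Qv"

definition free_gen :: "gen \<Rightarrow> free_alg" where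
  "free_gen g = Poly_Mapping.single (Word [g]) 1"

definition free_const :: "Qv \<Rightarrow> free_alg" where
  "free_const c = Poly_Mapping.single 0 c"

definition uv_relators :: "free_alg set" where
  "uv_relators =
    (let e = free_gen GenE; f = free_gen GenF; k = free_gen GenK; k' = free_gen GenK_inv in
      {k * k' - 1,
       k' * k - 1,
       k * e - free_const (vv powi 2) * (e * k),
       k * f - free_const (vv powi (-2)) * (f * k),
       (e * f - f * e) - free_const (inverse (vv - inverse vv)) * (k - k')})"

inductive_set uv_ideal :: "free_alg set" where
  base: "r \<in> uv_relators \<Longrightarrow> r \<in> uv_ideal"
| zero: "0 \<in> uv_ideal"
| add: "r \<in> uv_ideal \<Longrightarrow> s \<in> uv_ideal \<Longrightarrow> r + s \<in> uv_ideal"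
| mult_left: "r \<in> uv_ideal \<Longrightarrow> p * r \<in> uv_ideal"
| mult_right: "r \<in> uv_ideal \<Longrightarrow> r * p \<in> uv_ideal"

lemma uv_ideal_uminus: "r \<in> uv_ideal \<Longrightarrow> - r \<in> uv_ideal"
  using uv_ideal.mult_left[of r "- 1"] by simp

lemma uv_ideal_diff: "r \<in> uv_ideal \<Longrightarrow> s \<in> uv_ideal \<Longrightarrow> r - s \<in> uv_ideal"
  using uv_ideal.add[of r "- s"] uv_ideal_uminus[of s] by simp

quotient_type uv = free_alg / "\<lambda>p p'. p - p' \<in> uv_ideal"
proof (rule equivpI)
  show "reflp (\<lambda>p p'. p - p' \<in> uv_ideal)"
    by (rule reflpI) (simp add: uv_ideal.zero)
  show "symp (\<lambda>p p'. p - p' \<in> uv_ideal)"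
    using uv_ideal_uminus by (intro sympI) fastforce
  show "transp (\<lambda>p p'. p - p' \<in> uv_ideal)"
  proof (rule transpI)
    fix p p' p'' :: free_alg
    assume "p - p' \<in> uv_ideal" "p' - p'' \<in> uv_ideal"
    then show "p - p'' \<in> uv_ideal"
      using uv_ideal.add by fastforce
  qed
qed

lemma free_alg_anti_hom:
  fixes c :: "Qv \<Rightarrow> 'b::ring" and h :: "gen_word \<Rightarrow> 'b"
  assumes c_zero: "c 0 = 0" and c_add: "\<And>a b. c (a + b) = c a + c b"
    and c_mult: "\<And>a b. c (a * b) = c a * c b" and c_central: "\<And>a y. c a * y = y * c a"
    and h_add: "\<And>w w'. h (w + w') = h w' * h w"
  defines "\<phi> \<equiv> \<lambda>p. \<Sum>w\<in>Poly_Mapping.keys p. c (Poly_Mapping.lookup p w) * h w"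
  shows "\<phi> (Poly_Mapping.single w a) = c a * h w"
    and "\<phi> (p + p') = \<phi> p + \<phi> p'"
    and "\<phi> (p - p') = \<phi> p - \<phi> p'"
    and "\<phi> (p * p') = \<phi> p' * \<phi> p"
proof -
  show single: "\<phi> (Poly_Mapping.single w a) = c a * h w" for w a
    by (simp add: \<phi>_def c_zero)
  show add: "\<phi> (p + p') = \<phi> p + \<phi> p'" for p p'
    unfolding \<phi>_def
    by (rule setsum_keys_plus_distrib) (simp_all add: c_zero c_add algebra_simps)
  show diff: "\<phi> (p - p') = \<phi> p - \<phi> p'" for p p'
    using add[of "p - p'" p'] by simp
  have zero: "\<phi> 0 = 0"
    by (simp add: \<phi>_def)
  have mult_single: "\<phi> (Poly_Mapping.single w a * p') = \<phi> p' * \<phi> (Poly_Mapping.single w a)" for w a p'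
  proof (induction p' rule: update_induct)
    case const then show ?case by (simp add: zero)
  next
    case (update p' w' b)
    have eq: "Poly_Mapping.update w' b p' = Poly_Mapping.single w' b + p'"
      using update.hyps by (intro poly_mapping_eqI)
        (auto simp: lookup_update lookup_add lookup_single when_def in_keys_iff)
    have "c (a * b) * (h w' * h w) = (c b * h w') * (c a * h w)"
    proof -
      have "c (a * b) * (h w' * h w) = c b * (c a * h w') * h w"
        by (simp add: mult.commute[of a b] c_mult mult.assoc)
      also have "\<dots> = c b * (h w' * c a) * h w"
        by (simp only: c_central)
      finally show ?thesis by (simp add: mult.assoc)
    qed
    then show ?case
      unfolding eq by (simp add: distrib_left distrib_right add update.IH mult_single single h_add)
  qed
  show "\<phi> (p * p') = \<phi> p' * \<phi> p"
  proof (induction p rule: update_induct)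
    case const then show ?case by (simp add: zero)
  next
    case (update p w b)
    have eq: "Poly_Mapping.update w b p = Poly_Mapping.single w b + p"
      using update.hyps by (intro poly_mapping_eqI)
        (auto simp: lookup_update lookup_add lookup_single when_def in_keys_iff)
    show ?case
      unfolding eq by (simp add: distrib_left distrib_right add update.IH mult_single)
  qed
qed

text \<open>\<open>U\<^sub>v(sl\<^sub>2)\<close> is nontrivial because the counit does not kill \<open>1\<close>.\<close>

lemma one_notin_uv_ideal: "(1 :: free_alg) \<notin> uv_ideal"
proof -
  define h :: "gen_word \<Rightarrow> Qv" where
    "h w = (if set (letters w) \<subseteq> {GenK, GenK_inv} then 1 else 0)" for w
  define \<epsilon> where "\<epsilon> p = (\<Sum>w\<in>Poly_Mapping.keys p. Poly_Mapping.lookup p w * h w)" for p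
  have h_add: "h (w + w') = h w' * h w" for w w'
    by (simp add: h_def)
  note hom = free_alg_anti_hom[of "\<lambda>c. c" h, OF refl refl refl mult.commute h_add, folded \<epsilon>_def]
  have "\<epsilon> r = 0" if "r \<in> uv_ideal" for r
    using that
  proof induction
    case (base r)
    have "\<epsilon> 1 = 1"
      using hom(1)[of 0 1] by (simp add: h_def)
    with base show ?case
      by (auto simp: uv_relators_def Let_def hom free_gen_def free_const_def h_def)
  next
    case zero show ?case by (simp add: \<epsilon>_def)
  qed (simp_all add: hom)
  moreover have "\<epsilon> 1 = 1"
    using hom(1)[of 0 1] by (simp add: h_def)
  ultimately show ?thesis by fastforce
qed

instantiation uv :: ring_1
begin

lift_definition zero_uv :: uv is "0 :: free_alg" .
lift_definition one_uv :: uv is "1 :: free_alg" .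
lift_definition plus_uv :: "uv \<Rightarrow> uv \<Rightarrow> uv" is "(+) :: free_alg \<Rightarrow> free_alg \<Rightarrow> free_alg"
proof -
  fix p p' r r' :: free_alg
  assume "p - p' \<in> uv_ideal" "r - r' \<in> uv_ideal"
  then show "(p + r) - (p' + r') \<in> uv_ideal"
    using uv_ideal.add[of "p - p'" "r - r'"] by (simp add: algebra_simps)
qed
lift_definition minus_uv :: "uv \<Rightarrow> uv \<Rightarrow> uv" is "(-) :: free_alg \<Rightarrow> free_alg \<Rightarrow> free_alg"
proof -
  fix p p' r r' :: free_alg
  assume "p - p' \<in> uv_ideal" "r - r' \<in> uv_ideal"
  then show "(p - r) - (p' - r') \<in> uv_ideal"
    using uv_ideal_diff[of "p - p'" "r - r'"] by (simp add: algebra_simps)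
qed
lift_definition uminus_uv :: "uv \<Rightarrow> uv" is "uminus :: free_alg \<Rightarrow> free_alg"
proof -
  fix p p' :: free_alg
  assume "p - p' \<in> uv_ideal"
  then show "- p - (- p') \<in> uv_ideal"
    using uv_ideal_uminus[of "p - p'"] by simp
qed
lift_definition times_uv :: "uv \<Rightarrow> uv \<Rightarrow> uv" is "(*) :: free_alg \<Rightarrow> free_alg \<Rightarrow> free_alg"
proof -
  fix p p' r r' :: free_alg
  assume "p - p' \<in> uv_ideal" "r - r' \<in> uv_ideal"
  then have "(p - p') * r + p' * (r - r') \<in> uv_ideal"
    by (intro uv_ideal.add uv_ideal.mult_left uv_ideal.mult_right)
  then show "p * r - p' * r' \<in> uv_ideal"
    by (simp add: algebra_simps)
qed

instance
proof
  show "(0 :: uv) \<noteq> 1"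
    using one_notin_uv_ideal uv_ideal_uminus[of "- 1"] by transfer auto
qed (transfer; simp add: algebra_simps uv_ideal.zero)+

end

lift_definition uv_E :: uv is "free_gen GenE" .
lift_definition uv_F :: uv is "free_gen GenF" .
lift_definition uv_K :: uv is "free_gen GenK" .
lift_definition uv_K_inv :: uv is "free_gen GenK_inv" .

lift_definition uv_const :: "Qv \<Rightarrow> uv" is free_const .

abbreviation uv_scale :: "Qv \<Rightarrow> uv \<Rightarrow> uv" where
  "uv_scale c u \<equiv> uv_const c * u"

lemma free_const_simps:
  "free_const 0 = 0" "free_const 1 = 1"
  "free_const (a + b) = free_const a + free_const b"
  "free_const (a * b) = free_const a * free_const b"
  by (simp_all add: free_const_def single_add mult_single)

lemma free_const_central: "free_const c * p = p * free_const c"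
proof (induction p rule: update_induct)
  case const then show ?case by simp
next
  case (update p w b)
  have eq: "Poly_Mapping.update w b p = Poly_Mapping.single w b + p"
    using update.hyps by (intro poly_mapping_eqI)
      (auto simp: lookup_update lookup_add lookup_single when_def in_keys_iff)
  show ?case
    unfolding eq using update.IH
    by (simp add: distrib_left distrib_right free_const_def mult_single mult.commute)
qed

lemma uv_const_simps:
  "uv_const 0 = 0" "uv_const 1 = 1"
  "uv_const (a + b) = uv_const a + uv_const b"
  "uv_const (a * b) = uv_const a * uv_const b"
  by (transfer; simp add: free_const_simps uv_ideal.zero)+

lemma uv_const_central: "uv_const c * u = u * uv_const c"
  by transfer (simp add: free_const_central uv_ideal.zero)

lemma uv_relations:
  shows "uv_K * uv_K_inv = 1" and "uv_K_inv * uv_K = 1"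
    and "uv_K * uv_E = uv_scale (vv powi 2) (uv_E * uv_K)"
    and "uv_K * uv_F = uv_scale (vv powi (-2)) (uv_F * uv_K)"
    and "uv_E * uv_F - uv_F * uv_E = uv_scale (inverse (vv - inverse vv)) (uv_K - uv_K_inv)"
  by (transfer; rule uv_ideal.base; simp add: uv_relators_def Let_def)+

text \<open>The antipode is the anti-homomorphism of algebras with these values on the generators.\<close>

primrec gen_antipode :: "gen \<Rightarrow> uv" where
  "gen_antipode GenE = - (uv_K_inv * uv_E)"
| "gen_antipode GenF = - (uv_F * uv_K)"
| "gen_antipode GenK = uv_K_inv"
| "gen_antipode GenK_inv = uv_K"

definition word_antipode :: "gen_word \<Rightarrow> uv" where
  "word_antipode w = prod_list (map gen_antipode (rev (letters w)))"

definition free_antipode :: "free_alg \<Rightarrow> uv" where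
  "free_antipode p =
     (\<Sum>w\<in>Poly_Mapping.keys p. uv_const (Poly_Mapping.lookup p w) * word_antipode w)"

lemma word_antipode_add: "word_antipode (w + w') = word_antipode w' * word_antipode w"
  by (simp add: word_antipode_def)

lemmas free_antipode_hom =
  free_alg_anti_hom[of uv_const word_antipode, OF uv_const_simps(1,3,4) uv_const_central
    word_antipode_add, folded free_antipode_def]

lemma free_antipode_simps:
  "free_antipode 1 = 1" "free_antipode (free_const c) = uv_const c"
  "free_antipode (free_gen g) = gen_antipode g"
  using free_antipode_hom(1)[of 0 1]
  by (simp_all add: free_antipode_hom free_const_def free_gen_def word_antipode_def
      uv_const_simps)

lemma free_antipode_uv_ideal: "r \<in> uv_ideal \<Longrightarrow> free_antipode r = 0"
proof (induction rule: uv_ideal.induct)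
  case (base r)
  have const_left: "y * (uv_const c * z) = uv_const c * (y * z)" for y z c
    by (metis mult.assoc uv_const_central)
  have mult: "free_antipode (free_const c * p) = uv_const c * free_antipode p"
    "free_antipode (free_gen g * p) = free_antipode p * gen_antipode g" for c p g
    by (simp_all add: free_antipode_hom(4) free_antipode_simps uv_const_central)
  have cancel: "uv_K * (uv_K_inv * y) = y" "uv_K_inv * (uv_K * y) = y" for y
    by (simp_all add: uv_relations flip: mult.assoc)
  have KE: "uv_E * uv_K_inv = uv_const (vv powi 2) * (uv_K_inv * uv_E)"
  proof -
    have "uv_E * uv_K_inv = uv_K_inv * (uv_K * uv_E) * uv_K_inv"
      by (simp add: mult.assoc cancel)
    also have "\<dots> = uv_const (vv powi 2) * (uv_K_inv * uv_E)"
      by (simp add: uv_relations(3) mult.assoc const_left uv_relations(1))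
    finally show ?thesis .
  qed
  have KF: "uv_F * uv_K_inv = uv_const (vv powi (-2)) * (uv_K_inv * uv_F)"
  proof -
    have "uv_F * uv_K_inv = uv_K_inv * (uv_K * uv_F) * uv_K_inv"
      by (simp add: mult.assoc cancel)
    also have "\<dots> = uv_const (vv powi (-2)) * (uv_K_inv * uv_F)"
      by (simp add: uv_relations(4) mult.assoc const_left uv_relations(1))
    finally show ?thesis .
  qed
  have FK: "uv_const (vv powi (-2)) * (uv_K_inv * (uv_F * uv_K)) = uv_F"
    by (metis uv_relations(4) const_left cancel(2))
  have EF: "uv_F * uv_K * (uv_K_inv * uv_E) - uv_K_inv * uv_E * (uv_F * uv_K)
    = uv_const (inverse (vv - inverse vv)) * (uv_K_inv - uv_K)"
  proof -
    have "uv_E * (uv_F * uv_K) = uv_K * (uv_E * uv_F)"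
    proof -
      have "uv_K * (uv_E * uv_F) = uv_const (vv powi 2) * (uv_E * (uv_K * uv_F))"
        by (metis mult.assoc uv_relations(3))
      also have "\<dots> = uv_const (vv powi 2) * (uv_const (vv powi (-2)) * (uv_E * (uv_F * uv_K)))"
        using const_left[of uv_E "vv powi (-2)" "uv_F * uv_K"] by (simp only: uv_relations(4))
      also have "\<dots> = uv_E * (uv_F * uv_K)"
        by (simp add: uv_const_simps indet_nonzero power_int_minus flip: mult.assoc uv_const_simps(4))
      finally show ?thesis by simp
    qed
    then have "uv_F * uv_K * (uv_K_inv * uv_E) - uv_K_inv * uv_E * (uv_F * uv_K) = - (uv_E * uv_F - uv_F * uv_E)"
      by (simp add: mult.assoc cancel)
    also have "\<dots> = - (uv_const (inverse (vv - inverse vv)) * (uv_K - uv_K_inv))"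
      by (simp only: uv_relations(5))
    finally show ?thesis by (simp add: algebra_simps)
  qed
  from base show ?case
    by (auto simp: uv_relators_def Let_def free_antipode_hom(2-3) mult free_antipode_simps
        uv_relations(1,2) KE KF FK EF[simplified mult.assoc cancel] mult.assoc const_left[of uv_K_inv] cancel)
next
  case zero show ?case by (simp add: free_antipode_def)
qed (simp_all add: free_antipode_hom)

lift_definition antipode :: "uv \<Rightarrow> uv" is free_antipode
proof -
  fix p p' :: free_alg
  assume "p - p' \<in> uv_ideal"
  then have "free_antipode (p - p') = 0"
    by (rule free_antipode_uv_ideal)
  then show "free_antipode p = free_antipode p'"
    by (simp add: free_antipode_hom)
qed


section \<open>The integral form \<open>U\<^sub>\<A>\<close>\<close>

definition E_div :: "nat \<Rightarrow> uv" where
  "E_div n = uv_scale (inverse (qfact n)) (uv_E ^ n)"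

definition F_div :: "nat \<Rightarrow> uv" where
  "F_div n = uv_scale (inverse (qfact n)) (uv_F ^ n)"

text \<open>\<open>[K; c; t]\<close>. The factors commute, and the product lies in \<open>U\<^sub>\<A>\<close>, although its factors
  need not.\<close>

definition K_binom :: "int \<Rightarrow> nat \<Rightarrow> uv" where
  "K_binom c t = prod_list (map (\<lambda>s.
     uv_scale (inverse (vv powi s - vv powi (- s)))
       (uv_scale (vv powi (c - s + 1)) uv_K - uv_scale (vv powi (- c + s - 1)) uv_K_inv))
     [1..int t])"

inductive_set UA :: "uv set" where
  K: "uv_K \<in> UA"
| K_inv: "uv_K_inv \<in> UA"
| E_div: "E_div n \<in> UA"
| F_div: "F_div n \<in> UA"
| add: "x \<in> UA \<Longrightarrow> y \<in> UA \<Longrightarrow> x + y \<in> UA"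
| mult: "x \<in> UA \<Longrightarrow> y \<in> UA \<Longrightarrow> x * y \<in> UA"
| scale: "x \<in> UA \<Longrightarrow> uv_scale (laurent_eval vv p) x \<in> UA"

section \<open>The specialisation \<open>U\<^sub>q(sl\<^sub>2) = U\<^sub>\<A> \<otimes>\<^sub>\<A> k\<close>\<close>

text \<open>A multiplicative monoid written additively, so that \<open>'a mon \<Rightarrow>\<^sub>0 'k\<close> is its monoid
  algebra over \<open>'k\<close>.\<close>

datatype 'a mon = Mon (unMon: 'a)

instantiation mon :: (monoid_mult) monoid_add
begin
definition zero_mon :: "'a mon" where "0 = Mon 1"
definition plus_mon :: "'a mon \<Rightarrow> 'a mon \<Rightarrow> 'a mon" where "x + y = Mon (unMon x * unMon y)"
instance
  by standard (simp_all add: zero_mon_def plus_mon_def mult.assoc)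
end

text \<open>The tensor product \<open>U\<^sub>\<A> \<otimes>\<^sub>\<A> k\<close>, where \<open>\<A>\<close> acts on \<open>k\<close> through \<open>v \<mapsto> q\<close>, is the free
  \<open>k\<close>-module on the set \<open>U\<^sub>\<A>\<close> modulo the relations making \<open>u \<mapsto> u \<otimes> 1\<close> additive and
  \<open>\<A>\<close>-linear. The product \<open>(u \<otimes> c) (u' \<otimes> c') = u u' \<otimes> c c'\<close> is induced by that of the monoid
  algebra of \<open>U\<^sub>\<A>\<close>.\<close>

definition UA_monoid_alg :: "(uv mon \<Rightarrow>\<^sub>0 'k::field) ring" where
  "UA_monoid_alg =
     \<lparr>carrier = {p. Poly_Mapping.keys p \<subseteq> Mon ` UA}, mult = (*), one = 1, zero = 0, add = (+)\<rparr>"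

definition tensor_relators :: "'k::field \<Rightarrow> (uv mon \<Rightarrow>\<^sub>0 'k) set" where
  "tensor_relators q =
     {Poly_Mapping.single (Mon (u + u')) 1 - Poly_Mapping.single (Mon u) 1
        - Poly_Mapping.single (Mon u') 1 | u u'. u \<in> UA \<and> u' \<in> UA} \<union>
     {Poly_Mapping.single (Mon (uv_scale (laurent_eval vv p) u)) 1
        - Poly_Mapping.single (Mon u) (laurent_eval q p) | p u. u \<in> UA}"

definition tensor_ideal :: "'k::field \<Rightarrow> (uv mon \<Rightarrow>\<^sub>0 'k) set" where
  "tensor_ideal q = Idl\<^bsub>UA_monoid_alg\<^esub> (tensor_relators q)"

type_synonym 'k uq = "(uv mon \<Rightarrow>\<^sub>0 'k) set"

definition Uq :: "'k::field \<Rightarrow> 'k uq ring" where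
  "Uq q = UA_monoid_alg Quot tensor_ideal q"

text \<open>The element \<open>u \<otimes> c\<close>, for \<open>u \<in> U\<^sub>\<A>\<close>.\<close>

definition tensor :: "'k::field \<Rightarrow> uv \<Rightarrow> 'k \<Rightarrow> 'k uq" where
  "tensor q u c = tensor_ideal q +>\<^bsub>UA_monoid_alg\<^esub> Poly_Mapping.single (Mon u) c"

text \<open>The antipode \<open>u \<otimes> c \<mapsto> S(u) \<otimes> c\<close>. It preserves \<^const>\<open>tensor_ideal\<close>, so all members of
  the union below are the same coset.\<close>

definition monoid_alg_antipode :: "(uv mon \<Rightarrow>\<^sub>0 'k::field) \<Rightarrow> (uv mon \<Rightarrow>\<^sub>0 'k)" where
  "monoid_alg_antipode p =
     (\<Sum>m\<in>Poly_Mapping.keys p.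
        Poly_Mapping.single (Mon (antipode (unMon m))) (Poly_Mapping.lookup p m))"

definition uq_antipode :: "'k::field \<Rightarrow> 'k uq \<Rightarrow> 'k uq" where
  "uq_antipode q C = (\<Union>p\<in>C. tensor_ideal q +>\<^bsub>UA_monoid_alg\<^esub> monoid_alg_antipode p)"

section \<open>Modules over \<open>U\<^sub>q(sl\<^sub>2)\<close>\<close>

text \<open>A module is a subspace \<open>space M\<close> of an ambient vector space, which is the type \<open>'m\<close> with
  scalar multiplication \<open>scale M\<close>. The action outside \<open>space M\<close> is irrelevant.\<close>

record (overloaded) ('k, 'm) uq_mod =
  space :: "'m set"
  scale :: "'k \<Rightarrow> 'm \<Rightarrow> 'm"
  act :: "'k uq \<Rightarrow> 'm \<Rightarrow> 'm"

definition uq_module :: "'k::field \<Rightarrow> ('k, 'm::ab_group_add) uq_mod \<Rightarrow> bool" where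
  "uq_module q M \<longleftrightarrow>
     vector_space (scale M) \<and> module.subspace (scale M) (space M) \<and>
     (\<forall>a\<in>carrier (Uq q). \<forall>x\<in>space M. act M a x \<in> space M) \<and>
     (\<forall>a\<in>carrier (Uq q). \<forall>x\<in>space M. \<forall>y\<in>space M. act M a (x + y) = act M a x + act M a y) \<and>
     (\<forall>a\<in>carrier (Uq q). \<forall>b\<in>carrier (Uq q). \<forall>x\<in>space M.
        act M (a \<oplus>\<^bsub>Uq q\<^esub> b) x = act M a x + act M b x \<and>
        act M (a \<otimes>\<^bsub>Uq q\<^esub> b) x = act M a (act M b x)) \<and>
     (\<forall>c. \<forall>x\<in>space M. act M (tensor q 1 c) x = scale M c x)"

definition uq_submodule :: "'k::field \<Rightarrow> ('k, 'm::ab_group_add) uq_mod \<Rightarrow> 'm set \<Rightarrow> bool" where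
  "uq_submodule q M N \<longleftrightarrow>
     N \<subseteq> space M \<and> module.subspace (scale M) N \<and>
     (\<forall>a\<in>carrier (Uq q). \<forall>x\<in>N. act M a x \<in> N)"

definition uq_hom :: "'k::field \<Rightarrow> ('k, 'm::ab_group_add) uq_mod \<Rightarrow>
    ('k, 'n::ab_group_add) uq_mod \<Rightarrow> ('m \<Rightarrow> 'n) \<Rightarrow> bool" where
  "uq_hom q M N \<phi> \<longleftrightarrow>
     (\<forall>x\<in>space M. \<phi> x \<in> space N) \<and>
     (\<forall>x\<in>space M. \<forall>y\<in>space M. \<phi> (x + y) = \<phi> x + \<phi> y) \<and>
     (\<forall>a\<in>carrier (Uq q). \<forall>x\<in>space M. \<phi> (act M a x) = act N a (\<phi> x))"

text \<open>For submodules \<open>N \<subseteq> L\<close> of \<open>M\<close>: the quotient \<open>L / N\<close> is isomorphic to \<open>Q\<close>.\<close>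

definition subquotient_iso :: "'k::field \<Rightarrow> ('k, 'm::ab_group_add) uq_mod \<Rightarrow> 'm set \<Rightarrow> 'm set \<Rightarrow>
    ('k, 'n::ab_group_add) uq_mod \<Rightarrow> bool" where
  "subquotient_iso q M L N Q \<longleftrightarrow>
     (\<exists>\<phi>. uq_hom q (M\<lparr>space := L\<rparr>) Q \<phi> \<and> \<phi> ` L = space Q \<and> {x \<in> L. \<phi> x = 0} = N)"

definition finite_dim :: "('k::field, 'm::ab_group_add) uq_mod \<Rightarrow> bool" where
  "finite_dim M \<longleftrightarrow> (\<exists>B. finite B \<and> module.span (scale M) B = space M)"

definition indecomposable :: "'k::field \<Rightarrow> ('k, 'm::ab_group_add) uq_mod \<Rightarrow> bool" where
  "indecomposable q M \<longleftrightarrow>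
     space M \<noteq> {0} \<and>
     (\<forall>N N'. uq_submodule q M N \<and> uq_submodule q M N' \<and> N \<inter> N' = {0} \<and>
        {x + y | x y. x \<in> N \<and> y \<in> N'} = space M \<longrightarrow> N = {0} \<or> N' = {0})"

section \<open>Weyl modules and tilting modules\<close>

definition is_weyl :: "'k::field \<Rightarrow> nat \<Rightarrow> nat \<Rightarrow> ('k, 'm::ab_group_add) uq_mod \<Rightarrow> bool" where
  "is_weyl q l n M \<longleftrightarrow> uq_module q M \<and>
     (\<exists>x\<in>space M.
       let b = (\<lambda>t::int. if 0 \<le> t \<and> t \<le> int n then act M (tensor q (F_div (nat t)) 1) x else 0)
       in inj_on b {0..int n} \<and>
          \<not> module.dependent (scale M) (b ` {0..int n}) \<and>
          module.span (scale M) (b ` {0..int n}) = space M \<and>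
          (\<forall>t\<in>{0..int n}.
             act M (tensor q uv_K 1) (b t) = scale M (q powi (int n - 2 * t)) (b t) \<and>
             act M (tensor q (K_binom 0 l) 1) (b t)
               = scale M (specialise q (qbinom (int n - 2 * t) l)) (b t) \<and>
             act M (tensor q uv_F 1) (b t) = scale M (specialise q (qint (t + 1))) (b (t + 1)) \<and>
             act M (tensor q uv_E 1) (b t)
               = scale M (specialise q (qint (int n - t + 1))) (b (t - 1)) \<and>
             act M (tensor q (F_div l) 1) (b t)
               = scale M (specialise q (qbinom (int l + t) l)) (b (int l + t)) \<and>
             act M (tensor q (E_div l) 1) (b t)
               = scale M (specialise q (qbinom (int n + int l - t) l)) (b (t - int l))))"

text \<open>The dual module, with \<open>(a f)(w) = f(S(a) w)\<close>. Functionals on \<open>space M\<close> are extended by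
  zero to the ambient type.\<close>

definition dual_module :: "'k::field \<Rightarrow> ('k, 'm::ab_group_add) uq_mod \<Rightarrow> ('k, 'm \<Rightarrow> 'k) uq_mod" where
  "dual_module q M =
     \<lparr>space = {f. (\<forall>x\<in>space M. \<forall>y\<in>space M. f (x + y) = f x + f y) \<and>
                  (\<forall>c. \<forall>x\<in>space M. f (scale M c x) = c * f x) \<and>
                  (\<forall>x. x \<notin> space M \<longrightarrow> f x = 0)},
      scale = (\<lambda>c f x. c * f x),
      act = (\<lambda>a f x. if x \<in> space M then f (act M (uq_antipode q a) x) else 0)\<rparr>"

definition filtration :: "'k::field \<Rightarrow> ('k, 'm::ab_group_add) uq_mod \<Rightarrow> (nat \<Rightarrow> 'm set) \<Rightarrow> nat \<Rightarrow> bool" where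
  "filtration q M V r \<longleftrightarrow>
     V 0 = {0} \<and> V r = space M \<and> (\<forall>i\<le>r. uq_submodule q M (V i)) \<and> (\<forall>i<r. V i \<subseteq> V (Suc i))"

text \<open>The sequence \<open>ns\<close> lists the highest weights of the subquotients of the filtration. A Weyl
  module is finite dimensional, hence has an isomorphic copy inside \<^typ>\<open>nat \<Rightarrow> 'k\<close>.\<close>

definition weyl_filtration :: "'k::field \<Rightarrow> nat \<Rightarrow> ('k, 'm::ab_group_add) uq_mod \<Rightarrow> nat list \<Rightarrow> bool" where
  "weyl_filtration q l M ns \<longleftrightarrow>
     (\<exists>V. filtration q M V (length ns) \<and>
        (\<forall>i<length ns. \<exists>W :: ('k, nat \<Rightarrow> 'k) uq_mod.
           is_weyl q l (ns ! i) W \<and> subquotient_iso q M (V (Suc i)) (V i) W))"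

definition dual_weyl_filtration :: "'k::field \<Rightarrow> nat \<Rightarrow> ('k, 'm::ab_group_add) uq_mod \<Rightarrow> nat list \<Rightarrow> bool" where
  "dual_weyl_filtration q l M ns \<longleftrightarrow>
     (\<exists>V. filtration q M V (length ns) \<and>
        (\<forall>i<length ns. \<exists>W :: ('k, nat \<Rightarrow> 'k) uq_mod.
           is_weyl q l (ns ! i) W \<and> subquotient_iso q M (V (Suc i)) (V i) (dual_module q W)))"

definition tilting :: "'k::field \<Rightarrow> nat \<Rightarrow> ('k, 'm::ab_group_add) uq_mod \<Rightarrow> bool" where
  "tilting q l M \<longleftrightarrow> uq_module q M \<and> finite_dim M \<and>
     (\<exists>ns. weyl_filtration q l M ns) \<and> (\<exists>ns. dual_weyl_filtration q l M ns)"

text \<open>\<open>M\<close> is a model of \<open>T(k)\<close>.\<close>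

definition is_T :: "'k::field \<Rightarrow> nat \<Rightarrow> nat \<Rightarrow> ('k, 'm::ab_group_add) uq_mod \<Rightarrow> bool" where
  "is_T q l k M \<longleftrightarrow> tilting q l M \<and> indecomposable q M \<and>
     (\<exists>ns. weyl_filtration q l M ns \<and> count_list ns k = 1 \<and> (\<forall>k'>k. k' \<notin> set ns))"

section \<open>Characters\<close>

definition weight_space :: "'k::field \<Rightarrow> nat \<Rightarrow> ('k, 'm::ab_group_add) uq_mod \<Rightarrow> int \<Rightarrow> 'm set" where
  "weight_space q l M j =
     {y \<in> space M. act M (tensor q uv_K 1) y = scale M (q powi j) y \<and>
        act M (tensor q (K_binom 0 l) 1) y = scale M (specialise q (qbinom j l)) y}"

definition character :: "'k::field \<Rightarrow> nat \<Rightarrow> ('k, 'm::ab_group_add) uq_mod \<Rightarrow> 'f::field \<Rightarrow> 'f" where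
  "character q l M x =
     (\<Sum>j | weight_space q l M j \<noteq> {0}.
        of_nat (vector_space.dim (scale M) (weight_space q l M j)) * x powi j)"

section \<open>The field \<open>\<rat>(q)\<close>\<close>

definition rat_adjoin :: "complex \<Rightarrow> complex set" where
  "rat_adjoin z =
     \<Inter>{S. z \<in> S \<and> 1 \<in> S \<and> (\<forall>x\<in>S. \<forall>y\<in>S. x - y \<in> S \<and> x * y \<in> S \<and> x / y \<in> S)}"

text \<open>The scalars form a type \<open>'k\<close>, embedded into \<open>\<complex>\<close> with image \<open>\<rat>(exp(\<pi> i a / l))\<close>.\<close>

definition is_cyclotomic :: "nat \<Rightarrow> int \<Rightarrow> ('k::field \<Rightarrow> complex) \<Rightarrow> 'k \<Rightarrow> bool" where
  "is_cyclotomic l a emb q \<longleftrightarrow>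
     emb 1 = 1 \<and> (\<forall>x y. emb (x + y) = emb x + emb y) \<and> (\<forall>x y. emb (x * y) = emb x * emb y) \<and>
     emb q = exp (of_real pi * \<i> * of_int a / of_nat l) \<and> range emb = rat_adjoin (emb q)"

end

theory Submission imports Defs "HOL-Computational_Algebra.Polynomial_Factorial" begin

text \<open>Write \<open>k = k\<^sub>1 l + k\<^sub>0\<close>. The top layer of a Weyl filtration of \<open>T(k)\<close> gives a vector \<open>x\<close> of
  weight \<open>k\<close>. If \<open>k < l\<close> or \<open>k\<^sub>0 = l - 1\<close>, the coefficients of \<open>E\<^sup>(\<^sup>t\<^sup>) F\<^sup>(\<^sup>t\<^sup>) x\<close> are nonzero, so the
  functionals \<open>y \<mapsto> E\<^sup>(\<^sup>t\<^sup>) y\<close> (followed by the coefficient of \<open>x\<close>) cut out a complement of the span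
  of the \<open>F\<^sup>(\<^sup>t\<^sup>) x\<close>, and indecomposability makes it zero.

  Otherwise \<open>E\<^sup>(\<^sup>k\<^sup>0\<^sup>+\<^sup>1\<^sup>) F\<^sup>(\<^sup>k\<^sup>0\<^sup>+\<^sup>1\<^sup>) x = 0\<close>. The Casimir element acts on \<open>T(k)\<close> with a single generalised
  eigenvalue, which restricts the other Weyl factors to highest weights at most
  \<open>k' = k\<^sub>1 l - 2 - k\<^sub>0\<close>, and the dual Weyl filtration supplies \<open>w\<close> of weight \<open>k'\<close> with
  \<open>E\<^sup>(\<^sup>k\<^sup>0\<^sup>+\<^sup>1\<^sup>) w = x\<close>. The vectors \<open>F\<^sup>(\<^sup>t\<^sup>) x\<close> (\<open>t \<le> k\<close>) and \<open>F\<^sup>(\<^sup>s\<^sup>) w\<close> (\<open>s \<le> k'\<close>) span a submodule \<open>S\<close>. A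
  functional \<open>\<mu>\<close> on the weight space \<open>k'\<close> that is nonzero at \<open>F\<^sup>(\<^sup>k\<^sup>0\<^sup>+\<^sup>1\<^sup>) x\<close> yields functionals
  \<open>\<mu> \<circ> E\<^sup>(\<^sup>s\<^sup>)\<close> which, with those above, pair nondegenerately with \<open>S\<close>. Hence \<open>S\<close> again splits
  off and equals \<open>T(k)\<close>.\<close>

text \<open>The character counts vectors on which K and [K; 0; l] act by scalars, while a filtration
  controls eigenvalues only up to nilpotent parts. K is diagonalisable, but [K; 0; l] might have
  Jordan blocks. Decompositions therefore use generalised weights (\<open>gw\<close>), and the
  vectors of the final basis are shown to be true weight vectors (\<open>tw\<close>). A complement
  cut out by functionals must be stable under F^(r). Expanding E^(t) F^(r) y leaves terms in E^(t-i)
  y: for i = r this is a condition already imposed on y, and for i < r the weight is so high that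
  the vector is zero or is detected by the functionals at weight k. With two strings, the entry
  \<mu>(E^(s) F^(s) w) of the 2x2 pairing matrix is not computed. Nondegeneracy is instead proved by
  induction on s, applying E or E^(l) to an element of the radical. For s > 0 both fail only at s =
  l - 1 - \<open>k\<^sub>0\<close>, where a nonzero radical would force \<open>k\<^sub>1\<close> to
  be 1 or -1 in a field of characteristic 0, although it is at least 2 there.\<close>

section \<open>Laurent polynomials and their specialisation\<close>

lemma update_eq_single_plus:
  "w \<notin> Poly_Mapping.keys p \<Longrightarrow> Poly_Mapping.update w b p = Poly_Mapping.single w b + p"
  by (intro poly_mapping_eqI) (auto simp: lookup_update lookup_add lookup_single when_def in_keys_iff)

lemma laurent_eval_single [simp]: "laurent_eval y (Poly_Mapping.single j c) = of_int c * y powi j"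
  by (simp add: laurent_eval_def)

lemma laurent_eval_zero [simp]: "laurent_eval y 0 = 0"
  by (simp add: laurent_eval_def)

lemma laurent_eval_one [simp]: "laurent_eval y 1 = 1"
  using laurent_eval_single[of y 0 1] by simp

lemma laurent_eval_add: "laurent_eval y (p + r) = laurent_eval y p + laurent_eval y r"
  unfolding laurent_eval_def
  by (rule setsum_keys_plus_distrib) (simp_all add: algebra_simps)

lemma laurent_eval_uminus: "laurent_eval y (- p) = - laurent_eval y p"
  using laurent_eval_add[of y p "- p"] by (simp add: eq_neg_iff_add_eq_0 add.commute)

lemma laurent_eval_diff: "laurent_eval y (p - r) = laurent_eval y p - laurent_eval y r"
  using laurent_eval_add[of y p "- r"] by (simp add: laurent_eval_uminus)

lemma laurent_eval_mult:
  assumes "y \<noteq> 0"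
  shows "laurent_eval y (p * r) = laurent_eval y p * laurent_eval y r"
proof (induction p rule: update_induct)
  case const then show ?case by simp
next
  case (update p w b)
  have "laurent_eval y (Poly_Mapping.single w b * r) = of_int b * y powi w * laurent_eval y r"
  proof (induction r rule: update_induct)
    case const then show ?case by simp
  next
    case (update r w' b')
    then show ?case using assms
      by (simp add: update_eq_single_plus distrib_left laurent_eval_add mult_single power_int_add
          algebra_simps)
  qed
  with update show ?case
    by (simp add: update_eq_single_plus laurent_eval_add distrib_right)
qed

lemma indet_power_int: "j \<ge> 0 \<Longrightarrow> indet powi j = to_fract (monom 1 (nat j))"
proof -
  have "indet ^ n = to_fract (monom 1 n)" for n
  proof (induction n)
    case (Suc n)
    have "monom 1 (Suc n) = [:0, 1:] * (monom 1 n :: rat poly)"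
      by (simp add: monom_Suc)
    with Suc show ?case
      by (simp only: power_Suc to_fract_mult) (simp add: indet_def to_fract_def)
  qed (simp add: monom_0 flip: one_pCons)
  then show "j \<ge> 0 \<Longrightarrow> indet powi j = to_fract (monom 1 (nat j))"
    by (simp add: power_int_def)
qed

text \<open>Multiplied by v^-m, with m the lowest exponent, the value becomes an ordinary polynomial
  whose constant term is the lowest coefficient of p. The resulting injectivity gives the definite
  description in \<open>specialise\<close> its meaning.\<close>

lemma laurent_eval_indet_eq_0:
  assumes "laurent_eval vv p = 0"
  shows "p = 0"
proof (rule ccontr)
  assume "p \<noteq> 0"
  let ?S = "Poly_Mapping.keys p" and ?c = "Poly_Mapping.lookup p"
  define m where "m = Min ?S"
  have m: "m \<in> ?S" "\<And>j. j \<in> ?S \<Longrightarrow> m \<le> j"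
    using \<open>p \<noteq> 0\<close> by (auto simp: m_def)
  define P where "P = (\<Sum>j\<in>?S. monom (rat_of_int (?c j)) (nat (j - m)))"
  have of_int: "of_int c = to_fract [:rat_of_int c:]" for c
  proof (induction c rule: int_induct[where k = 0])
    case (step1 i)
    have "[:rat_of_int (i + 1):] = [:rat_of_int i:] + 1"
      by (simp add: one_pCons)
    with step1 show ?case by (simp only: to_fract_add) simp
  next
    case (step2 i)
    have "[:rat_of_int (i - 1):] = [:rat_of_int i:] - 1"
      by (simp add: one_pCons)
    with step2 show ?case by (simp only: to_fract_diff) simp
  qed simp
  have "to_fract P = (\<Sum>j\<in>?S. of_int (?c j) * indet powi (j - m))"
    unfolding P_def to_fract_sum
    by (intro sum.cong refl)
       (simp add: m indet_power_int of_int smult_monom flip: to_fract_mult)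
  also have "\<dots> = laurent_eval vv p * vv powi (- m)"
    by (simp add: laurent_eval_def sum_distrib_right mult.assoc indet_nonzero flip: power_int_add)
  finally have "P = 0"
    using assms by simp
  moreover have "coeff P 0 = rat_of_int (?c m)"
  proof -
    have "coeff P 0 = (\<Sum>j\<in>?S. if j = m then rat_of_int (?c j) else 0)"
      unfolding P_def coeff_sum using m(2) by (intro sum.cong) (auto simp: order.antisym)
    then show ?thesis using m(1) by simp
  qed
  ultimately show False
    using m(1) by (simp add: in_keys_iff)
qed

lemma laurent_eval_indet_inj: "laurent_eval vv p = laurent_eval vv r \<longleftrightarrow> p = r"
  using laurent_eval_indet_eq_0[of "p - r"] by (auto simp: laurent_eval_diff)

lemma specialise_laurent_eval [simp]: "specialise q (laurent_eval vv p) = laurent_eval q p"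
  by (simp add: specialise_def laurent_eval_indet_inj)

text \<open>The ring \<A> as a subset of \<rat>(v): the elements on which \<open>specialise\<close>
  behaves as a ring homomorphism.\<close>

definition laurents :: "Qv set" where
  "laurents = range (laurent_eval vv)"

lemma laurents_closed:
  "0 \<in> laurents" "1 \<in> laurents"
  "f \<in> laurents \<Longrightarrow> g \<in> laurents \<Longrightarrow> f + g \<in> laurents"
  "f \<in> laurents \<Longrightarrow> g \<in> laurents \<Longrightarrow> f - g \<in> laurents"
  "f \<in> laurents \<Longrightarrow> g \<in> laurents \<Longrightarrow> f * g \<in> laurents"
  "f \<in> laurents \<Longrightarrow> - f \<in> laurents"
  "f \<in> laurents \<Longrightarrow> f ^ n \<in> laurents"
  "vv powi j \<in> laurents"
proof -
  show *: "0 \<in> laurents" "1 \<in> laurents" "vv powi j \<in> laurents" for j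
    using laurent_eval_zero[of vv] laurent_eval_one[of vv] laurent_eval_single[of vv j 1]
    unfolding laurents_def by (metis rangeI, metis rangeI, metis rangeI mult_1 of_int_1)
  show m: "f * g \<in> laurents" if "f \<in> laurents" "g \<in> laurents" for f g
    using that unfolding laurents_def by (auto simp flip: laurent_eval_mult[OF indet_nonzero])
  show "f + g \<in> laurents" "f - g \<in> laurents" if "f \<in> laurents" "g \<in> laurents" for f g
    using that unfolding laurents_def by (auto simp flip: laurent_eval_add laurent_eval_diff)
  show "- f \<in> laurents" if "f \<in> laurents" for f
    using that unfolding laurents_def by (auto simp flip: laurent_eval_uminus)
  show "f ^ n \<in> laurents" if "f \<in> laurents" for f
    by (induction n) (use that * m in auto)
qed

text \<open>Identities at q are obtained by proving them in \<rat>(v), where quantum integers can be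
  inverted, and transporting them. The membership conditions keep denominators that vanish at q out
  of the transport.\<close>

lemma specialise_simps:
  assumes "q \<noteq> 0"
  shows "specialise q 0 = 0" "specialise q 1 = 1" "specialise q (vv powi j) = q powi j"
    "f \<in> laurents \<Longrightarrow> g \<in> laurents \<Longrightarrow> specialise q (f + g) = specialise q f + specialise q g"
    "f \<in> laurents \<Longrightarrow> g \<in> laurents \<Longrightarrow> specialise q (f - g) = specialise q f - specialise q g"
    "f \<in> laurents \<Longrightarrow> g \<in> laurents \<Longrightarrow> specialise q (f * g) = specialise q f * specialise q g"
    "f \<in> laurents \<Longrightarrow> specialise q (- f) = - specialise q f"
proof -
  show "specialise q 0 = 0" "specialise q 1 = 1" "specialise q (vv powi j) = q powi j"
    using specialise_laurent_eval[of q 0] specialise_laurent_eval[of q 1]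
      specialise_laurent_eval[of q "Poly_Mapping.single j 1"] by simp_all
  note flips = laurent_eval_add[of vv, symmetric] laurent_eval_diff[of vv, symmetric]
    laurent_eval_mult[of vv, OF indet_nonzero, symmetric] laurent_eval_uminus[of vv, symmetric]
  show "specialise q (f + g) = specialise q f + specialise q g"
    "specialise q (f - g) = specialise q f - specialise q g"
    "specialise q (f * g) = specialise q f * specialise q g"
    if "f \<in> laurents" "g \<in> laurents"
    using that assms unfolding laurents_def
    by (auto simp only: flips specialise_laurent_eval)
      (simp_all add: laurent_eval_add laurent_eval_diff laurent_eval_mult)
  show "specialise q (- f) = - specialise q f" if "f \<in> laurents"
    using that unfolding laurents_def
    by (auto simp only: flips specialise_laurent_eval) (simp add: laurent_eval_uminus)
qed

section \<open>Quantum integers and binomials over the rational functions\<close>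

text \<open>The quantum integer cleared of its denominator. With these factors, binomials and the
  brackets [K; c; t] can be compared without tracking powers of v - v^-1.\<close>

definition qd :: "int \<Rightarrow> Qv" where
  "qd n = vv powi n - vv powi (- n)"

lemma indet_powi_eq_1_iff [simp]: "vv powi n = 1 \<longleftrightarrow> n = 0"
proof
  assume "vv powi n = 1"
  then have "laurent_eval vv (Poly_Mapping.single n 1) = laurent_eval vv (Poly_Mapping.single 0 1)"
    by simp
  then have "Poly_Mapping.single n (1::int) = Poly_Mapping.single 0 1"
    unfolding laurent_eval_indet_inj .
  then show "n = 0"
    by (metis lookup_single_eq lookup_single_not_eq zero_neq_one)
qed simp

lemma qd_eq_0_iff [simp]: "qd n = 0 \<longleftrightarrow> n = 0"
proof -
  have "qd n = vv powi (- n) * (vv powi (2 * n) - 1)"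
    by (simp add: qd_def algebra_simps indet_nonzero flip: power_int_add)
  then show ?thesis by (simp add: indet_nonzero)
qed

lemma qd_simps: "qd 0 = 0" "qd (- n) = - qd n"
  by (simp_all add: qd_def)

lemma qint_qd: "qint n = qd n / qd 1"
  by (simp add: qint_def qd_def power_int_minus)

lemma qint_simps [simp]: "qint 0 = 0" "qint 1 = 1"
  by (simp_all add: qint_qd)

lemma qint_eq_0_iff [simp]: "qint n = 0 \<longleftrightarrow> n = 0"
  by (simp add: qint_qd)

lemma qd_in_laurents: "qd n \<in> laurents"
  by (simp add: qd_def laurents_closed)

definition qff :: "int \<Rightarrow> nat \<Rightarrow> Qv" where
  "qff n r = (\<Prod>i<r. qd (n - int i))"

lemma qff_0 [simp]: "qff n 0 = 1" and qff_Suc: "qff n (Suc r) = qff n r * qd (n - int r)"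
  by (simp_all add: qff_def)

lemma qff_add: "qff n (a + b) = qff n a * qff (n - int a) b"
  by (induction b) (simp_all add: qff_Suc algebra_simps)

lemma qff_Suc': "qff n (Suc r) = qd n * qff (n - 1) r"
  using qff_add[of n 1 r] by (simp add: qff_Suc)

definition qdfact :: "nat \<Rightarrow> Qv" where
  "qdfact r = qff (int r) r"

lemma qdfact_0 [simp]: "qdfact 0 = 1" and qdfact_Suc: "qdfact (Suc r) = qd (int (Suc r)) * qdfact r"
  by (simp_all add: qdfact_def qff_Suc' del: of_nat_Suc) simp

lemma qdfact_nonzero [simp]: "qdfact r \<noteq> 0"
  by (induction r) (simp_all add: qdfact_Suc del: of_nat_Suc)

lemma qdfact_prod: "qdfact r = (\<Prod>s\<in>{1..r}. qd (int s))"
  by (induction r) (simp_all add: qdfact_Suc)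

lemma qfact_qdfact: "qfact r = qdfact r / qd 1 ^ r"
  by (simp add: qfact_def qdfact_prod qint_qd prod_dividef)

lemma qfact_nonzero [simp]: "qfact r \<noteq> 0"
  by (simp add: qfact_qdfact)

lemma qfact_Suc: "qfact (Suc r) = qint (int (Suc r)) * qfact r"
  by (simp add: qfact_def)

lemma qbinom_qff: "qbinom n r = qff n r / qdfact r"
proof -
  have "qbinom n r = (\<Prod>s\<in>{1..r}. qd (n - int s + 1)) / qdfact r"
    by (simp add: qbinom_def prod_dividef qdfact_prod qd_def algebra_simps)
  also have "(\<Prod>s\<in>{1..r}. qd (n - int s + 1)) = qff n r"
    by (induction r) (simp_all add: qff_Suc)
  finally show ?thesis .
qed

lemma qbinom_0 [simp]: "qbinom n 0 = 1" and qbinom_1 [simp]: "qbinom n (Suc 0) = qint n"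
  by (simp_all add: qbinom_qff qff_Suc qdfact_Suc qint_qd)

lemma qbinom_self [simp]: "qbinom (int r) r = 1"
  by (simp add: qbinom_qff flip: qdfact_def)

text \<open>Both sides regroup the same falling factorial. At q, where [l]! vanishes, its image
  \<open>B_mult\<close> replaces the cancellation of factorials: it splits l off a large lower
  index.\<close>

lemma qbinom_mult: "qbinom n (a + b) * qbinom (int (a + b)) a = qbinom n a * qbinom (n - int a) b"
proof -
  have "qdfact (a + b) = qff (int (a + b)) a * qdfact b"
    by (simp add: qdfact_def qff_add)
  then show ?thesis
    using qdfact_nonzero[of "a + b"] by (simp add: qbinom_qff qff_add field_simps)
qed

lemma qbinom_qfact: "qbinom (int (a + b)) a = qfact (a + b) / (qfact a * qfact b)"
proof -
  have "qdfact (a + b) = qff (int (a + b)) a * qdfact b"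
    by (simp add: qdfact_def qff_add)
  then show ?thesis
    by (simp add: qbinom_qff qfact_qdfact field_simps power_add)
qed

lemma qd_add: "qd (m + n) = vv powi n * qd m + vv powi (- m) * qd n"
  by (simp add: qd_def algebra_simps indet_nonzero flip: power_int_add)

text \<open>The addition rule \<open>qd_add\<close>, applied to n + 1 = (n - r) + (r + 1), splits
  the leading factor of the falling factorial.\<close>

lemma qbinom_pascal:
  "qbinom (n + 1) (Suc r) = vv powi (int r + 1) * qbinom n (Suc r) + vv powi (int r - n) * qbinom n r"
proof -
  have "qd (n + 1) = vv powi (int r + 1) * qd (n - int r) + vv powi (int r - n) * qd (int r + 1)"
    using qd_add[of "n - int r" "int r + 1"] by simp
  then have "qff (n + 1) (Suc r) =
      vv powi (int r + 1) * qff n (Suc r) + vv powi (int r - n) * qff n r * qd (int (Suc r))"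
    unfolding qff_Suc'[of "n + 1"] by (simp add: qff_Suc algebra_simps)
  then show ?thesis
    by (simp add: qbinom_qff qdfact_Suc add_divide_distrib del: of_nat_Suc)
qed

text \<open>Pascal's rule runs upwards and downwards from n = 0, where the binomial vanishes. Going
  down requires the coefficient v^(r+1) to be a unit of \<A>.\<close>

lemma qbinom_in_laurents: "qbinom n r \<in> laurents"
proof (induction r arbitrary: n)
  case 0
  show ?case by (simp add: laurents_closed)
next
  case (Suc r)
  show ?case
  proof (induction n rule: int_induct[where k = 0])
    case base
    have "qff 0 (Suc r) = 0" by (simp add: qff_Suc' qd_simps)
    then show ?case by (simp add: qbinom_qff laurents_closed)
  next
    case (step1 i)
    then show ?case by (simp add: qbinom_pascal laurents_closed Suc)
  next
    case (step2 i)
    have "qbinom (i - 1) (Suc r) =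
        vv powi (- (int r + 1)) * (qbinom i (Suc r) - vv powi (int r - (i - 1)) * qbinom (i - 1) r)"
      using qbinom_pascal[of "i - 1" r] indet_nonzero
      by (simp only: power_int_minus) (simp add: algebra_simps)
    then show ?case
      by (simp add: step2 Suc laurents_closed del: minus_add_distrib)
  qed
qed

lemma qint_in_laurents: "qint n \<in> laurents"
  using qbinom_in_laurents[of n 1] by simp

section \<open>Commutation relations in the quantum group\<close>

lemma uv_const_uminus: "uv_const (- a) = - uv_const a"
  using uv_const_simps(3)[of a "- a"] by (simp add: uv_const_simps(1) eq_neg_iff_add_eq_0 add.commute)

lemma uv_const_diff: "uv_const (a - b) = uv_const a - uv_const b"
  using uv_const_simps(3)[of a "- b"] by (simp add: uv_const_uminus)

lemma uv_const_left: "NO_MATCH (uv_const d) u \<Longrightarrow> u * (uv_const c * w) = uv_const c * (u * w)"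
  by (metis mult.assoc uv_const_central)

lemma uv_const_merge: "uv_const a * (uv_const b * w) = uv_const (a * b) * w"
  by (simp add: uv_const_simps(4) mult.assoc)

lemma uv_const_cancel:
  assumes "a \<noteq> 0" "uv_const a * u = uv_const a * w"
  shows "u = w"
proof -
  have "uv_const (inverse a) * (uv_const a * u) = uv_const (inverse a) * (uv_const a * w)"
    using assms(2) by simp
  then show ?thesis using assms(1) by (simp add: uv_const_merge uv_const_simps(2))
qed

lemma uv_K_cancel [simp]: "uv_K * (uv_K_inv * y) = y" "uv_K_inv * (uv_K * y) = y"
  by (simp_all add: uv_relations flip: mult.assoc)

lemma uv_K_inv_E: "uv_K_inv * uv_E = uv_const (vv powi (-2)) * (uv_E * uv_K_inv)"
proof -
  have "uv_E * uv_K_inv = uv_K_inv * (uv_K * uv_E) * uv_K_inv"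
    by (simp add: mult.assoc)
  also have "\<dots> = uv_const (vv powi 2) * (uv_K_inv * uv_E)"
    unfolding uv_relations(3) by (simp add: mult.assoc uv_const_left uv_relations(1))
  finally show ?thesis
    by (simp add: uv_const_merge indet_nonzero uv_const_simps(2) del: power_int_numeral flip: power_int_add)
qed

lemma uv_K_inv_F: "uv_K_inv * uv_F = uv_const (vv powi 2) * (uv_F * uv_K_inv)"
proof -
  have "uv_F * uv_K_inv = uv_K_inv * (uv_K * uv_F) * uv_K_inv"
    by (simp add: mult.assoc)
  also have "\<dots> = uv_const (vv powi (-2)) * (uv_K_inv * uv_F)"
    unfolding uv_relations(4) by (simp add: mult.assoc uv_const_left uv_relations(1))
  finally show ?thesis
    by (simp add: uv_const_merge indet_nonzero uv_const_simps(2) del: power_int_numeral flip: power_int_add)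
qed

text \<open>The factors of \<open>[K; c; t]\<close>, up to scalars.\<close>

definition Kd :: "int \<Rightarrow> uv" where
  "Kd a = uv_const (vv powi a) * uv_K - uv_const (vv powi (- a)) * uv_K_inv"

lemma Kd_scale: "uv_const x * Kd a = uv_const (x * vv powi a) * uv_K - uv_const (x * vv powi (- a)) * uv_K_inv"
  by (simp add: Kd_def right_diff_distrib uv_const_merge)

lemma Kd_commute: "Kd a * Kd b = Kd b * Kd a"
  by (simp add: Kd_def algebra_simps uv_const_left uv_const_merge uv_relations(1,2) mult.commute
      flip: uv_const_simps(4))

lemma Kd_E: "Kd a * uv_E = uv_E * Kd (a + 2)"
  by (simp add: Kd_def algebra_simps uv_relations(3) uv_K_inv_E uv_const_left uv_const_merge
      indet_nonzero del: power_int_numeral flip: power_int_add)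

lemma Kd_F: "Kd a * uv_F = uv_F * Kd (a - 2)"
  by (simp add: Kd_def algebra_simps uv_relations(4) uv_K_inv_F uv_const_left uv_const_merge
      indet_nonzero del: power_int_numeral flip: power_int_add)

text \<open>Addition rule for the brackets, checked on the coefficients of K and K^-1. It is the
  linear relation behind both \<open>E_F_power\<close> and \<open>K_binom_step\<close>.\<close>

lemma Kd_linear:
  "uv_const (qd (a - t)) * Kd (m - a) + uv_const (qd t) * Kd m = uv_const (qd a) * Kd (m + t - a)"
proof -
  have *: "(uv_const A * uv_K - uv_const B * uv_K_inv) + (uv_const A' * uv_K - uv_const B' * uv_K_inv)
     = uv_const (A + A') * uv_K - uv_const (B + B') * uv_K_inv" for A B A' B'
    by (simp add: uv_const_simps algebra_simps)
  show ?thesis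
    unfolding Kd_scale * by (simp add: qd_def algebra_simps indet_nonzero flip: power_int_add)
qed

definition Kff :: "int \<Rightarrow> nat \<Rightarrow> uv" where
  "Kff c t = prod_list (map (\<lambda>i. Kd (c - int i)) [0..<t])"

lemma Kff_0 [simp]: "Kff c 0 = 1" and Kff_Suc: "Kff c (Suc t) = Kff c t * Kd (c - int t)"
  by (simp_all add: Kff_def)

lemma Kff_Suc': "Kff c (Suc t) = Kd c * Kff (c - 1) t"
proof (induction t)
  case (Suc t)
  have "Kff c (Suc (Suc t)) = Kd c * (Kff (c - 1) t * Kd (c - int (Suc t)))"
    using Suc by (simp add: Kff_Suc[of c "Suc t"] mult.assoc)
  then show ?case by (simp add: Kff_Suc[of "c - 1" t] diff_diff_eq add.commute)
qed (simp add: Kff_Suc)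

lemma Kff_add: "Kff c (a + b) = Kff c a * Kff (c - int a) b"
  by (induction b) (simp_all add: Kff_Suc mult.assoc algebra_simps)

lemma Kd_Kff: "Kd a * Kff c t = Kff c t * Kd a"
proof (induction t)
  case (Suc t)
  then show ?case by (metis Kff_Suc Kd_commute mult.assoc)
qed simp

lemma Kff_E: "Kff c t * uv_E = uv_E * Kff (c + 2) t"
proof (induction t)
  case (Suc t)
  have "Kff c (Suc t) * uv_E = Kff c t * uv_E * Kd (c - int t + 2)"
    by (simp add: Kff_Suc mult.assoc Kd_E)
  also have "\<dots> = uv_E * Kff (c + 2) (Suc t)"
    by (simp add: Suc Kff_Suc mult.assoc algebra_simps)
  finally show ?case .
qed simp

lemma Kff_F: "Kff c t * uv_F = uv_F * Kff (c - 2) t"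
proof (induction t)
  case (Suc t)
  have "Kff c (Suc t) * uv_F = Kff c t * uv_F * Kd (c - int t - 2)"
    by (simp add: Kff_Suc mult.assoc Kd_F)
  also have "\<dots> = uv_F * Kff (c - 2) (Suc t)"
    by (simp add: Suc Kff_Suc mult.assoc algebra_simps)
  finally show ?case .
qed simp

lemma K_binom_Kff: "K_binom c t = uv_const (inverse (qdfact t)) * Kff c t"
proof (induction t)
  case 0 show ?case by (simp add: K_binom_def uv_const_simps)
next
  case (Suc t)
  have upto: "[1..int (Suc t)] = [1..int t] @ [int (Suc t)]"
    using upto_rec2[of 1 "int (Suc t)"] by simp
  have "K_binom c (Suc t) = K_binom c t * (uv_const (inverse (qd (int (Suc t)))) * Kd (c - int t))"
    unfolding K_binom_def upto by (simp add: Kd_def qd_def algebra_simps)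
  then show ?case
    by (simp add: Suc Kff_Suc qdfact_Suc uv_const_left uv_const_merge mult.assoc mult.commute
        del: of_nat_Suc)
qed

lemma K_binom_0 [simp]: "K_binom c 0 = 1"
  by (simp add: K_binom_Kff uv_const_simps)

lemma K_binom_1: "K_binom c (Suc 0) = uv_const (inverse (qd 1)) * Kd c"
  by (simp add: K_binom_Kff Kff_Suc qdfact_Suc)

lemma K_binom_Suc:
  "K_binom c (Suc t) = uv_const (inverse (qd (int (Suc t)))) * (Kd (c - int t) * K_binom c t)"
  by (simp add: K_binom_Kff Kff_Suc qdfact_Suc uv_const_left uv_const_merge Kd_Kff
      del: of_nat_Suc)

lemma K_binom_Suc':
  "K_binom c (Suc t) = uv_const (inverse (qd (int (Suc t)))) * (Kd c * K_binom (c - 1) t)"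
  by (simp add: K_binom_Kff Kff_Suc' qdfact_Suc uv_const_left uv_const_merge del: of_nat_Suc)

lemma K_binom_mult:
  "uv_const (qbinom (int (a + b)) a) * K_binom c (a + b) = K_binom c a * K_binom (c - int a) b"
proof -
  have "qdfact (a + b) = qff (int (a + b)) a * qdfact b"
    by (simp add: qdfact_def qff_add)
  then have "qbinom (int (a + b)) a * inverse (qdfact (a + b)) = inverse (qdfact a) * inverse (qdfact b)"
    using qdfact_nonzero[of "a + b"] by (simp add: qbinom_qff field_simps)
  then show ?thesis
    by (simp add: K_binom_Kff Kff_add uv_const_left uv_const_merge mult.assoc del: of_nat_add)
qed

lemma K_binom_E: "K_binom c t * uv_E = uv_E * K_binom (c + 2) t"
  by (simp add: K_binom_Kff mult.assoc Kff_E uv_const_left)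

lemma K_binom_F: "K_binom c t * uv_F = uv_F * K_binom (c - 2) t"
  by (simp add: K_binom_Kff mult.assoc Kff_F uv_const_left)

lemma K_binom_E_div: "K_binom c t * E_div r = E_div r * K_binom (c + 2 * int r) t"
proof -
  have "K_binom c t * uv_E ^ r = uv_E ^ r * K_binom (c + 2 * int r) t"
  proof (induction r)
    case (Suc r)
    have "K_binom c t * uv_E ^ Suc r = K_binom c t * uv_E ^ r * uv_E"
      by (simp only: power_Suc2 mult.assoc)
    also have "\<dots> = uv_E ^ Suc r * K_binom (c + 2 * int (Suc r)) t"
      by (simp add: Suc mult.assoc K_binom_E power_Suc2 algebra_simps del: power_Suc)
    finally show ?case .
  qed simp
  then show ?thesis by (simp add: E_div_def uv_const_left mult.assoc)
qed

lemma K_binom_F_div: "K_binom c t * F_div r = F_div r * K_binom (c - 2 * int r) t"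
proof -
  have "K_binom c t * uv_F ^ r = uv_F ^ r * K_binom (c - 2 * int r) t"
  proof (induction r)
    case (Suc r)
    have "K_binom c t * uv_F ^ Suc r = K_binom c t * uv_F ^ r * uv_F"
      by (simp only: power_Suc2 mult.assoc)
    also have "\<dots> = uv_F ^ Suc r * K_binom (c - 2 * int (Suc r)) t"
      by (simp add: Suc mult.assoc K_binom_F power_Suc2 algebra_simps del: power_Suc)
    finally show ?case .
  qed simp
  then show ?thesis by (simp add: F_div_def uv_const_left mult.assoc)
qed

lemma K_E_power: "uv_K * uv_E ^ r = uv_const (vv powi (2 * int r)) * (uv_E ^ r * uv_K)"
proof (induction r)
  case (Suc r)
  have "uv_K * uv_E ^ Suc r = uv_K * uv_E ^ r * uv_E"
    by (simp only: power_Suc2 mult.assoc)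
  also have "\<dots> = uv_const (vv powi (2 * int (Suc r))) * (uv_E ^ Suc r * uv_K)"
    by (simp add: Suc mult.assoc uv_relations(3) uv_const_left uv_const_merge power_Suc2 indet_nonzero
        algebra_simps del: power_Suc power_int_numeral flip: power_int_add)
  finally show ?case .
qed (simp add: uv_const_simps)

lemma K_F_power: "uv_K * uv_F ^ r = uv_const (vv powi (- 2 * int r)) * (uv_F ^ r * uv_K)"
proof (induction r)
  case (Suc r)
  have "uv_K * uv_F ^ Suc r = uv_K * uv_F ^ r * uv_F"
    by (simp only: power_Suc2 mult.assoc)
  also have "\<dots> = uv_const (vv powi (- 2 * int (Suc r))) * (uv_F ^ Suc r * uv_K)"
    by (simp add: Suc mult.assoc uv_relations(4) uv_const_left uv_const_merge power_Suc2 indet_nonzero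
        algebra_simps del: power_Suc power_int_numeral flip: power_int_add)
  finally show ?case .
qed (simp add: uv_const_simps)

lemma K_E_div: "uv_K * E_div r = uv_const (vv powi (2 * int r)) * (E_div r * uv_K)"
  by (simp add: E_div_def uv_const_left K_E_power uv_const_merge mult.assoc mult.commute)

lemma K_F_div: "uv_K * F_div r = uv_const (vv powi (- 2 * int r)) * (F_div r * uv_K)"
  by (simp add: F_div_def uv_const_left K_F_power uv_const_merge mult.assoc mult.commute)

lemma E_div_0 [simp]: "E_div 0 = 1" and F_div_0 [simp]: "F_div 0 = 1"
  by (simp_all add: E_div_def F_div_def qfact_def uv_const_simps)

lemma E_div_1 [simp]: "E_div (Suc 0) = uv_E" and F_div_1 [simp]: "F_div (Suc 0) = uv_F"
  by (simp_all add: E_div_def F_div_def qfact_def uv_const_simps)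

lemma E_div_mult: "E_div r * E_div s = uv_const (qbinom (int (r + s)) r) * E_div (r + s)"
  unfolding E_div_def qbinom_qfact
  by (simp add: uv_const_left uv_const_merge mult.assoc flip: power_add) (simp add: field_simps)

lemma F_div_mult: "F_div r * F_div s = uv_const (qbinom (int (r + s)) r) * F_div (r + s)"
  unfolding F_div_def qbinom_qfact
  by (simp add: uv_const_left uv_const_merge mult.assoc flip: power_add) (simp add: field_simps)

lemma E_E_div: "uv_E * E_div r = uv_const (qint (int (Suc r))) * E_div (Suc r)"
proof -
  have "inverse (qfact r) = qint (int (Suc r)) * inverse (qfact (Suc r))"
    by (simp add: qfact_Suc field_simps del: of_nat_Suc)
  then show ?thesis by (simp add: E_div_def uv_const_left uv_const_merge)
qed

text \<open>The truncated exponent at n = 0 is harmless because its coefficient is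
  \<open>qint 0\<close>. In the induction, moving the bracket of K past the new F produces two
  brackets, which \<open>Kd_linear\<close> merges.\<close>

lemma E_F_power:
  "uv_E * uv_F ^ n = uv_F ^ n * uv_E + uv_const (qint (int n) / qd 1) * (uv_F ^ (n - 1) * Kd (1 - int n))"
proof (induction n)
  case 0 show ?case by (simp add: uv_const_simps)
next
  case (Suc n)
  have EF: "uv_E * uv_F = uv_F * uv_E + uv_const (1 / qd 1) * Kd 0"
    using uv_relations(5) by (simp add: Kd_def qd_def power_int_minus uv_const_simps algebra_simps inverse_eq_divide)
  have lin: "uv_const (1 / qd 1) * Kd 0 + uv_const (qint (int n) / qd 1) * Kd (- 1 - int n)
     = uv_const (qint (int (Suc n)) / qd 1) * Kd (- int n)"
  proof (rule uv_const_cancel[of "qd 1 * qd 1"])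
    show "uv_const (qd 1 * qd 1) * (uv_const (1 / qd 1) * Kd 0 + uv_const (qint (int n) / qd 1) * Kd (- 1 - int n))
      = uv_const (qd 1 * qd 1) * (uv_const (qint (int (Suc n)) / qd 1) * Kd (- int n))"
      using Kd_linear[of "int (Suc n)" 1 0]
      by (simp add: distrib_left uv_const_merge qint_qd add.commute)
  qed simp
  have "uv_E * uv_F ^ Suc n = uv_E * uv_F ^ n * uv_F"
    by (simp only: power_Suc2 mult.assoc)
  also have "\<dots> = uv_F ^ n * (uv_E * uv_F) + uv_const (qint (int n) / qd 1) * (uv_F ^ (n - 1) * (Kd (1 - int n) * uv_F))"
    by (simp add: Suc distrib_right mult.assoc)
  also have "uv_const (qint (int n) / qd 1) * (uv_F ^ (n - 1) * (Kd (1 - int n) * uv_F))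
      = uv_F ^ n * (uv_const (qint (int n) / qd 1) * Kd (- 1 - int n))"
  proof (cases n)
    case (Suc m)
    have "- 1 - int n = 1 - int n - 2" by simp
    with Suc show ?thesis
      by (simp only: Kd_F power_Suc2 mult.assoc diff_Suc_1) (simp add: uv_const_left)
  qed (simp add: uv_const_simps)
  also have "uv_F ^ n * (uv_E * uv_F) + \<dots> = uv_F ^ Suc n * uv_E + uv_F ^ n *
      (uv_const (1 / qd 1) * Kd 0 + uv_const (qint (int n) / qd 1) * Kd (- 1 - int n))"
    by (simp add: EF distrib_left power_Suc2 mult.assoc del: power_Suc)
  finally show ?case unfolding lin by (simp add: uv_const_left)
qed

lemma E_F_div:
  "uv_E * F_div (Suc s) = F_div (Suc s) * uv_E + F_div s * K_binom (- int s) 1"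
proof -
  have *: "inverse (qfact (Suc s)) * (qint (int (Suc s)) / qd 1) = inverse (qfact s) * inverse (qd 1)"
    by (simp add: qfact_Suc field_simps del: of_nat_Suc)
  have "uv_const (inverse (qfact (Suc s))) * (uv_E * uv_F ^ Suc s) =
      uv_const (inverse (qfact (Suc s))) * (uv_F ^ Suc s * uv_E)
      + uv_const (inverse (qfact (Suc s)) * (qint (int (Suc s)) / qd 1)) * (uv_F ^ s * Kd (- int s))"
    unfolding E_F_power by (simp add: distrib_left uv_const_merge del: power_Suc)
  then show ?thesis
    unfolding * by (simp add: F_div_def uv_const_left uv_const_merge K_binom_1 mult.assoc del: power_Suc)
qed

text \<open>Used with a = r + 1: it merges the two contributions to the term of index t when E^(r)
  F^(s) is multiplied by E. After removing the common factor \<open>K_binom (c - 1) (t - 1)\<close>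
  it becomes \<open>Kd_linear\<close>.\<close>

lemma K_binom_step:
  assumes "t \<ge> 1"
  shows "uv_const (qint (a - int t)) * K_binom (c - 1) t + K_binom (c - int t + a) 1 * K_binom (c - 1) (t - 1)
    = uv_const (qint a) * K_binom c t"
proof -
  obtain p where t: "t = Suc p" using assms by (cases t) auto
  have lin: "uv_const (qint (a - int t) / qd (int t)) * Kd (c - int t) + uv_const (1 / qd 1) * Kd (c - int t + a)
     = uv_const (qint a / qd (int t)) * Kd c"
  proof (rule uv_const_cancel[of "qd 1 * qd (int t)"])
    show "uv_const (qd 1 * qd (int t)) * (uv_const (qint (a - int t) / qd (int t)) * Kd (c - int t) + uv_const (1 / qd 1) * Kd (c - int t + a))
      = uv_const (qd 1 * qd (int t)) * (uv_const (qint a / qd (int t)) * Kd c)"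
      using Kd_linear[of a "int t" "c - int t + a"] assms
      by (simp add: distrib_left uv_const_merge qint_qd)
  qed (use assms in simp)
  show ?thesis
    unfolding t K_binom_Suc'[of c] K_binom_Suc[of "c - 1"] One_nat_def K_binom_1
    using arg_cong[OF lin, of "\<lambda>u. u * K_binom (c - 1) p"]
    by (simp add: t distrib_right uv_const_left uv_const_merge mult.assoc divide_inverse algebra_simps)
qed

text \<open>Induction on r through E E^(r) = [r + 1] E^(r+1). The sum runs over all t up to r, with
  zero terms for t > s, so that the two shifted sums of the step have a common range.\<close>

lemma E_div_F_div_aux:
  "E_div r * F_div s = (\<Sum>t\<le>r. if t \<le> s then
     F_div (s - t) * (K_binom (2 * int t - int r - int s) t * E_div (r - t)) else 0)"
proof (induction r)
  case 0 show ?case by simp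
next
  case (Suc r)
  \<comment> \<open>\<open>A t\<close> is the term in which E passes F^(s-t).
    \<open>B (Suc t)\<close> is the commutator term, which lowers the power of F by one and
    therefore belongs to index t + 1.\<close>
  define A where "A t = (if t \<le> s then F_div (s - t) *
    (uv_const (qint (int (Suc r) - int t)) * (K_binom (2 * int t - int r - int s - 2) t * E_div (Suc r - t))) else 0)" for t
  define B where "B t = (if 1 \<le> t \<and> t \<le> s then F_div (s - t) *
    (K_binom (int t - int s) 1 * (K_binom (2 * int t - int r - int s - 2) (t - 1) * E_div (Suc r - t))) else 0)" for t
  have step: "uv_E * (if t \<le> s then F_div (s - t) * (K_binom (2 * int t - int r - int s) t * E_div (r - t)) else 0)
      = A t + B (Suc t)" if "t \<le> r" for t
  proof (cases "t \<le> s")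
    case True
    have E: "uv_E * E_div (r - t) = uv_const (qint (int (Suc r) - int t)) * E_div (Suc r - t)"
      using that by (simp add: E_E_div Suc_diff_le of_nat_diff algebra_simps)
    have KE: "uv_E * (K_binom (2 * int t - int r - int s) t * E_div (r - t)) =
      uv_const (qint (int (Suc r) - int t)) * (K_binom (2 * int t - int r - int s - 2) t * E_div (Suc r - t))"
    proof -
      have "uv_E * K_binom (2 * int t - int r - int s) t = K_binom (2 * int t - int r - int s - 2) t * uv_E"
        using K_binom_E[of "2 * int t - int r - int s - 2" t] by simp
      then have "uv_E * (K_binom (2 * int t - int r - int s) t * E_div (r - t))
          = K_binom (2 * int t - int r - int s - 2) t * (uv_E * E_div (r - t))"
        by (simp flip: mult.assoc)
      then show ?thesis unfolding E by (simp add: uv_const_left)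
    qed
    show ?thesis
    proof (cases "t = s")
      case True
      then show ?thesis using KE by (simp add: A_def B_def)
    next
      case False
      then obtain d where d: "s - t = Suc d" "s - Suc t = d" "t < s" "int d = int s - int t - 1"
        using that[of "s - Suc t"] True False by (simp add: Suc_diff_Suc)
      have "uv_E * (F_div (s - t) * (K_binom (2 * int t - int r - int s) t * E_div (r - t))) =
         F_div (s - t) * (uv_E * (K_binom (2 * int t - int r - int s) t * E_div (r - t)))
         + F_div d * (K_binom (- int d) 1 * (K_binom (2 * int t - int r - int s) t * E_div (r - t)))"
        unfolding d(1) using E_F_div[of d] by (metis distrib_right mult.assoc)
      then show ?thesis unfolding KE using d by (simp add: A_def B_def algebra_simps)
    qed
  qed (simp add: A_def B_def)
  have "uv_const (qint (int (Suc r))) * (E_div (Suc r) * F_div s) = uv_E * (E_div r * F_div s)"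
    by (metis E_E_div mult.assoc)
  also have "\<dots> = (\<Sum>t\<le>r. A t + B (Suc t))"
    unfolding Suc sum_distrib_left using step by (intro sum.cong) auto
  also have "\<dots> = (\<Sum>t\<le>r. A t) + (\<Sum>t\<le>r. B (Suc t))"
    by (rule sum.distrib)
  also have "(\<Sum>t\<le>r. A t) = (\<Sum>t\<le>Suc r. A t)"
    by (simp add: A_def uv_const_simps)
  also have "(\<Sum>t\<le>r. B (Suc t)) = (\<Sum>t\<le>Suc r. B t)"
    unfolding sum.atMost_Suc_shift[of B] by (simp add: B_def)
  also have "(\<Sum>t\<le>Suc r. A t) + (\<Sum>t\<le>Suc r. B t) = uv_const (qint (int (Suc r))) *
     (\<Sum>t\<le>Suc r. if t \<le> s then F_div (s - t) * (K_binom (2 * int t - int (Suc r) - int s) t * E_div (Suc r - t)) else 0)"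
    unfolding sum_distrib_left sum.distrib[symmetric]
  proof (intro sum.cong refl)
    fix t assume "t \<in> {..Suc r}"
    show "A t + B t = uv_const (qint (int (Suc r))) *
      (if t \<le> s then F_div (s - t) * (K_binom (2 * int t - int (Suc r) - int s) t * E_div (Suc r - t)) else 0)"
    proof (cases "1 \<le> t \<and> t \<le> s")
      case True
      let ?c = "2 * int t - int (Suc r) - int s"
      have "uv_const (qint (int (Suc r) - int t)) * K_binom (2 * int t - int r - int s - 2) t
          + K_binom (int t - int s) 1 * K_binom (2 * int t - int r - int s - 2) (t - 1)
          = uv_const (qint (int (Suc r))) * K_binom ?c t"
        using K_binom_step[of t "int (Suc r)" ?c] True by (simp add: algebra_simps)
      from arg_cong[OF this, of "\<lambda>u. F_div (s - t) * (u * E_div (Suc r - t))"] True show ?thesis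
        by (simp add: A_def B_def distrib_left distrib_right mult.assoc uv_const_left del: of_nat_Suc)
    next
      case False
      then show ?thesis by (cases t) (auto simp: A_def B_def uv_const_left)
    qed
  qed
  finally show ?case
    by (rule uv_const_cancel[rotated]) simp
qed

lemma E_div_F_div:
  "E_div r * F_div s = (\<Sum>t\<le>min r s.
     F_div (s - t) * (K_binom (2 * int t - int r - int s) t * E_div (r - t)))"
  unfolding E_div_F_div_aux by (rule sum.mono_neutral_cong_right) auto

text \<open>On a vector of weight n this is \<open>qbinom_pascal\<close> at n + c: the factor K^-1
  supplies the missing power v^-n.\<close>

lemma K_binom_pascal:
  "K_binom (c + 1) (Suc t) = uv_const (vv powi (int t + 1)) * K_binom c (Suc t)
     + uv_const (vv powi (int t - c)) * (uv_K_inv * K_binom c t)"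
proof -
  have "Kd (c + 1) = uv_const (vv powi (int t + 1)) * Kd (c - int t)
     + uv_const (vv powi (int t - c) * qd (int (Suc t))) * uv_K_inv"
    by (simp add: Kd_def qd_def algebra_simps uv_const_merge indet_nonzero uv_const_diff flip: power_int_add)
  moreover have *: "inverse (qd (int (Suc t))) * (qd (int (Suc t)) * x) = x" for x
    by (simp add: field_simps del: of_nat_Suc)
  ultimately show ?thesis
    unfolding K_binom_Suc'[of "c + 1"] K_binom_Suc[of c]
    by (simp add: distrib_right distrib_left mult.assoc uv_const_left uv_const_merge mult.commute *
      del: of_nat_Suc)
qed

section \<open>Closure properties of the integral form\<close>

lemma UA_const: "f \<in> laurents \<Longrightarrow> u \<in> UA \<Longrightarrow> uv_const f * u \<in> UA"
  by (auto simp: laurents_def UA.scale)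

lemma UA_one: "1 \<in> UA"
  using UA.E_div[of 0] by simp

lemma UA_const': "f \<in> laurents \<Longrightarrow> uv_const f \<in> UA"
  using UA_const[OF _ UA_one] by simp

lemma UA_zero: "0 \<in> UA"
  using UA_const'[of 0] by (simp add: uv_const_simps laurents_closed)

lemma UA_uminus: "u \<in> UA \<Longrightarrow> - u \<in> UA"
  using UA_const[of "- 1" u] laurents_closed(2,6) by (simp add: uv_const_uminus uv_const_simps)

lemma UA_diff: "u \<in> UA \<Longrightarrow> w \<in> UA \<Longrightarrow> u - w \<in> UA"
  using UA.add[of u "- w"] UA_uminus by simp

lemma UA_sum: "(\<And>i. i \<in> I \<Longrightarrow> u i \<in> UA) \<Longrightarrow> sum u I \<in> UA"
  by (induction I rule: infinite_finite_induct) (auto intro: UA_zero UA.add)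

lemma UA_power: "u \<in> UA \<Longrightarrow> u ^ n \<in> UA"
  by (induction n) (auto intro: UA_one UA.mult)

lemma UA_E: "uv_E \<in> UA" and UA_F: "uv_F \<in> UA"
  using UA.E_div[of 1] UA.F_div[of 1] by simp_all

text \<open>Comparing the terms of \<open>E\<^sup>(\<^sup>t\<^sup>) F\<^sup>(\<^sup>t\<^sup>)\<close> isolates \<open>[K; 0; t]\<close>, and the Pascal rule moves the
  argument \<open>c\<close>.\<close>

lemma K_binom_in_UA: "K_binom c t \<in> UA"
proof (induction t arbitrary: c rule: less_induct)
  case (less t)
  show ?case
  proof (cases t)
    case 0 then show ?thesis by (simp add: UA_one)
  next
    case (Suc p)
    have K0: "K_binom 0 t \<in> UA"
    proof -
      have "E_div t * F_div t = (\<Sum>i<t. F_div (t - i) * (K_binom (2 * int i - int t - int t) i * E_div (t - i)))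
         + K_binom 0 t"
        unfolding E_div_F_div by (simp add: lessThan_Suc_atMost[symmetric])
      then have "K_binom 0 t = E_div t * F_div t - (\<Sum>i<t. F_div (t - i) * (K_binom (2 * int i - int t - int t) i * E_div (t - i)))"
        by (simp add: algebra_simps)
      moreover have "E_div t * F_div t - (\<Sum>i<t. F_div (t - i) * (K_binom (2 * int i - int t - int t) i * E_div (t - i))) \<in> UA"
        by (intro UA_diff UA_sum UA.mult UA.E_div UA.F_div less) simp
      ultimately show ?thesis by (simp only:)
    qed
    show ?thesis
    proof (induction c rule: int_induct[where k = 0])
      case base show ?case by (rule K0)
    next
      case (step1 i)
      then show ?case using less[of p i]
        by (simp add: Suc K_binom_pascal UA.add UA.mult UA_const UA.K_inv laurents_closed)
    next
      case (step2 i)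
      have "K_binom (i - 1) t = uv_const (vv powi (- (int p + 1))) *
         (K_binom i t - uv_const (vv powi (int p - (i - 1))) * (uv_K_inv * K_binom (i - 1) p))"
      proof -
        have "K_binom i t - uv_const (vv powi (int p - (i - 1))) * (uv_K_inv * K_binom (i - 1) p)
            = uv_const (vv powi (int p + 1)) * K_binom (i - 1) t"
          using K_binom_pascal[of "i - 1" p] Suc by simp
        then show ?thesis
          by (simp only: uv_const_merge) (simp add: indet_nonzero uv_const_simps flip: power_int_add)
      qed
      then show ?case using less[of p "i - 1"] step2
        by (simp add: Suc UA_diff UA.mult UA_const UA.K_inv laurents_closed del: minus_add_distrib)
    qed
  qed
qed

section \<open>The antipode on the integral form\<close>

lemma antipode_simps:
  "antipode (u + w) = antipode u + antipode w"
  "antipode (u * w) = antipode w * antipode u"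
  "antipode (uv_const c) = uv_const c"
  "antipode uv_E = - (uv_K_inv * uv_E)" "antipode uv_F = - (uv_F * uv_K)"
  "antipode uv_K = uv_K_inv" "antipode uv_K_inv = uv_K"
  by (transfer; simp add: free_antipode_hom free_antipode_simps)+

lemma antipode_one: "antipode 1 = 1"
  using antipode_simps(3)[of 1] by (simp add: uv_const_simps)

lemma antipode_power: "antipode (u ^ n) = antipode u ^ n"
  by (induction n) (simp_all add: antipode_one antipode_simps power_commutes)

lemma E_K_inv_power: "uv_E * uv_K_inv ^ n = uv_const (vv powi (2 * int n)) * (uv_K_inv ^ n * uv_E)"
proof (induction n)
  case (Suc n)
  have "uv_E * uv_K_inv = uv_const (vv powi 2) * (uv_K_inv * uv_E)"
    unfolding uv_K_inv_E by (simp add: uv_const_merge indet_nonzero uv_const_simps del: power_int_numeral flip: power_int_add)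
  then have "uv_E * uv_K_inv ^ Suc n = uv_const (vv powi 2) * (uv_K_inv * (uv_E * uv_K_inv ^ n))"
    by (metis mult.assoc power_Suc)
  also have "\<dots> = uv_const (vv powi (2 * int (Suc n))) * (uv_K_inv ^ Suc n * uv_E)"
    by (simp add: Suc uv_const_left uv_const_merge mult.assoc indet_nonzero algebra_simps del: power_int_numeral flip: power_int_add)
  finally show ?case .
qed (simp add: uv_const_simps)

lemma K_power_F: "uv_K ^ n * uv_F = uv_const (vv powi (- 2 * int n)) * (uv_F * uv_K ^ n)"
proof (induction n)
  case (Suc n)
  have "uv_K ^ Suc n * uv_F = uv_K ^ n * (uv_K * uv_F)"
    by (simp only: power_Suc2 mult.assoc)
  also have "\<dots> = uv_const (vv powi (- 2)) * (uv_K ^ n * uv_F * uv_K)"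
    by (simp add: uv_relations(4) uv_const_left mult.assoc)
  also have "\<dots> = uv_const (vv powi (- 2 * int (Suc n))) * (uv_F * uv_K ^ Suc n)"
    by (simp add: Suc uv_const_left uv_const_merge mult.assoc indet_nonzero algebra_simps power_commutes del: power_int_numeral flip: power_int_add)
  finally show ?case .
qed (simp add: uv_const_simps)

text \<open>The exponent n(n - 1) is twice 0 + 1 + ... + (n - 1), collected while moving the factors
  K^-1 to the left. The coefficient is a unit of \<A>, so the image stays in the integral form and
  nothing is lost at q.\<close>

lemma antipode_E_div:
  "antipode (E_div n) = uv_const ((- 1) ^ n * vv powi (int n * (int n - 1))) * (uv_K_inv ^ n * E_div n)"
proof -
  have "(- (uv_K_inv * uv_E)) ^ n = uv_const ((- 1) ^ n * vv powi (int n * (int n - 1))) * (uv_K_inv ^ n * uv_E ^ n)"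
  proof (induction n)
    case (Suc n)
    have "(- (uv_K_inv * uv_E)) ^ Suc n = - (uv_const ((- 1) ^ n * vv powi (int n * (int n - 1))) *
        (uv_K_inv * (uv_E * uv_K_inv ^ n) * uv_E ^ n))"
      by (simp add: Suc uv_const_left mult.assoc)
    also have "\<dots> = uv_const (- ((- 1) ^ n * (vv powi (int n * (int n - 1)) * vv powi (2 * int n)))) *
        (uv_K_inv ^ Suc n * uv_E ^ Suc n)"
      by (simp add: E_K_inv_power uv_const_left uv_const_merge uv_const_uminus mult.assoc)
    also have "vv powi (int n * (int n - 1)) * vv powi (2 * int n) = vv powi (int (Suc n) * (int (Suc n) - 1))"
      by (simp add: indet_nonzero algebra_simps flip: power_int_add)
    finally show ?case by simp
  qed (simp add: uv_const_simps)
  moreover have "antipode (E_div n) = uv_const (inverse (qfact n)) * (- (uv_K_inv * uv_E)) ^ n"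
    unfolding E_div_def antipode_simps(2,3) antipode_power antipode_simps(4) by (rule uv_const_central[symmetric])
  ultimately show ?thesis
    by (simp add: E_div_def uv_const_left uv_const_merge mult.commute)
qed

lemma antipode_F_div:
  "antipode (F_div n) = uv_const ((- 1) ^ n * vv powi (- (int n * (int n - 1)))) * (F_div n * uv_K ^ n)"
proof -
  have "(- (uv_F * uv_K)) ^ n = uv_const ((- 1) ^ n * vv powi (- (int n * (int n - 1)))) * (uv_F ^ n * uv_K ^ n)"
  proof (induction n)
    case (Suc n)
    have "(- (uv_F * uv_K)) ^ Suc n = - (uv_const ((- 1) ^ n * vv powi (- (int n * (int n - 1)))) *
        (uv_F ^ n * (uv_K ^ n * uv_F) * uv_K))"
      by (simp add: Suc power_Suc2 mult.assoc del: power_Suc)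
    also have "\<dots> = uv_const (- ((- 1) ^ n * (vv powi (- (int n * (int n - 1))) * vv powi (- 2 * int n)))) *
        (uv_F ^ Suc n * uv_K ^ Suc n)"
      by (simp add: K_power_F uv_const_left uv_const_merge uv_const_uminus power_Suc2 mult.assoc del: power_Suc)
    also have "vv powi (- (int n * (int n - 1))) * vv powi (- 2 * int n) = vv powi (- (int (Suc n) * (int (Suc n) - 1)))"
      by (simp add: indet_nonzero algebra_simps flip: power_int_add)
    finally show ?case by simp
  qed (simp add: uv_const_simps)
  moreover have "antipode (F_div n) = uv_const (inverse (qfact n)) * (- (uv_F * uv_K)) ^ n"
    unfolding F_div_def antipode_simps(2,3) antipode_power antipode_simps(5) by (rule uv_const_central[symmetric])
  ultimately show ?thesis
    by (simp add: F_div_def uv_const_left uv_const_merge mult.commute mult.assoc)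
qed

lemma sign_power_in_laurents: "(- 1) ^ n \<in> laurents"
  by (intro laurents_closed)

lemma antipode_in_UA: "u \<in> UA \<Longrightarrow> antipode u \<in> UA"
proof (induction rule: UA.induct)
  case (scale x p)
  then show ?case
    by (simp only: antipode_simps flip: uv_const_central) (rule UA.scale)
qed (auto simp: antipode_simps antipode_E_div antipode_F_div UA.intros UA_const UA_power
     laurents_closed sign_power_in_laurents)

section \<open>The Casimir element\<close>

lemma powi_add: "vv powi a * vv powi b = vv powi (a + b)"
  by (simp add: power_int_add indet_nonzero)

text \<open>The usual Casimir element multiplied by (v - v^-1)^2, which clears its denominator and
  puts it into \<open>UA\<close>.\<close>

definition casimir :: uv where
  "casimir = uv_const (qd 1 ^ 2) * (uv_F * uv_E) + uv_const (vv powi 1) * uv_K + uv_const (vv powi (- 1)) * uv_K_inv"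

lemma casimir_in_UA: "casimir \<in> UA"
  unfolding casimir_def
  by (intro UA.add UA.mult UA_const UA_E UA_F UA.K UA.K_inv laurents_closed qd_in_laurents)

lemma casimir_E: "casimir * uv_E = uv_E * casimir"
proof -
  have EF: "uv_E * uv_F = uv_F * uv_E + uv_const (1 / qd 1) * (uv_K - uv_K_inv)"
    using uv_relations(5) by (simp add: qd_def power_int_minus algebra_simps inverse_eq_divide)
  have "uv_E * casimir = uv_const (qd 1 ^ 2) * (uv_E * uv_F * uv_E)
     + uv_const (vv powi 1) * (uv_E * uv_K) + uv_const (vv powi (- 1)) * (uv_E * uv_K_inv)"
    by (simp add: casimir_def distrib_left uv_const_left mult.assoc)
  also have "\<dots> = uv_const (qd 1 ^ 2) * (uv_F * uv_E * uv_E) + uv_const (qd 1) * (uv_K * uv_E - uv_K_inv * uv_E)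
     + uv_const (vv powi 1) * (uv_E * uv_K) + uv_const (vv powi (- 1)) * (uv_E * uv_K_inv)"
    unfolding EF by (simp add: algebra_simps uv_const_left uv_const_merge power2_eq_square)
  also have "\<dots> = uv_const (qd 1 ^ 2) * (uv_F * uv_E * uv_E) +
     (uv_const (qd 1 * vv powi 2 + vv powi 1) * (uv_E * uv_K)
      + uv_const (vv powi (- 1) - qd 1 * vv powi (-2)) * (uv_E * uv_K_inv))"
    unfolding uv_relations(3) uv_K_inv_E
    by (simp add: algebra_simps uv_const_merge uv_const_simps(3) uv_const_diff del: power_int_numeral)
  also have "qd 1 * vv powi 2 + vv powi 1 = vv powi 3"
    by (simp only: qd_def left_diff_distrib powi_add) simp
  also have "vv powi (- 1) - qd 1 * vv powi (-2) = vv powi (- 3)"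
    by (simp only: qd_def left_diff_distrib powi_add) simp
  also have "uv_const (vv powi 3) * (uv_E * uv_K) + uv_const (vv powi (- 3)) * (uv_E * uv_K_inv)
      = uv_const (vv powi 1) * (uv_K * uv_E) + uv_const (vv powi (-1)) * (uv_K_inv * uv_E)"
    unfolding uv_relations(3) uv_K_inv_E
    by (simp only: uv_const_merge powi_add) simp
  also have "uv_const (qd 1 ^ 2) * (uv_F * uv_E * uv_E) + \<dots> = casimir * uv_E"
    by (simp add: casimir_def distrib_right mult.assoc)
  finally show ?thesis by simp
qed

lemma casimir_F: "casimir * uv_F = uv_F * casimir"
proof -
  have EF: "uv_E * uv_F = uv_F * uv_E + uv_const (1 / qd 1) * (uv_K - uv_K_inv)"
    using uv_relations(5) by (simp add: qd_def power_int_minus algebra_simps inverse_eq_divide)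
  have "casimir * uv_F = uv_const (qd 1 ^ 2) * (uv_F * (uv_E * uv_F))
     + uv_const (vv powi 1) * (uv_K * uv_F) + uv_const (vv powi (- 1)) * (uv_K_inv * uv_F)"
    by (simp add: casimir_def distrib_right uv_const_left mult.assoc)
  also have "\<dots> = uv_const (qd 1 ^ 2) * (uv_F * (uv_F * uv_E)) +
     (uv_const (qd 1 + vv powi 1 * vv powi (-2)) * (uv_F * uv_K)
      + uv_const (vv powi (- 1) * vv powi 2 - qd 1) * (uv_F * uv_K_inv))"
    unfolding EF uv_relations(4) uv_K_inv_F
    by (simp add: algebra_simps uv_const_left uv_const_merge uv_const_simps(3) uv_const_diff power2_eq_square
       del: power_int_numeral)
  also have "qd 1 + vv powi 1 * vv powi (-2) = vv powi 1"
    by (simp only: qd_def left_diff_distrib powi_add) simp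
  also have "vv powi (- 1) * vv powi 2 - qd 1 = vv powi (- 1)"
    by (simp only: qd_def left_diff_distrib powi_add) simp
  also have "uv_const (qd 1 ^ 2) * (uv_F * (uv_F * uv_E)) +
      (uv_const (vv powi 1) * (uv_F * uv_K) + uv_const (vv powi (- 1)) * (uv_F * uv_K_inv)) = uv_F * casimir"
    by (simp add: casimir_def distrib_left uv_const_left)
  finally show ?thesis .
qed

lemma casimir_K: "casimir * uv_K = uv_K * casimir"
proof -
  have "uv_K * (uv_F * uv_E) = uv_F * uv_E * uv_K"
    by (simp add: uv_relations(3,4) uv_const_left uv_const_merge indet_nonzero uv_const_simps
        mult.assoc del: power_int_numeral flip: mult.assoc[of uv_K] power_int_add)
  then show ?thesis
    by (simp add: casimir_def distrib_left distrib_right uv_const_left mult.assoc uv_relations(1,2))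
qed

lemma casimir_central: "u \<in> UA \<Longrightarrow> casimir * u = u * casimir"
proof (induction rule: UA.induct)
  case K then show ?case by (rule casimir_K)
next
  case K_inv
  have "uv_K_inv * (casimir * uv_K) * uv_K_inv = uv_K_inv * (uv_K * casimir) * uv_K_inv"
    by (simp only: casimir_K)
  then show ?case by (simp add: mult.assoc uv_relations(1))
next
  case (E_div n)
  have "casimir * uv_E ^ n = uv_E ^ n * casimir"
    using casimir_E by (simp add: power_commuting_commutes)
  then show ?case by (simp add: E_div_def uv_const_left mult.assoc)
next
  case (F_div n)
  have "casimir * uv_F ^ n = uv_F ^ n * casimir"
    using casimir_F by (simp add: power_commuting_commutes)
  then show ?case by (simp add: F_div_def uv_const_left mult.assoc)
next
  case (mult x y) then show ?case by (metis mult.assoc)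
qed (simp_all add: distrib_left distrib_right uv_const_left mult.assoc)

section \<open>The specialised algebra\<close>

lemma keys_mult_Mon:
  assumes "Poly_Mapping.keys p \<subseteq> Mon ` UA" "Poly_Mapping.keys r \<subseteq> Mon ` UA"
  shows "Poly_Mapping.keys (p * r) \<subseteq> Mon ` UA"
proof
  fix m assume "m \<in> Poly_Mapping.keys (p * r)"
  then obtain a b where "m = a + b" "a \<in> Poly_Mapping.keys p" "b \<in> Poly_Mapping.keys r"
    using keys_mult[of p r] by blast
  then show "m \<in> Mon ` UA"
    using assms by (auto simp: plus_mon_def dest!: subsetD intro!: imageI UA.mult)
qed

lemma keys_one_Mon: "Poly_Mapping.keys (1 :: uv mon \<Rightarrow>\<^sub>0 'k::field) \<subseteq> Mon ` UA"
  by (simp add: zero_mon_def UA_one)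

lemma UA_monoid_alg_ring: "ring (UA_monoid_alg :: (uv mon \<Rightarrow>\<^sub>0 'k::field) ring)"
proof (rule ringI)
  show "abelian_group (UA_monoid_alg :: (uv mon \<Rightarrow>\<^sub>0 'k) ring)"
  proof (rule abelian_groupI)
    fix x :: "uv mon \<Rightarrow>\<^sub>0 'k" assume "x \<in> carrier UA_monoid_alg"
    then show "\<exists>y\<in>carrier UA_monoid_alg. y \<oplus>\<^bsub>UA_monoid_alg\<^esub> x = \<zero>\<^bsub>UA_monoid_alg\<^esub>"
      by (intro bexI[of _ "- x"]) (auto simp: UA_monoid_alg_def keys_minus)
  qed (use keys_add in \<open>fastforce simp: UA_monoid_alg_def algebra_simps\<close>)+
  show "monoid (UA_monoid_alg :: (uv mon \<Rightarrow>\<^sub>0 'k) ring)"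
    using keys_mult_Mon keys_one_Mon
    by (intro monoidI) (auto simp: UA_monoid_alg_def mult.assoc)
qed (auto simp: UA_monoid_alg_def algebra_simps)

interpretation UAm: ring "UA_monoid_alg :: (uv mon \<Rightarrow>\<^sub>0 'k::field) ring"
  by (rule UA_monoid_alg_ring)

lemma UAm_simps:
  "mult UA_monoid_alg = (*)" "one UA_monoid_alg = 1" "zero UA_monoid_alg = 0" "add UA_monoid_alg = (+)"
  by (simp_all add: UA_monoid_alg_def)

lemma UAm_carrier: "p \<in> carrier UA_monoid_alg \<longleftrightarrow> Poly_Mapping.keys p \<subseteq> Mon ` UA"
  by (simp add: UA_monoid_alg_def)

lemma UAm_add:
  "p \<in> carrier UA_monoid_alg \<Longrightarrow> r \<in> carrier UA_monoid_alg \<Longrightarrow> p + r \<in> carrier UA_monoid_alg"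
  and UAm_mult:
  "p \<in> carrier UA_monoid_alg \<Longrightarrow> r \<in> carrier UA_monoid_alg \<Longrightarrow> p * r \<in> carrier UA_monoid_alg"
  using UAm.add.m_closed[of p r] UAm.m_closed[of p r] by (simp_all add: UAm_simps)

lemma UAm_single [simp]: "u \<in> UA \<Longrightarrow> Poly_Mapping.single (Mon u) c \<in> carrier UA_monoid_alg"
  by (simp add: UAm_carrier)

lemma UAm_uminus:
  assumes "(p :: uv mon \<Rightarrow>\<^sub>0 'k::field) \<in> carrier UA_monoid_alg"
  shows "- p \<in> carrier UA_monoid_alg" "\<ominus>\<^bsub>UA_monoid_alg\<^esub> p = - p"
proof -
  show *: "- p \<in> carrier UA_monoid_alg"
    using assms by (simp add: UAm_carrier keys_minus)
  show "\<ominus>\<^bsub>UA_monoid_alg\<^esub> p = - p"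
    by (rule UAm.minus_equality) (use assms * in \<open>simp_all add: UAm_simps\<close>)
qed

lemma UAm_minus:
  assumes "(p :: uv mon \<Rightarrow>\<^sub>0 'k::field) \<in> carrier UA_monoid_alg" "r \<in> carrier UA_monoid_alg"
  shows "p \<ominus>\<^bsub>UA_monoid_alg\<^esub> r = p - r" "p - r \<in> carrier UA_monoid_alg"
  using UAm.minus_closed[OF assms] assms by (simp_all add: a_minus_def UAm_uminus UAm_simps)

lemma tensor_relators_carrier: "tensor_relators q \<subseteq> carrier UA_monoid_alg"
proof -
  have "Poly_Mapping.single (Mon (u + u')) 1 - Poly_Mapping.single (Mon u) 1
        - Poly_Mapping.single (Mon u') 1 \<in> carrier UA_monoid_alg" if "u \<in> UA" "u' \<in> UA" for u u'
    using that by (intro UAm_minus(2) UAm_single UA.add)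
  moreover have "Poly_Mapping.single (Mon (uv_scale (laurent_eval vv p) u)) 1
        - Poly_Mapping.single (Mon u) (laurent_eval q p) \<in> carrier UA_monoid_alg" if "u \<in> UA" for u p
    using that by (intro UAm_minus(2) UAm_single UA.scale)
  ultimately show ?thesis
    unfolding tensor_relators_def by blast
qed

lemma tensor_ideal_ideal: "ideal (tensor_ideal q) UA_monoid_alg"
  unfolding tensor_ideal_def by (intro UAm.genideal_ideal tensor_relators_carrier)

lemma tensor_relators_ideal: "tensor_relators q \<subseteq> tensor_ideal q"
  unfolding tensor_ideal_def by (intro UAm.genideal_self tensor_relators_carrier)

abbreviation tcoset :: "'k::field \<Rightarrow> (uv mon \<Rightarrow>\<^sub>0 'k) \<Rightarrow> 'k uq" where
  "tcoset q p \<equiv> tensor_ideal q +>\<^bsub>UA_monoid_alg\<^esub> p"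

lemma tcoset_hom: "tcoset q \<in> ring_hom UA_monoid_alg (Uq q)"
  unfolding Uq_def using ideal.rcos_ring_hom[OF tensor_ideal_ideal] by blast

lemma tcoset_simps:
  assumes "p \<in> carrier UA_monoid_alg" "r \<in> carrier UA_monoid_alg"
  shows "tcoset q (p + r) = tcoset q p \<oplus>\<^bsub>Uq q\<^esub> tcoset q r"
    "tcoset q (p * r) = tcoset q p \<otimes>\<^bsub>Uq q\<^esub> tcoset q r"
  using ring_hom_add[OF tcoset_hom assms, of q] ring_hom_mult[OF tcoset_hom assms, of q]
  by (simp_all add: UAm_simps)

lemma tcoset_carrier: "p \<in> carrier UA_monoid_alg \<Longrightarrow> tcoset q p \<in> carrier (Uq q)"
  by (rule ring_hom_closed[OF tcoset_hom])

lemma tcoset_eq: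
  assumes "p \<in> carrier UA_monoid_alg" "r \<in> carrier UA_monoid_alg" "p - r \<in> tensor_ideal q"
  shows "tcoset q p = tcoset q r"
  using UAm.quotient_eq_iff_same_a_r_cos[OF tensor_ideal_ideal assms(1,2), of q] assms
  by (simp add: UAm_minus)

lemma Uq_carrier_cases:
  assumes "a \<in> carrier (Uq q)"
  obtains p where "p \<in> carrier UA_monoid_alg" "a = tcoset q p"
  using assms unfolding Uq_def FactRing_def A_RCOSETS_def' by auto

lemma tensor_simps:
  assumes "u \<in> UA" "w \<in> UA"
  shows "tensor q u c \<in> carrier (Uq q)"
    "tensor q (u * w) (c * d) = tensor q u c \<otimes>\<^bsub>Uq q\<^esub> tensor q w d"
    "tensor q (u + w) 1 = tensor q u 1 \<oplus>\<^bsub>Uq q\<^esub> tensor q w 1"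
    "tensor q (uv_const (laurent_eval vv p) * u) 1 = tensor q u (laurent_eval q p)"
proof -
  show "tensor q u c \<in> carrier (Uq q)"
    using assms by (simp add: tensor_def tcoset_carrier)
  show "tensor q (u * w) (c * d) = tensor q u c \<otimes>\<^bsub>Uq q\<^esub> tensor q w d"
    using assms by (simp add: tensor_def mult_single plus_mon_def flip: tcoset_simps(2))
  have "Poly_Mapping.single (Mon (u + w)) 1 - Poly_Mapping.single (Mon u) 1
        - Poly_Mapping.single (Mon w) 1 \<in> tensor_relators q"
    using assms unfolding tensor_relators_def by blast
  then have "Poly_Mapping.single (Mon (u + w)) 1 - (Poly_Mapping.single (Mon u) 1
        + Poly_Mapping.single (Mon w) 1) \<in> tensor_ideal q"
    using tensor_relators_ideal by (metis diff_diff_eq in_mono)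
  then have "tcoset q (Poly_Mapping.single (Mon (u + w)) 1) =
      tcoset q (Poly_Mapping.single (Mon u) 1 + Poly_Mapping.single (Mon w) 1)"
    using assms by (intro tcoset_eq) (simp_all add: UA.add UAm_add)
  then show "tensor q (u + w) 1 = tensor q u 1 \<oplus>\<^bsub>Uq q\<^esub> tensor q w 1"
    unfolding tensor_def using assms by (simp add: tcoset_simps)
  have "Poly_Mapping.single (Mon (uv_scale (laurent_eval vv p) u)) 1
        - Poly_Mapping.single (Mon u) (laurent_eval q p) \<in> tensor_relators q"
    using assms unfolding tensor_relators_def by blast
  then show "tensor q (uv_const (laurent_eval vv p) * u) 1 = tensor q u (laurent_eval q p)"
    unfolding tensor_def using assms tensor_relators_ideal
    by (intro tcoset_eq) (auto simp: UA.scale)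
qed

lemma uq_module_act:
  assumes "uq_module q M" "a \<in> carrier (Uq q)" "y \<in> space M"
  shows "act M a y \<in> space M"
    "x \<in> space M \<Longrightarrow> act M a (x + y) = act M a x + act M a y"
    "b \<in> carrier (Uq q) \<Longrightarrow> act M (a \<oplus>\<^bsub>Uq q\<^esub> b) y = act M a y + act M b y"
    "b \<in> carrier (Uq q) \<Longrightarrow> act M (a \<otimes>\<^bsub>Uq q\<^esub> b) y = act M a (act M b y)"
  using assms unfolding uq_module_def by simp_all

lemma uq_module_act_const:
  "uq_module q M \<Longrightarrow> y \<in> space M \<Longrightarrow> act M (tensor q 1 c) y = scale M c y"
  unfolding uq_module_def by simp

text \<open>Every class is a finite sum of tensors u \<otimes> c, and c can be absorbed into the
  subspace. Stability under the elements u \<otimes> 1 is therefore stability under the whole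
  algebra.\<close>

lemma uq_module_tcoset_induct:
  fixes M :: "('k::field, 'm::ab_group_add) uq_mod"
  assumes M: "uq_module q M" and N: "module.subspace (scale M) N" "N \<subseteq> space M"
    and op: "\<And>u y. u \<in> UA \<Longrightarrow> y \<in> N \<Longrightarrow> act M (tensor q u 1) y \<in> N"
    and p: "p \<in> carrier UA_monoid_alg" and y: "y \<in> N"
  shows "act M (tcoset q p) y \<in> N"
proof -
  interpret vector_space "scale M" using M by (simp add: uq_module_def)
  have tensor: "act M (tensor q u c) y \<in> N" if "u \<in> UA" for u c
  proof -
    have "tensor q u c = tensor q u 1 \<otimes>\<^bsub>Uq q\<^esub> tensor q 1 c"
      using tensor_simps(2)[OF that UA_one, of q 1 c] by simp
    then have "act M (tensor q u c) y = act M (tensor q u 1) (scale M c y)"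
      using that y N(2) UA_one
      by (simp add: uq_module_act[OF M] uq_module_act_const[OF M] tensor_simps subset_iff)
    then show ?thesis using op[OF that] subspace_scale[OF N(1) y] by simp
  qed
  have "Poly_Mapping.keys p \<subseteq> Mon ` UA \<Longrightarrow> act M (tcoset q p) y \<in> N"
  proof (induction p rule: update_induct)
    case const
    have "tensor q 1 0 = tcoset q 0" by (simp add: tensor_def)
    then show ?case using tensor[of 1 0] UA_one by simp
  next
    case (update p m c)
    have keys: "Poly_Mapping.keys p \<subseteq> Mon ` UA" "m \<in> Mon ` UA"
      using update.prems update.hyps by (auto simp: keys_update)
    then obtain u where u: "u \<in> UA" "m = Mon u" by auto
    have "act M (tcoset q (Poly_Mapping.single m c + p)) y
        = act M (tensor q u c) y + act M (tcoset q p) y"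
      using N(2) y u keys UAm_single[OF u(1), of c]
      by (subst tcoset_simps(1))
        (auto simp: UAm_carrier tensor_def intro!: uq_module_act(3)[OF M] tcoset_carrier)
    then show ?case
      using tensor[OF u(1)] update.IH[OF keys(1)] subspace_add[OF N(1)] update.hyps
      by (simp add: update_eq_single_plus)
  qed
  then show ?thesis using p by (simp add: UAm_carrier)
qed

subsection \<open>The antipode of the specialised algebra\<close>

lemma monoid_alg_antipode_hom:
  "monoid_alg_antipode (Poly_Mapping.single (Mon u) c) = Poly_Mapping.single (Mon (antipode u)) c"
  "monoid_alg_antipode (p + r) = monoid_alg_antipode p + monoid_alg_antipode r"
  "monoid_alg_antipode (p - r) = monoid_alg_antipode p - monoid_alg_antipode r"
  "monoid_alg_antipode 0 = 0"
  "monoid_alg_antipode (p * r) = monoid_alg_antipode r * monoid_alg_antipode p"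
proof -
  show single: "monoid_alg_antipode (Poly_Mapping.single (Mon u) c) = Poly_Mapping.single (Mon (antipode u)) c" for u c
    by (simp add: monoid_alg_antipode_def)
  show add: "monoid_alg_antipode (p + r) = monoid_alg_antipode p + monoid_alg_antipode r" for p r
    unfolding monoid_alg_antipode_def
    by (rule setsum_keys_plus_distrib) (simp_all add: single_add)
  show "monoid_alg_antipode (p - r) = monoid_alg_antipode p - monoid_alg_antipode r"
    using add[of "p - r" r] by simp
  show zero: "monoid_alg_antipode 0 = 0"
    by (simp add: monoid_alg_antipode_def)
  have mult_single: "monoid_alg_antipode (Poly_Mapping.single m c * r) =
      monoid_alg_antipode r * monoid_alg_antipode (Poly_Mapping.single m c)" for m c r
  proof (induction r rule: update_induct)
    case const then show ?case by (simp add: zero)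
  next
    case (update r m' d)
    obtain u u' where "m = Mon u" "m' = Mon u'" by (metis mon.exhaust)
    then show ?case using update
      by (simp add: update_eq_single_plus distrib_left distrib_right add mult_single single
          plus_mon_def antipode_simps mult.commute[of c])
  qed
  show "monoid_alg_antipode (p * r) = monoid_alg_antipode r * monoid_alg_antipode p"
  proof (induction p rule: update_induct)
    case const then show ?case by (simp add: zero)
  next
    case (update p m c)
    then show ?case
      by (simp add: update_eq_single_plus distrib_left distrib_right add mult_single)
  qed
qed

lemma monoid_alg_antipode_carrier:
  assumes "p \<in> carrier UA_monoid_alg"
  shows "monoid_alg_antipode p \<in> carrier UA_monoid_alg"
proof -
  have "(\<Sum>m\<in>S. Poly_Mapping.single (Mon (antipode (unMon m))) (Poly_Mapping.lookup p m)) \<in> carrier UA_monoid_alg"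
    if "S \<subseteq> Poly_Mapping.keys p" "finite S" for S
    using that(2,1)
  proof (induction S)
    case empty show ?case by (simp add: UAm_carrier)
  next
    case (insert m S)
    then have "unMon m \<in> UA"
      using assms by (auto simp: UAm_carrier)
    with insert show ?case
      by (simp add: antipode_in_UA UAm_add)
  qed
  then show ?thesis by (simp add: monoid_alg_antipode_def)
qed

text \<open>The preimage of the ideal is again a two-sided ideal, since an anti-homomorphism only
  exchanges the two sides. It contains the relators because the antipode maps each of them to a
  relator of the same kind.\<close>

lemma monoid_alg_antipode_tensor_ideal:
  assumes "p \<in> tensor_ideal q"
  shows "monoid_alg_antipode p \<in> tensor_ideal q"
proof -
  interpret I: ideal "tensor_ideal q" "UA_monoid_alg"
    by (rule tensor_ideal_ideal)
  define J where "J = {p \<in> carrier UA_monoid_alg. monoid_alg_antipode p \<in> tensor_ideal q}"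
  note closed = UAm_add UAm_mult
  have "ideal J UA_monoid_alg"
  proof (rule idealI)
    show "subgroup J (add_monoid (UA_monoid_alg :: (uv mon \<Rightarrow>\<^sub>0 'a) ring))"
    proof (rule group.subgroupI)
      show "group (add_monoid (UA_monoid_alg :: (uv mon \<Rightarrow>\<^sub>0 'a) ring))"
        by (rule UAm.add.is_group)
      show "J \<noteq> {}"
        using I.zero_closed by (auto simp: J_def UAm_carrier UAm_simps monoid_alg_antipode_hom intro!: exI[of _ 0])
      fix a assume a: "a \<in> J"
      have "monoid_alg_antipode (- a) = - monoid_alg_antipode a"
        using monoid_alg_antipode_hom(3)[of 0 a] by (simp add: monoid_alg_antipode_hom)
      moreover have "inv\<^bsub>add_monoid UA_monoid_alg\<^esub> a = - a"
        using a UAm_uminus(2)[of a] unfolding a_inv_def J_def by simp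
      ultimately show "inv\<^bsub>add_monoid UA_monoid_alg\<^esub> a \<in> J"
        using a I.a_inv_closed[of "monoid_alg_antipode a"] UAm_uminus[of a]
          UAm_uminus[OF monoid_alg_antipode_carrier[of a]]
        by (simp add: J_def del: monoid.simps partial_object.simps)
    next
      fix a b assume "a \<in> J" "b \<in> J"
      then show "a \<otimes>\<^bsub>add_monoid UA_monoid_alg\<^esub> b \<in> J"
        using I.a_closed[of "monoid_alg_antipode a" "monoid_alg_antipode b"]
        by (simp add: J_def UAm_simps monoid_alg_antipode_hom closed)
    qed (auto simp: J_def)
  next
    fix a x assume "a \<in> J" "x \<in> carrier (UA_monoid_alg :: (uv mon \<Rightarrow>\<^sub>0 'a) ring)"
    then show "x \<otimes>\<^bsub>UA_monoid_alg\<^esub> a \<in> J" "a \<otimes>\<^bsub>UA_monoid_alg\<^esub> x \<in> J"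
      using I.I_r_closed[of "monoid_alg_antipode a" "monoid_alg_antipode x"]
        I.I_l_closed[of "monoid_alg_antipode a" "monoid_alg_antipode x"] monoid_alg_antipode_carrier[of x]
      by (auto simp: J_def UAm_simps monoid_alg_antipode_hom closed)
  qed (rule UA_monoid_alg_ring)
  moreover have "tensor_relators q \<subseteq> J"
  proof
    fix p assume p: "p \<in> tensor_relators q"
    have "monoid_alg_antipode p \<in> tensor_relators q"
      using p unfolding tensor_relators_def
    proof (elim UnE CollectE exE conjE)
      fix u u' assume "u \<in> UA" "u' \<in> UA" "p = Poly_Mapping.single (Mon (u + u')) 1 - Poly_Mapping.single (Mon u) 1
        - Poly_Mapping.single (Mon u') 1"
      then show "monoid_alg_antipode p \<in> {Poly_Mapping.single (Mon (u + u')) 1 - Poly_Mapping.single (Mon u) 1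
        - Poly_Mapping.single (Mon u') 1 | u u'. u \<in> UA \<and> u' \<in> UA} \<union>
        {Poly_Mapping.single (Mon (uv_scale (laurent_eval vv p) u)) 1
        - Poly_Mapping.single (Mon u) (laurent_eval q p) | p u. u \<in> UA}"
        by (intro UnI1 CollectI exI[of _ "antipode u"] exI[of _ "antipode u'"])
          (simp add: monoid_alg_antipode_hom antipode_simps antipode_in_UA)
    next
      fix s u assume "u \<in> UA" "p = Poly_Mapping.single (Mon (uv_scale (laurent_eval vv s) u)) 1
        - Poly_Mapping.single (Mon u) (laurent_eval q s)"
      then show "monoid_alg_antipode p \<in> {Poly_Mapping.single (Mon (u + u')) 1 - Poly_Mapping.single (Mon u) 1
        - Poly_Mapping.single (Mon u') 1 | u u'. u \<in> UA \<and> u' \<in> UA} \<union>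
        {Poly_Mapping.single (Mon (uv_scale (laurent_eval vv p) u)) 1
        - Poly_Mapping.single (Mon u) (laurent_eval q p) | p u. u \<in> UA}"
        by (intro UnI2 CollectI exI[of _ s] exI[of _ "antipode u"])
          (simp add: monoid_alg_antipode_hom antipode_simps antipode_in_UA uv_const_central)
    qed
    then show "p \<in> J"
      using p tensor_relators_carrier tensor_relators_ideal by (auto simp: J_def)
  qed
  ultimately have "tensor_ideal q \<subseteq> J"
    unfolding tensor_ideal_def by (rule UAm.genideal_minimal)
  then show ?thesis using assms by (auto simp: J_def)
qed

text \<open>All members of the union in \<open>uq_antipode\<close> are the same coset, because the
  antipode preserves the ideal.\<close>

lemma uq_antipode_tensor:
  assumes "u \<in> UA"
  shows "uq_antipode q (tensor q u c) = tensor q (antipode u) c"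
proof -
  interpret I: ideal "tensor_ideal q" "UA_monoid_alg"
    by (rule tensor_ideal_ideal)
  let ?s = "Poly_Mapping.single (Mon u) c"
  have eq: "tcoset q (monoid_alg_antipode p) = tensor q (antipode u) c" if "p \<in> tensor q u c" for p
  proof -
    obtain i where i: "i \<in> tensor_ideal q" "p = i + ?s"
      using \<open>p \<in> tensor q u c\<close> unfolding tensor_def a_r_coset_def' by (auto simp: UAm_simps)
    then have "p \<in> carrier UA_monoid_alg"
      using assms I.Icarr by (simp add: UAm_add)
    then show ?thesis
      unfolding tensor_def using i assms
      by (intro tcoset_eq) (simp_all add: monoid_alg_antipode_hom antipode_in_UA UAm_add
          monoid_alg_antipode_carrier monoid_alg_antipode_tensor_ideal I.Icarr)
  qed
  have "?s \<in> tensor q u c"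
    using I.zero_closed unfolding tensor_def a_r_coset_def' by (auto simp: UAm_simps)
  then show ?thesis unfolding uq_antipode_def using eq by blast
qed

section \<open>Quantum numbers at a root of unity\<close>

text \<open>Characteristic 0 keeps the integers n div l distinct in the field, so that [K; 0; l]
  separates weights. It also excludes the exceptional value of \<open>k\<^sub>1\<close> in
  \<open>nondegenerate\<close>.\<close>

locale root_of_unity =
  fixes q :: "'k::field" and l :: nat
  assumes l_ge: "3 \<le> l" and l_odd: "odd l" and q_power_l: "q ^ l = - 1"
    and q_primitive: "\<And>m. 0 < m \<Longrightarrow> m < 2 * l \<Longrightarrow> q ^ m \<noteq> 1"
    and char_0: "\<And>n. (of_nat n :: 'k) = 0 \<Longrightarrow> n = 0"
begin

abbreviation B :: "int \<Rightarrow> nat \<Rightarrow> 'k" where "B n r \<equiv> specialise q (qbinom n r)"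
abbreviation N :: "int \<Rightarrow> 'k" where "N n \<equiv> specialise q (qint n)"

lemma q_nonzero [simp]: "q \<noteq> 0"
  using q_power_l l_ge by (cases "q = 0") (auto simp: power_0_left)

lemmas specialise' = specialise_simps[OF q_nonzero]

lemma specialise_0_1 [simp]: "specialise q 0 = 0" "specialise q 1 = 1"
  by (simp_all add: specialise')

lemma of_int_eq_0: "(of_int m :: 'k) = 0 \<longleftrightarrow> m = 0"
proof
  assume *: "(of_int m :: 'k) = 0"
  show "m = 0"
  proof (cases "0 \<le> m")
    case True
    then have "(of_nat (nat m) :: 'k) = of_int m" by simp
    then have "nat m = 0" using * char_0 by metis
    then show ?thesis using True by simp
  next
    case False
    then have "(of_nat (nat (- m)) :: 'k) = - of_int m" by simp
    then have "(of_nat (nat (- m)) :: 'k) = 0" using * by simp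
    then have "nat (- m) = 0" by (rule char_0)
    then show ?thesis using False by simp
  qed
qed simp

lemma q_powi_l: "q powi int l = - 1"
  by (simp add: q_power_l)

lemma q_powi_mult_l: "q powi (int l * m) = (- 1) powi m"
  by (simp only: power_int_mult q_powi_l)

lemma q_powi_eq_1: "q powi m = 1 \<longleftrightarrow> 2 * int l dvd m"
proof -
  have L: "0 < 2 * int l" using l_ge by simp
  define r where "r = nat (m mod (2 * int l))"
  have "m = 2 * int l * (m div (2 * int l)) + int r"
    using L by (simp add: r_def)
  moreover have "q powi (2 * int l) = 1"
    using q_powi_mult_l[of 2] by (simp add: mult.commute)
  ultimately have "q powi m = q ^ r"
    by (metis power_int_add power_int_mult power_int_1_left mult_1 power_int_of_nat q_nonzero)
  moreover have "r < 2 * l" using L unfolding r_def by (simp add: nat_less_iff)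
  ultimately have "q powi m = 1 \<longleftrightarrow> r = 0"
    using q_primitive[of r] by (cases "r = 0") auto
  also have "\<dots> \<longleftrightarrow> 2 * int l dvd m"
    using pos_mod_sign[OF L, of m] unfolding r_def dvd_eq_mod_eq_0 by linarith
  finally show ?thesis .
qed

lemma q_powi_eq: "q powi m = q powi n \<longleftrightarrow> 2 * int l dvd m - n"
proof -
  have "q powi m = q powi n \<longleftrightarrow> q powi (m - n) = 1"
    by (simp add: power_int_diff)
  then show ?thesis by (simp add: q_powi_eq_1)
qed

lemma q_diff_nonzero: "q - inverse q \<noteq> 0"
proof
  assume "q - inverse q = 0"
  then have "q powi 1 = q powi (- 1)" by (simp add: power_int_minus)
  then have "2 * int l dvd 2" by (simp only: q_powi_eq) simp
  then show False using l_ge by (auto dest: zdvd_imp_le)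
qed

lemma N_eq: "N n = (q powi n - q powi (- n)) / (q - inverse q)"
proof -
  have "qint n * (vv powi 1 - vv powi (- 1)) = vv powi n - vv powi (- n)"
    using qd_eq_0_iff[of 1] by (simp add: qint_qd qd_def del: qd_eq_0_iff)
  then have "specialise q (qint n * (vv powi 1 - vv powi (- 1))) = specialise q (vv powi n - vv powi (- n))"
    by simp
  then have "N n * (q powi 1 - q powi (- 1)) = q powi n - q powi (- n)"
    by (simp only: specialise' laurents_closed qint_in_laurents)
  then show ?thesis using q_diff_nonzero by (simp add: power_int_minus field_simps)
qed

lemma N_eq_0: "N n = 0 \<longleftrightarrow> int l dvd n"
proof -
  have "N n = 0 \<longleftrightarrow> q powi n = q powi (- n)"
    using q_diff_nonzero by (simp add: N_eq)
  also have "\<dots> \<longleftrightarrow> int l dvd n"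
    by (simp add: q_powi_eq)
  finally show ?thesis .
qed

lemma B_0 [simp]: "B n 0 = 1" and B_self [simp]: "B (int r) r = 1" and B_1 [simp]: "B n (Suc 0) = N n"
  by (simp_all add: specialise')

lemma N_1 [simp]: "N 1 = 1"
  by (simp add: specialise')

lemma B_mult: "B n (a + b) * B (int (a + b)) a = B n a * B (n - int a) b"
  using arg_cong[OF qbinom_mult[of n a b], of "specialise q"]
  by (simp only: specialise' qbinom_in_laurents)

lemma B_Suc: "N (int (Suc r)) * B n (Suc r) = N n * B (n - 1) r"
  using B_mult[of n 1 r] by (simp add: mult.commute)

lemma B_pascal: "B (n + 1) (Suc r) = q powi (int r + 1) * B n (Suc r) + q powi (int r - n) * B n r"
  using arg_cong[OF qbinom_pascal[of n r], of "specialise q"]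
  by (simp only: specialise' laurents_closed qbinom_in_laurents)

lemma N_Suc_nonzero: "Suc r < l \<Longrightarrow> N (int (Suc r)) \<noteq> 0"
  by (simp add: N_eq_0 del: of_nat_Suc) (metis nat_dvd_not_less zero_less_Suc)

text \<open>One of n, n - 1, ..., n - r + 1 is a multiple of l, while [1], ..., [r] stay invertible
  because r < l.\<close>

lemma B_eq_0:
  assumes "r < l" "n mod int l < int r"
  shows "B n r = 0"
  using assms
proof (induction r arbitrary: n)
  case 0
  then show ?case using l_ge pos_mod_sign[of "int l" n] by linarith
next
  case (Suc r)
  show ?case
  proof (cases "n mod int l = 0")
    case True
    then have "N n = 0" by (simp add: N_eq_0 dvd_eq_mod_eq_0)
    then show ?thesis using B_Suc[of r n] N_Suc_nonzero[of r] Suc.prems by simp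
  next
    case False
    have L: "0 < int l" using l_ge by simp
    have "(n - 1) mod int l = n mod int l - 1"
    proof (rule int_mod_pos_eq)
      show "n - 1 = int l * (n div int l) + (n mod int l - 1)" by simp
    qed (use False pos_mod_sign[OF L, of n] pos_mod_bound[OF L, of n] in linarith)+
    then have "B (n - 1) r = 0" using Suc by simp
    then show ?thesis using B_Suc[of r n] N_Suc_nonzero[of r] Suc.prems by simp
  qed
qed

lemma N_add_mult_l: "N (int l * m + n) = (- 1) powi m * N n"
proof -
  have "- (int l * m + n) = int l * (- m) + (- n)" by simp
  then have "q powi (- (int l * m + n)) = (- 1) powi (- m) * q powi (- n)"
    by (simp only: power_int_add[OF disjI1[OF q_nonzero]] q_powi_mult_l)
  moreover have "(- 1 :: 'k) powi (- m) = (- 1) powi m"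
    by (simp add: power_int_minus_left)
  ultimately have "q powi (- (int l * m + n)) = (- 1) powi m * q powi (- n)" by simp
  moreover have "q powi (int l * m + n) = (- 1) powi m * q powi n"
    by (simp only: power_int_add[OF disjI1[OF q_nonzero]] q_powi_mult_l)
  ultimately show ?thesis
    by (simp only: N_eq) (simp add: right_diff_distrib)
qed

lemma N_minus: "N (- n) = - N n"
  by (simp add: N_eq diff_divide_distrib)

lemma qbinom_Suc_self: "qbinom (int (Suc r)) r = qint (int (Suc r))"
proof -
  have "qff (int (Suc r)) r * qd 1 = qdfact (Suc r)"
    using qff_Suc[of "int (Suc r)" r] by (simp add: qdfact_def)
  then have "qff (int (Suc r)) r * qd 1 = qd (int (Suc r)) * qdfact r"
    by (simp only: qdfact_Suc)
  then show ?thesis by (simp add: qbinom_qff qint_qd field_simps del: of_nat_Suc)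
qed

lemma B_Suc': "N (int (Suc r)) * B n (Suc r) = N (n - int r) * B n r"
  using B_mult[of n r 1] by (simp add: qbinom_Suc_self mult.commute del: of_nat_Suc)

text \<open>Since [lm - s] = -(-1)^m [s], every numerator factor is a sign times the matching
  denominator factor.\<close>

lemma B_top:
  assumes "r < l"
  shows "B (int l * m - 1) r = (- ((- 1) powi m)) ^ r"
  using assms
proof (induction r)
  case (Suc r)
  have "N (int l * m - 1 - int r) = N (int l * m + (- int (Suc r)))"
    by (simp add: algebra_simps)
  also have "\<dots> = - ((- 1) powi m) * N (int (Suc r))"
    by (simp only: N_add_mult_l N_minus) simp
  finally have "N (int (Suc r)) * B (int l * m - 1) (Suc r) = N (int (Suc r)) * (- ((- 1) powi m)) ^ Suc r"
    using Suc B_Suc'[of r "int l * m - 1"] by simp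
  then show ?case using N_Suc_nonzero[OF Suc.prems] by (simp del: power_Suc of_nat_Suc)
qed simp

lemma minus_one_powi_mult_l: "(- 1 :: 'k) powi (int l * m) = (- 1) powi m"
  using l_odd by (simp add: power_int_mult)

lemma minus_one_powi_cases: "(- 1 :: 'k) powi m = 1 \<or> (- 1 :: 'k) powi m = - 1"
  by (simp add: power_int_minus_left)

lemma minus_one_powi_sq: "(- 1 :: 'k) powi m * (- 1) powi m = 1"
  using minus_one_powi_cases[of m] by auto

text \<open>The defining quotient has a denominator that vanishes at q, so the value is found by
  recursion. By Pascal's rule B (n + 1) l = - B n l unless l divides n + 1; there
  \<open>B_top\<close> contributes one more sign. The right-hand side obeys the same rule, as n div
  l jumps at exactly these places.\<close>

lemma B_l: "B n l = (- 1) powi (n + 1) * of_int (n div int l)"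
proof -
  define D where "D n = B n l - (- 1) powi (n + 1) * of_int (n div int l)" for n
  obtain p where p: "l = Suc p" using l_ge by (cases l) auto
  then have pl: "int l = int p + 1" by simp
  have step: "D (n + 1) = - D n" for n
  proof -
    have pascal: "B (n + 1) l = - B n l + q powi (int p - n) * B n p"
      using B_pascal[of n p] q_powi_l by (simp add: p add.commute)
    show ?thesis
    proof (cases "(n + 1) mod int l = 0")
      case True
      then obtain m where m: "n = int l * m - 1"
        by (metis add_diff_cancel_right' mod_0_imp_dvd dvd_def)
      have "int p - n = int l * (1 - m)" using m p by (simp add: algebra_simps)
      then have "q powi (int p - n) = - ((- 1) powi m)"
        using minus_one_powi_cases[of m] by (auto simp: q_powi_mult_l power_int_diff)
      moreover have "B n p = 1"
        using B_top[of p m] p l_odd minus_one_powi_cases[of m] by (auto simp: m)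
      ultimately have 1: "B (n + 1) l = - B n l - (- 1) powi m"
        by (simp add: pascal)
      have d1: "(n + 1) div int l = m" using l_ge m by simp
      have d2: "n div int l = m - 1"
      proof (rule int_div_pos_eq)
        show "n = int l * (m - 1) + (int l - 1)" by (simp add: m algebra_simps)
      qed (use l_ge in auto)
      have s: "(- 1 :: 'k) powi (n + 1) = (- 1) powi m" "(- 1 :: 'k) powi (n + 1 + 1) = - ((- 1) powi m)"
        using minus_one_powi_mult_l[of m] by (simp_all add: m power_int_add)
      show ?thesis
        unfolding D_def 1 d1 d2 s by (simp add: algebra_simps)
    next
      case False
      have L: "0 < int l" using l_ge by simp
      have *: "n mod int l < int p"
      proof (rule ccontr)
        assume "\<not> n mod int l < int p"
        then have "n mod int l = int l - 1" using pos_mod_bound[OF L, of n] pl by linarith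
        then have "(n + 1) mod int l = 0" by (metis diff_add_cancel mod_add_left_eq mod_self)
        then show False using False by simp
      qed
      have d: "(n + 1) div int l = n div int l"
      proof (rule int_div_pos_eq)
        show "n + 1 = int l * (n div int l) + (n mod int l + 1)" by simp
      qed (use * pl pos_mod_sign[OF L, of n] in linarith)+
      have B0: "B n p = 0" using B_eq_0[of p n] * p by simp
      have s: "(- 1 :: 'k) powi (n + 1 + 1) = - ((- 1) powi (n + 1))"
        by (simp add: power_int_add)
      show ?thesis unfolding D_def pascal d B0 s by simp
    qed
  qed
  have "qbinom 0 (Suc p) = 0" by (simp add: qbinom_qff qff_Suc' qd_simps)
  then have "D 0 = 0" by (simp add: D_def p specialise')
  then have "D n = 0"
  proof (induction n rule: int_induct[where k = 0])
    case (step2 i)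
    then show ?case using step[of "i - 1"] by simp
  qed (auto simp: step)
  then show ?thesis by (simp add: D_def)
qed

lemma B_l_eq_0: "B n l = 0 \<longleftrightarrow> n div int l = 0"
  using minus_one_powi_cases[of "n + 1"] unfolding B_l mult_eq_0_iff of_int_eq_0 by auto

text \<open>Nonvanishing half of the quantum Lucas theorem. A lower index r >= l is reduced by l
  through \<open>B_mult\<close>, B n l being nonzero for n >= l. For r < l none of n, ..., n - r + 1
  is divisible by l.\<close>

lemma B_nonzero: "r \<le> n \<Longrightarrow> r mod l \<le> n mod l \<Longrightarrow> B (int n) r \<noteq> 0"
proof (induction r arbitrary: n rule: less_induct)
  case (less r)
  show ?case
  proof (cases "r < l")
    case True
    have "B (int n) s \<noteq> 0" if "s \<le> n mod l" for s n
      using that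
    proof (induction s arbitrary: n)
      case (Suc s)
      obtain m where m: "n = Suc m"
        using Suc.prems by (cases n) auto
      then have "s \<le> m mod l"
        using Suc.prems by (auto simp: mod_Suc split: if_splits)
      then have "B (int m) s \<noteq> 0" by (rule Suc.IH)
      moreover have "N (int n) \<noteq> 0"
        using Suc.prems by (auto simp: N_eq_0 simp flip: dvd_eq_mod_eq_0)
      ultimately show ?case using B_Suc[of s "int n"] m by auto
    qed simp
    then show ?thesis using less.prems True by simp
  next
    case False
    then have le: "l \<le> r" "l \<le> n" using less.prems by auto
    then have mods: "(r - l) mod l = r mod l" "(n - l) mod l = n mod l"
      by (simp_all add: le_mod_geq)
    have "B (int (n - l)) (r - l) \<noteq> 0"
      using less.IH[of "r - l" "n - l"] le less.prems l_ge mods by simp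
    moreover have "B (int n) l \<noteq> 0"
      using le l_ge by (simp add: B_l_eq_0 div_eq_0_iff flip: of_nat_div)
    ultimately show ?thesis
      using B_mult[of "int n" l "r - l"] le by (auto simp: of_nat_diff)
  qed
qed

text \<open>K determines j modulo 2l, hence its parity and its residue modulo l. The parity fixes
  the sign in \<open>B_l\<close>, so [K; 0; l] then determines j div l.\<close>

lemma weight_inj:
  assumes "q powi i = q powi j" "B i l = B j l"
  shows "i = j"
proof -
  have dvd: "2 * int l dvd i - j" using assms(1) by (simp add: q_powi_eq)
  then have "even (i - j)" by (meson dvd_mult_left dvd_trans)
  then have "(- 1 :: 'k) powi (i + 1) = (- 1) powi (j + 1)"
    by (auto simp: power_int_minus_left)
  then have "i div int l = j div int l"
    using assms(2) minus_one_powi_cases[of "j + 1"] of_int_eq_0[of "i div int l - j div int l"]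
    unfolding B_l by auto
  moreover have "i mod int l = j mod int l"
    using dvd by (metis dvd_mult_right mod_eq_dvd_iff mult.commute)
  ultimately show ?thesis by (metis div_mult_mod_eq)
qed

text \<open>X + X^-1 = Y + Y^-1 factors as (X - Y)(X^-1 - Y) = 0. The two factors give the two
  linkage classes, n and its reflection -n - 2.\<close>

lemma casimir_value_eq:
  assumes "q powi (m + 1) + q powi (- (m + 1)) = q powi (n + 1) + q powi (- (n + 1))"
  shows "2 * int l dvd m - n \<or> 2 * int l dvd m + n + 2"
proof -
  define X Y X' Y' where XY: "X = q powi (m + 1)" "Y = q powi (n + 1)"
    "X' = q powi (- (m + 1))" "Y' = q powi (- (n + 1))"
  have inv: "X * X' = 1" "Y * Y' = 1"
    unfolding XY by (simp_all only: power_int_add[OF disjI1[OF q_nonzero], symmetric]) simp_all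
  have "(X - Y) * (X' - Y) = (X * X' - Y * Y') - Y * (X + X' - (Y + Y'))"
    by (simp add: algebra_simps)
  also have "\<dots> = 0"
    using inv assms by (simp add: XY)
  finally have "X = Y \<or> X' = Y" by simp
  then have "2 * int l dvd m + 1 - (n + 1) \<or> 2 * int l dvd - (m + 1) - (n + 1)"
    unfolding XY q_powi_eq .
  moreover have "m + 1 - (n + 1) = m - n" "- (m + 1) - (n + 1) = - (m + n + 2)" by simp_all
  ultimately show ?thesis by (simp only: dvd_minus_iff)
qed

end

section \<open>Generalised eigenspaces\<close>

lemma (in vector_space) span_Union_subspaces:
  assumes "\<And>a. a \<in> A \<Longrightarrow> subspace (S a)" "y \<in> span (\<Union>a\<in>A. S a)"
  obtains F g where "finite F" "F \<subseteq> A" "\<And>a. a \<in> F \<Longrightarrow> g a \<in> S a" "y = (\<Sum>a\<in>F. g a)"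
proof -
  have "\<exists>F g. finite F \<and> F \<subseteq> A \<and> (\<forall>a\<in>F. g a \<in> S a) \<and> y = (\<Sum>a\<in>F. g a)"
    using assms(2)
  proof (induction rule: span_induct_alt)
    case base
    show ?case by (intro exI[of _ "{}"]) auto
  next
    case (step c z y)
    then obtain a F g where a: "a \<in> A" "z \<in> S a"
      and F: "finite F" "F \<subseteq> A" "\<And>b. b \<in> F \<Longrightarrow> g b \<in> S b" "y = (\<Sum>b\<in>F. g b)" by blast
    define g' where "g' b = (if b = a then scale c z else 0) + (if b \<in> F then g b else 0)" for b
    have "g' b \<in> S b" if "b \<in> insert a F" for b
      using that a F assms(1) unfolding g'_def
      by (auto intro!: subspace_add subspace_scale simp: subspace_0 subset_iff)
    moreover have "scale c z + y = (\<Sum>b\<in>insert a F. g' b)"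
    proof -
      have "(\<Sum>b\<in>insert a F. if b \<in> F then g b else 0) = (\<Sum>b\<in>F. g b)"
        using F(1) by (intro sum.mono_neutral_cong_right) auto
      then show ?thesis
        unfolding g'_def sum.distrib using F(1,4) by simp
    qed
    ultimately show ?case using a F
      by (intro exI[of _ "insert a F"] exI[of _ g']) auto
  qed
  then show ?thesis using that by blast
qed

text \<open>Linearity is asked for on U only, because the action of a module is unspecified outside
  its space. Restricting U to a submodule keeps eigenvector decompositions inside it.\<close>

locale linear_on = vector_space scale
  for scale :: "'k::field \<Rightarrow> 'm::ab_group_add \<Rightarrow> 'm" (infixr "*s" 75) +
  fixes U :: "'m set" and A :: "'m \<Rightarrow> 'm"
  assumes U: "subspace U" and closed: "x \<in> U \<Longrightarrow> A x \<in> U"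
    and add: "x \<in> U \<Longrightarrow> y \<in> U \<Longrightarrow> A (x + y) = A x + A y"
    and scale: "x \<in> U \<Longrightarrow> A (c *s x) = c *s A x"
begin

lemmas U_simps = subspace_0[OF U] subspace_add[OF U] subspace_scale[OF U] subspace_diff[OF U]
  subspace_neg[OF U]

lemma zero: "A 0 = 0"
  using scale[of 0 0] U_simps by simp

lemma diff: "x \<in> U \<Longrightarrow> y \<in> U \<Longrightarrow> A (x - y) = A x - A y"
  using add[of "x - y" y] U_simps by simp

lemma sum: "(\<And>i. i \<in> I \<Longrightarrow> g i \<in> U) \<Longrightarrow> A (\<Sum>i\<in>I. g i) = (\<Sum>i\<in>I. A (g i))"
  by (induction I rule: infinite_finite_induct) (auto simp: zero add subspace_sum[OF U])

lemma power: "linear_on scale U (A ^^ n)"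
proof (induction n)
  case (Suc n)
  then interpret p: linear_on scale U "A ^^ n" .
  show ?case
    by unfold_locales (auto simp: U closed add scale p.closed p.add p.scale)
qed (unfold_locales, auto simp: U)

definition D :: "'k \<Rightarrow> 'm \<Rightarrow> 'm" where
  "D a y = A y - a *s y"

lemma D_linear: "linear_on scale U (D a)"
  by unfold_locales
    (auto simp: U D_def closed U_simps add scale algebra_simps scale_left_commute)

lemma D_closed: "x \<in> U \<Longrightarrow> D a x \<in> U"
  using D_linear by (rule linear_on.closed)

lemma D_power_linear: "linear_on scale U (D a ^^ n)"
  using D_linear by (rule linear_on.power)

lemma D_power_closed: "x \<in> U \<Longrightarrow> (D a ^^ n) x \<in> U"
  using D_power_linear by (rule linear_on.closed)

lemma D_commute: "y \<in> U \<Longrightarrow> D a (D b y) = D b (D a y)"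
  by (simp add: D_def diff closed U_simps scale algebra_simps scale_left_commute)

lemma D_power_commute: "y \<in> U \<Longrightarrow> D a ((D b ^^ n) y) = (D b ^^ n) (D a y)"
  by (induction n) (simp_all, metis D_commute D_power_closed)

lemma D_power_power_commute: "y \<in> U \<Longrightarrow> (D a ^^ m) ((D b ^^ n) y) = (D b ^^ n) ((D a ^^ m) y)"
  by (induction m) (simp_all add: D_power_commute D_power_closed)

lemma D_power_zero: "(D a ^^ n) 0 = 0"
  using linear_on.zero[OF D_power_linear] .

lemma D_swap: "D a y = D b y + (b - a) *s y"
  by (simp add: D_def algebra_simps)

lemma D_power_mono:
  assumes "(D a ^^ m) y = 0" "m \<le> n"
  shows "(D a ^^ n) y = 0"
proof -
  have "(D a ^^ n) y = (D a ^^ (n - m)) ((D a ^^ m) y)"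
    using assms(2) by (metis comp_apply funpow_add le_add_diff_inverse2)
  then show ?thesis by (simp add: assms D_power_zero)
qed

lemma D_power_eigen: "y \<in> U \<Longrightarrow> D b y = 0 \<Longrightarrow> (D a ^^ m) y = (b - a) ^ m *s y"
proof (induction m)
  case (Suc m)
  have "D a y = (b - a) *s y" using Suc.prems by (simp add: D_swap[of a y b])
  then show ?case using Suc
    by (simp add: linear_on.scale[OF D_linear] mult.commute)
qed simp

lemma D_power_disjoint:
  assumes "y \<in> U" "(D a ^^ m) y = 0" "(D b ^^ n) y = 0" "a \<noteq> b"
  shows "y = 0"
  using assms(2)
proof (induction m)
  case (Suc m)
  let ?z = "(D a ^^ m) y"
  have "(D b ^^ n) ?z = 0"
    using assms(1,3) by (simp add: D_power_power_commute D_power_zero)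
  then have "(a - b) ^ n *s ?z = 0"
    using Suc.prems assms(1) by (simp add: D_power_eigen D_power_closed)
  then show ?case using Suc.IH assms(4) by simp
qed simp

text \<open>On vectors killed by a power of A - b, the operator A - a = (A - b) + (b - a) is
  invertible. Instead of a geometric series: if (A - a) h = (A - b) u, then (u - h) / (b - a) is
  mapped to u.\<close>

lemma D_solve:
  assumes "u \<in> U" "(D b ^^ n) u = 0" "a \<noteq> b"
  shows "\<exists>h\<in>U. D a h = u \<and> (D b ^^ n) h = 0"
  using assms(1,2)
proof (induction n arbitrary: u)
  case 0
  then show ?case using U_simps linear_on.zero[OF D_linear] by auto
next
  case (Suc n)
  have "\<exists>h\<in>U. D a h = D b u \<and> (D b ^^ n) h = 0"
    by (rule Suc.IH) (use Suc.prems D_closed D_power_commute in auto)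
  then obtain h where h: "h \<in> U" "D a h = D b u" "(D b ^^ n) h = 0"
    by blast
  let ?h = "inverse (b - a) *s (u - h)"
  have "D a ?h = u"
    using h Suc.prems assms(3) D_swap[of a u b]
    by (simp add: linear_on.scale[OF D_linear] linear_on.diff[OF D_linear] U_simps)
  moreover have "(D b ^^ Suc n) ?h = 0"
    using h(1) Suc.prems h(3) D_power_mono[OF h(3), of "Suc n"]
    by (simp add: linear_on.scale[OF D_power_linear] linear_on.diff[OF D_power_linear] U_simps
        del: funpow.simps)
  ultimately show ?case using h Suc.prems U_simps by blast
qed

text \<open>Partial fractions by induction on the list. After decomposing (A - a) y, the components
  for b \<noteq> a are lifted by \<open>D_solve\<close>. Subtracting the lifts from y leaves a
  vector that A - a maps to the a-component, so a power of A - a kills it.\<close>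

lemma eigen_decomposition:
  assumes "y \<in> U" "fold D as y = 0"
  shows "\<exists>g. (\<forall>a\<in>set as. g a \<in> U \<and> (D a ^^ count_list as a) (g a) = 0) \<and> y = (\<Sum>a\<in>set as. g a)"
  using assms
proof (induction as arbitrary: y)
  case Nil then show ?case by simp
next
  case (Cons a as)
  have "\<exists>g. (\<forall>b\<in>set as. g b \<in> U \<and> (D b ^^ count_list as b) (g b) = 0) \<and> D a y = (\<Sum>b\<in>set as. g b)"
    by (rule Cons.IH) (use Cons.prems D_closed in auto)
  then obtain g where g: "\<And>b. b \<in> set as \<Longrightarrow> g b \<in> U \<and> (D b ^^ count_list as b) (g b) = 0"
    "D a y = (\<Sum>b\<in>set as. g b)"
    by blast
  have "\<exists>h\<in>U. D a h = g b \<and> (D b ^^ count_list as b) h = 0" if "b \<in> set as" "b \<noteq> a" for b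
    using D_solve[of "g b" _ b a] g(1)[OF that(1)] that(2) by metis
  then obtain h where h: "\<And>b. b \<in> set as \<Longrightarrow> b \<noteq> a \<Longrightarrow> h b \<in> U \<and> D a (h b) = g b \<and> (D b ^^ count_list as b) (h b) = 0"
    by metis
  define r where "r = (\<Sum>b\<in>set as - {a}. h b)"
  have r: "r \<in> U" "D a r = (\<Sum>b\<in>set as - {a}. g b)"
  proof -
    show "r \<in> U" unfolding r_def using h by (auto intro!: subspace_sum[OF U])
    have "D a r = (\<Sum>b\<in>set as - {a}. D a (h b))"
      unfolding r_def by (rule linear_on.sum[OF D_linear]) (use h in auto)
    also have "\<dots> = (\<Sum>b\<in>set as - {a}. g b)"
      using h by (intro sum.cong) auto
    finally show "D a r = (\<Sum>b\<in>set as - {a}. g b)" .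
  qed
  have Dy: "D a (y - r) = (if a \<in> set as then g a else 0)"
    using r Cons.prems g(2) by (simp add: linear_on.diff[OF D_linear] sum_diff1)
  define g' where "g' b = (if b = a then y - r else h b)" for b
  have "g' b \<in> U \<and> (D b ^^ count_list (a # as) b) (g' b) = 0" if "b \<in> set (a # as)" for b
  proof (cases "b = a")
    case True
    have "(D a ^^ count_list as a) (D a (y - r)) = 0"
      using g(1)[of a] by (auto simp: Dy D_power_zero)
    then show ?thesis using True r Cons.prems U_simps
      by (simp add: g'_def D_power_commute)
  next
    case False
    then show ?thesis using h[of b] that by (simp add: g'_def)
  qed
  moreover have "y = (\<Sum>b\<in>set (a # as). g' b)"
  proof -
    have "(\<Sum>b\<in>set (a # as). g' b) = g' a + (\<Sum>b\<in>set as - {a}. g' b)"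
      by (metis List.finite_set finite_insert insertI1 insert_Diff_single list.simps(15) sum.insert_remove)
    also have "(\<Sum>b\<in>set as - {a}. g' b) = r"
      unfolding r_def g'_def by (intro sum.cong) auto
    finally show ?thesis by (simp add: g'_def)
  qed
  ultimately show ?case by blast
qed

lemma eigen_independent:
  assumes "finite F" "\<And>a. a \<in> F \<Longrightarrow> g a \<in> U \<and> (\<exists>m. (D a ^^ m) (g a) = 0)" "(\<Sum>a\<in>F. g a) = 0" "a \<in> F"
  shows "g a = 0"
  using assms
proof (induction F arbitrary: g a rule: finite_induct)
  case (insert b F)
  obtain m where m: "(D b ^^ m) (g b) = 0" using insert.prems(1)[of b] by auto
  note lin = D_power_linear[where a = b and n = m]
  have "(\<Sum>c\<in>F. (D b ^^ m) (g c)) = (D b ^^ m) (\<Sum>c\<in>insert b F. g c)"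
    using insert.prems insert.hyps m by (subst linear_on.sum[OF lin]) auto
  also have "\<dots> = 0" by (simp only: insert.prems D_power_zero)
  finally have s: "(\<Sum>c\<in>F. (D b ^^ m) (g c)) = 0" .
  have F: "g c = 0" if c: "c \<in> F" for c
  proof -
    have "(D b ^^ m) (g c) = 0"
    proof (rule insert.IH[of "\<lambda>c. (D b ^^ m) (g c)", OF _ s c])
      fix d assume "d \<in> F"
      then obtain n where "g d \<in> U" "(D d ^^ n) (g d) = 0" using insert.prems(1) by blast
      then show "(D b ^^ m) (g d) \<in> U \<and> (\<exists>n. (D d ^^ n) ((D b ^^ m) (g d)) = 0)"
        by (metis D_power_closed D_power_power_commute D_power_zero)
    qed
    moreover obtain n where "(D c ^^ n) (g c) = 0" using insert.prems(1) c by blast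
    moreover have "b \<noteq> c" using c insert.hyps by auto
    ultimately show ?thesis using D_power_disjoint[of "g c"] insert.prems(1)[of c] c by blast
  qed
  then have "g b = 0" using insert.prems(2) insert.hyps by simp
  then show ?case using F insert.prems(3) by auto
qed simp

end

section \<open>Modules over the integral form\<close>

text \<open>Only the operators of u \<otimes> 1 with u in \<open>UA\<close> are kept. Identities of
  U_v between elements of the integral form then apply verbatim, and their coefficients are
  specialised by \<open>op_laurent\<close>.\<close>

locale uq_rep = root_of_unity q l + vector_space scale
  for q :: "'k::field" and l :: nat and scale :: "'k \<Rightarrow> 'm::ab_group_add \<Rightarrow> 'm" (infixr "*s" 75) +
  fixes V :: "'m set" and op :: "uv \<Rightarrow> 'm \<Rightarrow> 'm"
  assumes V: "subspace V" and op_V: "u \<in> UA \<Longrightarrow> y \<in> V \<Longrightarrow> op u y \<in> V"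
    and op_add: "u \<in> UA \<Longrightarrow> x \<in> V \<Longrightarrow> y \<in> V \<Longrightarrow> op u (x + y) = op u x + op u y"
    and op_scale: "u \<in> UA \<Longrightarrow> y \<in> V \<Longrightarrow> op u (c *s y) = c *s op u y"
    and op_plus: "u \<in> UA \<Longrightarrow> u' \<in> UA \<Longrightarrow> y \<in> V \<Longrightarrow> op (u + u') y = op u y + op u' y"
    and op_mult: "u \<in> UA \<Longrightarrow> u' \<in> UA \<Longrightarrow> y \<in> V \<Longrightarrow> op (u * u') y = op u (op u' y)"
    and op_laurent: "u \<in> UA \<Longrightarrow> y \<in> V \<Longrightarrow> op (uv_const (laurent_eval vv p) * u) y = laurent_eval q p *s op u y"
    and op_one: "y \<in> V \<Longrightarrow> op 1 y = y"
begin

abbreviation "e r \<equiv> op (E_div r)"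
abbreviation "f r \<equiv> op (F_div r)"
abbreviation "kk \<equiv> op uv_K"
abbreviation "ki \<equiv> op uv_K_inv"
abbreviation "hb c t \<equiv> op (K_binom c t)"

lemmas V_simps = subspace_0[OF V] subspace_add[OF V] subspace_scale[OF V] subspace_diff[OF V]
  subspace_neg[OF V] subspace_sum[OF V]

lemmas UA_simps = UA.K UA.K_inv UA.E_div UA.F_div K_binom_in_UA UA.mult UA.add casimir_in_UA

lemma op_linear: "u \<in> UA \<Longrightarrow> linear_on scale V (op u)"
  by unfold_locales (auto simp: V op_V op_add op_scale)

lemma op_zero: "u \<in> UA \<Longrightarrow> op u 0 = 0"
  using linear_on.zero[OF op_linear] .

lemma op_diff: "u \<in> UA \<Longrightarrow> x \<in> V \<Longrightarrow> y \<in> V \<Longrightarrow> op u (x - y) = op u x - op u y"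
  using linear_on.diff[OF op_linear] .

lemma op_sum: "u \<in> UA \<Longrightarrow> (\<And>i. i \<in> I \<Longrightarrow> g i \<in> V) \<Longrightarrow> op u (\<Sum>i\<in>I. g i) = (\<Sum>i\<in>I. op u (g i))"
  using linear_on.sum[OF op_linear] .

lemma op_const: "c \<in> laurents \<Longrightarrow> u \<in> UA \<Longrightarrow> y \<in> V \<Longrightarrow> op (uv_const c * u) y = specialise q c *s op u y"
  by (auto simp: laurents_def op_laurent)

lemma op_zero_left: "y \<in> V \<Longrightarrow> op 0 y = 0"
  using op_const[of 0 1 y] by (simp add: laurents_closed UA_one uv_const_simps)

lemma op_sum_left:
  "(\<And>i. i \<in> I \<Longrightarrow> u i \<in> UA) \<Longrightarrow> y \<in> V \<Longrightarrow> op (\<Sum>i\<in>I. u i) y = (\<Sum>i\<in>I. op (u i) y)"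
  by (induction I rule: infinite_finite_induct) (auto simp: op_zero_left op_plus UA_sum)

lemma op_power: "u \<in> UA \<Longrightarrow> y \<in> V \<Longrightarrow> op (u ^ n) y = (op u ^^ n) y"
  by (induction n) (simp_all add: op_one op_mult UA_power)

lemma e_0 [simp]: "y \<in> V \<Longrightarrow> e 0 y = y" and f_0 [simp]: "y \<in> V \<Longrightarrow> f 0 y = y"
  by (simp_all add: op_one)

lemma hb_0 [simp]: "y \<in> V \<Longrightarrow> hb c 0 y = y"
  by (simp add: op_one)

lemma ki_kk: "y \<in> V \<Longrightarrow> ki (kk y) = y" and kk_ki: "y \<in> V \<Longrightarrow> kk (ki y) = y"
  by (simp_all add: UA_simps uv_relations op_one flip: op_mult)

lemma ee: "y \<in> V \<Longrightarrow> e r (e s y) = B (int (r + s)) r *s e (r + s) y"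
  by (simp add: UA_simps op_mult[symmetric] E_div_mult op_const qbinom_in_laurents)

lemma ff: "y \<in> V \<Longrightarrow> f r (f s y) = B (int (r + s)) r *s f (r + s) y"
  by (simp add: UA_simps op_mult[symmetric] F_div_mult op_const qbinom_in_laurents)

lemma ef: "y \<in> V \<Longrightarrow> e r (f s y) =
    (\<Sum>t\<le>min r s. f (s - t) (hb (2 * int t - int r - int s) t (e (r - t) y)))"
  by (simp add: UA_simps op_mult[symmetric] E_div_F_div op_sum_left)

lemma ke: "y \<in> V \<Longrightarrow> kk (e r y) = q powi (2 * int r) *s e r (kk y)"
  by (simp add: UA_simps op_mult[symmetric] K_E_div op_const laurents_closed specialise')

lemma kf: "y \<in> V \<Longrightarrow> kk (f r y) = q powi (- 2 * int r) *s f r (kk y)"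
  by (simp add: UA_simps op_mult[symmetric] K_F_div op_const laurents_closed specialise' del: mult_minus_left)

lemma hb_e: "y \<in> V \<Longrightarrow> hb c t (e r y) = e r (hb (c + 2 * int r) t y)"
  by (simp add: UA_simps op_mult[symmetric] K_binom_E_div)

lemma hb_f: "y \<in> V \<Longrightarrow> hb c t (f r y) = f r (hb (c - 2 * int r) t y)"
  by (simp add: UA_simps op_mult[symmetric] K_binom_F_div)

lemma hb_mult: "y \<in> V \<Longrightarrow> B (int (a + b)) a *s hb c (a + b) y = hb c a (hb (c - int a) b y)"
  by (simp add: UA_simps op_mult[symmetric] flip: op_const[OF qbinom_in_laurents] K_binom_mult)

lemma hb_pascal:
  assumes "y \<in> V"
  shows "hb (c + 1) (Suc t) y = q powi (int t + 1) *s hb c (Suc t) y + q powi (int t - c) *s ki (hb c t y)"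
proof -
  have "hb (c + 1) (Suc t) y = op (uv_const (vv powi (int t + 1)) * K_binom c (Suc t)) y
     + op (uv_const (vv powi (int t - c)) * (uv_K_inv * K_binom c t)) y"
    unfolding K_binom_pascal using assms by (intro op_plus UA_const UA_simps laurents_closed)
  then show ?thesis
    using assms by (simp only: op_const UA_simps laurents_closed specialise' op_mult)
qed

lemma Kd_in_UA: "Kd a \<in> UA"
  unfolding Kd_def by (intro UA_diff UA_const UA_simps laurents_closed)

lemma op_Kd:
  assumes "y \<in> V"
  shows "op (Kd a) y = q powi a *s kk y - q powi (- a) *s ki y"
proof -
  have "op (uv_const (vv powi a) * uv_K) y = op (Kd a) y + op (uv_const (vv powi (- a)) * uv_K_inv) y"
    using assms op_plus[OF Kd_in_UA UA_const[OF laurents_closed(8) UA.K_inv], of y a "- a"]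
    by (simp add: Kd_def)
  then have "q powi a *s kk y = op (Kd a) y + q powi (- a) *s ki y"
    using assms by (simp only: op_const UA_simps laurents_closed specialise')
  then show ?thesis by simp
qed

lemma hb_Suc:
  assumes "y \<in> V"
  shows "(q powi int (Suc t) - q powi (- int (Suc t))) *s hb c (Suc t) y = op (Kd (c - int t)) (hb c t y)"
proof -
  have "uv_const (qd (int (Suc t))) * K_binom c (Suc t) = Kd (c - int t) * K_binom c t"
    unfolding K_binom_Suc by (simp add: uv_const_merge uv_const_simps del: of_nat_Suc)
  then have "specialise q (qd (int (Suc t))) *s hb c (Suc t) y = op (Kd (c - int t)) (hb c t y)"
    using assms by (simp only: flip: op_const[OF qd_in_laurents K_binom_in_UA assms] op_mult[OF Kd_in_UA K_binom_in_UA assms])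
  then show ?thesis
    by (simp only: qd_def specialise' laurents_closed)
qed

lemma ki_weight: "y \<in> V \<Longrightarrow> kk y = q powi j *s y \<Longrightarrow> ki y = q powi (- j) *s y"
proof -
  assume y: "y \<in> V" "kk y = q powi j *s y"
  then have "y = q powi j *s ki y" using ki_kk[of y] by (simp add: op_scale UA_simps)
  then show ?thesis
    by (metis power_int_minus power_int_eq_0_iff q_nonzero scale_scale left_inverse scale_one)
qed

text \<open>For t < l the denominators of [K; c; t] are invertible at q, so the eigenvalue of K
  alone determines the value.\<close>

lemma hb_weight_small:
  assumes "y \<in> V" "kk y = q powi j *s y" "t < l"
  shows "hb c t y = B (j + c) t *s y"
  using assms(3)
proof (induction t)
  case (Suc t)
  have d: "q powi int (Suc t) - q powi (- int (Suc t)) \<noteq> 0"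
    using N_Suc_nonzero[OF Suc.prems] by (simp add: N_eq del: of_nat_Suc)
  have "(q powi int (Suc t) - q powi (- int (Suc t))) *s hb c (Suc t) y = op (Kd (c - int t)) (B (j + c) t *s y)"
    using Suc by (simp only: hb_Suc[OF assms(1)] Suc_lessD)
  also have "\<dots> = B (j + c) t *s (q powi (c - int t) *s (q powi j *s y) - q powi (- (c - int t)) *s (q powi (- j) *s y))"
    using assms(1) by (simp only: op_scale Kd_in_UA op_Kd ki_weight[OF assms(1,2)] assms(2))
  also have "\<dots> = (B (j + c) t * (q powi (j + c - int t) - q powi (- (j + c - int t)))) *s y"
  proof -
    have "q powi (c - int t) * q powi j = q powi (j + c - int t)"
      "q powi (- (c - int t)) * q powi (- j) = q powi (- (j + c - int t))"
      unfolding power_int_add[OF disjI1[OF q_nonzero], symmetric] by (simp_all add: algebra_simps)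
    then show ?thesis
      by (simp only: scale_scale flip: scale_left_diff_distrib)
  qed
  also have "B (j + c) t * (q powi (j + c - int t) - q powi (- (j + c - int t)))
     = (q powi int (Suc t) - q powi (- int (Suc t))) * B (j + c) (Suc t)"
  proof -
    have d: "q powi n - q powi (- n) = N n * (q - inverse q)" for n
      using q_diff_nonzero by (simp add: N_eq)
    show ?thesis
      unfolding d using arg_cong[OF B_Suc'[of t "j + c"], of "\<lambda>x. x * (q - inverse q)"]
      by (simp only: mult_ac)
  qed
  finally show ?case using d by (simp flip: scale_scale del: of_nat_Suc)
qed (simp add: assms op_one)

section \<open>Generalised and true weight vectors\<close>

text \<open>On generalised weight j this is the nilpotent part of [K; 0; l].\<close>

definition nu :: "int \<Rightarrow> 'm \<Rightarrow> 'm" where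
  "nu j y = hb 0 l y - B j l *s y"

text \<open>K is required to act by its eigenvalue exactly, which \<open>K_kill\<close> makes
  possible; only [K; 0; l] is allowed a nilpotent part.\<close>

definition gw :: "int \<Rightarrow> 'm \<Rightarrow> bool" where
  "gw j y \<longleftrightarrow> y \<in> V \<and> kk y = q powi j *s y \<and> (\<exists>m. (nu j ^^ m) y = 0)"

definition tw :: "int \<Rightarrow> 'm \<Rightarrow> bool" where
  "tw j y \<longleftrightarrow> y \<in> V \<and> kk y = q powi j *s y \<and> hb 0 l y = B j l *s y"

text \<open>By Pascal's rule [K; c+1; l] is -[K; c; l] plus a multiple of K^-1 [K; c; l-1], and the
  latter is a scalar by \<open>hb_weight_small\<close>. So changing c changes the scalar part, but
  the nilpotent part only by a sign.\<close>

lemma hb_weight_l: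
  assumes "y \<in> V" "kk y = q powi j *s y"
  shows "hb c l y = B (j + c) l *s y + (- 1) powi c *s nu j y"
proof -
  obtain p where p: "l = Suc p" using l_ge by (cases l) auto
  define R where "R c = hb c l y - (B (j + c) l *s y + (- 1) powi c *s nu j y)" for c
  have step: "R (c + 1) = - R c" for c
  proof -
    have "hb (c + 1) l y = q powi int l *s hb c l y + q powi (int p - c) *s ki (hb c p y)"
      using hb_pascal[OF assms(1), of c p] by (simp add: p add.commute)
    also have "ki (hb c p y) = (B (j + c) p * q powi (- j)) *s y"
      using hb_weight_small[OF assms, of p c] ki_weight[OF assms] assms(1) p
      by (simp add: op_scale UA_simps)
    finally have *: "hb (c + 1) l y = q powi int l *s hb c l y
      + q powi (int p - c) *s ((B (j + c) p * q powi (- j)) *s y)" .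
    have w: "q powi (int p - (j + c)) = q powi (int p - c) * q powi (- j)"
      by (simp add: algebra_simps flip: power_int_add)
    have 1: "hb (c + 1) l y = - hb c l y + (q powi (int p - (j + c)) * B (j + c) p) *s y"
      unfolding * w by (simp only: q_powi_l scale_scale scale_minus_left scale_one) (simp add: mult_ac)
    have "B (j + c + 1) l = q powi int l * B (j + c) l + q powi (int p - (j + c)) * B (j + c) p"
      using B_pascal[of "j + c" p] by (simp add: p add.commute)
    then have 2: "B (j + (c + 1)) l = - B (j + c) l + q powi (int p - (j + c)) * B (j + c) p"
      by (simp add: q_power_l algebra_simps)
    have 3: "(- 1 :: 'k) powi (c + 1) = - ((- 1) powi c)" by (simp add: power_int_add)
    show ?thesis unfolding R_def 1 2 3 by (simp add: scale_left_distrib algebra_simps)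
  qed
  have "R 0 = 0" by (simp add: R_def nu_def)
  then have "R c = 0"
  proof (induction c rule: int_induct[where k = 0])
    case (step2 i)
    then show ?case using step[of "i - 1"] by simp
  qed (auto simp: step)
  then show ?thesis by (simp add: R_def)
qed

text \<open>For t >= l the bracket [K; c; l] is split off by \<open>hb_mult\<close>; the coefficient
  [t choose l] is nonzero at q and can be cancelled.\<close>

lemma tw_hb:
  assumes "tw j y"
  shows "hb c t y = B (j + c) t *s y"
proof (induction t arbitrary: c rule: less_induct)
  case (less t)
  have y: "y \<in> V" "kk y = q powi j *s y" and nu: "nu j y = 0"
    using assms by (auto simp: tw_def nu_def)
  show ?case
  proof (cases "t < l")
    case True
    then show ?thesis using hb_weight_small y by blast
  next
    case False
    then have t: "t = l + (t - l)" by simp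
    have "B (int t) l *s hb c t y = hb c l (hb (c - int l) (t - l) y)"
      using hb_mult[OF y(1), of l "t - l" c] t by simp
    also have "hb (c - int l) (t - l) y = B (j + (c - int l)) (t - l) *s y"
      using False l_ge by (intro less) auto
    also have "hb c l (B (j + (c - int l)) (t - l) *s y) = (B (j + c - int l) (t - l) * B (j + c) l) *s y"
      using y hb_weight_l[OF y, of c] nu by (simp add: op_scale UA_simps algebra_simps)
    also have "B (j + c - int l) (t - l) * B (j + c) l = B (int t) l * B (j + c) t"
      using B_mult[of "j + c" l "t - l"] t by (simp add: mult.commute)
    finally have "B (int t) l *s (hb c t y - B (j + c) t *s y) = 0"
      by (simp add: algebra_simps)
    moreover have "B (int t) l \<noteq> 0"
      using False l_ge by (simp add: B_l_eq_0 div_eq_0_iff flip: of_nat_div)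
    ultimately show ?thesis by simp
  qed
qed

lemma tw_gw: "tw j y \<Longrightarrow> gw j y"
  unfolding tw_def gw_def nu_def by (auto intro!: exI[of _ 1])

lemma gw_V: "gw j y \<Longrightarrow> y \<in> V" and tw_V: "tw j y \<Longrightarrow> y \<in> V"
  by (simp_all add: gw_def tw_def)

interpretation H: linear_on scale V "hb 0 l"
  by (rule op_linear) (rule UA_simps)

interpretation K: linear_on scale V kk
  by (rule op_linear) (rule UA_simps)

lemma nu_D: "nu j = H.D (B j l)"
  by (simp add: fun_eq_iff nu_def H.D_def)

lemma nu_linear: "linear_on scale V (nu j)"
  unfolding nu_D by (rule H.D_linear)

lemma nu_V: "y \<in> V \<Longrightarrow> nu j y \<in> V"
  using linear_on.closed[OF nu_linear] .

lemma kk_hb: "y \<in> V \<Longrightarrow> kk (hb c t y) = hb c t (kk y)"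
proof -
  have "uv_K * Kd a = Kd a * uv_K" for a
    by (simp add: Kd_def algebra_simps uv_const_left uv_relations(1,2))
  then have "uv_K * Kff c t = Kff c t * uv_K"
    by (induction t) (simp_all add: Kff_Suc, metis mult.assoc)
  then have "uv_K * K_binom c t = K_binom c t * uv_K"
    by (simp add: K_binom_Kff uv_const_left mult.assoc)
  then show "y \<in> V \<Longrightarrow> kk (hb c t y) = hb c t (kk y)"
    by (simp add: UA_simps flip: op_mult)
qed

lemma nu_weight: "y \<in> V \<Longrightarrow> kk y = c *s y \<Longrightarrow> kk (nu j y) = c *s nu j y"
  by (simp add: nu_def op_diff op_scale UA_simps V_simps op_V kk_hb scale_right_diff_distrib scale_left_commute)

lemma nu_power_weight: "y \<in> V \<Longrightarrow> kk y = c *s y \<Longrightarrow> kk ((nu j ^^ m) y) = c *s (nu j ^^ m) y \<and> (nu j ^^ m) y \<in> V"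
  by (induction m) (simp_all add: nu_weight nu_V)

text \<open>E^(r) shifts the argument c by the even number 2r, for which the sign in
  \<open>hb_weight_l\<close> is +1. Hence it intertwines the nilpotent parts.\<close>

lemma nu_e:
  assumes "y \<in> V" "kk y = q powi j *s y"
  shows "nu (j + 2 * int r) (e r y) = e r (nu j y)"
proof -
  have "nu (j + 2 * int r) (e r y) = e r (hb (2 * int r) l y) - B (j + 2 * int r) l *s e r y"
    using assms by (simp add: nu_def hb_e)
  also have "hb (2 * int r) l y = B (j + 2 * int r) l *s y + nu j y"
    using hb_weight_l[OF assms, of "2 * int r"] by (simp add: power_int_mult)
  finally show ?thesis using assms by (simp add: op_add op_scale UA_simps V_simps nu_V)
qed

lemma nu_f:
  assumes "y \<in> V" "kk y = q powi j *s y"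
  shows "nu (j - 2 * int r) (f r y) = f r (nu j y)"
proof -
  have "nu (j - 2 * int r) (f r y) = f r (hb (- 2 * int r) l y) - B (j - 2 * int r) l *s f r y"
    using assms by (simp add: nu_def hb_f)
  also have "hb (- 2 * int r) l y = B (j - 2 * int r) l *s y + nu j y"
    using hb_weight_l[OF assms, of "- 2 * int r"] by (simp add: power_int_minus power_int_mult)
  finally show ?thesis using assms by (simp add: op_add op_scale UA_simps V_simps nu_V)
qed

lemma weight_e: "y \<in> V \<Longrightarrow> kk y = q powi j *s y \<Longrightarrow> kk (e r y) = q powi (j + 2 * int r) *s e r y"
  by (simp add: ke op_scale UA_simps power_int_add mult.commute)

lemma weight_f: "y \<in> V \<Longrightarrow> kk y = q powi j *s y \<Longrightarrow> kk (f r y) = q powi (j - 2 * int r) *s f r y"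
  using power_int_add[of q "- 2 * int r" j] by (simp add: kf op_scale UA_simps)

lemma gw_e: "gw j y \<Longrightarrow> gw (j + 2 * int r) (e r y)"
proof -
  assume y: "gw j y"
  then obtain m where m: "(nu j ^^ m) y = 0" by (auto simp: gw_def)
  have "(nu (j + 2 * int r) ^^ n) (e r y) = e r ((nu j ^^ n) y)" for n
    using nu_power_weight[of y "q powi j" _ j] y by (induction n) (simp_all add: nu_e gw_def)
  then have "(nu (j + 2 * int r) ^^ m) (e r y) = 0"
    by (simp add: m op_zero UA_simps)
  then show ?thesis using y by (auto simp: gw_def weight_e op_V UA_simps)
qed

lemma gw_f: "gw j y \<Longrightarrow> gw (j - 2 * int r) (f r y)"
proof -
  assume y: "gw j y"
  then obtain m where m: "(nu j ^^ m) y = 0" by (auto simp: gw_def)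
  have "(nu (j - 2 * int r) ^^ n) (f r y) = f r ((nu j ^^ n) y)" for n
    using nu_power_weight[of y "q powi j" _ j] y by (induction n) (simp_all add: nu_f gw_def)
  then have "(nu (j - 2 * int r) ^^ m) (f r y) = 0"
    by (simp add: m op_zero UA_simps)
  then show ?thesis using y by (auto simp: gw_def weight_f op_V UA_simps)
qed

lemma tw_nu: "tw j y \<longleftrightarrow> y \<in> V \<and> kk y = q powi j *s y \<and> nu j y = 0"
  by (simp add: tw_def nu_def)

lemma tw_f: "tw j y \<Longrightarrow> tw (j - 2 * int r) (f r y)"
  by (simp add: tw_nu nu_f weight_f op_V op_zero UA_simps)

lemma subspace_gw: "subspace {y. gw j y}"
proof (rule subspaceI)
  show "0 \<in> {y. gw j y}"
    by (auto simp: gw_def V_simps op_zero UA_simps intro!: exI[of _ 0])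
next
  fix x y assume "x \<in> {y. gw j y}" "y \<in> {y. gw j y}"
  then obtain m n where mn: "(nu j ^^ m) x = 0" "(nu j ^^ n) y = 0" and xy: "x \<in> V" "y \<in> V"
    "kk x = q powi j *s x" "kk y = q powi j *s y" by (auto simp: gw_def)
  have "(nu j ^^ (max m n)) x = 0" "(nu j ^^ (max m n)) y = 0"
    using mn H.D_power_mono unfolding nu_D by auto
  then have "(nu j ^^ (max m n)) (x + y) = 0"
    using linear_on.add[OF H.D_power_linear xy(1,2)] unfolding nu_D by simp
  then show "x + y \<in> {y. gw j y}"
    using xy by (auto simp: gw_def V_simps op_add UA_simps scale_right_distrib)
next
  fix c x assume "x \<in> {y. gw j y}"
  then show "c *s x \<in> {y. gw j y}"
    using linear_on.scale[OF H.D_power_linear] unfolding nu_D gw_def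
    by (fastforce simp: V_simps op_scale UA_simps mult.commute)
qed

lemma subspace_tw: "subspace {y. tw j y}"
  by (rule subspaceI)
    (auto simp: tw_def V_simps op_add op_scale op_zero UA_simps scale_right_distrib mult.commute)

lemma gw_closed:
  "gw j 0" "gw j x \<Longrightarrow> gw j y \<Longrightarrow> gw j (x + y)" "gw j x \<Longrightarrow> gw j y \<Longrightarrow> gw j (x - y)"
  "gw j x \<Longrightarrow> gw j (c *s x)"
  using subspace_0[OF subspace_gw] subspace_add[OF subspace_gw] subspace_diff[OF subspace_gw]
    subspace_scale[OF subspace_gw] by simp_all

lemma tw_closed:
  "tw j 0" "tw j x \<Longrightarrow> tw j y \<Longrightarrow> tw j (x + y)" "tw j x \<Longrightarrow> tw j y \<Longrightarrow> tw j (x - y)"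
  "tw j x \<Longrightarrow> tw j (c *s x)"
  using subspace_0[OF subspace_tw] subspace_add[OF subspace_tw] subspace_diff[OF subspace_tw]
    subspace_scale[OF subspace_tw] by simp_all

text \<open>The components are separated in two stages: by the eigenvalue of K and then, among
  weights with the same power of q, by that of [K; 0; l], which is injective there by
  \<open>weight_inj\<close>.\<close>

lemma gw_independent:
  assumes "finite J" "\<And>j. j \<in> J \<Longrightarrow> gw j (g j)" "(\<Sum>j\<in>J. g j) = 0" "j \<in> J"
  shows "g j = 0"
proof -
  define G where "G \<kappa> = (\<Sum>j\<in>{j\<in>J. q powi j = \<kappa>}. g j)" for \<kappa>
  have GV: "G \<kappa> \<in> V" for \<kappa>
    unfolding G_def using assms(2) by (intro V_simps) (auto dest: gw_V)
  have Gk: "K.D \<kappa> (G \<kappa>) = 0" for \<kappa>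
  proof -
    have "kk (G \<kappa>) = (\<Sum>j\<in>{j\<in>J. q powi j = \<kappa>}. \<kappa> *s g j)"
      unfolding G_def using assms(2)
      by (subst op_sum) (auto simp: UA_simps gw_def intro!: sum.cong)
    then show ?thesis by (simp add: K.D_def G_def scale_sum_right)
  qed
  have "G (q powi j) = 0"
  proof (rule K.eigen_independent[of "(\<lambda>j. q powi j) ` J"])
    show "(\<Sum>\<kappa>\<in>(\<lambda>j. q powi j) ` J. G \<kappa>) = 0"
      using sum.image_gen[OF assms(1), of g "\<lambda>j. q powi j"] assms(3) by (simp add: G_def)
  qed (use assms GV Gk in \<open>auto intro!: exI[of _ 1]\<close>)
  let ?J = "{i\<in>J. q powi i = q powi j}"
  have inj: "inj_on (\<lambda>i. B i l) ?J"
    using weight_inj by (auto intro!: inj_onI)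
  define h where "h a = g (the_inv_into ?J (\<lambda>i. B i l) a)" for a
  have h: "h (B i l) = g i" if "i \<in> ?J" for i
    unfolding h_def by (subst the_inv_into_f_f[OF inj that]) simp
  have "h (B j l) = 0"
  proof (rule H.eigen_independent[of "(\<lambda>i. B i l) ` ?J"])
    show "(\<Sum>a\<in>(\<lambda>i. B i l) ` ?J. h a) = 0"
      using \<open>G (q powi j) = 0\<close> h by (simp add: sum.reindex[OF inj] G_def)
    show "h a \<in> V \<and> (\<exists>m. (H.D a ^^ m) (h a) = 0)" if "a \<in> (\<lambda>i. B i l) ` ?J" for a
      using that assms(2) by (auto simp: h gw_def nu_D)
  qed (use assms in auto)
  then show ?thesis using h assms(4) by simp
qed

definition submod :: "'m set \<Rightarrow> bool" where
  "submod U \<longleftrightarrow> subspace U \<and> U \<subseteq> V \<and> (\<forall>u\<in>UA. \<forall>y\<in>U. op u y \<in> U)"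

lemma submodI:
  assumes "subspace U" "U \<subseteq> V" "\<And>r y. y \<in> U \<Longrightarrow> e r y \<in> U" "\<And>r y. y \<in> U \<Longrightarrow> f r y \<in> U"
    "\<And>y. y \<in> U \<Longrightarrow> kk y \<in> U" "\<And>y. y \<in> U \<Longrightarrow> ki y \<in> U"
  shows "submod U"
proof -
  have "\<forall>y\<in>U. op u y \<in> U" if "u \<in> UA" for u
    using that
  proof (induction rule: UA.induct)
    case (add x y)
    then show ?case using assms(1,2) by (auto simp: op_plus subset_iff subspace_add)
  next
    case (mult x y)
    then show ?case using assms(2) by (auto simp: op_mult subset_iff)
  next
    case (scale x p)
    then show ?case using assms(1,2) by (auto simp: op_laurent subset_iff subspace_scale)
  qed (use assms in auto)
  then show ?thesis using assms by (simp add: submod_def)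
qed

lemma submod_V: "submod V"
  by (simp add: submod_def V op_V)

lemma submod_0: "submod {0}"
  by (auto simp: submod_def V_simps op_zero subspace_def)

lemma primitive_tw_ef:
  assumes "tw j x" "\<And>p. p \<ge> 1 \<Longrightarrow> e p x = 0"
  shows "e r (f s x) = (if r \<le> s then B (j + int r - int s) r *s f (s - r) x else 0)"
proof -
  have xV: "x \<in> V" using assms(1) by (rule tw_V)
  have "e r (f s x) = (\<Sum>t\<le>min r s. if t = r then f (s - t) (hb (2 * int t - int r - int s) t x) else 0)"
    unfolding ef[OF xV] using assms xV
    by (intro sum.cong) (auto simp: op_zero op_one UA_simps)
  then show ?thesis
    using assms(1) xV by (auto simp: tw_hb op_scale op_one UA_simps algebra_simps)
qed

lemma op_casimir_central: "u \<in> UA \<Longrightarrow> y \<in> V \<Longrightarrow> op casimir (op u y) = op u (op casimir y)"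
  by (simp add: casimir_in_UA casimir_central flip: op_mult)

lemma op_casimir_primitive:
  assumes "y \<in> V" "kk y = q powi j *s y" "e 1 y = 0"
  shows "op casimir y = (q powi (j + 1) + q powi (- (j + 1))) *s y"
proof -
  have UAs: "uv_const (qd 1 ^ 2) * (uv_F * uv_E) \<in> UA" "uv_const (vv powi 1) * uv_K \<in> UA"
     "uv_const (vv powi (- 1)) * uv_K_inv \<in> UA"
    by (intro UA_const UA.mult UA_E UA_F UA.K UA.K_inv laurents_closed qd_in_laurents)+
  have "op casimir y = op (uv_const (qd 1 ^ 2) * (uv_F * uv_E)) y + op (uv_const (vv powi 1) * uv_K) y
     + op (uv_const (vv powi (- 1)) * uv_K_inv) y"
    unfolding casimir_def using assms(1) UAs by (simp add: op_plus UA.add)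
  also have "op (uv_const (qd 1 ^ 2) * (uv_F * uv_E)) y = 0"
  proof -
    have "op (uv_F * uv_E) y = 0"
      using assms by (simp add: op_mult UA_E UA_F op_zero)
    then show ?thesis
      using assms(1) op_const[of "qd 1 ^ 2" "uv_F * uv_E" y]
      by (simp add: laurents_closed qd_in_laurents UA.mult UA_E UA_F)
  qed
  also have "op (uv_const (vv powi 1) * uv_K) y = q powi (j + 1) *s y"
    using assms by (simp add: op_const laurents_closed UA_simps specialise' power_int_add mult.commute
        del: power_int_1_right)
  also have "op (uv_const (vv powi (- 1)) * uv_K_inv) y = q powi (- (j + 1)) *s y"
    using assms ki_weight[OF assms(1,2)] by (simp only: op_const laurents_closed UA_simps specialise')
      (simp add: power_int_add[symmetric] algebra_simps del: power_int_minus1_right)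
  finally show ?thesis by (simp add: scale_left_distrib)
qed

end

section \<open>Filtrations by Weyl modules\<close>

context uq_rep
begin

interpretation H: linear_on scale V "hb 0 l"
  by (rule op_linear) (rule UA_simps)

interpretation K: linear_on scale V kk
  by (rule op_linear) (rule UA_simps)

lemma submodD:
  assumes "submod U"
  shows "subspace U" "y \<in> U \<Longrightarrow> y \<in> V" "w \<in> UA \<Longrightarrow> y \<in> U \<Longrightarrow> op w y \<in> U"
  using assms by (auto simp: submod_def)

lemma submod_linear: "submod U \<Longrightarrow> w \<in> UA \<Longrightarrow> linear_on scale U (op w)"
  by unfold_locales (auto simp: submod_def op_add op_scale subset_iff)

text \<open>The relation \<open>[0; l] [l]! = 0\<close> shows that \<open>K\<close> satisfies the separable equation \<open>K\<^sup>2\<^sup>l = 1\<close>.\<close>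

lemma K_kill: "\<exists>as. distinct as \<and> (\<forall>y\<in>V. fold K.D as y = 0)"
proof -
  \<comment> \<open>Eigenvalues come in pairs q^i and q^(l+i) = -q^i, because (K - q^i)(K + q^i) =
    q^i K (q^-i K - q^i K^-1), and the last factor extends [K; 0; i] to a multiple of
    [K; 0; i+1].\<close>
  define L where "L n = concat (map (\<lambda>i. [i, l + i]) [0..<n])" for n
  have set_L: "set (L n) = {..<n} \<union> {l..<l + n}" for n
    by (induction n) (auto simp: L_def)
  have L: "distinct (L n)" if "n \<le> l" for n
    using that
  proof (induction n)
    case (Suc n)
    have "L (Suc n) = L n @ [n, l + n]" by (simp add: L_def)
    then show ?case using Suc set_L[of n] by auto
  qed (simp add: L_def)
  have inj: "inj_on (\<lambda>i. q powi int i) (set (L l))"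
  proof (rule inj_onI)
    fix i j assume "i \<in> set (L l)" "j \<in> set (L l)" "q powi int i = q powi int j"
    then have "2 * int l dvd int i - int j" "\<bar>int i - int j\<bar> < 2 * int l"
      by (simp_all only: set_L q_powi_eq) auto
    then show "i = j" using dvd_imp_le_int[of "int i - int j" "2 * int l"] by auto
  qed
  let ?q = "\<lambda>i::nat. q powi int i"
  have step: "K.D (?q (l + t)) (K.D (?q t) z) = q powi int t *s kk (op (Kd (- int t)) z)" if "z \<in> V" for z t
  proof -
    have "kk (op (Kd (- int t)) z) = q powi (- int t) *s kk (kk z) - q powi int t *s z"
      using that by (simp add: op_Kd op_diff op_scale UA_simps V_simps op_V kk_ki)
    then have R: "q powi int t *s kk (op (Kd (- int t)) z) = kk (kk z) - (q powi int t * q powi int t) *s z"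
      by (simp add: scale_right_diff_distrib flip: power_int_add del: power_int_of_nat)
    have "?q (l + t) = - ?q t"
      by (simp add: power_int_add q_power_l)
    then show ?thesis unfolding R
      using that by (simp add: K.D_def op_diff op_scale UA_simps V_simps op_V algebra_simps del: power_int_of_nat)
  qed
  \<comment> \<open>Up to a power of q, each step multiplies c by q^(n+1) - q^-(n+1), which vanishes
    at n + 1 = l.\<close>
  have "\<exists>c. \<forall>y\<in>V. fold K.D (map ?q (L n)) y = c *s (kk ^^ n) (hb 0 n y) \<and> (n = l \<longrightarrow> c = 0)" for n
  proof (induction n)
    case 0
    show ?case using l_ge by (intro exI[of _ 1]) (auto simp: L_def op_one)
  next
    case (Suc n)
    then obtain c where c: "\<And>y. y \<in> V \<Longrightarrow> fold K.D (map ?q (L n)) y = c *s (kk ^^ n) (hb 0 n y)" by blast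
    define d where "d = q powi int (Suc n) - q powi (- int (Suc n))"
    have "L (Suc n) = L n @ [n, l + n]" by (simp add: L_def)
    then have "fold K.D (map ?q (L (Suc n))) y = (c * q powi int n * d) *s (kk ^^ Suc n) (hb 0 (Suc n) y)"
      if y: "y \<in> V" for y
    proof -
      have kkV: "(kk ^^ m) z \<in> V" if "z \<in> V" for m z
        using that by (induction m) (auto simp: op_V UA_simps)
      have kk_Kd: "kk (op (Kd a) z) = op (Kd a) (kk z)" if "z \<in> V" for a z
        using that by (simp add: op_Kd op_diff op_scale UA_simps V_simps op_V kk_ki ki_kk)
      have pow: "op (Kd a) ((kk ^^ m) z) = (kk ^^ m) (op (Kd a) z)" if "z \<in> V" for a m z
        using that by (induction m) (simp_all add: kk_Kd[symmetric] kkV)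
      interpret P: linear_on scale V "kk ^^ n" by (rule K.power)
      have hV: "hb 0 n y \<in> V" "hb 0 (Suc n) y \<in> V" using y by (simp_all add: op_V UA_simps)
      have "fold K.D (map ?q (L (Suc n))) y = K.D (?q (l + n)) (K.D (?q n) (c *s (kk ^^ n) (hb 0 n y)))"
        using y by (simp add: \<open>L (Suc n) = L n @ [n, l + n]\<close> c del: power_int_of_nat)
      also have "\<dots> = q powi int n *s kk (op (Kd (- int n)) (c *s (kk ^^ n) (hb 0 n y)))"
        by (rule step) (intro V_simps kkV hV)
      also have "op (Kd (- int n)) (c *s (kk ^^ n) (hb 0 n y)) = c *s (kk ^^ n) (d *s hb 0 (Suc n) y)"
        using hV y hb_Suc[of y n 0] by (simp add: op_scale Kd_in_UA kkV pow d_def del: of_nat_Suc)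
      also have "q powi int n *s kk \<dots> = (c * q powi int n * d) *s (kk ^^ Suc n) (hb 0 (Suc n) y)"
        using hV by (simp add: P.scale op_scale UA_simps V_simps kkV mult_ac)
      finally show ?thesis .
    qed
    moreover have "c * q powi int n * d = 0" if "Suc n = l"
      using that by (simp add: d_def q_powi_l q_power_l power_int_minus)
    ultimately show ?case by blast
  qed
  from this[of l] have "\<forall>y\<in>V. fold K.D (map ?q (L l)) y = 0" by auto
  moreover have "distinct (map ?q (L l))" using L[of l] inj by (simp add: distinct_map)
  ultimately show ?thesis by blast
qed

text \<open>The eigenvalue of \<open>casimir\<close> on the Weyl module of highest weight n.\<close>

definition cv :: "int \<Rightarrow> 'k" where
  "cv n = q powi (n + 1) + q powi (- (n + 1))"

text \<open>\<open>layer n U U' u\<close>: the quotient \<open>U' / U\<close> is a Weyl module whose highest weight vector, of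
  weight \<open>n\<close>, is the class of \<open>u\<close>.\<close>

definition layer :: "nat \<Rightarrow> 'm set \<Rightarrow> 'm set \<Rightarrow> 'm \<Rightarrow> bool" where
  "layer n U U' u \<longleftrightarrow> u \<in> U' \<and> (\<forall>y\<in>U'. \<exists>c. y - (\<Sum>t\<le>n. c t *s f t u) \<in> U) \<and>
     (\<forall>c. (\<Sum>t\<le>n. c t *s f t u) \<in> U \<longrightarrow> (\<forall>t\<le>n. c t = 0)) \<and>
     (\<forall>t\<le>n. kk (f t u) - q powi (int n - 2 * int t) *s f t u \<in> U \<and>
        hb 0 l (f t u) - B (int n - 2 * int t) l *s f t u \<in> U \<and>
        op casimir (f t u) - cv (int n) *s f t u \<in> U)"

text \<open>Modulo U the vector y is a combination of eigenvectors of w, so w - a just multiplies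
  its coordinates. The next two lemmas iterate this for one eigenvalue and for a list.\<close>

lemma layer_D:
  assumes "submod U" "w \<in> UA" "u \<in> V" "y \<in> V"
    and eig: "\<And>t. t \<le> n \<Longrightarrow> op w (f t u) - ev t *s f t u \<in> U"
    and y: "y - (\<Sum>t\<le>n. c t *s f t u) \<in> U"
  shows "linear_on.D scale (op w) a y - (\<Sum>t\<le>n. ((ev t - a) * c t) *s f t u) \<in> U"
proof -
  interpret W: linear_on scale V "op w" by (rule op_linear) fact
  have U: "subspace U" using assms(1) by (rule submodD)
  let ?s = "\<Sum>t\<le>n. c t *s f t u"
  have fV: "f t u \<in> V" for t using assms(3) by (simp add: op_V UA_simps)
  then have sV: "?s \<in> V" by (intro V_simps)
  have "op w ?s = (\<Sum>t\<le>n. c t *s op w (f t u))"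
    using fV by (simp add: W.sum V_simps W.scale)
  then have "W.D a y - (\<Sum>t\<le>n. ((ev t - a) * c t) *s f t u)
     = op w (y - ?s) - a *s (y - ?s) + (\<Sum>t\<le>n. c t *s (op w (f t u) - ev t *s f t u))"
    using assms(4) sV
    by (simp add: W.diff W.D_def scale_right_diff_distrib scale_sum_right sum_subtractf
        left_diff_distrib right_diff_distrib scale_left_diff_distrib mult.commute)
  also have "\<dots> \<in> U"
    by (rule subspace_add[OF U subspace_diff[OF U submodD(3)[OF assms(1,2) y] subspace_scale[OF U y]]
          subspace_sum[OF U subspace_scale[OF U]]]) (rule eig, simp)
  finally show ?thesis .
qed

lemma layer_D_power:
  assumes "submod U" "w \<in> UA" "u \<in> V" "y \<in> V"
    and eig: "\<And>t. t \<le> n \<Longrightarrow> op w (f t u) - ev t *s f t u \<in> U"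
    and y: "y - (\<Sum>t\<le>n. c t *s f t u) \<in> U"
  shows "(linear_on.D scale (op w) a ^^ m) y - (\<Sum>t\<le>n. ((ev t - a) ^ m * c t) *s f t u) \<in> U"
proof (induction m)
  case (Suc m)
  interpret W: linear_on scale V "op w" by (rule op_linear) fact
  show ?case
    using layer_D[OF assms(1-3) W.D_power_closed[OF assms(4)] eig Suc, of a]
    by (simp add: mult.assoc)
qed (use y in simp)

lemma layer_D_fold:
  assumes "submod U" "w \<in> UA" "u \<in> V" "y \<in> V"
    and eig: "\<And>t. t \<le> n \<Longrightarrow> op w (f t u) - ev t *s f t u \<in> U"
    and y: "y - (\<Sum>t\<le>n. c t *s f t u) \<in> U"
  shows "fold (linear_on.D scale (op w)) as y - (\<Sum>t\<le>n. (prod_list (map (\<lambda>a. ev t - a) as) * c t) *s f t u) \<in> U"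
  using assms(4) y
proof (induction as arbitrary: y c)
  case (Cons a as)
  interpret W: linear_on scale V "op w" by (rule op_linear) fact
  show ?case
    using Cons.IH[OF W.D_closed[OF Cons.prems(1)] layer_D[OF assms(1-3) Cons.prems(1) eig Cons.prems(2), of a]]
    by (simp add: mult.assoc mult.left_commute)
qed simp

lemma layer_change:
  assumes "submod U" "submod U'" "layer n U U' u" "x \<in> U'" "x - u \<in> U"
  shows "layer n U U' x"
proof -
  have U: "subspace U" using assms(1) by (rule submodD)
  have u: "u \<in> U'" using assms(3) by (simp add: layer_def)
  have V: "x \<in> V" "u \<in> V" using submodD(2)[OF assms(2)] assms(4) u by auto
  have ft: "f t x - f t u \<in> U" for t
    using submodD(3)[OF assms(1) _ assms(5)] V by (simp add: UA_simps flip: op_diff)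
  have sums: "(\<Sum>t\<le>n. c t *s f t x) - (\<Sum>t\<le>n. c t *s f t u) \<in> U" for c
    unfolding sum_subtractf[symmetric] scale_right_diff_distrib[symmetric]
    using U ft by (intro subspace_sum subspace_scale)
  have eig: "op w (f t x) - a *s f t x \<in> U" if "w \<in> UA" "op w (f t u) - a *s f t u \<in> U" for w a t
  proof -
    have "op w (f t x - f t u) - a *s (f t x - f t u) + (op w (f t u) - a *s f t u) \<in> U"
      by (rule subspace_add[OF U subspace_diff[OF U submodD(3)[OF assms(1) that(1) ft]
            subspace_scale[OF U ft]] that(2)])
    then show ?thesis
      using V that(1) by (simp add: op_diff UA_simps op_V scale_right_diff_distrib)
  qed
  show ?thesis
    unfolding layer_def
  proof (intro conjI ballI allI impI)
    fix y assume "y \<in> U'"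
    then obtain c where "y - (\<Sum>t\<le>n. c t *s f t u) \<in> U" using assms(3) by (auto simp: layer_def)
    from subspace_diff[OF U this sums[of c]] show "\<exists>c. y - (\<Sum>t\<le>n. c t *s f t x) \<in> U" by auto
  next
    fix c t assume "(\<Sum>t\<le>n. c t *s f t x) \<in> U" and t: "t \<le> n"
    from subspace_diff[OF U this(1) sums[of c]] have "(\<Sum>t\<le>n. c t *s f t u) \<in> U" by simp
    then show "c t = 0" using assms(3) t by (auto simp: layer_def)
  qed (use assms eig in \<open>auto simp: layer_def UA_simps\<close>)
qed

end

locale uq_filt = uq_rep q l scale V op
  for q :: "'k::field" and l :: nat and scale :: "'k \<Rightarrow> 'm::ab_group_add \<Rightarrow> 'm" (infixr "*s" 75)
    and V :: "'m set" and op :: "uv \<Rightarrow> 'm \<Rightarrow> 'm" +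
  fixes F :: "nat \<Rightarrow> 'm set" and ns :: "nat list" and u :: "nat \<Rightarrow> 'm"
  assumes F_submod: "i \<le> length ns \<Longrightarrow> submod (F i)"
    and F_0: "F 0 = {0}" and F_V: "F (length ns) = V"
    and F_mono: "i < length ns \<Longrightarrow> F i \<subseteq> F (Suc i)"
    and F_layer: "i < length ns \<Longrightarrow> layer (ns ! i) (F i) (F (Suc i)) (u i)"
begin

interpretation H: linear_on scale V "hb 0 l"
  by (rule op_linear) (rule UA_simps)

interpretation K: linear_on scale V kk
  by (rule op_linear) (rule UA_simps)

lemma F_subspace: "i \<le> length ns \<Longrightarrow> subspace (F i)"
  using F_submod submodD(1) by blast

lemma F_in_V: "i \<le> length ns \<Longrightarrow> y \<in> F i \<Longrightarrow> y \<in> V"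
  using F_submod submodD(2) by blast

lemma layerD:
  assumes "i < length ns"
  shows "u i \<in> F (Suc i)" "u i \<in> V" "y \<in> F (Suc i) \<Longrightarrow> \<exists>c. y - (\<Sum>t\<le>ns ! i. c t *s f t (u i)) \<in> F i"
    "(\<Sum>t\<le>ns ! i. c t *s f t (u i)) \<in> F i \<Longrightarrow> t \<le> ns ! i \<Longrightarrow> c t = 0"
    "t \<le> ns ! i \<Longrightarrow> kk (f t (u i)) - q powi (int (ns ! i) - 2 * int t) *s f t (u i) \<in> F i"
    "t \<le> ns ! i \<Longrightarrow> hb 0 l (f t (u i)) - B (int (ns ! i) - 2 * int t) l *s f t (u i) \<in> F i"
    "t \<le> ns ! i \<Longrightarrow> op casimir (f t (u i)) - cv (int (ns ! i)) *s f t (u i) \<in> F i"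
  using F_layer[OF assms] F_in_V[of "Suc i" "u i"] assms unfolding layer_def by auto

lemma find_layer:
  assumes "y \<in> V" "y \<noteq> 0"
  obtains i where "i < length ns" "y \<in> F (Suc i)" "y \<notin> F i"
proof -
  let ?i = "LEAST i. y \<in> F i"
  have "y \<in> F (length ns)" using assms F_V by simp
  then have i: "y \<in> F ?i" "?i \<le> length ns" by (rule LeastI, rule Least_le)
  then obtain p where p: "?i = Suc p" using assms F_0 by (cases ?i) auto
  then have "y \<notin> F p" using not_less_Least[of p "\<lambda>i. y \<in> F i"] by auto
  then show ?thesis using that[of p] i p by auto
qed

text \<open>Operators that kill y multiply its coordinates in the layer by powers of eigenvalue
  differences. By independence these products vanish, so a nonzero coordinate must have the weight
  of y.\<close>

lemma layer_weight:
  assumes "i < length ns" "y \<in> F (Suc i)" "kk y = \<kappa> *s y" "(H.D a ^^ m) y = 0"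
    and y: "y - (\<Sum>t\<le>ns ! i. c t *s f t (u i)) \<in> F i" and t: "t \<le> ns ! i" "c t \<noteq> 0"
  shows "\<kappa> = q powi (int (ns ! i) - 2 * int t) \<and> a = B (int (ns ! i) - 2 * int t) l"
proof
  have i: "i \<le> length ns" using assms(1) by simp
  have yV: "y \<in> V" using assms F_in_V[of "Suc i"] by auto
  note sub = F_submod[OF i]
  have "K.D \<kappa> y - (\<Sum>t\<le>ns ! i. ((q powi (int (ns ! i) - 2 * int t) - \<kappa>) * c t) *s f t (u i)) \<in> F i"
    using sub yV y assms(1) by (intro layer_D layerD UA_simps) auto
  from subspace_neg[OF F_subspace[OF i] this]
  have "(\<Sum>t\<le>ns ! i. ((q powi (int (ns ! i) - 2 * int t) - \<kappa>) * c t) *s f t (u i)) \<in> F i"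
    by (simp add: K.D_def assms(3))
  from layerD(4)[OF assms(1) this t(1)]
  have "(q powi (int (ns ! i) - 2 * int t) - \<kappa>) * c t = 0" .
  then show "\<kappa> = q powi (int (ns ! i) - 2 * int t)" using t by simp
  have "(H.D a ^^ m) y - (\<Sum>t\<le>ns ! i. ((B (int (ns ! i) - 2 * int t) l - a) ^ m * c t) *s f t (u i)) \<in> F i"
    using sub yV y assms(1) by (intro layer_D_power layerD UA_simps) auto
  from subspace_neg[OF F_subspace[OF i] this]
  have "(\<Sum>t\<le>ns ! i. ((B (int (ns ! i) - 2 * int t) l - a) ^ m * c t) *s f t (u i)) \<in> F i"
    by (simp add: assms(4))
  from layerD(4)[OF assms(1) this t(1)]
  have "(B (int (ns ! i) - 2 * int t) l - a) ^ m * c t = 0" .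
  then show "a = B (int (ns ! i) - 2 * int t) l" using t by simp
qed

lemma layer_nonzero_coeff:
  assumes "i < length ns" "y \<in> F (Suc i)" "y \<notin> F i" "y - (\<Sum>t\<le>ns ! i. c t *s f t (u i)) \<in> F i"
  obtains t where "t \<le> ns ! i" "c t \<noteq> 0"
proof -
  have "\<not> (\<forall>t\<le>ns ! i. c t = 0)"
  proof
    assume "\<forall>t\<le>ns ! i. c t = 0"
    then have "(\<Sum>t\<le>ns ! i. c t *s f t (u i)) = 0" by (intro sum.neutral) auto
    then show False using assms(3,4) by simp
  qed
  then show ?thesis using that by blast
qed

lemma weight_exists:
  assumes "y \<in> V" "y \<noteq> 0" "kk y = \<kappa> *s y" "(H.D a ^^ m) y = 0"
  shows "\<exists>j. \<kappa> = q powi j \<and> a = B j l"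
proof -
  obtain i where i: "i < length ns" "y \<in> F (Suc i)" "y \<notin> F i"
    using find_layer assms by blast
  obtain c where c: "y - (\<Sum>t\<le>ns ! i. c t *s f t (u i)) \<in> F i"
    using layerD(3)[OF i(1,2)] by blast
  obtain t where "t \<le> ns ! i" "c t \<noteq> 0" using layer_nonzero_coeff[OF i c] .
  then show ?thesis using layer_weight[OF i(1,2) assms(3,4) c] by blast
qed

text \<open>In each layer the product of w - \<open>ev i t\<close> over all t maps
  \<open>F (Suc i)\<close> into \<open>F i\<close>. Concatenating the finitely many lists kills the
  whole space.\<close>

lemma kill:
  assumes "w \<in> UA"
    and eig: "\<And>i t. i < length ns \<Longrightarrow> t \<le> ns ! i \<Longrightarrow> op w (f t (u i)) - ev i t *s f t (u i) \<in> F i"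
  shows "\<exists>as. \<forall>y\<in>V. fold (linear_on.D scale (op w)) as y = 0"
proof -
  interpret W: linear_on scale V "op w" by (rule op_linear) fact
  have "\<exists>as. \<forall>y\<in>F i. fold W.D as y = 0" if "i \<le> length ns" for i
    using that
  proof (induction i)
    case 0
    show ?case by (intro exI[of _ "[]"]) (simp add: F_0)
  next
    case (Suc i)
    then obtain as where as: "\<And>y. y \<in> F i \<Longrightarrow> fold W.D as y = 0" by auto
    have i: "i < length ns" "i \<le> length ns" using Suc.prems by auto
    let ?L = "map (ev i) [0..<Suc (ns ! i)]"
    have "fold W.D ?L y \<in> F i" if y: "y \<in> F (Suc i)" for y
    proof -
      obtain c where c: "y - (\<Sum>t\<le>ns ! i. c t *s f t (u i)) \<in> F i"
        using layerD(3)[OF i(1) y] by blast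
      have "fold W.D ?L y - (\<Sum>t\<le>ns ! i. (prod_list (map (\<lambda>a. ev i t - a) ?L) * c t) *s f t (u i)) \<in> F i"
        using F_submod[OF i(2)] assms(1) eig[OF i(1)] c layerD(2)[OF i(1)] y F_in_V[OF Suc.prems]
        by (intro layer_D_fold) auto
      moreover have "prod_list (map (\<lambda>a. ev i t - a) ?L) = 0" if "t \<le> ns ! i" for t
        using that by (auto simp: prod_list_zero_iff image_iff simp del: upt_Suc intro!: bexI[of _ t])
      ultimately show ?thesis by (simp del: upt_Suc)
    qed
    then show ?case using as by (intro exI[of _ "?L @ as"]) (simp del: upt_Suc)
  qed
  then show ?thesis using F_V by auto
qed

lemma H_kill: "\<exists>as. \<forall>y\<in>V. fold H.D as y = 0"
  by (rule kill[where ev = "\<lambda>i t. B (int (ns ! i) - 2 * int t) l"]) (auto intro: layerD UA_simps)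

text \<open>First K and then [K; 0; l] is decomposed, the latter inside the eigenspaces of K. As the
  list for K has no repetitions, the K-components are true eigenvectors.
  \<open>weight_exists\<close> identifies each occurring pair of eigenvalues with an integer
  weight.\<close>

lemma weight_decomposition:
  assumes U: "submod U" and y: "y \<in> U"
  obtains J g where "finite J" "\<And>j. j \<in> J \<Longrightarrow> gw j (g j) \<and> g j \<in> U" "y = (\<Sum>j\<in>J. g j)"
proof -
  have sub: "subspace U" using U by (rule submodD)
  let ?S = "\<lambda>j. {z \<in> U. gw j z}"
  obtain ks where ks: "distinct ks" "\<And>y. y \<in> V \<Longrightarrow> fold K.D ks y = 0" using K_kill by blast
  obtain hs where hs: "\<And>y. y \<in> V \<Longrightarrow> fold H.D hs y = 0" using H_kill by blast
  interpret KU: linear_on scale U kk by (rule submod_linear[OF U]) (rule UA_simps)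
  obtain g where g: "\<And>a. a \<in> set ks \<Longrightarrow> g a \<in> U \<and> (K.D a ^^ count_list ks a) (g a) = 0"
    "y = (\<Sum>a\<in>set ks. g a)"
    using KU.eigen_decomposition[OF y ks(2)[OF submodD(2)[OF U y]]] by blast
  have "g a \<in> span (\<Union>j\<in>UNIV. ?S j)" if a: "a \<in> set ks" for a
  proof -
    have "count_list ks a = 1" using ks(1) a by (induction ks) auto
    then have ga: "g a \<in> U" "kk (g a) = a *s g a" using g(1)[OF a] by (auto simp: K.D_def)
    let ?U = "{z \<in> U. kk z = a *s z}"
    have subU: "subspace ?U"
      using sub submodD(2)[OF U]
      by (intro subspaceI) (auto simp: subspace_0 subspace_add subspace_scale op_zero op_add op_scale UA_simps
          scale_right_distrib scale_left_commute)
    interpret HU: linear_on scale ?U "hb 0 l"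
      by unfold_locales (auto simp: subU submodD[OF U] UA_simps op_add op_scale kk_hb)
    obtain h where h: "\<And>b. b \<in> set hs \<Longrightarrow> h b \<in> ?U \<and> (H.D b ^^ count_list hs b) (h b) = 0"
      "g a = (\<Sum>b\<in>set hs. h b)"
      using HU.eigen_decomposition[of "g a" hs] ga hs[OF submodD(2)[OF U ga(1)]] by blast
    have "h b \<in> span (\<Union>j\<in>UNIV. ?S j)" if b: "b \<in> set hs" for b
    proof (cases "h b = 0")
      case True
      then show ?thesis by (simp add: span_zero)
    next
      case False
      have hb: "h b \<in> U" "h b \<in> V" "kk (h b) = a *s h b" "(H.D b ^^ count_list hs b) (h b) = 0"
        using h(1)[OF b] submodD(2)[OF U] by auto
      then obtain j where "a = q powi j" "b = B j l" using weight_exists False by blast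
      then have "gw j (h b)" using hb by (auto simp: gw_def nu_D)
      then show ?thesis using hb by (auto intro: span_base)
    qed
    then show ?thesis unfolding h(2) by (rule span_sum)
  qed
  then have "y \<in> span (\<Union>j\<in>UNIV. ?S j)" unfolding g(2) by (rule span_sum)
  moreover have "subspace (?S j)" for j
    using subspace_inter[OF sub subspace_gw[of j]] by (simp add: Int_def)
  ultimately show ?thesis
    using span_Union_subspaces[of UNIV ?S y] that by (metis (no_types, lifting) mem_Collect_eq)
qed

text \<open>The generator u of a layer is a weight vector only modulo the lower step. Its component
  of weight n differs from u by an element of that step, because n - 2t = n only for t = 0.\<close>

lemma gw_lift:
  assumes i: "i < length ns"
  shows "\<exists>x. gw (int (ns ! i)) x \<and> layer (ns ! i) (F i) (F (Suc i)) x"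
proof -
  let ?n = "ns ! i"
  have le: "i \<le> length ns" "Suc i \<le> length ns" using i by auto
  note sub = F_subspace[OF le(1)]
  obtain J g where J: "finite J" "\<And>j. j \<in> J \<Longrightarrow> gw j (g j) \<and> g j \<in> F (Suc i)" "u i = (\<Sum>j\<in>J. g j)"
    using weight_decomposition[OF F_submod[OF le(2)] layerD(1)[OF i]] by metis
  have "\<exists>c. g j - (\<Sum>t\<le>?n. c t *s f t (u i)) \<in> F i \<and> (\<forall>t\<le>?n. c t \<noteq> 0 \<longrightarrow> j = int ?n - 2 * int t)"
    if j: "j \<in> J" for j
  proof -
    obtain c where c: "g j - (\<Sum>t\<le>?n. c t *s f t (u i)) \<in> F i"
      using layerD(3)[OF i, of "g j"] J(2)[OF j] by blast
    obtain m where m: "kk (g j) = q powi j *s g j" "(H.D (B j l) ^^ m) (g j) = 0"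
      using J(2)[OF j] by (auto simp: gw_def nu_D)
    have "j = int ?n - 2 * int t" if "t \<le> ?n" "c t \<noteq> 0" for t
      using layer_weight[OF i _ m c that] J(2)[OF j] weight_inj by blast
    then show ?thesis using c by blast
  qed
  then obtain c where c: "\<And>j. j \<in> J \<Longrightarrow> g j - (\<Sum>t\<le>?n. c j t *s f t (u i)) \<in> F i"
    "\<And>j t. j \<in> J \<Longrightarrow> t \<le> ?n \<Longrightarrow> c j t \<noteq> 0 \<Longrightarrow> j = int ?n - 2 * int t"
    by metis
  \<comment> \<open>Total coordinates of all components. They reproduce those of \<open>u i\<close>,
    so \<open>C 0\<close> is 1, and only the component of weight n can contribute to it.\<close>
  define C where "C t = (\<Sum>j\<in>J. c j t)" for t
  have "(\<Sum>j\<in>J. g j - (\<Sum>t\<le>?n. c j t *s f t (u i))) \<in> F i"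
    using c(1) by (intro subspace_sum[OF sub])
  also have "(\<Sum>j\<in>J. g j - (\<Sum>t\<le>?n. c j t *s f t (u i))) = u i - (\<Sum>t\<le>?n. C t *s f t (u i))"
    unfolding sum_subtractf J(3)[symmetric] C_def scale_sum_left by (simp add: sum.swap[of _ J])
  also have "u i - (\<Sum>t\<le>?n. C t *s f t (u i)) = (\<Sum>t\<le>?n. ((if t = 0 then 1 else 0) - C t) *s f t (u i))"
  proof -
    have "(\<Sum>t\<le>?n. (if t = 0 then 1 else 0) *s f t (u i)) = (\<Sum>t\<le>?n. if t = 0 then f t (u i) else 0)"
      by (intro sum.cong) auto
    then have "(\<Sum>t\<le>?n. (if t = 0 then 1 else 0) *s f t (u i)) = u i"
      using layerD(2)[OF i] by (simp add: op_one)
    then show ?thesis by (simp only: sum_subtractf scale_left_diff_distrib)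
  qed
  finally have "(if (0::nat) = 0 then 1 else 0) - C 0 = 0"
    by (rule layerD(4)[OF i]) simp
  then have C0: "C 0 = 1" by simp
  have c0: "c j 0 = 0" if "j \<in> J" "j \<noteq> int ?n" for j
    using c(2)[OF that(1), of 0] that(2) by auto
  have n: "int ?n \<in> J"
  proof (rule ccontr)
    assume "int ?n \<notin> J"
    then have "C 0 = 0" unfolding C_def using c0 by (intro sum.neutral) auto
    then show False using C0 by simp
  qed
  have "C 0 = c (int ?n) 0"
    unfolding C_def using c0 n J(1) by (subst sum.remove[of _ "int ?n"]) auto
  then have c1: "c (int ?n) 0 = 1" using C0 by simp
  have ct: "c (int ?n) t = 0" if "t \<le> ?n" "t \<noteq> 0" for t
    using c(2)[OF n that(1)] that by auto
  have "(\<Sum>t\<le>?n. c (int ?n) t *s f t (u i)) = (\<Sum>t\<le>?n. if t = 0 then f t (u i) else 0)"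
    using c1 ct by (intro sum.cong) auto
  then have "(\<Sum>t\<le>?n. c (int ?n) t *s f t (u i)) = u i"
    using layerD(2)[OF i] by (simp add: op_one)
  then have "g (int ?n) - u i \<in> F i" using c(1)[OF n] by simp
  then show ?thesis
    using layer_change[OF F_submod F_submod F_layer[OF i]] le J(2)[OF n] by blast
qed

end

locale uq_wfilt = uq_filt q l scale V op F ns u
  for q :: "'k::field" and l :: nat and scale :: "'k \<Rightarrow> 'm::ab_group_add \<Rightarrow> 'm" (infixr "*s" 75)
    and V :: "'m set" and op :: "uv \<Rightarrow> 'm \<Rightarrow> 'm" and F ns u +
  assumes u_gw: "i < length ns \<Longrightarrow> gw (int (ns ! i)) (u i)"

lemma (in uq_filt) wfilt_exists: "\<exists>x. uq_wfilt q l scale V op F ns x"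
proof -
  obtain x where x: "\<And>i. i < length ns \<Longrightarrow> gw (int (ns ! i)) (x i) \<and> layer (ns ! i) (F i) (F (Suc i)) (x i)"
    using gw_lift by metis
  then show ?thesis
    by (intro exI[of _ x]) (unfold_locales, use F_submod F_0 F_V F_mono in auto)
qed

context uq_wfilt
begin

interpretation H: linear_on scale V "hb 0 l"
  by (rule op_linear) (rule UA_simps)

interpretation C: linear_on scale V "op casimir"
  by (rule op_linear) (rule UA_simps)

lemma gw_layer:
  assumes i: "i < length ns" and y: "y \<in> F (Suc i)" "gw j y" "y \<notin> F i"
  shows "\<exists>t\<le>ns ! i. j = int (ns ! i) - 2 * int t \<and> (\<exists>c. y - c *s f t (u i) \<in> F i)"
proof -
  obtain c where c: "y - (\<Sum>t\<le>ns ! i. c t *s f t (u i)) \<in> F i"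
    using layerD(3)[OF i y(1)] by blast
  obtain m where m: "kk y = q powi j *s y" "(H.D (B j l) ^^ m) y = 0"
    using y(2) by (auto simp: gw_def nu_D)
  have j: "j = int (ns ! i) - 2 * int t" if "t \<le> ns ! i" "c t \<noteq> 0" for t
    using layer_weight[OF i y(1) m c that] weight_inj by blast
  obtain t where t: "t \<le> ns ! i" "c t \<noteq> 0" using layer_nonzero_coeff[OF i y(1,3) c] .
  have "c s = 0" if "s \<le> ns ! i" "s \<noteq> t" for s
    using j[OF t] j[OF that(1)] that(2) by auto
  then have "(\<Sum>s\<le>ns ! i. c s *s f s (u i)) = (\<Sum>s\<le>ns ! i. if s = t then c t *s f t (u i) else 0)"
    by (intro sum.cong) auto
  then have "y - c t *s f t (u i) \<in> F i" using c t by simp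
  then show ?thesis using t j[OF t] by blast
qed

lemma gw_bound:
  assumes "gw j y" "y \<noteq> 0"
  shows "\<exists>i<length ns. \<exists>t\<le>ns ! i. j = int (ns ! i) - 2 * int t"
  using find_layer[OF gw_V[OF assms(1)] assms(2)] gw_layer assms(1) by metis

lemma f_u_notin: "i < length ns \<Longrightarrow> t \<le> ns ! i \<Longrightarrow> f t (u i) \<notin> F i"
proof
  assume i: "i < length ns" and t: "t \<le> ns ! i" and "f t (u i) \<in> F i"
  moreover have "(\<Sum>s\<le>ns ! i. (if s = t then 1 else 0) *s f s (u i)) = (\<Sum>s\<le>ns ! i. if s = t then f t (u i) else 0)"
    by (intro sum.cong) auto
  ultimately have "(\<Sum>s\<le>ns ! i. (if s = t then 1 else 0) *s f s (u i)) \<in> F i" by simp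
  from layerD(4)[OF i this t] show False by simp
qed

text \<open>The generalised eigenspaces of the Casimir element are submodules, so an indecomposable
  module lies in a single one.\<close>

lemma casimir_block:
  assumes indec: "\<And>N N'. submod N \<Longrightarrow> submod N' \<Longrightarrow> N \<inter> N' = {0} \<Longrightarrow>
      (\<And>y. y \<in> V \<Longrightarrow> \<exists>a\<in>N. \<exists>b\<in>N'. y = a + b) \<Longrightarrow> N = {0} \<or> N' = {0}"
    and x: "x \<in> V" "x \<noteq> 0" "op casimir x = c *s x" and i: "i < length ns"
  shows "cv (int (ns ! i)) = c"
proof -
  obtain as where as: "\<And>y. y \<in> V \<Longrightarrow> fold C.D as y = 0"
    using kill[of casimir "\<lambda>i t. cv (int (ns ! i))"] layerD(7) casimir_in_UA by blast
  define S where "S a = {y \<in> V. \<exists>m. (C.D a ^^ m) y = 0}" for a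
  have S_sub: "subspace (S a)" for a
  proof (rule subspaceI)
    show "0 \<in> S a" by (auto simp: S_def V_simps intro: exI[of _ 0])
    fix y z assume "y \<in> S a" "z \<in> S a"
    then obtain m n where "y \<in> V" "z \<in> V" "(C.D a ^^ m) y = 0" "(C.D a ^^ n) z = 0" by (auto simp: S_def)
    moreover from this have "(C.D a ^^ max m n) y = 0" "(C.D a ^^ max m n) z = 0"
      using C.D_power_mono by auto
    ultimately show "y + z \<in> S a"
      using linear_on.add[OF C.D_power_linear[where a = a and n = "max m n"], of y z] V_simps
      by (auto simp: S_def)
  next
    fix y b assume "y \<in> S a"
    then show "b *s y \<in> S a"
      using linear_on.scale[OF C.D_power_linear] V_simps by (auto simp: S_def)
  qed
  have S_op: "op w y \<in> S a" if w: "w \<in> UA" "y \<in> S a" for w y a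
  proof -
    obtain m where m: "y \<in> V" "(C.D a ^^ m) y = 0" using w(2) by (auto simp: S_def)
    have comm: "C.D a (op w z) = op w (C.D a z)" if "z \<in> V" for z
      using that w(1)
      by (simp add: C.D_def op_casimir_central op_diff op_scale op_V V_simps casimir_in_UA)
    have "(C.D a ^^ n) (op w y) = op w ((C.D a ^^ n) y)" for n
      using m(1) by (induction n) (simp_all add: comm C.D_power_closed)
    then show ?thesis using m w(1) by (auto simp: S_def op_V op_zero intro!: exI[of _ m])
  qed
  define N where "N = span (\<Union>a\<in>-{c}. S a)"
  have SV: "S a \<subseteq> V" for a by (auto simp: S_def)
  have N_V: "N \<subseteq> V" unfolding N_def using SV by (intro span_minimal) (auto simp: V)
  have "submod (S c)" using S_sub SV S_op by (auto simp: submod_def)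
  moreover have "submod N"
    unfolding submod_def
  proof (intro conjI ballI)
    show "subspace N" by (simp add: N_def)
    fix w y assume w: "w \<in> UA" and "y \<in> N"
    from this(2) have "y \<in> V \<and> op w y \<in> N"
      unfolding N_def
    proof (induction rule: span_induct_alt)
      case (step b z y)
      then obtain a where a: "a \<noteq> c" "z \<in> S a" by auto
      then have "z \<in> V" "op w z \<in> span (\<Union>a\<in>-{c}. S a)" using S_op[OF w a(2)] SV by (auto intro!: span_base)
      then show ?case using step w
        by (auto simp: op_add op_scale V_simps intro: span_add span_scale)
    qed (use w in \<open>auto simp: op_zero span_zero V_simps\<close>)
    then show "op w y \<in> N" by simp
  qed (rule N_V)
  moreover have "S c \<inter> N = {0}"
  proof -
    have "y = 0" if y: "y \<in> S c" "y \<in> N" for y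
    proof -
      obtain A g where A: "finite A" "A \<subseteq> - {c}" "\<And>a. a \<in> A \<Longrightarrow> g a \<in> S a" "y = (\<Sum>a\<in>A. g a)"
        using y(2) S_sub unfolding N_def by (metis span_Union_subspaces)
      define g' where "g' a = (if a = c then - y else g a)" for a
      have "g' c = 0"
      proof (rule C.eigen_independent[of "insert c A"])
        show "(\<Sum>a\<in>insert c A. g' a) = 0"
        proof -
          have "(\<Sum>a\<in>A. g' a) = y" unfolding A(4) g'_def using A(2) by (intro sum.cong) auto
          then show ?thesis using A(1,2) by (subst sum.insert) (auto simp: g'_def)
        qed
        show "g' a \<in> V \<and> (\<exists>m. (C.D a ^^ m) (g' a) = 0)" if "a \<in> insert c A" for a
          using that A(2,3) subspace_neg[OF S_sub y(1)] by (auto simp: g'_def S_def)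
      qed (use A in auto)
      then show ?thesis by (simp add: g'_def)
    qed
    moreover have "0 \<in> S c" "0 \<in> N" using S_sub subspace_0 by (auto simp: N_def span_zero)
    ultimately show ?thesis by blast
  qed
  moreover have "\<exists>a\<in>S c. \<exists>b\<in>N. y = a + b" if yV: "y \<in> V" for y
  proof -
    obtain g where g: "\<And>a. a \<in> set as \<Longrightarrow> g a \<in> V \<and> (C.D a ^^ count_list as a) (g a) = 0"
      "y = (\<Sum>a\<in>set as. g a)"
      using C.eigen_decomposition[OF yV as[OF yV]] by blast
    then have gS: "\<And>a. a \<in> set as \<Longrightarrow> g a \<in> S a" by (auto simp: S_def)
    have "(\<Sum>a\<in>set as - {c}. g a) \<in> N"
      unfolding N_def using gS by (intro span_sum) (auto intro: span_base)
    moreover have "(if c \<in> set as then g c else 0) \<in> S c" using gS S_sub subspace_0 by auto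
    moreover have "y = (if c \<in> set as then g c else 0) + (\<Sum>a\<in>set as - {c}. g a)"
      unfolding g(2) by (auto simp: sum.remove)
    ultimately show ?thesis by blast
  qed
  ultimately have "S c = {0} \<or> N = {0}" by (rule indec)
  moreover have "x \<in> S c" using x by (auto simp: S_def C.D_def intro!: exI[of _ 1])
  ultimately have "N = {0}" using x(2) by auto
  then have V: "y \<in> S c" if "y \<in> V" for y
    using that \<open>\<And>y. y \<in> V \<Longrightarrow> \<exists>a\<in>S c. \<exists>b\<in>N. y = a + b\<close> by fastforce
  let ?n = "ns ! i"
  obtain m where m: "(C.D c ^^ m) (u i) = 0" using V[OF layerD(2)[OF i]] by (auto simp: S_def)
  have le: "i \<le> length ns" using i by simp
  have "u i - (\<Sum>t\<le>?n. (if t = 0 then 1 else 0) *s f t (u i)) = 0"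
  proof -
    have "(\<Sum>t\<le>?n. (if t = 0 then 1 else 0) *s f t (u i)) = (\<Sum>t\<le>?n. if t = 0 then f t (u i) else 0)"
      by (intro sum.cong) auto
    then show ?thesis using layerD(2)[OF i] by (simp add: op_one)
  qed
  \<comment> \<open>Everything now lies in \<open>S c\<close>. Since \<open>u i\<close> has
    coordinates (1, 0, ..., 0) in its layer, being killed by the m-th power of
    \<open>casimir\<close> - c forces (\<open>cv\<close> n - c)^m = 0.\<close>
  then have "(C.D c ^^ m) (u i) - (\<Sum>t\<le>?n. ((cv (int ?n) - c) ^ m * (if t = 0 then 1 else 0)) *s f t (u i)) \<in> F i"
    using F_submod[OF le] layerD[OF i] casimir_in_UA subspace_0[OF F_subspace[OF le]]
    by (intro layer_D_power[where ev = "\<lambda>t. cv (int ?n)"]) auto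
  from subspace_neg[OF F_subspace[OF le] this]
  have "(\<Sum>t\<le>?n. ((cv (int ?n) - c) ^ m * (if t = 0 then 1 else 0)) *s f t (u i)) \<in> F i"
    unfolding m by simp
  from layerD(4)[OF i this, of 0]
  have "(cv (int ?n) - c) ^ m * (if (0::nat) = 0 then 1 else 0) = 0" by simp
  then show ?thesis by simp
qed

end

section \<open>Splitting off the indecomposable tilting modules\<close>

lemma Kff_commute: "Kff c t * Kff c' t' = Kff c' t' * Kff c t"
proof (induction t)
  case (Suc t)
  have "Kff c (Suc t) * Kff c' t' = Kff c t * (Kff c' t' * Kd (c - int t))"
    by (simp add: Kff_Suc mult.assoc Kd_Kff)
  also have "\<dots> = Kff c' t' * Kff c (Suc t)"
    using Suc by (simp add: Kff_Suc flip: mult.assoc)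
  finally show ?case .
qed simp

lemma K_binom_commute: "K_binom c t * K_binom c' t' = K_binom c' t' * K_binom c t"
  by (simp add: K_binom_Kff uv_const_left uv_const_merge mult.assoc mult.commute[of "inverse (qdfact t)"]
      Kff_commute[of c t])

context root_of_unity
begin

text \<open>Vanishing half of the quantum Lucas theorem: subtracting l from both indices keeps the
  residues, until r < l.\<close>

lemma B_eq_0_mod: "n mod int l < int (r mod l) \<Longrightarrow> B n r = 0"
proof (induction r arbitrary: n rule: less_induct)
  case (less r)
  show ?case
  proof (cases "r < l")
    case True
    then show ?thesis using less.prems B_eq_0[of r n] by simp
  next
    case False
    then have "(r - l) mod l = r mod l" by (simp add: le_mod_geq)
    moreover have "(n - int l) mod int l = n mod int l" by simp
    ultimately have "B (n - int l) (r - l) = 0"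
      using less.IH[of "r - l" "n - int l"] less.prems False l_ge by simp
    moreover have "B (int r) l \<noteq> 0"
      using False l_ge by (simp add: B_l_eq_0 div_eq_0_iff flip: of_nat_div)
    ultimately show ?thesis
      using B_mult[of n l "r - l"] False by auto
  qed
qed

lemma B_shift: "r < l \<Longrightarrow> B (int l * m + n) r = ((- 1) powi m) ^ r * B n r"
proof (induction r)
  case (Suc r)
  have *: "N (int l * m + n - int r) = (- 1) powi m * N (n - int r)"
    using N_add_mult_l[of m "n - int r"] by (simp add: algebra_simps)
  have "N (int (Suc r)) * B (int l * m + n) (Suc r) = N (int (Suc r)) * (((- 1) powi m) ^ Suc r * B n (Suc r))"
    using Suc B_Suc'[of r "int l * m + n"] B_Suc'[of r n] unfolding *
    by (simp del: of_nat_Suc add: mult.left_commute[of "N (int (Suc r))"])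
  then show ?case using N_Suc_nonzero[OF Suc.prems] by (metis mult_cancel_left)
qed simp

lemma sign_power_cases: "((- 1 :: 'k) powi m) ^ r = 1 \<or> ((- 1 :: 'k) powi m) ^ r = - 1"
  using minus_one_powi_cases[of m] by (auto simp: minus_one_power_iff)

text \<open>With zero determinant, (D, -C') and (C, -A) would lie in the kernel, so all four entries
  would vanish and the kernel would not be trivial. The solution is Cramer's rule.\<close>

lemma linear_system_2:
  fixes A C C' D :: 'k
  assumes "\<And>a b. a * A + b * C = 0 \<Longrightarrow> a * C' + b * D = 0 \<Longrightarrow> a = 0 \<and> b = 0"
  shows "\<exists>a b. a * A + b * C = \<alpha> \<and> a * C' + b * D = \<beta>"
proof -
  have det: "A * D - C * C' \<noteq> 0"
  proof
    assume det: "A * D - C * C' = 0"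
    then have "D = 0 \<and> - C' = 0" using assms[of D "- C'"] by (simp add: algebra_simps)
    moreover have "C = 0 \<and> - A = 0" using det assms[of C "- A"] by (simp add: algebra_simps)
    ultimately show False using assms[of 1 0] by simp
  qed
  define a b where "a = (\<alpha> * D - \<beta> * C) / (A * D - C * C')" and "b = (\<beta> * A - \<alpha> * C') / (A * D - C * C')"
  have "a * A + b * C = \<alpha> * (A * D - C * C') / (A * D - C * C')"
    by (simp add: a_def b_def add_divide_distrib[symmetric] algebra_simps)
  moreover have "a * C' + b * D = \<beta> * (A * D - C * C') / (A * D - C * C')"
    by (simp add: a_def b_def add_divide_distrib[symmetric] algebra_simps)
  ultimately show ?thesis using det by auto
qed

end

context uq_rep
begin

interpretation H: linear_on scale V "hb 0 l"
  by (rule op_linear) (rule UA_simps)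

lemma op_span:
  assumes "w \<in> UA" "G \<subseteq> V" "\<And>g. g \<in> G \<Longrightarrow> op w g \<in> span G'" "y \<in> span G"
  shows "op w y \<in> span G'"
proof -
  have "y \<in> V \<and> op w y \<in> span G'"
    using assms(4)
  proof (induction rule: span_induct_alt)
    case base
    then show ?case using assms(1) by (simp add: op_zero V_simps span_zero)
  next
    case (step c x y)
    then show ?case using assms(1-3)
      by (auto simp: op_add op_scale V_simps subset_iff intro!: span_add span_scale)
  qed
  then show ?thesis by simp
qed

lemma span_V: "G \<subseteq> V \<Longrightarrow> span G \<subseteq> V"
  by (rule span_minimal[OF _ V])

lemma graded_submod:
  assumes gw: "\<And>j y. y \<in> S j \<Longrightarrow> gw j y"
    and e: "\<And>j y r. y \<in> S j \<Longrightarrow> e r y \<in> S (j + 2 * int r)"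
    and f: "\<And>j y r. y \<in> S j \<Longrightarrow> f r y \<in> S (j - 2 * int r)"
  shows "submod (span (\<Union>j\<in>UNIV. S j))" (is "submod (span ?G)")
proof (rule submodI)
  have GV: "?G \<subseteq> V" using gw gw_V by blast
  then show "span ?G \<subseteq> V" by (rule span_V)
  fix r y assume y: "y \<in> span ?G"
  show "e r y \<in> span ?G"
    by (rule op_span[OF UA.E_div GV _ y]) (use e in \<open>auto intro!: span_base\<close>)
  show "f r y \<in> span ?G"
    by (rule op_span[OF UA.F_div GV _ y]) (use f in \<open>auto intro!: span_base\<close>)
next
  have GV: "?G \<subseteq> V" using gw gw_V by blast
  fix y assume y: "y \<in> span ?G"
  show "kk y \<in> span ?G"
  proof (rule op_span[OF UA.K GV _ y])
    fix g assume g: "g \<in> ?G"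
    then obtain j where "gw j g" using gw by blast
    then have "kk g = q powi j *s g" by (simp add: gw_def)
    then show "kk g \<in> span ?G" using g by (auto intro: span_base span_scale)
  qed
  show "ki y \<in> span ?G"
  proof (rule op_span[OF UA.K_inv GV _ y])
    fix g assume g: "g \<in> ?G"
    then obtain j where "gw j g" using gw by blast
    then have "ki g = q powi (- j) *s g" by (intro ki_weight) (auto simp: gw_def)
    then show "ki g \<in> span ?G" using g by (auto intro: span_base span_scale)
  qed
qed simp

lemma nilpotent_eigen:
  assumes "y \<in> V" "(nu j ^^ m) y = 0" "nu j y = c *s y" "c \<noteq> 0"
  shows "y = 0"
proof -
  have "(nu j ^^ n) y = c ^ n *s y" for n
    using assms(1,3) by (induction n) (simp_all add: linear_on.scale[OF nu_linear] mult.commute)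
  then show ?thesis using assms(2,4) by simp
qed

lemma hb_hb: "y \<in> V \<Longrightarrow> hb c t (hb c' t' y) = hb c' t' (hb c t y)"
  by (simp add: UA_simps K_binom_commute[of c t] flip: op_mult)

lemma gw_hb: "gw j y \<Longrightarrow> gw j (hb c t y)"
proof -
  assume y: "gw j y"
  then have yV: "y \<in> V" and k: "kk y = q powi j *s y" by (auto simp: gw_def)
  have comm: "nu j (hb c t z) = hb c t (nu j z)" if "z \<in> V" for z
    using that by (simp add: nu_def hb_hb[of z 0] op_diff op_scale UA_simps V_simps op_V)
  have "(nu j ^^ m) (hb c t y) = hb c t ((nu j ^^ m) y)" for m
    using nu_power_weight[OF yV k] by (induction m) (simp_all add: comm)
  moreover obtain m where "(nu j ^^ m) y = 0" using y by (auto simp: gw_def)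
  ultimately have "(nu j ^^ m) (hb c t y) = 0" by (simp add: op_zero UA_simps)
  then show ?thesis using yV k by (auto simp: gw_def kk_hb op_V op_scale UA_simps)
qed

lemma gw_nu: "gw j y \<Longrightarrow> gw j (nu j y)"
  unfolding nu_def by (intro gw_closed gw_hb)

text \<open>On weight vectors \<open>[K; 0; nl]\<close> is a polynomial in \<open>[K; 0; l]\<close> that has a simple root at
  the value belonging to a weight \<open>j\<close> with \<open>0 \<le> j < nl\<close> (only the last block matters here).\<close>

lemma hb_kernel_tw:
  assumes y: "gw j y" and j: "j div int l = int n - 1" and n: "1 \<le> n" and zero: "hb 0 (n * l) y = 0"
  shows "tw j y"
proof -
  have yV: "y \<in> V" and k: "kk y = q powi j *s y" using y by (auto simp: gw_def)
  \<comment> \<open>The bracket split off at stage i + 1 acts on weight j as plus or minus i plus a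
    nilpotent operator, because (j + c) div l = i. For i >= 1 it is injective and can be cancelled;
    for i = 0 it is \<open>nu\<close> up to sign.\<close>
  have "nu j y = 0" if "1 \<le> i" "i \<le> n" "hb (- (int n - int i) * int l) (i * l) y = 0" for i
    using that
  proof (induction i)
    case (Suc i)
    define c where "c = - (int n - int (Suc i)) * int l"
    define y' where "y' = hb (c - int l) (i * l) y"
    have y': "gw j y'" using y by (simp add: y'_def gw_hb)
    have "hb c l y' = B (int (l + i * l)) l *s hb c (l + i * l) y"
      using hb_mult[OF yV, of l "i * l" c] by (simp add: y'_def)
    also have "\<dots> = 0" using Suc.prems by (simp add: c_def)
    finally have "hb c l y' = 0" .
    then have nu: "B (j + c) l *s y' + (- 1) powi c *s nu j y' = 0"
      using hb_weight_l[of y' j c] y' by (simp add: gw_def)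
    have "(- 1) powi c *s (B (j + c) l *s y' + (- 1) powi c *s nu j y') = 0"
      by (simp only: nu) simp
    then have "((- 1) powi c * B (j + c) l) *s y' + nu j y' = 0"
      by (simp add: scale_right_distrib minus_one_powi_sq)
    then have nu': "nu j y' = (- ((- 1) powi c * B (j + c) l)) *s y'"
      by (simp add: eq_neg_iff_add_eq_0 add.commute)
    have "(j + c) div int l = int i"
      using j l_ge by (simp add: c_def)
    then have B: "B (j + c) l = 0 \<longleftrightarrow> i = 0" by (simp add: B_l_eq_0)
    show ?case
    proof (cases "i = 0")
      case True
      then have "y' = y" using yV by (simp add: y'_def op_one)
      then show ?thesis using nu' B True by simp
    next
      case False
      then have "- ((- 1 :: 'k) powi c * B (j + c) l) \<noteq> 0"
        using B minus_one_powi_cases[of c] by auto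
      then have "y' = 0" using nilpotent_eigen[OF _ _ nu'] y' by (auto simp: gw_def)
      then have "hb (- (int n - int i) * int l) (i * l) y = 0"
        by (simp add: y'_def c_def algebra_simps)
      then show ?thesis using Suc False by simp
    qed
  qed simp
  from this[of n] show ?thesis using n zero y by (simp add: tw_nu gw_def)
qed

section \<open>Weight bases and characters\<close>

text \<open>The spanning condition concerns generalised weight vectors while the basis consists of
  true ones; so a weight basis also proves that the two notions agree. The family is indexed because
  two strings can share a weight.\<close>

definition weight_basis :: "'i set \<Rightarrow> ('i \<Rightarrow> 'm) \<Rightarrow> ('i \<Rightarrow> int) \<Rightarrow> bool" where
  "weight_basis I b wt \<longleftrightarrow> finite I \<and> (\<forall>i\<in>I. tw (wt i) (b i)) \<and>
     (\<forall>j y. gw j y \<longrightarrow> y \<in> span (b ` {i\<in>I. wt i = j})) \<and>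
     (\<forall>j c. (\<Sum>i\<in>{i\<in>I. wt i = j}. c i *s b i) = 0 \<longrightarrow> (\<forall>i\<in>I. wt i = j \<longrightarrow> c i = 0))"

lemma weight_basis_tw:
  assumes "weight_basis I b wt"
  shows "{y. tw j y} = span (b ` {i\<in>I. wt i = j})" "dim {y. tw j y} = card {i\<in>I. wt i = j}"
proof -
  let ?I = "{i\<in>I. wt i = j}"
  have fin: "finite ?I" using assms by (simp add: weight_basis_def)
  have ind: "c i = 0" if "(\<Sum>i\<in>?I. c i *s b i) = 0" "i \<in> ?I" for c i
    using assms that unfolding weight_basis_def by blast
  show eq: "{y. tw j y} = span (b ` ?I)"
  proof
    show "{y. tw j y} \<subseteq> span (b ` ?I)" using assms tw_gw by (auto simp: weight_basis_def)
    show "span (b ` ?I) \<subseteq> {y. tw j y}"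
      using assms by (intro span_minimal subspace_tw) (auto simp: weight_basis_def)
  qed
  have inj: "inj_on b ?I"
  proof (rule inj_onI, rule ccontr)
    fix i i' assume i: "i \<in> ?I" "i' \<in> ?I" "b i = b i'" "i \<noteq> i'"
    have "(\<Sum>s\<in>?I. (if s = i then 1 else if s = i' then - 1 else 0) *s b s) =
      (\<Sum>s\<in>?I. (if s = i then b i else 0) + (if s = i' then - b i' else 0))"
      using i(4) by (intro sum.cong) auto
    also have "\<dots> = b i - b i'" using i(1,2) fin by (simp add: sum.distrib)
    finally show False using ind[of "\<lambda>s. if s = i then 1 else if s = i' then - 1 else 0" i] i by simp
  qed
  have "independent (b ` ?I)"
  proof (rule independent_if_scalars_zero)
    fix f x assume *: "(\<Sum>x\<in>b ` ?I. f x *s x) = 0" "x \<in> b ` ?I"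
    then obtain i where "i \<in> ?I" "x = b i" by blast
    moreover have "(\<Sum>i\<in>?I. f (b i) *s b i) = 0" using * by (simp add: sum.reindex[OF inj])
    ultimately show "f x = 0" using ind[of "\<lambda>i. f (b i)" i] by simp
  qed (use fin in simp)
  then show "dim {y. tw j y} = card ?I"
    unfolding eq using card_image[OF inj] by (simp add: dim_eq_card_independent)
qed

lemma weight_basis_character:
  fixes X :: "'f::field"
  assumes "weight_basis I b wt"
  shows "(\<Sum>j | {y. tw j y} \<noteq> {0}. of_nat (dim {y. tw j y}) * X powi j) = (\<Sum>i\<in>I. X powi wt i)"
proof -
  have fin: "finite I" using assms by (simp add: weight_basis_def)
  have dim0: "card {i\<in>I. wt i = j} = 0" if "{y. tw j y} = {0}" for j
  proof -
    have "dim {y. tw j y} = 0"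
      unfolding that using dim_span_eq_card_independent[OF independent_empty] by (simp only: span_empty card.empty)
    then show ?thesis using weight_basis_tw(2)[OF assms] by simp
  qed
  have sub: "wt ` I \<supseteq> {j. {y. tw j y} \<noteq> {0}}"
  proof
    fix j assume j: "j \<in> {j. {y. tw j y} \<noteq> {0}}"
    show "j \<in> wt ` I"
    proof (rule ccontr)
      assume "j \<notin> wt ` I"
      then have "{i\<in>I. wt i = j} = {}" by auto
      then have "{y. tw j y} = {0}"
        unfolding weight_basis_tw(1)[OF assms] by (simp only: image_empty span_empty)
      then show False using j by simp
    qed
  qed
  have "(\<Sum>j | {y. tw j y} \<noteq> {0}. of_nat (dim {y. tw j y}) * X powi j)
     = (\<Sum>j\<in>wt ` I. of_nat (card {i\<in>I. wt i = j}) * X powi j)"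
    unfolding weight_basis_tw(2)[OF assms]
  proof (rule sum.mono_neutral_left[OF _ sub])
    show "\<forall>j\<in>wt ` I - {j. {y. tw j y} \<noteq> {0}}. of_nat (card {i\<in>I. wt i = j}) * X powi j = 0"
    proof
      fix j assume "j \<in> wt ` I - {j. {y. tw j y} \<noteq> {0}}"
      then have "{y. tw j y} = {0}" by blast
      then show "of_nat (card {i\<in>I. wt i = j}) * X powi j = 0" by (simp only: dim0) simp
    qed
  qed (use fin in simp)
  also have "\<dots> = (\<Sum>j\<in>wt ` I. \<Sum>i\<in>{i\<in>I. wt i = j}. X powi wt i)"
    by (intro sum.cong) auto
  also have "\<dots> = (\<Sum>i\<in>I. X powi wt i)"
    by (rule sum.image_gen[symmetric]) (rule fin)
  finally show ?thesis .
qed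

end

text \<open>The layer \<open>i\<^sub>0\<close> carries the highest weight \<open>k\<close> of the module, all other layers have highest
  weight at most \<open>k'\<close>.\<close>

locale uq_top = uq_wfilt q l scale V op F ns u
  for q :: "'k::field" and l :: nat and scale :: "'k \<Rightarrow> 'm::ab_group_add \<Rightarrow> 'm" (infixr "*s" 75)
    and V :: "'m set" and op :: "uv \<Rightarrow> 'm \<Rightarrow> 'm" and F ns u +
  fixes k i\<^sub>0 :: nat and k' :: int
  assumes i0: "i\<^sub>0 < length ns" "ns ! i\<^sub>0 = k"
    and other: "i < length ns \<Longrightarrow> i \<noteq> i\<^sub>0 \<Longrightarrow> int (ns ! i) \<le> k'" and k'_less: "k' < int k"
begin

interpretation H: linear_on scale V "hb 0 l"
  by (rule op_linear) (rule UA_simps)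

definition x :: 'm where "x = u i\<^sub>0"

lemma x_gw: "gw (int k) x"
  using u_gw[OF i0(1)] by (simp add: x_def i0(2))

lemma x_V: "x \<in> V"
  using x_gw by (rule gw_V)

lemma gw_bound': "gw j y \<Longrightarrow> int k < \<bar>j\<bar> \<Longrightarrow> y = 0"
proof (rule ccontr)
  assume y: "gw j y" "int k < \<bar>j\<bar>" "y \<noteq> 0"
  then obtain i t where i: "i < length ns" "t \<le> ns ! i" "j = int (ns ! i) - 2 * int t"
    using gw_bound by blast
  moreover have "int (ns ! i) \<le> int k" using other[OF i(1)] k'_less i0 by (cases "i = i\<^sub>0") auto
  ultimately show False using y(2) by auto
qed

lemma f_x_nonzero: "t \<le> k \<Longrightarrow> f t x \<noteq> 0"
  using f_u_notin[OF i0(1), of t] subspace_0[OF F_subspace[of i\<^sub>0]] i0 by (auto simp: x_def)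

lemma x_nonzero: "x \<noteq> 0"
  using f_x_nonzero[of 0] x_V by (simp add: op_one)

lemma gw_f_x: "gw (int k - 2 * int t) (f t x)"
  using gw_f[OF x_gw] .

lemma f_x_zero: "k < t \<Longrightarrow> f t x = 0"
  using gw_bound'[OF gw_f_x] by auto

text \<open>A weight beyond k' in absolute value occurs in no layer but \<open>i\<^sub>0\<close>.
  Below that layer the vector is zero; in it, subtracting a multiple of F^(t) x leads back to the
  case below.\<close>

lemma gw_span_aux:
  assumes "i \<le> length ns" "y \<in> F i" "gw j y" "k' < \<bar>j\<bar>"
  shows "(i \<le> i\<^sub>0 \<longrightarrow> y = 0) \<and> (\<exists>t\<le>k. \<exists>c. y = c *s f t x \<and> (y \<noteq> 0 \<longrightarrow> j = int k - 2 * int t))"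
  using assms
proof (induction i arbitrary: y)
  case 0
  then show ?case by (auto simp: F_0 intro!: exI[of _ 0])
next
  case (Suc i)
  have i: "i < length ns" using Suc.prems by simp
  show ?case
  proof (cases "y \<in> F i")
    case True
    then show ?thesis using Suc.IH[of y] Suc.prems by auto
  next
    case False
    obtain t c where t: "t \<le> ns ! i" "j = int (ns ! i) - 2 * int t" "y - c *s f t (u i) \<in> F i"
      using gw_layer[OF i Suc.prems(2,3) False] by blast
    have ii: "i = i\<^sub>0"
    proof (rule ccontr)
      assume "i \<noteq> i\<^sub>0"
      then show False using other[OF i] t Suc.prems(4) by auto
    qed
    then have *: "t \<le> k" "j = int k - 2 * int t" "y - c *s f t x \<in> F i\<^sub>0"
      using t i0 by (auto simp: x_def)
    have "gw j (y - c *s f t x)"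
      using Suc.prems(3) gw_f_x[of t] *(2) by (intro gw_closed) auto
    then have "y - c *s f t x = 0"
      using Suc.IH[of "y - c *s f t x"] *(3) Suc.prems i ii by auto
    then show ?thesis using * ii by auto
  qed
qed

lemma gw_span:
  assumes "gw j y" "k' < \<bar>j\<bar>"
  obtains t c where "t \<le> k" "y = c *s f t x" "y \<noteq> 0 \<Longrightarrow> j = int k - 2 * int t"
proof -
  have "y \<in> F (length ns)" using assms gw_V F_V by simp
  from gw_span_aux[OF _ this assms] show ?thesis using that by blast
qed

lemma gw_top: "gw (int k) y \<Longrightarrow> \<exists>c. y = c *s x"
proof -
  assume y: "gw (int k) y"
  have "k' < \<bar>int k\<bar>" using k'_less by simp
  from gw_span[OF y this] obtain t c where t: "y = c *s f t x" "y \<noteq> 0 \<Longrightarrow> int k = int k - 2 * int t"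
    by blast
  show ?thesis
  proof (cases "y = 0")
    case True
    then show ?thesis by (intro exI[of _ 0]) simp
  next
    case False
    then show ?thesis using t x_V by (auto simp: op_one)
  qed
qed

text \<open>The generalised weight space k is a line, and a nilpotent operator on a line is
  zero.\<close>

lemma x_tw: "tw (int k) x"
proof -
  obtain c where c: "nu (int k) x = c *s x" using gw_top[OF gw_nu[OF x_gw]] by blast
  have "c = 0"
    using nilpotent_eigen[OF x_V _ c] x_nonzero x_gw by (auto simp: gw_def)
  then show ?thesis using c x_gw by (simp add: tw_nu gw_def)
qed

lemma e_x: "1 \<le> p \<Longrightarrow> e p x = 0"
  using gw_bound'[OF gw_e[OF x_gw]] by auto

lemma e_f_x: "e r (f s x) = (if r \<le> s then B (int k + int r - int s) r *s f (s - r) x else 0)"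
  using primitive_tw_ef[OF x_tw e_x] by simp

lemma tw_f_x: "tw (int k - 2 * int t) (f t x)"
  using tw_f[OF x_tw] .

lemma casimir_x: "op casimir x = cv (int k) *s x"
  unfolding cv_def using op_casimir_primitive[OF x_V _ e_x[of 1]] x_gw by (simp add: gw_def)

end

section \<open>Graded complements and the case of one string\<close>

locale uq_indec = uq_top +
  assumes indec: "submod M \<Longrightarrow> submod M' \<Longrightarrow> M \<inter> M' = {0} \<Longrightarrow>
      (\<And>y. y \<in> V \<Longrightarrow> \<exists>a\<in>M. \<exists>b\<in>M'. y = a + b) \<Longrightarrow> M = {0} \<or> M' = {0}"
begin

text \<open>Reduces splitting to single weights: S and M span submodules that are complementary
  because they are so in each weight. Indecomposability makes one of them zero, and x excludes
  S.\<close>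

lemma graded_complement:
  assumes S: "\<And>j. subspace (S j)" "\<And>j y. y \<in> S j \<Longrightarrow> gw j y"
      "\<And>j y r. y \<in> S j \<Longrightarrow> e r y \<in> S (j + 2 * int r)"
      "\<And>j y r. y \<in> S j \<Longrightarrow> f r y \<in> S (j - 2 * int r)"
    and M: "\<And>j. subspace (M j)" "\<And>j y. y \<in> M j \<Longrightarrow> gw j y"
      "\<And>j y r. y \<in> M j \<Longrightarrow> e r y \<in> M (j + 2 * int r)"
      "\<And>j y r. y \<in> M j \<Longrightarrow> f r y \<in> M (j - 2 * int r)"
    and disj: "\<And>j y. y \<in> S j \<Longrightarrow> y \<in> M j \<Longrightarrow> y = 0"
    and cover: "\<And>j y. gw j y \<Longrightarrow> \<exists>a\<in>S j. \<exists>b\<in>M j. y = a + b"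
    and x: "x \<in> S (int k)" and y: "gw j y"
  shows "y \<in> S j"
proof -
  let ?S = "span (\<Union>j\<in>UNIV. S j)" and ?M = "span (\<Union>j\<in>UNIV. M j)"
  have "submod ?S" using S(2-4) by (rule graded_submod)
  moreover have "submod ?M" using M(2-4) by (rule graded_submod)
  moreover have "?S \<inter> ?M = {0}"
  proof -
    have "y = 0" if yy: "y \<in> ?S" "y \<in> ?M" for y
    proof -
      obtain I a where a: "finite I" "\<And>j. j \<in> I \<Longrightarrow> a j \<in> S j" "y = (\<Sum>j\<in>I. a j)"
        using span_Union_subspaces[OF S(1) yy(1)] by metis
      obtain J b where b: "finite J" "\<And>j. j \<in> J \<Longrightarrow> b j \<in> M j" "y = (\<Sum>j\<in>J. b j)"
        using span_Union_subspaces[OF M(1) yy(2)] by metis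
      define a' where "a' j = (if j \<in> I then a j else 0)" for j
      define b' where "b' j = (if j \<in> J then b j else 0)" for j
      have a': "a' j \<in> S j" and b': "b' j \<in> M j" for j
        using a(2) b(2) S(1) M(1) subspace_0 by (auto simp: a'_def b'_def)
      have sums: "y = (\<Sum>j\<in>I \<union> J. a' j)" "y = (\<Sum>j\<in>I \<union> J. b' j)"
      proof -
        show "y = (\<Sum>j\<in>I \<union> J. a' j)"
          unfolding a(3) using a(1) b(1) by (intro sum.mono_neutral_cong_left) (auto simp: a'_def)
        show "y = (\<Sum>j\<in>I \<union> J. b' j)"
          unfolding b(3) using a(1) b(1) by (intro sum.mono_neutral_cong_left) (auto simp: b'_def)
      qed
      have "a' j - b' j = 0" if "j \<in> I \<union> J" for j
      proof (rule gw_independent[of "I \<union> J" "\<lambda>j. a' j - b' j"])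
        show "(\<Sum>j\<in>I \<union> J. a' j - b' j) = 0" unfolding sum_subtractf using sums by simp
      qed (use a b a' b' S(2) M(2) that in \<open>auto intro: gw_closed\<close>)
      then have "a' j = 0" if "j \<in> I \<union> J" for j
        using that disj[OF a', of j] b'[of j] by simp
      then show ?thesis unfolding sums(1) by (intro sum.neutral) auto
    qed
    then show ?thesis by (auto simp: span_zero)
  qed
  moreover have "\<exists>a\<in>?S. \<exists>b\<in>?M. y = a + b" if yV: "y \<in> V" for y
  proof -
    obtain J g where J: "finite J" "\<And>j. j \<in> J \<Longrightarrow> gw j (g j) \<and> g j \<in> V" "y = (\<Sum>j\<in>J. g j)"
      using weight_decomposition[OF submod_V yV] by metis
    have "\<exists>a b. a \<in> S j \<and> b \<in> M j \<and> g j = a + b" if "j \<in> J" for j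
      using cover[of j "g j"] J(2)[OF that] by blast
    then obtain a b where ab: "\<And>j. j \<in> J \<Longrightarrow> a j \<in> S j" "\<And>j. j \<in> J \<Longrightarrow> b j \<in> M j"
      "\<And>j. j \<in> J \<Longrightarrow> g j = a j + b j" by metis
    have "y = (\<Sum>j\<in>J. a j) + (\<Sum>j\<in>J. b j)"
      unfolding J(3) sum.distrib[symmetric] using ab(3) by (intro sum.cong) auto
    moreover have "(\<Sum>j\<in>J. a j) \<in> ?S" "(\<Sum>j\<in>J. b j) \<in> ?M"
      using ab by (auto intro!: span_sum intro: span_base)
    ultimately show ?thesis by blast
  qed
  ultimately have "?S = {0} \<or> ?M = {0}" by (rule indec)
  moreover have "x \<in> ?S" using x by (auto intro: span_base)
  ultimately have M0: "?M = {0}" using x_nonzero by auto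
  obtain a b where ab: "a \<in> S j" "b \<in> M j" "y = a + b" using cover[OF y] by blast
  then have "b \<in> ?M" by (auto intro: span_base)
  then show ?thesis using M0 ab by simp
qed

lemma linkage: "i < length ns \<Longrightarrow> cv (int (ns ! i)) = cv (int k)"
  using casimir_block[OF _ x_V x_nonzero casimir_x] indec by blast

lemma weyl_case:
  assumes B: "\<And>t. t \<le> k \<Longrightarrow> B (int k) t \<noteq> 0"
  shows "weight_basis {..k} (\<lambda>t. f t x) (\<lambda>t. int k - 2 * int t)"
proof -
  define S where "S j = span {f t x |t. int k - 2 * int t = j}" for j
  \<comment> \<open>At most one t satisfies k - 2t = j, so each weight carries at most one linear
    condition: E^(t) maps weight j into the line of x.\<close>
  define M where "M j = {y. gw j y \<and> (\<forall>t. int k - 2 * int t = j \<longrightarrow> e t y = 0)}" for j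
  have genV: "{f t x |t. int k - 2 * int t = j} \<subseteq> V" for j
    using gw_f_x gw_V by blast
  have S_single: "S (int k - 2 * int t) = span {f t x}" for t
  proof -
    have "{f s x |s. int k - 2 * int s = int k - 2 * int t} = {f t x}" by auto
    then show ?thesis by (simp add: S_def)
  qed
  have S_gw: "gw j y" if "y \<in> S j" for j y
  proof -
    have "S j \<subseteq> {y. gw j y}"
      unfolding S_def using gw_f_x by (intro span_minimal subspace_gw) auto
    then show ?thesis using that by auto
  qed
  have S_f_x: "f t x \<in> S (int k - 2 * int t)" for t
    by (auto simp: S_single intro: span_base)
  have S_e: "e r y \<in> S (j + 2 * int r)" if "y \<in> S j" for j y r
    unfolding S_def
  proof (rule op_span[OF UA.E_div genV _ that[unfolded S_def]])
    fix g assume "g \<in> {f t x |t. int k - 2 * int t = j}"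
    then obtain t where t: "g = f t x" "j = int k - 2 * int t" by blast
    have "e r g \<in> S (j + 2 * int r)"
    proof (cases "r \<le> t")
      case True
      then have "j + 2 * int r = int k - 2 * int (t - r)" using t by (simp add: of_nat_diff)
      then show ?thesis using S_f_x[of "t - r"] True
        by (simp add: t(1) e_f_x S_def span_scale del: of_nat_diff)
    qed (simp add: t(1) e_f_x S_def span_zero)
    then show "e r g \<in> span {f t x |t. int k - 2 * int t = j + 2 * int r}" by (simp add: S_def)
  qed
  have S_f: "f r y \<in> S (j - 2 * int r)" if "y \<in> S j" for j y r
    unfolding S_def
  proof (rule op_span[OF UA.F_div genV _ that[unfolded S_def]])
    fix g assume "g \<in> {f t x |t. int k - 2 * int t = j}"
    then obtain t where t: "g = f t x" "j = int k - 2 * int t" by blast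
    then have j: "j - 2 * int r = int k - 2 * int (r + t)" by simp
    have "f (r + t) x \<in> span {f t x |t. int k - 2 * int t = j - 2 * int r}"
      using S_f_x[of "r + t"] by (simp only: j S_def)
    then show "f r g \<in> span {f t x |t. int k - 2 * int t = j - 2 * int r}"
      unfolding t(1) ff[OF x_V] by (rule span_scale)
  qed
  have M_sub: "subspace (M j)" for j
    by (rule subspaceI)
      (auto simp: M_def gw_closed op_zero[OF UA.E_div] op_add[OF UA.E_div gw_V gw_V] op_scale[OF UA.E_div gw_V])
  have M_e: "e r y \<in> M (j + 2 * int r)" if "y \<in> M j" for j y r
    using that gw_e[of j y r] by (auto simp: M_def ee gw_V)
  have M_f: "f r y \<in> M (j - 2 * int r)" if y: "y \<in> M j" for j y r
  proof -
    have yV: "y \<in> V" and gw: "gw j y" using y gw_V by (auto simp: M_def)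
    have "e t (f r y) = 0" if t: "int k - 2 * int t = j - 2 * int r" for t
      unfolding ef[OF yV]
    proof (rule sum.neutral, intro ballI)
      fix i assume i: "i \<in> {..min t r}"
      \<comment> \<open>E^(t-i) y has weight k + 2(r - i). This exceeds k for i < r, and for i = r
        the vanishing is the condition defining \<open>M j\<close>.\<close>
      have "e (t - i) y = 0"
      proof (cases "i = r")
        case True
        then show ?thesis using y t i by (auto simp: M_def of_nat_diff)
      next
        case False
        then show ?thesis using gw_bound'[OF gw_e[OF gw, of "t - i"]] i t by (auto simp: of_nat_diff)
      qed
      then show "f (r - i) (hb (2 * int i - int t - int r) i (e (t - i) y)) = 0"
        by (simp add: op_zero UA_simps)
    qed
    then show ?thesis using gw_f[OF gw] by (auto simp: M_def)
  qed
  have disj: "y = 0" if yy: "y \<in> S j" "y \<in> M j" for j y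
  proof (cases "\<exists>t. j = int k - 2 * int t")
    case True
    then obtain t where t: "j = int k - 2 * int t" by blast
    then obtain c where c: "y = c *s f t x" using yy(1) S_single[of t] by (auto simp: span_singleton)
    show ?thesis
    proof (cases "t \<le> k")
      case True
      have "e t y = 0" using yy(2) t by (auto simp: M_def)
      then have "(c * B (int k) t) *s x = 0"
        using x_V gw_f_x[of t] by (simp add: c op_scale UA_simps gw_V e_f_x op_one)
      then show ?thesis using B[OF True] x_nonzero c by simp
    qed (use c f_x_zero in simp)
  next
    case False
    then have "{f t x |t. int k - 2 * int t = j} = {}" by auto
    then have "y \<in> span {}" using yy(1) unfolding S_def by simp
    then show ?thesis by simp
  qed
  have cover: "\<exists>a\<in>S j. \<exists>b\<in>M j. y = a + b" if y: "gw j y" for j y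
  proof (cases "\<exists>t. t \<le> k \<and> j = int k - 2 * int t")
    case True
    then obtain t where t: "t \<le> k" "j = int k - 2 * int t" by blast
    have yV: "y \<in> V" using y by (rule gw_V)
    obtain \<alpha> where \<alpha>: "e t y = \<alpha> *s x"
      using gw_top[of "e t y"] gw_e[OF y, of t] t(2) by auto
    define a where "a = (\<alpha> / B (int k) t) *s f t x"
    have aS: "a \<in> S j" using S_f_x[of t] unfolding a_def t(2) S_def by (rule span_scale)
    have "e t a = \<alpha> *s x"
      using B[OF t(1)] x_V gw_f_x[of t] by (simp add: a_def op_scale UA_simps gw_V e_f_x op_one)
    then have "e t (y - a) = 0"
      using \<alpha> yV S_gw[OF aS] by (simp add: op_diff UA_simps gw_V)
    then have "y - a \<in> M j" using y S_gw[OF aS] t(2) by (auto simp: M_def gw_closed)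
    then show ?thesis using aS by (intro bexI[of _ a] bexI[of _ "y - a"]) auto
  next
    case False
    have "y \<in> M j"
    proof -
      have "e t y = 0" if "int k - 2 * int t = j" for t
      proof -
        have "k < t" using False that by (auto simp: not_le)
        then have "y = 0" using gw_bound'[OF y] that by auto
        then show ?thesis by (simp add: op_zero UA_simps)
      qed
      then show ?thesis using y by (auto simp: M_def)
    qed
    moreover have "0 \<in> S j" by (simp add: S_def span_zero)
    ultimately show ?thesis by force
  qed
  have xS: "x \<in> S (int k)" using S_f_x[of 0] x_V by (simp add: op_one)
  have main: "y \<in> S j" if "gw j y" for j y
  proof (rule graded_complement[OF _ S_gw S_e S_f M_sub _ M_e M_f disj cover xS that])
    show "subspace (S i)" for i by (simp add: S_def)
    show "gw i v" if "v \<in> M i" for i v using that by (simp add: M_def)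
  qed
  show ?thesis
    unfolding weight_basis_def
  proof (intro conjI allI impI ballI)
    fix j y assume y: "gw j y"
    show "y \<in> span ((\<lambda>t. f t x) ` {i \<in> {..k}. int k - 2 * int i = j})"
    proof (cases "\<exists>t. j = int k - 2 * int t")
      case True
      then obtain t where t: "j = int k - 2 * int t" by blast
      show ?thesis
      proof (cases "t \<le> k")
        case True
        then have "{i \<in> {..k}. int k - 2 * int i = j} = {t}" using t by auto
        then show ?thesis using main[OF y] S_single[of t] t by simp
      next
        case False
        then have "y = 0" using gw_bound'[OF y] t by auto
        then show ?thesis by (simp add: span_zero)
      qed
    next
      case False
      then have "{f t x |t. int k - 2 * int t = j} = {}" by auto
      then have "y = 0" using main[OF y] by (simp add: S_def)
      then show ?thesis by (simp add: span_zero)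
    qed
  next
    fix j c i assume c: "(\<Sum>i\<in>{i \<in> {..k}. int k - 2 * int i = j}. c i *s f i x) = 0"
      and i: "i \<in> {..k}" "int k - 2 * int i = j"
    have "{i \<in> {..k}. int k - 2 * int i = j} = {i}" using i by auto
    then show "c i = 0" using c f_x_nonzero[of i] i by simp
  qed (auto intro: tw_f_x)
qed

end

text \<open>The case of two Weyl factors \<open>W(k)\<close> and \<open>W(k')\<close>, where \<open>k'\<close> is the reflection of
  \<open>k = k\<^sub>1 l + k\<^sub>0\<close> in the wall \<open>k\<^sub>1 l - 1\<close>.\<close>

locale uq_proj = uq_indec q l scale V op F ns u k i\<^sub>0 k'
  for q :: "'k::field" and l :: nat and scale :: "'k \<Rightarrow> 'm::ab_group_add \<Rightarrow> 'm" (infixr "*s" 75)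
    and V :: "'m set" and op :: "uv \<Rightarrow> 'm \<Rightarrow> 'm" and F ns u k i\<^sub>0 k' +
  fixes k\<^sub>0 k\<^sub>1 :: nat and w :: 'm
  assumes k_eq: "k = k\<^sub>1 * l + k\<^sub>0" and k0_le: "k\<^sub>0 + 2 \<le> l" and k1_pos: "1 \<le> k\<^sub>1"
    and k'_eq: "k' = int k\<^sub>1 * int l - 2 - int k\<^sub>0"
    and w_gw: "gw k' w" and e_w: "e (Suc k\<^sub>0) w = x"
begin

definition z :: 'm where "z = f (Suc k\<^sub>0) x"

lemma L_le: "int l \<le> int k\<^sub>1 * int l"
  using k1_pos mult_right_mono[of 1 "int k\<^sub>1" "int l"] by simp

lemma k'_nonneg: "0 \<le> k'"
proof -
  have "int k\<^sub>0 + 2 \<le> int l" using k0_le by linarith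
  then show ?thesis using L_le k'_eq by linarith
qed

lemma int_k: "int k = int k\<^sub>1 * int l + int k\<^sub>0"
  by (simp add: k_eq)

lemma k_k': "int k = k' + 2 * int k\<^sub>0 + 2"
  by (simp add: int_k k'_eq)

lemma k'_div: "k' div int l = int k\<^sub>1 - 1" and k'_mod: "k' mod int l = int l - 2 - int k\<^sub>0"
proof -
  have eq: "k' = int l * (int k\<^sub>1 - 1) + (int l - 2 - int k\<^sub>0)"
    by (simp add: k'_eq algebra_simps)
  have b: "0 \<le> int l - 2 - int k\<^sub>0" "int l - 2 - int k\<^sub>0 < int l" using k0_le by auto
  show "k' div int l = int k\<^sub>1 - 1" by (rule int_div_pos_eq[OF eq b])
  show "k' mod int l = int l - 2 - int k\<^sub>0" by (rule int_mod_pos_eq[OF eq b])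
qed

lemma B_k: "p mod l \<le> k\<^sub>0 \<Longrightarrow> p \<le> k \<Longrightarrow> B (int k) p \<noteq> 0"
  using k0_le by (intro B_nonzero) (simp_all add: k_eq)

lemma B_top_nonzero: "s < k\<^sub>1 * l \<Longrightarrow> B (int k\<^sub>1 * int l - 1) s \<noteq> 0"
proof -
  assume s: "s < k\<^sub>1 * l"
  obtain p where p: "k\<^sub>1 = Suc p" using k1_pos by (cases k\<^sub>1) auto
  have "(k\<^sub>1 * l - 1) mod l = l - 1"
  proof -
    have "k\<^sub>1 * l - 1 = (l - 1) + p * l" using p l_ge by simp
    then have "(k\<^sub>1 * l - 1) mod l = ((l - 1) + p * l) mod l" by (simp only:)
    also have "\<dots> = l - 1" unfolding mod_mult_self1 using l_ge by simp
    finally show ?thesis .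
  qed
  moreover have "s mod l \<le> l - 1" using mod_less_divisor[of l s] l_ge by linarith
  ultimately have "B (int (k\<^sub>1 * l - 1)) s \<noteq> 0" using s by (intro B_nonzero) auto
  moreover have "int (k\<^sub>1 * l - 1) = int k\<^sub>1 * int l - 1"
  proof -
    have "1 \<le> k\<^sub>1 * l" using s by linarith
    then show ?thesis by (simp only: of_nat_diff of_nat_mult of_nat_1)
  qed
  ultimately show ?thesis by simp
qed

lemma w_V: "w \<in> V"
  using w_gw by (rule gw_V)

lemma f_x_V: "f t x \<in> V"
  using gw_f_x by (rule gw_V)

lemma e_f_x_top: "t \<le> k \<Longrightarrow> e t (f t x) = B (int k) t *s x"
  using x_V by (simp add: e_f_x op_one)

lemma gw_mid: "gw j y \<Longrightarrow> k' < j \<Longrightarrow> j + 2 * int p = int k \<Longrightarrow> \<exists>c. y = c *s f p x"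
proof -
  assume y: "gw j y" and j: "k' < j" "j + 2 * int p = int k"
  have "k' < \<bar>j\<bar>" using j(1) by simp
  from gw_span[OF y this] obtain t c where t: "y = c *s f t x" "y \<noteq> 0 \<Longrightarrow> j = int k - 2 * int t"
    by blast
  show ?thesis
  proof (cases "y = 0")
    case True
    then show ?thesis by (intro exI[of _ 0]) simp
  next
    case False
    then have "t = p" using t(2) j(2) by auto
    then show ?thesis using t(1) by blast
  qed
qed

text \<open>Here p <= \<open>k\<^sub>0\<close>, so the last base-l digit of p does not exceed that
  of k, and E^(p) F^(p) x is a nonzero multiple of x.\<close>

lemma gw_mid_zero:
  assumes "gw j y" "k' < j" "j + 2 * int p = int k" "e p y = 0"
  shows "y = 0"
proof -
  obtain c where c: "y = c *s f p x" using gw_mid assms by blast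
  have p: "p \<le> k\<^sub>0" using assms(2,3) k_k' by linarith
  then have "B (int k) p \<noteq> 0" using B_k[of p] k0_le k_eq by simp
  moreover have "(c * B (int k) p) *s x = 0"
    using assms(4) p k_eq by (simp add: c op_scale UA_simps f_x_V e_f_x_top)
  ultimately show ?thesis using c x_nonzero by simp
qed

lemma e_mid:
  assumes "gw k' y" "1 \<le> p"
  shows "\<exists>c. e p y = (if p \<le> Suc k\<^sub>0 then c *s f (Suc k\<^sub>0 - p) x else 0)"
proof (cases "p \<le> Suc k\<^sub>0")
  case True
  have "\<exists>c. e p y = c *s f (Suc k\<^sub>0 - p) x"
    by (rule gw_mid[OF gw_e[OF assms(1)]]) (use assms(2) True k_k' in \<open>auto simp: of_nat_diff\<close>)
  then show ?thesis using True by simp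
next
  case False
  then have "int k < \<bar>k' + 2 * int p\<bar>" using k_k' k'_nonneg by auto
  then show ?thesis using False gw_bound'[OF gw_e[OF assms(1), of p]] by simp
qed

text \<open>Since \<open>F\<^sup>(\<^sup>n\<^sup>)\<close> kills weight \<open>k'\<close> for \<open>n = k\<^sub>1 l\<close>, expanding \<open>E\<^sup>(\<^sup>n\<^sup>) F\<^sup>(\<^sup>n\<^sup>) y = 0\<close> leaves
  \<open>[K; 0; n] y = 0\<close>: the coefficients of the other terms vanish at \<open>q\<close>.\<close>

lemma gw_tw: "gw k' y \<Longrightarrow> tw k' y"
proof -
  assume y: "gw k' y"
  then have yV: "y \<in> V" by (rule gw_V)
  define n where "n = k\<^sub>1 * l"
  have "gw (k' - 2 * int n) (f n y)" using y by (rule gw_f)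
  \<comment> \<open>With n = \<open>k\<^sub>1 * l\<close>, the weight k' - 2n is -(k + 2), just
    outside the weights that occur.\<close>
  moreover have "int k < \<bar>k' - 2 * int n\<bar>" using L_le by (simp add: k'_eq int_k n_def)
  ultimately have "f n y = 0" by (rule gw_bound')
  then have "(\<Sum>t\<le>n. f (n - t) (hb (2 * int t - int n - int n) t (e (n - t) y))) = 0"
    using ef[OF yV, of n n] by (simp add: op_zero UA_simps)
  moreover have "f (n - t) (hb (2 * int t - int n - int n) t (e (n - t) y)) = 0" if t: "t < n" for t
  proof -
    define p where "p = n - t"
    have p: "1 \<le> p" "int t = int n - int p" using t by (auto simp: p_def of_nat_diff)
    have "hb (2 * int t - int n - int n) t (e p y) = 0"
    proof (cases "p \<le> Suc k\<^sub>0")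
      case True
      then obtain c where c: "e p y = c *s f (Suc k\<^sub>0 - p) x" using e_mid[OF y p(1)] by auto
      have "tw (k' + 2 * int p) (f (Suc k\<^sub>0 - p) x)"
        using tw_f_x[of "Suc k\<^sub>0 - p"] True k_k' by (simp add: of_nat_diff)
      then have "hb (2 * int t - int n - int n) t (f (Suc k\<^sub>0 - p) x) = B k' t *s f (Suc k\<^sub>0 - p) x"
        using p(2) by (simp add: tw_hb)
      \<comment> \<open>As t = \<open>k\<^sub>1 * l\<close> - p with 1 <= p <=
        \<open>k\<^sub>0\<close> + 1, the last digit of t is l - p, which exceeds the last digit l -
        2 - \<open>k\<^sub>0\<close> of k'.\<close>
      moreover have "B k' t = 0"
      proof (rule B_eq_0_mod)
        have eq: "int t = int l * (int k\<^sub>1 - 1) + (int l - int p)"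
          using p(2) by (simp add: n_def algebra_simps)
        have "int t mod int l = int l - int p"
          by (rule int_mod_pos_eq[OF eq]) (use p True k0_le in auto)
        then show "k' mod int l < int (t mod l)"
          using True by (simp add: k'_mod of_nat_mod)
      qed
      ultimately show ?thesis by (simp add: c op_scale UA_simps f_x_V)
    next
      case False
      then show ?thesis using e_mid[OF y p(1)] by (simp add: op_zero UA_simps)
    qed
    then show ?thesis by (simp add: p_def op_zero UA_simps)
  qed
  ultimately have "hb 0 n y = 0"
    using yV by (simp add: lessThan_Suc_atMost[symmetric] op_one op_V UA_simps)
  then show "tw k' y"
    using k'_div k1_pos by (intro hb_kernel_tw[OF y, of k\<^sub>1]) (simp_all add: n_def)
qed

lemma w_tw: "tw k' w"
  using gw_tw[OF w_gw] .

lemma z_nonzero: "z \<noteq> 0"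
proof -
  have "Suc k\<^sub>0 \<le> k" using k_k' k'_nonneg by linarith
  then show ?thesis unfolding z_def by (rule f_x_nonzero)
qed

text \<open>For p <= \<open>k\<^sub>0\<close> + 1 the coefficient of E^(p) z is a binomial with
  upper index \<open>k\<^sub>1 * l\<close> + p - 1 and lower index p; the last digit p - 1 of the
  upper index is too small. So z is a singular vector inside the string of x.\<close>

lemma e_z: "1 \<le> p \<Longrightarrow> e p z = 0"
proof (cases "p \<le> Suc k\<^sub>0")
  case True
  assume p: "1 \<le> p"
  have eq: "int k + int p - int (Suc k\<^sub>0) = int l * int k\<^sub>1 + (int p - 1)"
    using int_k by simp
  have "(int k + int p - int (Suc k\<^sub>0)) mod int l = int p - 1"
    by (rule int_mod_pos_eq[OF eq]) (use p True k0_le in auto)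
  then have "B (int k + int p - int (Suc k\<^sub>0)) p = 0"
    using True k0_le by (intro B_eq_0) auto
  then show ?thesis by (simp add: z_def e_f_x del: of_nat_Suc)
qed (simp add: z_def e_f_x)

text \<open>This is the functional \<mu> of the overview, taken on the ambient space by extension
  from the independent set {z}. Only its values at weight k' matter.\<close>

lemma functional_exists:
  "\<exists>\<phi> :: 'm \<Rightarrow> 'k. (\<forall>y y'. \<phi> (y + y') = \<phi> y + \<phi> y') \<and> (\<forall>c y. \<phi> (c *s y) = c * \<phi> y) \<and> \<phi> z = 1"
proof -
  interpret vs: vector_space "(*) :: 'k \<Rightarrow> 'k \<Rightarrow> 'k"
    by unfold_locales (simp_all add: algebra_simps)
  interpret vp: vector_space_pair scale "(*) :: 'k \<Rightarrow> 'k \<Rightarrow> 'k" ..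
  have "independent {z}" using z_nonzero by simp
  from vp.linear_independent_extend[OF this, of "\<lambda>_. 1"]
  obtain \<phi> where lin: "Vector_Spaces.linear scale (*) \<phi>" and z: "\<phi> z = 1" by auto
  interpret lin: Vector_Spaces.linear scale "(*)" \<phi> by (rule lin)
  show ?thesis
    using lin.add lin.scale z by blast
qed

definition \<phi> :: "'m \<Rightarrow> 'k" where
  "\<phi> = (SOME \<phi>. (\<forall>y y'. \<phi> (y + y') = \<phi> y + \<phi> y') \<and> (\<forall>c y. \<phi> (c *s y) = c * \<phi> y) \<and> \<phi> z = 1)"

lemma phi: "\<phi> (y + y') = \<phi> y + \<phi> y'" "\<phi> (c *s y) = c * \<phi> y" "\<phi> z = 1"
  using someI_ex[OF functional_exists] unfolding \<phi>_def by blast+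

lemma phi_0: "\<phi> 0 = 0"
  using phi(2)[of 0 0] by simp

lemma phi_diff: "\<phi> (y - y') = \<phi> y - \<phi> y'"
  using phi(1)[of "y - y'" y'] by simp

section \<open>The span of two strings and the radical of its pairing\<close>

definition S :: "int \<Rightarrow> 'm set" where
  "S j = span ({f t x |t. int k - 2 * int t = j} \<union> {f s w |s. k' - 2 * int s = j})"

definition N' :: "int \<Rightarrow> 'm set" where
  "N' j = {y. gw j y \<and> (\<forall>t. int k - 2 * int t = j \<longrightarrow> e t y = 0) \<and>
     (\<forall>s. k' - 2 * int s = j \<longrightarrow> \<phi> (e s y) = 0)}"

lemma S_f_x: "int k - 2 * int t = j \<Longrightarrow> f t x \<in> S j" and S_f_w: "k' - 2 * int s = j \<Longrightarrow> f s w \<in> S j"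
  unfolding S_def by (blast intro: span_base)+

lemma S_subspace: "subspace (S j)"
  by (simp add: S_def)

lemmas S_closed = subspace_0[OF S_subspace] subspace_add[OF S_subspace] subspace_scale[OF S_subspace]

lemma gw_f_w: "gw (k' - 2 * int s) (f s w)"
  using gw_f[OF w_gw] .

lemma f_w_V: "f s w \<in> V"
  using gw_f_w by (rule gw_V)

lemma S_gw: "y \<in> S j \<Longrightarrow> gw j y"
proof -
  have "S j \<subseteq> {y. gw j y}"
    unfolding S_def using gw_f_x gw_f_w by (intro span_minimal subspace_gw) auto
  then show "y \<in> S j \<Longrightarrow> gw j y" by auto
qed

text \<open>Only the shape is needed: one vector from each string, with C left uncomputed. The
  vanishing of C is recorded for the case that E^(r) would lead above x, where the truncated index
  \<open>s + Suc k\<^sub>0 - r\<close> has no meaning.\<close>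

lemma e_f_w:
  "\<exists>C. e r (f s w) = C *s f (s + Suc k\<^sub>0 - r) x + (if r \<le> s then B (k' + int r - int s) r *s f (s - r) w else 0)
     \<and> (s + Suc k\<^sub>0 < r \<longrightarrow> C = 0)"
proof -
  have *: "\<exists>c. f (s - t) (hb (2 * int t - int r - int s) t (e (r - t) w)) = c *s f (s + Suc k\<^sub>0 - r) x
     \<and> (s + Suc k\<^sub>0 < r \<longrightarrow> c = 0)"
    if t: "t \<le> s" "t < r" for t
  proof (cases "r - t \<le> Suc k\<^sub>0")
    case True
    have "1 \<le> r - t" using t by simp
    from e_mid[OF w_gw this] True obtain c where c: "e (r - t) w = c *s f (Suc k\<^sub>0 - (r - t)) x"
      by metis
    have "s - t + (Suc k\<^sub>0 - (r - t)) = s + Suc k\<^sub>0 - r" using t True by simp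
    then show ?thesis
      using True t by (simp add: c op_scale UA_simps f_x_V tw_hb[OF tw_f_x] ff x_V scale_scale)
  next
    case False
    have "1 \<le> r - t" using t by simp
    from e_mid[OF w_gw this] False have "e (r - t) w = 0" by metis
    then show ?thesis by (intro exI[of _ 0]) (simp add: op_zero UA_simps)
  qed
  define g where "g t = f (s - t) (hb (2 * int t - int r - int s) t (e (r - t) w))" for t
  have sum: "\<exists>c. (\<Sum>t\<in>T. g t) = c *s f (s + Suc k\<^sub>0 - r) x \<and> (s + Suc k\<^sub>0 < r \<longrightarrow> c = 0)"
    if T: "T \<subseteq> {t. t \<le> s \<and> t < r}" "finite T" for T
    using T(2,1)
  proof (induction T)
    case empty
    show ?case by (intro exI[of _ 0]) simp
  next
    case (insert t T)
    then obtain c where c: "(\<Sum>t\<in>T. g t) = c *s f (s + Suc k\<^sub>0 - r) x" "s + Suc k\<^sub>0 < r \<longrightarrow> c = 0" by auto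
    obtain c' where c': "g t = c' *s f (s + Suc k\<^sub>0 - r) x" "s + Suc k\<^sub>0 < r \<longrightarrow> c' = 0"
      using *[of t] insert.prems unfolding g_def by auto
    show ?case
      using insert.hyps c c' by (intro exI[of _ "c' + c"]) (simp add: scale_left_distrib)
  qed
  show ?thesis
  proof (cases "r \<le> s")
    case True
    have "e r (f s w) = (\<Sum>t<r. g t) + g r"
      unfolding ef[OF w_V] g_def using True by (simp add: min_absorb1 lessThan_Suc_atMost[symmetric])
    moreover have "g r = B (k' + int r - int s) r *s f (s - r) w"
      using w_V by (simp add: g_def op_one tw_hb[OF w_tw] op_scale UA_simps algebra_simps)
    moreover have "{..<r} \<subseteq> {t. t \<le> s \<and> t < r}" using True by auto
    from sum[OF this] obtain c where "(\<Sum>t<r. g t) = c *s f (s + Suc k\<^sub>0 - r) x" "s + Suc k\<^sub>0 < r \<longrightarrow> c = 0"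
      by blast
    ultimately show ?thesis using True by (intro exI[of _ c]) simp
  next
    case False
    have "e r (f s w) = (\<Sum>t\<le>s. g t)"
      unfolding ef[OF w_V] g_def using False by (simp add: min_absorb2)
    moreover have "{..s} \<subseteq> {t. t \<le> s \<and> t < r}" using False by auto
    from sum[OF this] obtain c where "(\<Sum>t\<le>s. g t) = c *s f (s + Suc k\<^sub>0 - r) x" "s + Suc k\<^sub>0 < r \<longrightarrow> c = 0"
      by blast
    ultimately show ?thesis using False by (intro exI[of _ c]) simp
  qed
qed

lemma S_genV: "{f t x |t. int k - 2 * int t = j} \<union> {f s w |s. k' - 2 * int s = j} \<subseteq> V"
  using f_x_V f_w_V by blast

lemma S_e: "y \<in> S j \<Longrightarrow> e r y \<in> S (j + 2 * int r)"
proof -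
  assume y: "y \<in> S j"
  have "e r y \<in> span ({f t x |t. int k - 2 * int t = j + 2 * int r} \<union> {f s w |s. k' - 2 * int s = j + 2 * int r})"
  proof (rule op_span[OF UA.E_div S_genV _ y[unfolded S_def]])
    fix g assume "g \<in> {f t x |t. int k - 2 * int t = j} \<union> {f s w |s. k' - 2 * int s = j}"
    then consider t where "g = f t x" "int k - 2 * int t = j" | s where "g = f s w" "k' - 2 * int s = j" by blast
    then have "e r g \<in> S (j + 2 * int r)"
    proof cases
      case (1 t)
      show ?thesis
      proof (cases "r \<le> t")
        case True
        then have "f (t - r) x \<in> S (j + 2 * int r)" using 1 by (intro S_f_x) (simp add: of_nat_diff)
        then show ?thesis using True by (simp add: 1 e_f_x S_closed)
      qed (simp add: 1 e_f_x S_closed)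
    next
      case (2 s)
      obtain C where C: "e r g = C *s f (s + Suc k\<^sub>0 - r) x + (if r \<le> s then B (k' + int r - int s) r *s f (s - r) w else 0)"
        "s + Suc k\<^sub>0 < r \<longrightarrow> C = 0" using e_f_w[of r s] 2 by blast
      have "C *s f (s + Suc k\<^sub>0 - r) x \<in> S (j + 2 * int r)"
      proof (cases "s + Suc k\<^sub>0 < r")
        case True
        then show ?thesis using C(2) by (simp add: S_closed)
      next
        case False
        then show ?thesis using 2 k_k' by (intro S_closed(3) S_f_x) (simp add: of_nat_diff)
      qed
      moreover have "(if r \<le> s then B (k' + int r - int s) r *s f (s - r) w else 0) \<in> S (j + 2 * int r)"
        using 2 S_f_w[of "s - r" "j + 2 * int r"] by (auto simp: of_nat_diff S_closed)
      ultimately show ?thesis unfolding C(1) by (rule S_closed)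
    qed
    then show "e r g \<in> span ({f t x |t. int k - 2 * int t = j + 2 * int r} \<union> {f s w |s. k' - 2 * int s = j + 2 * int r})"
      by (simp add: S_def)
  qed
  then show ?thesis by (simp add: S_def)
qed

lemma S_f: "y \<in> S j \<Longrightarrow> f r y \<in> S (j - 2 * int r)"
proof -
  assume y: "y \<in> S j"
  have "f r y \<in> span ({f t x |t. int k - 2 * int t = j - 2 * int r} \<union> {f s w |s. k' - 2 * int s = j - 2 * int r})"
  proof (rule op_span[OF UA.F_div S_genV _ y[unfolded S_def]])
    fix g assume "g \<in> {f t x |t. int k - 2 * int t = j} \<union> {f s w |s. k' - 2 * int s = j}"
    then have "f r g \<in> S (j - 2 * int r)"
      using x_V w_V by (auto simp: ff intro!: S_closed(3) S_f_x S_f_w)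
    then show "f r g \<in> span ({f t x |t. int k - 2 * int t = j - 2 * int r} \<union> {f s w |s. k' - 2 * int s = j - 2 * int r})"
      by (simp add: S_def)
  qed
  then show ?thesis by (simp add: S_def)
qed

lemma N'_subspace: "subspace (N' j)"
  by (rule subspaceI)
    (auto simp: N'_def gw_closed op_zero[OF UA.E_div] op_add[OF UA.E_div gw_V gw_V] op_scale[OF UA.E_div gw_V] phi phi_0)

lemma N'_e: "y \<in> N' j \<Longrightarrow> e r y \<in> N' (j + 2 * int r)"
  using gw_e[of j y r] by (auto simp: N'_def ee gw_V phi)

text \<open>New against the case of one string: for i < r, E^(s-i) y can have a weight above k' but
  not above k. A further E^(p) moves it to weight k, where the first family of conditions kills it,
  and \<open>gw_mid_zero\<close> says that E^(p) is injective on the way.\<close>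

lemma N'_f:
  assumes y: "y \<in> N' j"
  shows "f r y \<in> N' (j - 2 * int r)"
proof -
  have yV: "y \<in> V" and gw: "gw j y" using y gw_V by (auto simp: N'_def)
  have "e t (f r y) = 0" if t: "int k - 2 * int t = j - 2 * int r" for t
    unfolding ef[OF yV]
  proof (rule sum.neutral, intro ballI)
    fix i assume i: "i \<in> {..min t r}"
    have "e (t - i) y = 0"
    proof (cases "i = r")
      case True
      then show ?thesis using y t i by (auto simp: N'_def of_nat_diff)
    next
      case False
      then show ?thesis using gw_bound'[OF gw_e[OF gw, of "t - i"]] i t by (auto simp: of_nat_diff)
    qed
    then show "f (r - i) (hb (2 * int i - int t - int r) i (e (t - i) y)) = 0"
      by (simp add: op_zero UA_simps)
  qed
  moreover have "\<phi> (e s (f r y)) = 0" if s: "k' - 2 * int s = j - 2 * int r" for s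
  proof -
    have zero: "e (s - i) y = 0" if i: "i \<le> s" "i < r" for i
    proof (cases "k' + 2 * int (r - i) \<le> int k")
      case False
      have "gw (k' + 2 * int (r - i)) (e (s - i) y)"
        using gw_e[OF gw, of "s - i"] s i by (simp add: of_nat_diff algebra_simps)
      then show ?thesis using False k'_nonneg by (intro gw_bound') auto
    next
      case True
      define p where "p = Suc k\<^sub>0 - (r - i)"
      have p: "int p = int (Suc k\<^sub>0) - int r + int i"
        using True i k_k' by (simp add: p_def of_nat_diff)
      have "e p (e (s - i) y) = B (int (p + (s - i))) p *s e (p + (s - i)) y"
        using yV by (rule ee)
      also have "e (p + (s - i)) y = 0"
        using y p s i k_k' by (simp add: N'_def of_nat_diff)
      finally have ep: "e p (e (s - i) y) = 0" by simp
      have si: "int (s - i) = int s - int i" using i by (simp add: of_nat_diff)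
      have "int i < int r" using i by simp
      then show ?thesis
        using si p s k_k' by (intro gw_mid_zero[OF gw_e[OF gw] _ _ ep]) linarith+
    qed
    show ?thesis
    proof (cases "r \<le> s")
      case True
      have "e s (f r y) = (\<Sum>i\<le>r. f (r - i) (hb (2 * int i - int s - int r) i (e (s - i) y)))"
        unfolding ef[OF yV] using True by (simp add: min_absorb2)
      also have "\<dots> = hb (int r - int s) r (e (s - r) y)"
        using zero True yV by (simp add: lessThan_Suc_atMost[symmetric] op_zero UA_simps op_V op_one)
      \<comment> \<open>The bracket acts by a scalar because every generalised weight vector of
        weight k' is a true one. Thus \<open>\<phi>\<close> meets a multiple of a vector that it
        already annihilates.\<close>
      also have "\<dots> = B (k' + (int r - int s)) r *s e (s - r) y"
      proof (rule tw_hb, rule gw_tw)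
        show "gw k' (e (s - r) y)"
        proof -
          have "j + 2 * int (s - r) = k'" using s True by (simp add: of_nat_diff)
          with gw_e[OF gw, of "s - r"] show ?thesis by (simp only:)
        qed
      qed
      finally have "e s (f r y) = B (k' + (int r - int s)) r *s e (s - r) y" .
      moreover have "\<phi> (e (s - r) y) = 0"
        using y s True by (simp add: N'_def of_nat_diff)
      ultimately show ?thesis by (simp add: phi)
    next
      case False
      have "e s (f r y) = 0"
        unfolding ef[OF yV] using zero False by (intro sum.neutral) (auto simp: op_zero UA_simps)
      then show ?thesis by (simp add: phi_0)
    qed
  qed
  ultimately show ?thesis using gw_f[OF gw] by (auto simp: N'_def)
qed

text \<open>Together with \<open>e_f_x_z\<close>: in the 2x2 matrix pairing F^(s+k0+1) x and F^(s) w
  (k0 for \<open>k\<^sub>0\<close>) with the two functionals, both off-diagonal entries are this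
  binomial, nonzero for s < \<open>k\<^sub>1 * l\<close>.\<close>

lemma e_f_w_top: "e (s + Suc k\<^sub>0) (f s w) = B (int k\<^sub>1 * int l - 1) s *s x"
proof -
  let ?t = "s + Suc k\<^sub>0"
  have "e ?t (f s w) = (\<Sum>i\<le>s. f (s - i) (hb (2 * int i - int ?t - int s) i (e (?t - i) w)))"
    unfolding ef[OF w_V] by (simp add: min_absorb2)
  also have "\<dots> = (\<Sum>i\<le>s. if i = s then hb (2 * int s - int ?t - int s) s x else 0)"
  proof (intro sum.cong refl)
    fix i assume i: "i \<in> {..s}"
    show "f (s - i) (hb (2 * int i - int ?t - int s) i (e (?t - i) w)) = (if i = s then hb (2 * int s - int ?t - int s) s x else 0)"
    proof (cases "i = s")
      case True
      then show ?thesis using e_w x_V by (simp add: op_one op_V UA_simps)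
    next
      case False
      have "1 \<le> ?t - i" "\<not> ?t - i \<le> Suc k\<^sub>0" using i False by auto
      from e_mid[OF w_gw this(1)] this(2) have "e (?t - i) w = 0" by metis
      then show ?thesis using False by (simp add: op_zero UA_simps)
    qed
  qed
  also have "\<dots> = hb (- int (Suc k\<^sub>0)) s x" by simp
  also have "\<dots> = B (int k\<^sub>1 * int l - 1) s *s x"
    using int_k by (simp add: tw_hb[OF x_tw])
  finally show ?thesis .
qed

lemma e_f_x_z: "e s (f (s + Suc k\<^sub>0) x) = B (int k\<^sub>1 * int l - 1) s *s z"
  using int_k by (simp add: e_f_x z_def)

text \<open>E w is a multiple d of a vector in the string of x. Applying \<open>e k\<^sub>0\<close>
  determines d, since it turns E w into [\<open>k\<^sub>0\<close> + 1] times
  \<open>e (Suc k\<^sub>0) w\<close>, which is x.\<close>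

lemma e_1_f_w:
  obtains d where "d * B (int k) k\<^sub>0 = N (int (Suc k\<^sub>0))"
    "\<And>s. 1 \<le> s \<Longrightarrow> e 1 (f s w) = (d * B (int (s + k\<^sub>0)) s) *s f (s + k\<^sub>0) x + N (k' + 1 - int s) *s f (s - 1) w"
proof -
  obtain d where d: "e 1 w = d *s f k\<^sub>0 x" using e_mid[OF w_gw, of 1] by auto
  have k0k: "k\<^sub>0 \<le> k" by (simp add: k_eq)
  have "e k\<^sub>0 (e 1 w) = (d * B (int k) k\<^sub>0) *s x"
    by (simp only: d op_scale UA.E_div f_x_V e_f_x_top[OF k0k] scale_scale)
  moreover have "e k\<^sub>0 (e 1 w) = N (int (Suc k\<^sub>0)) *s x"
    using ee[OF w_V, of k\<^sub>0 1] by (simp add: e_w qbinom_Suc_self del: of_nat_Suc E_div_1)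
  ultimately have "(d * B (int k) k\<^sub>0 - N (int (Suc k\<^sub>0))) *s x = 0"
    by (simp add: scale_left_diff_distrib)
  then have 1: "d * B (int k) k\<^sub>0 = N (int (Suc k\<^sub>0))" using x_nonzero by simp
  have "e 1 (f s w) = (d * B (int (s + k\<^sub>0)) s) *s f (s + k\<^sub>0) x + N (k' + 1 - int s) *s f (s - 1) w"
    if s: "1 \<le> s" for s
  proof -
    have "e 1 (f s w) = (\<Sum>t\<le>1. f (s - t) (hb (2 * int t - int 1 - int s) t (e (1 - t) w)))"
      unfolding ef[OF w_V] using s by (simp add: min_absorb1)
    also have "\<dots> = f s (e 1 w) + f (s - 1) (hb (1 - int s) 1 w)"
      using w_V by (simp add: op_one op_V UA_simps del: E_div_1)
    also have "f s (e 1 w) = (d * B (int (s + k\<^sub>0)) s) *s f (s + k\<^sub>0) x"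
      unfolding d using x_V by (simp add: op_scale UA_simps f_x_V ff)
    also have "hb (1 - int s) 1 w = N (k' + 1 - int s) *s w"
      using tw_hb[OF w_tw, of "1 - int s" 1] by (simp add: algebra_simps)
    finally show ?thesis using w_V by (simp add: op_scale UA_simps)
  qed
  with 1 show ?thesis by (rule that)
qed

text \<open>The radical is stable under E and E^(l), which lead to the cases s - 1 and s - l. E
  yields b = 0 if [k' + 1 - s] is nonzero, and E^(l) does if s >= l. One value of s remains and is
  settled by two explicit equations. Once b = 0, the condition with \<open>\<phi>\<close> yields a =
  0.\<close>

lemma nondegenerate:
  assumes "int s \<le> k'" "a *s f (s + Suc k\<^sub>0) x + b *s f s w \<in> N' (k' - 2 * int s)"
  shows "a = 0 \<and> b = 0"
  using assms
proof (induction s arbitrary: a b rule: less_induct)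
  case (less s)
  let ?t = "s + Suc k\<^sub>0"
  let ?y = "a *s f ?t x + b *s f s w"
  have yV: "f ?t x \<in> V" "f s w \<in> V" "a *s f ?t x \<in> V" "b *s f s w \<in> V"
    using f_x_V f_w_V V_simps by auto
  have wt: "int k - 2 * int ?t = k' - 2 * int s" using k_k' by simp
  have s_less: "s < k\<^sub>1 * l"
  proof -
    have "int s < int (k\<^sub>1 * l)" using less.prems(1) by (simp add: k'_eq)
    then show ?thesis by (simp only: of_nat_less_iff)
  qed
  have C: "B (int k\<^sub>1 * int l - 1) s \<noteq> 0" using B_top_nonzero[OF s_less] .
  have ey: "e ?t ?y = 0" and phi_y: "\<phi> (e s ?y) = 0"
    using less.prems(2) wt by (auto simp: N'_def)
  have a0: "a = 0" if "b = 0"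
  proof -
    have "e s ?y = (a * B (int k\<^sub>1 * int l - 1) s) *s z"
      using that yV by (simp add: op_scale UA_simps e_f_x_z del: add_Suc_right)
    then show ?thesis using phi_y C by (simp add: phi)
  qed
  show ?case
  proof (cases "s = 0")
    case True
    \<comment> \<open>At s = 0 the operator kills z and sends w to x.\<close>
    have "e ?t ?y = b *s x"
      using True yV e_z[of "Suc k\<^sub>0"] w_V by (simp add: op_add op_scale UA_simps V_simps op_one e_w flip: z_def)
    then have "b = 0" using ey x_nonzero by simp
    then show ?thesis using a0 by simp
  next
    case False
    then have s1: "1 \<le> s" by simp
    obtain d where d: "d * B (int k) k\<^sub>0 = N (int (Suc k\<^sub>0))"
      "\<And>s. 1 \<le> s \<Longrightarrow> e 1 (f s w) = (d * B (int (s + k\<^sub>0)) s) *s f (s + k\<^sub>0) x + N (k' + 1 - int s) *s f (s - 1) w"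
      using e_1_f_w by blast
    have e1x: "e 1 (f ?t x) = N (int k\<^sub>1 * int l - int s) *s f (s + k\<^sub>0) x"
      using e_f_x[of 1 ?t] int_k by (simp add: algebra_simps)
    have "e 1 ?y = (a * N (int k\<^sub>1 * int l - int s) + b * (d * B (int (s + k\<^sub>0)) s)) *s f (s - 1 + Suc k\<^sub>0) x
       + (b * N (k' + 1 - int s)) *s f (s - 1) w"
      using yV s1 by (simp add: op_add op_scale UA_simps e1x d(2) scale_right_distrib scale_left_distrib
          del: E_div_1 One_nat_def add_Suc_right)
    moreover have "e 1 ?y \<in> N' (k' - 2 * int (s - 1))"
      using N'_e[OF less.prems(2), of 1] s1 by (simp add: of_nat_diff algebra_simps)
    ultimately have mem: "(a * N (int k\<^sub>1 * int l - int s) + b * (d * B (int (s + k\<^sub>0)) s)) *s f (s - 1 + Suc k\<^sub>0) x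
       + (b * N (k' + 1 - int s)) *s f (s - 1) w \<in> N' (k' - 2 * int (s - 1))" by (simp only:)
    have "s - 1 < s" "int (s - 1) \<le> k'" using s1 less.prems(1) by linarith+
    from less.IH[OF this mem]
    have eq: "a * N (int k\<^sub>1 * int l - int s) + b * (d * B (int (s + k\<^sub>0)) s) = 0 \<and> b * N (k' + 1 - int s) = 0" .
    show ?thesis
    proof (cases "N (k' + 1 - int s) = 0")
      case False
      then show ?thesis using eq a0 by simp
    next
      case N0: True
      show ?thesis
      proof (cases "l \<le> s")
        case True
        obtain c where c: "e l (f s w) = c *s f (s + Suc k\<^sub>0 - l) x + B (k' + int l - int s) l *s f (s - l) w"
          using e_f_w[of l s] True by auto
        have st: "s + Suc k\<^sub>0 - l = s - l + Suc k\<^sub>0" using True by simp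
        have "e l ?y = (a * B (int k + int l - int ?t) l + b * c) *s f (s - l + Suc k\<^sub>0) x
           + (b * B (k' + int l - int s) l) *s f (s - l) w"
          using yV True e_f_x[of l ?t] unfolding st[symmetric]
          by (simp add: op_add op_scale UA_simps c scale_right_distrib scale_left_distrib)
        moreover have "e l ?y \<in> N' (k' - 2 * int (s - l))"
          using N'_e[OF less.prems(2), of l] True by (simp add: of_nat_diff algebra_simps)
        ultimately have mem: "(a * B (int k + int l - int ?t) l + b * c) *s f (s - l + Suc k\<^sub>0) x
           + (b * B (k' + int l - int s) l) *s f (s - l) w \<in> N' (k' - 2 * int (s - l))" by (simp only:)
        have "s - l < s" "int (s - l) \<le> k'" using True l_ge less.prems(1) by linarith+
        from less.IH[OF this mem] have "b * B (k' + int l - int s) l = 0" by simp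
        \<comment> \<open>Since s <= k', the quotient of k' + l - s by l is at least 1, and
          \<open>B_l_eq_0\<close> applies.\<close>
        moreover have "B (k' + int l - int s) l \<noteq> 0"
        proof -
          have "(k' - int s + int l) div int l = (k' - int s) div int l + 1"
            using l_ge by simp
          moreover have "0 \<le> (k' - int s) div int l"
            using less.prems(1) l_ge by (simp add: pos_imp_zdiv_nonneg_iff)
          moreover have "k' + int l - int s = k' - int s + int l" by simp
          ultimately show ?thesis by (simp only: B_l_eq_0)
        qed
        ultimately show ?thesis using a0 by simp
      next
        case False
        have "int l dvd k' + 1 - int s" using N0 by (simp add: N_eq_0)
        then have "int l dvd int k\<^sub>1 * int l - (k' + 1 - int s)" by (rule dvd_diff[OF dvd_triv_right])
        \<comment> \<open>As k' + 1 - s = \<open>k\<^sub>1 * l\<close> - (s +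
          \<open>k\<^sub>0\<close> + 1), l divides \<open>?t\<close>, which lies strictly between 0
          and 2l and hence equals l.\<close>
        then have "int l dvd int ?t" by (simp add: k'_eq algebra_simps)
        then have "l dvd ?t" by (simp only: of_nat_dvd_iff)
        then obtain m where m: "?t = l * m" by (auto simp: dvd_def)
        have "?t < l * 2" using False k0_le by simp
        then have "m < 2" using m by simp
        moreover have "m \<noteq> 0" using m by (intro notI) simp
        ultimately have "m = 1" by simp
        then have tl: "?t = l" using m by simp
        then have sl: "s < l" "int s = int l - 1 - int k\<^sub>0" by linarith+
        \<comment> \<open>For \<open>k\<^sub>1\<close> = 1 the bound s <= k' = l - 2 -
          \<open>k\<^sub>0\<close> contradicts s = l - 1 - \<open>k\<^sub>0\<close>.\<close>
        have k1: "2 \<le> k\<^sub>1"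
        proof (rule ccontr)
          assume "\<not> 2 \<le> k\<^sub>1"
          then have "k\<^sub>1 = 1" using k1_pos by simp
          then show False using less.prems(1) sl by (simp add: k'_eq)
        qed
        define n where "n = N (int (Suc k\<^sub>0))"
        have n0: "n \<noteq> 0" unfolding n_def using k0_le by (intro N_Suc_nonzero) simp
        define \<epsilon>\<^sub>1 :: 'k where "\<epsilon>\<^sub>1 = (- 1) powi (int k\<^sub>1 - 1)"
        have \<epsilon>1: "\<epsilon>\<^sub>1 = 1 \<or> \<epsilon>\<^sub>1 = - 1" unfolding \<epsilon>\<^sub>1_def by (rule minus_one_powi_cases)
        have N1: "N (int k\<^sub>1 * int l - int s) = \<epsilon>\<^sub>1 * n"
        proof -
          have "int k\<^sub>1 * int l - int s = int l * (int k\<^sub>1 - 1) + int (Suc k\<^sub>0)"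
            using sl(2) by (simp add: algebra_simps)
          then show ?thesis by (simp only: N_add_mult_l \<epsilon>\<^sub>1_def n_def)
        qed
        define \<epsilon>\<^sub>2 :: 'k where "\<epsilon>\<^sub>2 = ((- 1) powi int k\<^sub>1) ^ k\<^sub>0"
        have \<epsilon>2: "\<epsilon>\<^sub>2 = 1 \<or> \<epsilon>\<^sub>2 = - 1" unfolding \<epsilon>\<^sub>2_def by (rule sign_power_cases)
        have "B (int k) k\<^sub>0 = \<epsilon>\<^sub>2"
          using B_shift[of k\<^sub>0 "int k\<^sub>1" "int k\<^sub>0"] k0_le int_k by (simp add: \<epsilon>\<^sub>2_def mult.commute)
        then have "d * \<epsilon>\<^sub>2 = n" using d(1) by (simp add: n_def)
        then have d\<epsilon>: "d = \<epsilon>\<^sub>2 * n" using \<epsilon>2 by (elim disjE) auto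
        have Bs: "B (int (s + k\<^sub>0)) s = 1"
        proof -
          have "int (s + k\<^sub>0) = int l * 1 - 1" using sl(2) by simp
          then show ?thesis using B_top[OF sl(1), of 1] by (simp only:) simp
        qed
        have "n * (\<epsilon>\<^sub>1 * a + \<epsilon>\<^sub>2 * b) = 0"
          using eq unfolding N1 d\<epsilon> Bs by (simp add: algebra_simps)
        then have ab: "\<epsilon>\<^sub>1 * a + \<epsilon>\<^sub>2 * b = 0" using n0 by simp
        define \<epsilon>\<^sub>3 where "\<epsilon>\<^sub>3 = B (int k\<^sub>1 * int l - 1) s"
        have \<epsilon>3: "\<epsilon>\<^sub>3 = 1 \<or> \<epsilon>\<^sub>3 = - 1"
          unfolding \<epsilon>\<^sub>3_def using B_top[OF sl(1), of "int k\<^sub>1"] minus_one_powi_cases[of "int k\<^sub>1"]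
          by (auto simp: mult.commute minus_one_power_iff)
        define \<epsilon>\<^sub>4 :: 'k where "\<epsilon>\<^sub>4 = (- 1) powi (int k + 1)"
        have \<epsilon>4: "\<epsilon>\<^sub>4 = 1 \<or> \<epsilon>\<^sub>4 = - 1" unfolding \<epsilon>\<^sub>4_def by (rule minus_one_powi_cases)
        have "int k div int l = int k\<^sub>1"
          using k0_le int_k by (intro int_div_pos_eq[of _ _ _ "int k\<^sub>0"]) auto
        then have Bk: "B (int k) ?t = \<epsilon>\<^sub>4 * of_nat k\<^sub>1"
          unfolding tl by (simp add: B_l \<epsilon>\<^sub>4_def)
        have "?t \<le> k" using tl k1_pos k_eq by (simp add: trans_le_add1)
        then have "e ?t ?y = (a * (\<epsilon>\<^sub>4 * of_nat k\<^sub>1) + b * \<epsilon>\<^sub>3) *s x"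
          using yV by (simp add: op_add op_scale UA_simps e_f_x_top Bk e_f_w_top \<epsilon>\<^sub>3_def scale_left_distrib
              del: add_Suc_right)
        then have ab': "a * (\<epsilon>\<^sub>4 * of_nat k\<^sub>1) + b * \<epsilon>\<^sub>3 = 0" using ey x_nonzero by simp
        \<comment> \<open>\<open>ab\<close> comes from E and \<open>ab'\<close> from E^(l), because
          \<open>?t\<close> is l. Every \<epsilon> is a sign, so eliminating a from a nonzero
          solution would give \<open>k\<^sub>1\<close> = 1 or \<open>k\<^sub>1\<close> = -1 in the
          field.\<close>
        have "b = 0"
        proof (rule ccontr)
          assume b: "b \<noteq> 0"
          define \<sigma> where "\<sigma> = - (\<epsilon>\<^sub>1 * \<epsilon>\<^sub>2)"
          have \<sigma>: "\<sigma> = 1 \<or> \<sigma> = - 1" using \<epsilon>1 \<epsilon>2 by (auto simp: \<sigma>_def)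
          have "\<epsilon>\<^sub>1 * (\<epsilon>\<^sub>1 * a + \<epsilon>\<^sub>2 * b) = 0" by (simp add: ab)
          moreover have "\<epsilon>\<^sub>1 * \<epsilon>\<^sub>1 = 1" using \<epsilon>1 by auto
          ultimately have "a = \<sigma> * b"
            by (simp add: \<sigma>_def distrib_left add_eq_0_iff2 flip: mult.assoc)
          then have "b * (\<sigma> * \<epsilon>\<^sub>4 * of_nat k\<^sub>1 + \<epsilon>\<^sub>3) = 0" using ab' by (simp add: algebra_simps)
          then have "\<sigma> * \<epsilon>\<^sub>4 * of_nat k\<^sub>1 = - \<epsilon>\<^sub>3" using b by (simp add: add_eq_0_iff2)
          then have "(of_nat k\<^sub>1 :: 'k) = 1 \<or> (of_nat k\<^sub>1 :: 'k) = - 1"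
            using \<sigma> \<epsilon>3 \<epsilon>4 by (elim disjE) (simp_all add: minus_equation_iff[of "of_nat k\<^sub>1"])
          then have "(of_nat (k\<^sub>1 - 1) :: 'k) = 0 \<or> (of_nat (k\<^sub>1 + 1) :: 'k) = 0"
            using k1_pos by (auto simp: of_nat_diff)
          then show False using char_0 k1 by fastforce
        qed
        then show ?thesis using a0 by simp
      qed
    qed
  qed
qed

text \<open>For |j| > k' and t <= k, either t <= \<open>k\<^sub>0\<close> or t lies between
  \<open>k\<^sub>1 * l\<close> and k. In both cases the last digit of t is at most
  \<open>k\<^sub>0\<close>, so the outer weights behave as in the case of one string.\<close>

lemma low_gw:
  assumes "gw j y" "int k - 2 * int t = j" "k' < \<bar>j\<bar>"
  obtains c where "y = c *s f t x" "t \<le> k \<or> y = 0" "t \<le> k \<Longrightarrow> B (int k) t \<noteq> 0"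
proof -
  obtain t' c where t': "t' \<le> k" "y = c *s f t' x" "y \<noteq> 0 \<Longrightarrow> j = int k - 2 * int t'"
    using gw_span[OF assms(1,3)] by blast
  have B: "B (int k) t \<noteq> 0" if "t \<le> k"
  proof (cases "0 \<le> j")
    case True
    then have "t \<le> k\<^sub>0" using assms(2,3) k_k' by linarith
    then show ?thesis using B_k[of t] that k0_le by simp
  next
    case False
    then have "k\<^sub>1 * l \<le> t"
    proof -
      have "k' < - j" using assms(3) False by simp
      then have "int (k\<^sub>1 * l) \<le> int t"
        unfolding of_nat_mult using assms(2) k'_eq int_k by linarith
      then show ?thesis by (simp only: of_nat_le_iff)
    qed
    then obtain p where p: "t = k\<^sub>1 * l + p" using le_Suc_ex by blast
    then have "p \<le> k\<^sub>0" using that k_eq by simp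
    then have "t mod l \<le> k\<^sub>0" using p k0_le by simp
    then show ?thesis using B_k that by blast
  qed
  show ?thesis
  proof (cases "y = 0")
    case True
    then show ?thesis using that[of 0] B by simp
  next
    case False
    then have "t' = t" using t'(3) assms(2) by auto
    then show ?thesis using that[of c] t' B by simp
  qed
qed

lemma S_cases:
  assumes "y \<in> S j"
  shows "(\<exists>s a b. k' - 2 * int s = j \<and> y = a *s f (s + Suc k\<^sub>0) x + b *s f s w) \<or>
    (\<exists>t a. t \<le> k\<^sub>0 \<and> int k - 2 * int t = j \<and> y = a *s f t x) \<or> y = 0"
proof (cases "\<exists>s. k' - 2 * int s = j")
  case True
  then obtain s where s: "k' - 2 * int s = j" by blast
  then have "{f t x |t. int k - 2 * int t = j} \<union> {f s w |s. k' - 2 * int s = j} = {f (s + Suc k\<^sub>0) x, f s w}"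
  proof -
    have "int k - 2 * int t = j \<longleftrightarrow> t = s + Suc k\<^sub>0" for t using s k_k' by auto
    moreover have "k' - 2 * int s' = j \<longleftrightarrow> s' = s" for s' using s by auto
    ultimately show ?thesis by auto
  qed
  then have "y \<in> span {f (s + Suc k\<^sub>0) x, f s w}" using assms by (simp add: S_def)
  then obtain a b where "y - a *s f (s + Suc k\<^sub>0) x = b *s f s w"
    unfolding span_insert[of "f (s + Suc k\<^sub>0) x" "{f s w}"] span_singleton by blast
  then have "y = a *s f (s + Suc k\<^sub>0) x + b *s f s w" by (simp add: algebra_simps)
  then show ?thesis using s by blast
next
  case nos: False
  then have 0: "{f s w |s. k' - 2 * int s = j} = {}" by auto
  show ?thesis
  proof (cases "\<exists>t. int k - 2 * int t = j")
    case True
    then obtain t where t: "int k - 2 * int t = j" by blast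
    have "t \<le> k\<^sub>0"
    proof (rule ccontr)
      assume "\<not> t \<le> k\<^sub>0"
      then have "k' - 2 * int (t - Suc k\<^sub>0) = j" using t k_k' by (simp add: of_nat_diff)
      then show False using nos by blast
    qed
    moreover have "{f t x |t. int k - 2 * int t = j} = {f t x}" using t by auto
    then have "y \<in> span {f t x}" using assms 0 unfolding S_def by simp
    ultimately show ?thesis using t by (auto simp: span_singleton)
  next
    case False
    then have "{f t x |t. int k - 2 * int t = j} = {}" by auto
    then have "y \<in> span {}" using assms 0 unfolding S_def by simp
    then show ?thesis by simp
  qed
qed

lemma disjoint:
  assumes "y \<in> S j" "y \<in> N' j"
  shows "y = 0"
proof -
  have gw: "gw j y" and ey: "\<And>t. int k - 2 * int t = j \<Longrightarrow> e t y = 0" using assms(2) by (auto simp: N'_def)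
  have low: "y = 0" if tj: "int k - 2 * int t = j" "k' < \<bar>j\<bar>" for t
  proof -
    obtain c where c: "y = c *s f t x" "t \<le> k \<or> y = 0" "t \<le> k \<Longrightarrow> B (int k) t \<noteq> 0"
      using low_gw[OF gw tj] by blast
    show ?thesis
    proof (cases "t \<le> k")
      case True
      have "(c * B (int k) t) *s x = 0"
        using ey[OF tj(1)] by (simp add: c(1) op_scale UA_simps f_x_V e_f_x_top[OF True])
      then show ?thesis using c True x_nonzero by simp
    qed (use c(2) in simp)
  qed
  from S_cases[OF assms(1)] consider
    s a b where "k' - 2 * int s = j" "y = a *s f (s + Suc k\<^sub>0) x + b *s f s w" |
    t where "t \<le> k\<^sub>0" "int k - 2 * int t = j" | "y = 0" by blast
  then show ?thesis
  proof cases
    case (1 s a b)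
    show ?thesis
    proof (cases "int s \<le> k'")
      case True
      then have "a = 0 \<and> b = 0" using nondegenerate[of s a b] 1 assms(2) by simp
      then show ?thesis using 1 by simp
    next
      case False
      then show ?thesis using low[of "s + Suc k\<^sub>0"] 1(1) k_k' k'_nonneg by simp
    qed
  next
    case (2 t)
    then show ?thesis using low[of t] k_k' by simp
  qed
qed

lemma cover:
  assumes y: "gw j y"
  shows "\<exists>a\<in>S j. \<exists>b\<in>N' j. y = a + b"
proof (cases "\<exists>t. int k - 2 * int t = j")
  case False
  then have "y \<in> N' j"
  proof -
    have "\<not> (\<exists>s. k' - 2 * int s = j)"
    proof
      assume "\<exists>s. k' - 2 * int s = j"
      then obtain s where "k' - 2 * int s = j" by blast
      then have "int k - 2 * int (s + Suc k\<^sub>0) = j" using k_k' by simp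
      then show False using False by blast
    qed
    then show ?thesis using False y by (auto simp: N'_def)
  qed
  then show ?thesis using S_closed(1) by (intro bexI[of _ 0] bexI[of _ y]) auto
next
  case True
  then obtain t where t: "int k - 2 * int t = j" by blast
  have yV: "y \<in> V" using y by (rule gw_V)
  show ?thesis
  proof (cases "k' < \<bar>j\<bar>")
    case True
    then obtain c where "y = c *s f t x" using low_gw[OF y t] by blast
    then have "y \<in> S j" using S_f_x[OF t] S_closed by simp
    then show ?thesis using subspace_0[OF N'_subspace] by (intro bexI[of _ y] bexI[of _ 0]) auto
  next
    case False
    then have ts: "Suc k\<^sub>0 \<le> t" using t k_k' by linarith
    define s where "s = t - Suc k\<^sub>0"
    have s: "t = s + Suc k\<^sub>0" "k' - 2 * int s = j" using ts t k_k' by (auto simp: s_def of_nat_diff)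
    have sk: "int s \<le> k'" using s(2) False by linarith
    have uniq: "int k - 2 * int t' = j \<longleftrightarrow> t' = t" "k' - 2 * int s' = j \<longleftrightarrow> s' = s" for t' s'
      using t s(2) by auto
    have ty: "gw (int k) (e t v)" if "gw j v" for v
      using gw_e[OF that, of t] t by (simp add: algebra_simps)
    obtain \<alpha> where \<alpha>: "e t y = \<alpha> *s x" using gw_top[OF ty[OF y]] by blast
    have gx: "gw j (f t x)" and gwf: "gw j (f s w)" using gw_f_x[of t] gw_f_w[of s] t s by auto
    obtain A where A: "e t (f t x) = A *s x" using gw_top[OF ty[OF gx]] by blast
    obtain C where C: "e t (f s w) = C *s x" using gw_top[OF ty[OF gwf]] by blast
    have mem: "a *s f t x + b *s f s w \<in> N' j \<longleftrightarrow> a * A + b * C = 0 \<and> a * \<phi> (e s (f t x)) + b * \<phi> (e s (f s w)) = 0" for a b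
    proof -
      have "gw j (a *s f t x + b *s f s w)" using gx gwf by (intro gw_closed)
      moreover have "e t (a *s f t x + b *s f s w) = (a * A + b * C) *s x"
        using A C f_x_V f_w_V V_simps by (simp add: op_add op_scale UA_simps scale_left_distrib)
      moreover have "\<phi> (e s (a *s f t x + b *s f s w)) = a * \<phi> (e s (f t x)) + b * \<phi> (e s (f s w))"
        using f_x_V f_w_V V_simps by (simp add: op_add op_scale UA_simps phi)
      ultimately show ?thesis using uniq x_nonzero by (auto simp: N'_def)
    qed
    \<comment> \<open>By \<open>mem\<close>, nondegeneracy says that the 2x2 system has trivial
      kernel. It can therefore be solved with the two values of y as right-hand side.\<close>
    obtain a b where ab: "a * A + b * C = \<alpha>" "a * \<phi> (e s (f t x)) + b * \<phi> (e s (f s w)) = \<phi> (e s y)"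
      using linear_system_2[of A C "\<phi> (e s (f t x))" "\<phi> (e s (f s w))" \<alpha> "\<phi> (e s y)"]
        nondegenerate[OF sk] mem unfolding s by metis
    define v where "v = a *s f t x + b *s f s w"
    have vS: "v \<in> S j" unfolding v_def using S_f_x[OF t] S_f_w[OF s(2)] by (intro S_closed)
    have vV: "v \<in> V" using S_gw[OF vS] by (rule gw_V)
    have "e t v = \<alpha> *s x"
      using A C f_x_V f_w_V V_simps ab(1) by (simp add: v_def op_add op_scale UA_simps flip: scale_left_distrib)
    then have "e t (y - v) = 0" using \<alpha> yV vV by (simp add: op_diff UA_simps)
    moreover have "\<phi> (e s v) = \<phi> (e s y)"
      using f_x_V f_w_V V_simps ab(2) by (simp add: v_def op_add op_scale UA_simps phi)
    then have "\<phi> (e s (y - v)) = 0" using yV vV by (simp add: op_diff UA_simps phi_diff)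
    ultimately have "y - v \<in> N' j" using gw_closed(3)[OF y S_gw[OF vS]] uniq by (auto simp: N'_def)
    then show ?thesis using vS by (intro bexI[of _ v] bexI[of _ "y - v"]) auto
  qed
qed

lemma all_S: "gw j y \<Longrightarrow> y \<in> S j"
proof (rule graded_complement[OF S_subspace S_gw S_e S_f N'_subspace _ N'_e N'_f disjoint cover])
  show "x \<in> S (int k)" using S_f_x[of 0] x_V by (simp add: op_one)
  show "gw i v" if "v \<in> N' i" for i v using that by (simp add: N'_def)
qed

lemma proj_case:
  "weight_basis ({..k} <+> {..nat k'})
     (case_sum (\<lambda>t. f t x) (\<lambda>s. f s w)) (case_sum (\<lambda>t. int k - 2 * int t) (\<lambda>s. k' - 2 * int s))"
  (is "weight_basis ?I ?b ?wt")
  unfolding weight_basis_def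
proof (intro conjI allI impI ballI)
  show "finite ?I" by simp
  fix i assume "i \<in> ?I"
  then show "tw (?wt i) (?b i)" using tw_f_x tw_f[OF w_tw] by auto
next
  fix j y assume y: "gw j y"
  let ?J = "{i \<in> ?I. ?wt i = j}"
  have xJ: "f t x \<in> span (?b ` ?J)" if "int k - 2 * int t = j" for t
  proof (cases "t \<le> k")
    case True
    then have "Inl t \<in> ?J" using that by auto
    then show ?thesis by (auto intro!: span_base image_eqI[of _ _ "Inl t"])
  qed (simp add: f_x_zero span_zero)
  have wJ: "f s w \<in> span (?b ` ?J)" if s: "k' - 2 * int s = j" for s
  proof (cases "int s \<le> k'")
    case True
    then have "Inr s \<in> ?J" using that by auto
    then show ?thesis by (auto intro!: span_base image_eqI[of _ _ "Inr s"])
  next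
    case False
    \<comment> \<open>F^(s) w has weight below -k' here. It need not vanish, but only the string of
      x reaches these weights.\<close>
    have t: "int k - 2 * int (s + Suc k\<^sub>0) = j" using s k_k' by simp
    have "k' < \<bar>j\<bar>" using False s k'_nonneg by linarith
    then obtain c where "f s w = c *s f (s + Suc k\<^sub>0) x"
      using low_gw[OF _ t, of "f s w"] gw_f_w[of s] s by blast
    then show ?thesis using xJ[OF t] by (simp add: span_scale)
  qed
  have "S j \<subseteq> span (?b ` ?J)"
    unfolding S_def using xJ wJ by (intro span_minimal subspace_span) auto
  then show "y \<in> span (?b ` ?J)" using all_S[OF y] by blast
next
  fix j c i
  let ?J = "{i \<in> ?I. ?wt i = j}"
  assume sum: "(\<Sum>i\<in>?J. c i *s ?b i) = 0" and i: "i \<in> ?I" "?wt i = j"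
  show "c i = 0"
  proof (cases "\<exists>s. int s \<le> k' \<and> k' - 2 * int s = j")
    case True
    then obtain s where s: "int s \<le> k'" "k' - 2 * int s = j" by blast
    have tk: "s + Suc k\<^sub>0 \<le> k" using s(1) k_k' by linarith
    have J: "?J = {Inl (s + Suc k\<^sub>0), Inr s}"
    proof -
      have t: "int k - 2 * int t = j \<longleftrightarrow> t = s + Suc k\<^sub>0" for t using s k_k' by auto
      have s': "k' - 2 * int s' = j \<longleftrightarrow> s' = s" for s' using s by auto
      have "s \<le> nat k'" using s(1) by linarith
      then have "i \<in> ?J \<longleftrightarrow> i \<in> {Inl (s + Suc k\<^sub>0), Inr s}" for i
        using tk by (cases i) (auto simp only: t s' sum.case mem_Collect_eq InlI InrI
            insert_iff empty_iff atMost_iff Plus_def sum.inject sum.distinct Un_iff image_iff)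
      then show ?thesis by blast
    qed
    have zero: "c (Inl (s + Suc k\<^sub>0)) *s f (s + Suc k\<^sub>0) x + c (Inr s) *s f s w = 0"
      using sum unfolding J by simp
    \<comment> \<open>Independence is nondegeneracy applied to the zero vector, which lies in the
      radical.\<close>
    have "c (Inl (s + Suc k\<^sub>0)) *s f (s + Suc k\<^sub>0) x + c (Inr s) *s f s w \<in> N' (k' - 2 * int s)"
      unfolding zero by (rule subspace_0[OF N'_subspace])
    from nondegenerate[OF s(1) this] have "c (Inl (s + Suc k\<^sub>0)) = 0 \<and> c (Inr s) = 0" .
    moreover have "i \<in> ?J" using i by simp
    then have "i = Inl (s + Suc k\<^sub>0) \<or> i = Inr s" unfolding J by simp
    ultimately show ?thesis by auto
  next
    case False
    then obtain t where t: "i = Inl t" "t \<le> k" "int k - 2 * int t = j"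
      using i k'_nonneg by (auto simp: le_nat_iff)
    have "?J = {i}" using t False k'_nonneg by (auto simp: le_nat_iff)
    then have "c i *s f t x = 0" using sum t(1) by simp
    then show ?thesis using f_x_nonzero[OF t(2)] by simp
  qed
qed

end

section \<open>Modules, Weyl filtrations and dual Weyl filtrations\<close>

abbreviation action :: "'k::field \<Rightarrow> ('k, 'm::ab_group_add) uq_mod \<Rightarrow> uv \<Rightarrow> 'm \<Rightarrow> 'm" where
  "action q M u \<equiv> act M (tensor q u 1)"

lemma (in uq_rep) layer_independent:
  "layer n U U' u \<Longrightarrow> (\<Sum>t\<le>n. c t *s f t u) \<in> U \<Longrightarrow> t \<le> n \<Longrightarrow> c t = 0"
  unfolding layer_def by blast

lemma (in uq_rep) layer_span:
  "layer n U U' u \<Longrightarrow> y \<in> U' \<Longrightarrow> \<exists>c. y - (\<Sum>t\<le>n. c t *s f t u) \<in> U"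
  unfolding layer_def by blast

context root_of_unity
begin

lemma act_tensor:
  fixes M :: "('k, 'm::ab_group_add) uq_mod"
  assumes M: "uq_module q M" and u: "u \<in> UA" and y: "y \<in> space M"
  shows "act M (tensor q u c) y = scale M c (action q M u y)"
    and "act M (tensor q u c) y = action q M u (scale M c y)"
proof -
  have "tensor q u c = tensor q 1 c \<otimes>\<^bsub>Uq q\<^esub> tensor q u 1" "tensor q u c = tensor q u 1 \<otimes>\<^bsub>Uq q\<^esub> tensor q 1 c"
    using tensor_simps(2)[OF UA_one u, of q c 1] tensor_simps(2)[OF u UA_one, of q 1 c] by simp_all
  moreover note car = tensor_simps(1)[OF UA_one UA_one, of q c] tensor_simps(1)[OF u u, of q 1]
  ultimately show "act M (tensor q u c) y = scale M c (action q M u y)"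
    "act M (tensor q u c) y = action q M u (scale M c y)"
    using uq_module_act(4)[OF M car(1) y car(2)] uq_module_act(4)[OF M car(2) y car(1)]
      uq_module_act_const[OF M y] uq_module_act_const[OF M uq_module_act(1)[OF M car(2) y]] by simp_all
qed

lemma uq_module_rep:
  fixes M :: "('k, 'm::ab_group_add) uq_mod"
  assumes M: "uq_module q M"
  shows "uq_rep q l (scale M) (space M) (action q M)"
proof -
  interpret vector_space "scale M" using M by (simp add: uq_module_def)
  note car = tensor_simps(1)[where q = q and c = 1]
  show ?thesis
  proof unfold_locales
    show "subspace (space M)" using M by (simp add: uq_module_def)
    fix u u' x y c p
    assume u: "u \<in> UA" and y: "y \<in> space M"
    show "action q M u y \<in> space M"
      by (rule uq_module_act(1)[OF M car[OF u u] y])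
    show "action q M u (scale M c y) = scale M c (action q M u y)"
      by (rule trans[OF act_tensor(2)[OF M u y, symmetric] act_tensor(1)[OF M u y]])
    show "action q M (uv_const (laurent_eval vv p) * u) y = scale M (laurent_eval q p) (action q M u y)"
      unfolding tensor_simps(4)[OF u u] by (rule act_tensor(1)[OF M u y])
    show "action q M u (x + y) = action q M u x + action q M u y" if "x \<in> space M"
      by (rule uq_module_act(2)[OF M car[OF u u] y that])
    assume u': "u' \<in> UA"
    show "action q M (u + u') y = action q M u y + action q M u' y"
      unfolding tensor_simps(3)[OF u u'] by (rule uq_module_act(3)[OF M car[OF u u] y car[OF u' u']])
    show "action q M (u * u') y = action q M u (action q M u' y)"
      using uq_module_act(4)[OF M car[OF u u] y car[OF u' u']] tensor_simps(2)[OF u u', of q 1 1] by simp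
  next
    fix y assume "y \<in> space M"
    then show "action q M 1 y = y" using uq_module_act_const[OF M, of y 1] by simp
  qed
qed

lemma uq_submodule_iff:
  fixes M :: "('k, 'm::ab_group_add) uq_mod"
  assumes M: "uq_module q M"
  shows "uq_submodule q M L \<longleftrightarrow> uq_rep.submod (scale M) (space M) (action q M) L"
proof -
  interpret uq_rep q l "scale M" "space M" "action q M" by (rule uq_module_rep[OF M])
  show ?thesis
  proof
    assume "uq_submodule q M L"
    then show "submod L"
      using tensor_simps(1)[where q = q and c = 1] by (auto simp: uq_submodule_def submod_def)
  next
    assume L: "submod L"
    have "act M a y \<in> L" if a: "a \<in> carrier (Uq q)" and y: "y \<in> L" for a y
    proof -
      obtain p where p: "p \<in> carrier UA_monoid_alg" "a = tcoset q p"
        using Uq_carrier_cases[OF a] by blast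
      show ?thesis unfolding p(2)
        by (rule uq_module_tcoset_induct[OF M]) (use L p(1) y in \<open>auto simp: submod_def\<close>)
    qed
    then show "uq_submodule q M L" using L by (auto simp: uq_submodule_def submod_def)
  qed
qed

text \<open>Compatibility with scalars is not part of \<open>uq_hom\<close>; it follows because 1
  \<otimes> c acts as c on both modules.\<close>

lemma uq_hom_action:
  fixes M :: "('k, 'm::ab_group_add) uq_mod" and Q :: "('k, 'n::ab_group_add) uq_mod"
  assumes M: "uq_module q M" and Q: "uq_module q Q" and hom: "uq_hom q (M\<lparr>space := L\<rparr>) Q \<phi>"
    and L: "L \<subseteq> space M"
  shows "y \<in> L \<Longrightarrow> \<phi> y \<in> space Q" "x \<in> L \<Longrightarrow> y \<in> L \<Longrightarrow> \<phi> (x + y) = \<phi> x + \<phi> y"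
    "u \<in> UA \<Longrightarrow> y \<in> L \<Longrightarrow> \<phi> (action q M u y) = action q Q u (\<phi> y)"
    "y \<in> L \<Longrightarrow> \<phi> (scale M c y) = scale Q c (\<phi> y)"
proof -
  show Q1: "y \<in> L \<Longrightarrow> \<phi> y \<in> space Q" for y using hom by (simp add: uq_hom_def)
  show "x \<in> L \<Longrightarrow> y \<in> L \<Longrightarrow> \<phi> (x + y) = \<phi> x + \<phi> y" using hom by (simp add: uq_hom_def)
  show "u \<in> UA \<Longrightarrow> y \<in> L \<Longrightarrow> \<phi> (action q M u y) = action q Q u (\<phi> y)"
    using hom tensor_simps(1)[where q = q and c = 1] by (simp add: uq_hom_def)
  show "\<phi> (scale M c y) = scale Q c (\<phi> y)" if y: "y \<in> L"
  proof -
    have "\<phi> (act M (tensor q 1 c) y) = act Q (tensor q 1 c) (\<phi> y)"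
      using hom y tensor_simps(1)[OF UA_one UA_one, of q c] by (simp add: uq_hom_def)
    then show ?thesis
      using uq_module_act_const[OF M, of y c] uq_module_act_const[OF Q Q1[OF y], of c] y L by auto
  qed
qed

section \<open>Weyl modules and Weyl filtrations\<close>

text \<open>A Weyl module is its own filtration with one layer, so the results on the top layer
  apply to it. The bound is -1 because there is no other layer.\<close>

lemma is_weyl_top:
  fixes W :: "('k, 'n::ab_group_add) uq_mod"
  assumes W: "is_weyl q l n W"
  shows "\<exists>x. uq_top q l (scale W) (space W) (action q W) (\<lambda>i. if i = 0 then {0} else space W) [n] (\<lambda>_. x) n 0 (- 1)"
proof -
  have M: "uq_module q W" using W by (simp add: is_weyl_def)
  interpret uq_rep q l "scale W" "space W" "action q W" by (rule uq_module_rep[OF M])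
  define b where "b x = (\<lambda>t::int. if 0 \<le> t \<and> t \<le> int n then act W (tensor q (F_div (nat t)) 1) x else 0)" for x
  obtain x where x: "x \<in> space W" and inj: "inj_on (b x) {0..int n}"
    and ind: "independent (b x ` {0..int n})" and span: "span (b x ` {0..int n}) = space W"
    and K: "\<And>t. t \<in> {0..int n} \<Longrightarrow> kk (b x t) = scale W (q powi (int n - 2 * t)) (b x t)"
    and H: "\<And>t. t \<in> {0..int n} \<Longrightarrow> hb 0 l (b x t) = scale W (B (int n - 2 * t) l) (b x t)"
    and E: "\<And>t. t \<in> {0..int n} \<Longrightarrow> action q W uv_E (b x t) = scale W (N (int n - t + 1)) (b x (t - 1))"
    using W unfolding is_weyl_def Let_def b_def by blast
  have f: "f t x = b x (int t)" if "t \<le> n" for t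
    using that by (simp add: b_def)
  have img: "b x ` {0..int n} = (\<lambda>t. f t x) ` {..n}"
  proof -
    have "{0..int n} = int ` {..n}" by (auto simp: image_iff intro!: bexI[of _ "nat _"])
    then show ?thesis using f by (auto simp: image_image)
  qed
  have inj': "inj_on (\<lambda>t. f t x) {..n}"
  proof (rule inj_onI)
    fix s t assume "s \<in> {..n}" "t \<in> {..n}" "f s x = f t x"
    then show "s = t" using inj_onD[OF inj, of "int s" "int t"] f[of s] f[of t] by simp
  qed
  have x0: "f 0 x = x" using x by (simp add: op_one)
  have bx0: "b x 0 = x" using f[of 0] x0 by simp
  have Kx: "kk x = scale W (q powi int n) x" and Hx: "hb 0 l x = scale W (B (int n) l) x"
    using K[of 0] H[of 0] bx0 by simp_all
  have Ex: "e 1 x = 0" using E[of 0] bx0 by (simp add: b_def)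
  have cas: "action q W casimir x = scale W (cv (int n)) x"
    using op_casimir_primitive[OF x Kx Ex] by (simp add: cv_def)
  have lay: "layer n {0} (space W) x"
    unfolding layer_def
  proof (intro conjI ballI allI impI)
    fix y assume "y \<in> space W"
    then have "y \<in> span ((\<lambda>t. f t x) ` {..n})" using span img by simp
    then obtain c where "y = (\<Sum>v\<in>(\<lambda>t. f t x) ` {..n}. scale W (c v) v)"
      by (auto simp: span_finite)
    then have "y = (\<Sum>t\<le>n. scale W (c (f t x)) (f t x))"
      by (simp add: sum.reindex[OF inj'])
    then show "\<exists>c. y - (\<Sum>t\<le>n. scale W (c t) (f t x)) \<in> {0}" by auto
  next
    fix c t assume *: "(\<Sum>t\<le>n. scale W (c t) (f t x)) \<in> {0}" and t: "t \<le> n"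
    define g where "g v = c (the_inv_into {..n} (\<lambda>t. f t x) v)" for v
    have g: "g (f t x) = c t" if "t \<le> n" for t
      unfolding g_def using the_inv_into_f_f[OF inj', of t] that by simp
    have "(\<Sum>v\<in>(\<lambda>t. f t x) ` {..n}. scale W (g v) v) = (\<Sum>t\<le>n. scale W (c t) (f t x))"
      unfolding sum.reindex[OF inj'] using g by (intro sum.cong) auto
    then have "(\<Sum>v\<in>(\<lambda>t. f t x) ` {..n}. scale W (g v) v) = 0" using * by simp
    moreover have "independent ((\<lambda>t. f t x) ` {..n})" using ind img by simp
    ultimately have "g (f t x) = 0" using t by (intro independentD[of "(\<lambda>t. f t x) ` {..n}" _ g]) auto
    then show "c t = 0" using g t by simp
  next
    fix t assume t: "t \<le> n"
    show "kk (f t x) - scale W (q powi (int n - 2 * int t)) (f t x) \<in> {0}"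
      using K[of "int t"] f[OF t] t by simp
    show "hb 0 l (f t x) - scale W (B (int n - 2 * int t) l) (f t x) \<in> {0}"
      using H[of "int t"] f[OF t] t by simp
    show "action q W casimir (f t x) - scale W (cv (int n)) (f t x) \<in> {0}"
      using x by (simp add: op_casimir_central UA_simps cas op_scale)
  qed (rule x)
  have "gw (int n) x" using x Kx Hx by (intro tw_gw) (simp add: tw_def)
  then show ?thesis
    using lay submod_0 submod_V V_simps
    by (intro exI[of _ x], unfold_locales) auto
qed

text \<open>A highest weight vector of each quotient is lifted along the quotient map, and its
  relations hold modulo the kernel \<open>F i\<close>. The lift need not be a weight vector;
  \<open>wfilt_exists\<close> replaces it by one.\<close>

lemma weyl_filtration_filt:
  fixes M :: "('k, 'm::ab_group_add) uq_mod"
  assumes M: "uq_module q M" and filt: "weyl_filtration q l M ns"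
  shows "\<exists>F u. uq_wfilt q l (scale M) (space M) (action q M) F ns u"
proof -
  interpret M: uq_rep q l "scale M" "space M" "action q M" by (rule uq_module_rep[OF M])
  obtain F where F: "filtration q M F (length ns)"
    and sub: "\<And>i. i < length ns \<Longrightarrow> \<exists>W :: ('k, nat \<Rightarrow> 'k) uq_mod.
           is_weyl q l (ns ! i) W \<and> subquotient_iso q M (F (Suc i)) (F i) W"
    using filt unfolding weyl_filtration_def by blast
  have F_sub: "M.submod (F i)" if "i \<le> length ns" for i
    using F that uq_submodule_iff[OF M] by (simp add: filtration_def)
  have "\<exists>u. M.layer (ns ! i) (F i) (F (Suc i)) u" if i: "i < length ns" for i
  proof -
    let ?n = "ns ! i" and ?L = "F (Suc i)"
    obtain W :: "('k, nat \<Rightarrow> 'k) uq_mod" where W: "is_weyl q l ?n W" "subquotient_iso q M ?L (F i) W"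
      using sub[OF i] by blast
    then obtain \<phi> where hom: "uq_hom q (M\<lparr>space := ?L\<rparr>) W \<phi>" and surj: "\<phi> ` ?L = space W"
      and ker: "{x \<in> ?L. \<phi> x = 0} = F i" by (auto simp: subquotient_iso_def)
    obtain v where "uq_top q l (scale W) (space W) (action q W) (\<lambda>i. if i = 0 then {0} else space W) [?n] (\<lambda>_. v) ?n 0 (- 1)"
      using is_weyl_top[OF W(1)] by blast
    then interpret W: uq_top q l "scale W" "space W" "action q W" "\<lambda>i. if i = 0 then {0} else space W" "[?n]" "\<lambda>_. v" ?n 0 "- 1" .
    have layW: "W.layer ?n {0} (space W) v" using W.F_layer[of 0] by simp
    have MW: "uq_module q W" using W(1) by (simp add: is_weyl_def)
    have L: "?L \<subseteq> space M" "M.submod ?L" using F_sub[of "Suc i"] i by (auto simp: M.submod_def)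
    note \<phi> = uq_hom_action[OF M MW hom L(1)]
    note subL = M.submodD(1)[OF L(2)]
    have closed: "\<And>u y. u \<in> UA \<Longrightarrow> y \<in> ?L \<Longrightarrow> action q M u y \<in> ?L" using L(2) by (auto simp: M.submod_def)
    note sL = M.subspace_0[OF subL] M.subspace_add[OF subL] M.subspace_scale[OF subL] M.subspace_diff[OF subL]
    have phi_diff: "\<phi> (x - y) = \<phi> x - \<phi> y" if "x \<in> ?L" "y \<in> ?L" for x y
      using \<phi>(2)[of "x - y" y] that sL by simp
    have phi_0: "\<phi> 0 = 0" using phi_diff[OF sL(1) sL(1)] by simp
    have phi_sum: "\<phi> (\<Sum>t\<in>T. g t) = (\<Sum>t\<in>T. \<phi> (g t))" if "\<And>t. g t \<in> ?L" for g :: "nat \<Rightarrow> 'm" and T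
      using that by (induction T rule: infinite_finite_induct) (auto simp: phi_0 \<phi>(2) M.subspace_sum[OF subL])
    obtain u where u: "u \<in> ?L" "\<phi> u = v"
      using surj W.x_V unfolding W.x_def by (metis imageE)
    have fL: "M.f t u \<in> ?L" for t using closed u by (simp add: UA.F_div)
    have phi_f: "\<phi> (M.f t u) = W.f t v" for t using \<phi>(3) u by (simp add: UA.F_div)
    have phi_lin: "\<phi> (\<Sum>t\<le>?n. scale M (c t) (M.f t u)) = (\<Sum>t\<le>?n. scale W (c t) (W.f t v))" for c
      using phi_sum[of "\<lambda>t. scale M (c t) (M.f t u)"] fL sL \<phi>(4) phi_f by simp
    have linL: "(\<Sum>t\<le>?n. scale M (c t) (M.f t u)) \<in> ?L" for c
      by (rule M.subspace_sum[OF subL]) (use fL sL in auto)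
    have kerI: "y \<in> F i" if "y \<in> ?L" "\<phi> y = 0" for y using ker that by blast
    have eig: "action q M w (M.f t u) - scale M a (M.f t u) \<in> F i"
      if "w \<in> UA" "action q W w (W.f t v) - scale W a (W.f t v) \<in> {0}" for w t a
      using that fL[of t] closed sL \<phi> phi_f by (intro kerI) (simp_all add: phi_diff)
    have "M.layer ?n (F i) ?L u"
      unfolding M.layer_def
    proof (intro conjI ballI allI impI)
      fix y assume y: "y \<in> ?L"
      then obtain c where "\<phi> y - (\<Sum>t\<le>?n. scale W (c t) (W.f t v)) \<in> {0}"
        using layW \<phi>(1) unfolding W.layer_def by blast
      then have "y - (\<Sum>t\<le>?n. scale M (c t) (M.f t u)) \<in> F i"
        using y linL sL by (intro kerI) (simp_all add: phi_diff phi_lin)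
      then show "\<exists>c. y - (\<Sum>t\<le>?n. scale M (c t) (M.f t u)) \<in> F i" by blast
    next
      fix c t assume "(\<Sum>t\<le>?n. scale M (c t) (M.f t u)) \<in> F i" and t: "t \<le> ?n"
      then have "\<phi> (\<Sum>t\<le>?n. scale M (c t) (M.f t u)) = 0" using ker by blast
      then show "c t = 0" using layW t unfolding phi_lin W.layer_def by blast
    next
      fix t assume t: "t \<le> ?n"
      show "M.kk (M.f t u) - scale M (q powi (int ?n - 2 * int t)) (M.f t u) \<in> F i"
        "M.hb 0 l (M.f t u) - scale M (B (int ?n - 2 * int t) l) (M.f t u) \<in> F i"
        "action q M casimir (M.f t u) - scale M (M.cv (int ?n)) (M.f t u) \<in> F i"
        using layW t unfolding W.layer_def M.cv_def W.cv_def by (auto intro: eig M.UA_simps)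
    qed (rule u)
    then show ?thesis by blast
  qed
  then obtain u where "\<And>i. i < length ns \<Longrightarrow> M.layer (ns ! i) (F i) (F (Suc i)) (u i)" by metis
  then interpret uq_filt q l "scale M" "space M" "action q M" F ns u
    using F F_sub by unfold_locales (auto simp: filtration_def)
  show ?thesis using wfilt_exists by blast
qed

text \<open>The functional dual to the vector \<open>F\<^sup>(\<^sup>n\<^sup>-\<^sup>r\<^sup>)\<close> of \<open>W(n)\<close> is mapped by \<open>E\<^sup>(\<^sup>r\<^sup>)\<close> to a multiple of the
  highest weight vector of \<open>W\<^sup>*(n)\<close>.\<close>

lemma dual_weyl_filtration_lift:
  fixes M :: "('k, 'm::ab_group_add) uq_mod"
  assumes M: "uq_module q M" and dual: "dual_weyl_filtration q l M ms"
    and top: "uq_top q l (scale M) (space M) (action q M) F ns u k i\<^sub>0 k'" and r: "r \<le> k"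
  shows "\<exists>w. uq_rep.gw q l (scale M) (space M) (action q M) (int k - 2 * int r) w \<and>
     action q M (E_div r) w = uq_top.x u i\<^sub>0"
proof -
  interpret uq_top q l "scale M" "space M" "action q M" F ns u k i\<^sub>0 k' by (rule top)
  obtain G where G: "filtration q M G (length ms)"
    and sub: "\<And>i. i < length ms \<Longrightarrow> \<exists>W :: ('k, nat \<Rightarrow> 'k) uq_mod.
           is_weyl q l (ms ! i) W \<and> subquotient_iso q M (G (Suc i)) (G i) (dual_module q W)"
    using dual unfolding dual_weyl_filtration_def by blast
  have G_sub: "submod (G i)" if "i \<le> length ms" for i
    using G that uq_submodule_iff[OF M] by (simp add: filtration_def)
  \<comment> \<open>The layer in which x first appears; there its image is a nonzero functional on a
    Weyl module.\<close>
  obtain i where i: "i < length ms" "x \<in> G (Suc i)" "x \<notin> G i"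
  proof -
    let ?i = "LEAST i. x \<in> G i"
    have "x \<in> G (length ms)" using x_V G by (simp add: filtration_def)
    then have i: "x \<in> G ?i" "?i \<le> length ms" by (rule LeastI, rule Least_le)
    then obtain p where p: "?i = Suc p" using G x_nonzero by (cases ?i) (auto simp: filtration_def)
    then have "x \<notin> G p" using not_less_Least[of p "\<lambda>i. x \<in> G i"] by auto
    then show ?thesis using that[of p] i p by auto
  qed
  let ?L = "G (Suc i)" and ?n = "ms ! i"
  have subs: "submod ?L" "submod (G i)" using G_sub i(1) by auto
  have L: "?L \<subseteq> space M" using subs by (auto simp: submod_def)
  note sL = submodD(1)[OF subs(1)]
  obtain W :: "('k, nat \<Rightarrow> 'k) uq_mod" where W: "is_weyl q l ?n W" "subquotient_iso q M ?L (G i) (dual_module q W)"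
    using sub[OF i(1)] by blast
  then obtain \<psi> where hom: "uq_hom q (M\<lparr>space := ?L\<rparr>) (dual_module q W) \<psi>"
    and surj: "\<psi> ` ?L = space (dual_module q W)" and ker: "{x \<in> ?L. \<psi> x = 0} = G i"
    by (auto simp: subquotient_iso_def)
  obtain v where "uq_top q l (scale W) (space W) (action q W) (\<lambda>i. if i = 0 then {0} else space W) [?n] (\<lambda>_. v) ?n 0 (- 1)"
    using is_weyl_top[OF W(1)] by blast
  then interpret W: uq_top q l "scale W" "space W" "action q W" "\<lambda>i. if i = 0 then {0} else space W" "[?n]" "\<lambda>_. v" ?n 0 "- 1" .
  have vx: "W.x = v" by (simp add: W.x_def)
  have MW: "uq_module q W" using W(1) by (simp add: is_weyl_def)
  have \<psi>_add: "\<psi> (y + y') = \<psi> y + \<psi> y'" if "y \<in> ?L" "y' \<in> ?L" for y y'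
    using hom that by (simp add: uq_hom_def)
  have \<psi>_diff: "\<psi> (y - y') = \<psi> y - \<psi> y'" if "y \<in> ?L" "y' \<in> ?L" for y y'
    using \<psi>_add[of "y - y'" y'] that subspace_diff[OF sL] by simp
  have \<psi>_act: "\<psi> (act M (tensor q a c) y) p = (if p \<in> space W then \<psi> y (act W (tensor q (antipode a) c) p) else 0)"
    if "a \<in> UA" "y \<in> ?L" for a c y p
    using hom that tensor_simps(1)[OF that(1) that(1), of q c]
    by (simp add: uq_hom_def dual_module_def uq_antipode_tensor)
  have \<psi>_space: "\<psi> y \<in> space (dual_module q W)" if "y \<in> ?L" for y
    using surj that by blast
  have \<psi>_lin: "\<psi> y (p + p') = \<psi> y p + \<psi> y p'" "\<psi> y (scale W c p) = c * \<psi> y p"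
    if "y \<in> ?L" "p \<in> space W" "p' \<in> space W" for y p p' c
    using \<psi>_space[OF that(1)] that by (simp_all add: dual_module_def)
  have \<psi>_out: "\<psi> y p = 0" if "y \<in> ?L" "p \<notin> space W" for y p
    using \<psi>_space[OF that(1)] that by (simp_all add: dual_module_def)
  have \<psi>_scale: "\<psi> (scale M c y) = (\<lambda>p. c * \<psi> y p)" if y: "y \<in> ?L" for c y
  proof
    fix p
    have "scale M c y = act M (tensor q 1 c) y" using uq_module_act_const[OF M] y L by auto
    then have "\<psi> (scale M c y) p = (if p \<in> space W then \<psi> y (scale W c p) else 0)"
      using \<psi>_act[OF UA_one y, of c p] uq_module_act_const[OF MW, of p c] by (simp add: antipode_one)
    then show "\<psi> (scale M c y) p = c * \<psi> y p"
      using \<psi>_lin(2)[OF y] \<psi>_out[OF y] by auto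
  qed
  have kkW: "(W.ki ^^ m) p = scale W (q powi (- (j * int m))) p" "(W.kk ^^ m) p = scale W (q powi (j * int m)) p"
    if "W.tw j p" for m j p
  proof -
    have p: "p \<in> space W" "W.kk p = scale W (q powi j) p" using that by (auto simp: W.tw_def)
    note ki = W.ki_weight[OF p]
    show "(W.ki ^^ m) p = scale W (q powi (- (j * int m))) p"
      using p ki by (induction m) (simp_all add: W.op_scale UA.K_inv power_int_add[symmetric] algebra_simps)
    show "(W.kk ^^ m) p = scale W (q powi (j * int m)) p"
      using p by (induction m) (simp_all add: W.op_scale UA.K power_int_add[symmetric] algebra_simps)
  qed
  have tw_fv: "W.tw (int ?n - 2 * int t) (W.f t v)" for t using W.tw_f_x[of t] by (simp add: vx)
  have fvW: "W.f t v \<in> space W" for t using tw_fv by (rule W.tw_V)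
  have laur: "(- 1) ^ m * vv powi j \<in> laurents" for m j
    by (intro laurents_closed)
  have sp: "specialise q ((- 1) ^ m * vv powi j) \<noteq> 0" for m j
  proof -
    have "specialise q ((- 1) ^ m) = (- 1) ^ m"
      by (induction m) (simp_all add: specialise' laurents_closed sign_power_in_laurents)
    then show ?thesis by (simp only: specialise' laurents_closed) simp
  qed
  \<comment> \<open>The antipode of E^(m) is a unit times K^-m E^(m). The unit and the power of q
    produced by K^-m are hidden in the nonzero c.\<close>
  have ae: "\<exists>c. c \<noteq> 0 \<and> action q W (antipode (E_div m)) (W.f t v) =
      (if m \<le> t then scale W (c * B (int ?n + int m - int t) m) (W.f (t - m) v) else 0)" for m t
  proof -
    let ?g = "(- 1) ^ m * vv powi (int m * (int m - 1))"
    have "action q W (antipode (E_div m)) (W.f t v) = scale W (specialise q ?g) ((W.ki ^^ m) (W.e m (W.f t v)))"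
      unfolding antipode_E_div using fvW
      by (simp add: W.op_const laur UA.mult UA_power UA.K_inv UA.E_div W.op_mult W.op_power W.op_V)
    moreover have "W.e m (W.f t v) = (if m \<le> t then scale W (B (int ?n + int m - int t) m) (W.f (t - m) v) else 0)"
      using W.e_f_x[of m t] by (simp add: vx)
    moreover have ki0: "(W.ki ^^ m) 0 = 0" by (induction m) (simp_all only: funpow.simps comp_apply id_apply W.op_zero[OF UA.K_inv])
    moreover have "(W.ki ^^ m) (scale W b (W.f (t - m) v)) = scale W (b * q powi (- ((int ?n - 2 * int (t - m)) * int m))) (W.f (t - m) v)" for b
      using kkW(1)[OF W.tw_closed(4)[OF tw_fv]] by simp
    ultimately show ?thesis
      using sp[of m "int m * (int m - 1)"]
      by (intro exI[of _ "specialise q ?g * q powi (- ((int ?n - 2 * int (t - m)) * int m))"])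
        (auto simp: mult_ac)
  qed
  have af: "action q W (antipode (F_div m)) (W.f t v) = 0" if "?n < m" for m t
  proof -
    let ?g = "(- 1) ^ m * vv powi (- (int m * (int m - 1)))"
    have "action q W (antipode (F_div m)) (W.f t v) = scale W (specialise q ?g) (W.f m ((W.kk ^^ m) (W.f t v)))"
      unfolding antipode_F_div using fvW
      by (simp add: W.op_const laur UA.mult UA_power UA.K UA.F_div W.op_mult W.op_power)
    also have "W.f m ((W.kk ^^ m) (W.f t v)) = 0"
    proof -
      have "W.f (m + t) v = 0" using W.f_x_zero[of "m + t"] that by (simp add: vx)
      then show ?thesis
        using kkW(2)[OF tw_fv] fvW W.x_V by (simp add: W.op_scale UA.F_div W.ff vx)
    qed
    finally show ?thesis by (simp only: W.scale_zero_right)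
  qed
  have ext: "g = g'" if gg: "g \<in> space (dual_module q W)" "g' \<in> space (dual_module q W)"
    and eq: "\<And>t. t \<le> ?n \<Longrightarrow> g (W.f t v) = g' (W.f t v)" for g g'
  proof
    fix p
    have lin: "h (p + p') = h p + h p'" "h (scale W c p) = c * h p"
      if "h \<in> space (dual_module q W)" "p \<in> space W" "p' \<in> space W" for h p p' c
      using that by (simp_all add: dual_module_def)
    have sum: "h (\<Sum>t\<in>T. scale W (c t) (W.f t v)) = (\<Sum>t\<in>T. c t * h (W.f t v))"
      if h: "h \<in> space (dual_module q W)" and T: "finite T" for h and T :: "nat set" and c
      using T
    proof (induction T)
      case empty
      have "h 0 = 0"
        using lin(2)[OF h W.V_simps(1) W.V_simps(1), of 0] by (simp only: W.scale_zero_right mult_zero_left)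
      then show ?case by (simp only: sum.empty)
    next
      case (insert t T)
      have S: "(\<Sum>t\<in>T. scale W (c t) (W.f t v)) \<in> space W" using fvW by (intro W.V_simps)
      show ?case
        unfolding sum.insert[OF insert.hyps] lin(1)[OF h W.V_simps(3)[OF fvW] S] lin(2)[OF h fvW fvW] insert.IH
        by (rule refl)
    qed
    show "g p = g' p"
    proof (cases "p \<in> space W")
      case True
      then obtain c where "p - (\<Sum>t\<le>?n. scale W (c t) (W.f t v)) \<in> {0}"
        using W.F_layer[of 0] unfolding W.layer_def by auto
      then have "p = (\<Sum>t\<le>?n. scale W (c t) (W.f t v))" by simp
      then show ?thesis using sum[OF gg(1), of "{..?n}" c] sum[OF gg(2), of "{..?n}" c] eq by simp
    next
      case False
      then show ?thesis using gg by (simp add: dual_module_def)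
    qed
  qed
  have zero_space: "(\<lambda>_. 0) \<in> space (dual_module q W)" by (simp add: dual_module_def)
  have B_cancel: "B (int ?n + int m - int ?n) m = 1" for m
    using B_self[of m] by (simp only: add_diff_cancel_left')
  \<comment> \<open>F^(t) v is a nonzero multiple of S(E^(n-t)) F^(n) v, the binomial there being 1,
    while E^(n-t) x = 0. So \<open>\<psi> x\<close> lives on the lowest basis vector only.\<close>
  have \<psi>x: "\<psi> x (W.f t v) = 0" if t: "t < ?n" for t
  proof -
    let ?m = "?n - t"
    obtain c where c: "c \<noteq> 0" "action q W (antipode (E_div ?m)) (W.f ?n v) =
      (if ?m \<le> ?n then scale W (c * B (int ?n + int ?m - int ?n) ?m) (W.f (?n - ?m) v) else 0)"
      using ae[of ?m ?n] by blast
    moreover have "?m \<le> ?n" "?n - ?m = t" using t by simp_all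
    ultimately have "action q W (antipode (E_div ?m)) (W.f ?n v) = scale W c (W.f t v)"
      by (simp only: B_cancel if_True mult_1_right)
    moreover have "e ?m x = 0" using t by (intro e_x) simp
    then have "\<psi> (e ?m x) (W.f ?n v) = \<psi> 0 (W.f ?n v)" by simp
    moreover have "\<psi> 0 = 0" using \<psi>_diff[OF i(2) i(2)] by simp
    ultimately have "c * \<psi> x (W.f t v) = 0"
      using \<psi>_act[OF UA.E_div i(2), of ?m 1 "W.f ?n v"] fvW \<psi>_lin(2)[OF i(2) fvW fvW, of c t] by simp
    then show ?thesis using c(1) by simp
  qed
  define \<gamma> where "\<gamma> = \<psi> x (W.f ?n v)"
  have \<gamma>: "\<gamma> \<noteq> 0"
  proof
    assume "\<gamma> = 0"
    then have "\<psi> x = (\<lambda>_. 0)"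
      using \<psi>x by (intro ext \<psi>_space i zero_space) (metis \<gamma>_def le_neq_implies_less)
    then have "x \<in> G i" using ker i(2) by (auto simp: zero_fun_def)
    then show False using i(3) by simp
  qed
  \<comment> \<open>For n < k the antipode of F^(k) kills W(n), so F^(k) x would lie in
    \<open>G i\<close>, and with it E^(k) F^(k) x = x.\<close>
  have nk: "k \<le> ?n"
  proof (rule ccontr)
    assume "\<not> k \<le> ?n"
    then have "\<psi> (f k x) (W.f t v) = 0" for t
      using \<psi>_act[OF UA.F_div i(2), of k 1] fvW af[of k t] \<psi>_lin(2)[OF i(2) W.V_simps(1) W.V_simps(1), of 0] by simp
    moreover have fL: "f k x \<in> ?L" using submodD(3)[OF subs(1) UA.F_div i(2)] .
    ultimately have "\<psi> (f k x) = (\<lambda>_. 0)" by (intro ext \<psi>_space zero_space) auto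
    then have "f k x \<in> G i" using ker fL by (auto simp: zero_fun_def)
    then have "e k (f k x) \<in> G i" using submodD(3)[OF subs(2) UA.E_div] by blast
    then show False using i(3) x_V by (simp add: e_f_x op_one)
  qed
  \<comment> \<open>Coordinate functional of F^(n-r) v, well defined because the coordinates are
    unique; r <= n since r <= k <= n.\<close>
  define \<delta> where "\<delta> p = (if p \<in> space W then (THE a. \<exists>c. p = (\<Sum>t\<le>?n. scale W (c t) (W.f t v)) \<and> a = c (?n - r)) else 0)" for p
  have layW: "W.layer ?n {0} (space W) v" using W.F_layer[of 0] by simp
  have \<delta>_sum: "\<delta> (\<Sum>t\<le>?n. scale W (c t) (W.f t v)) = c (?n - r)" for c
  proof -
    let ?p = "\<lambda>c. \<Sum>t\<le>?n. scale W (c t) (W.f t v)"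
    have "?p c \<in> space W" using fvW by (intro W.V_simps)
    moreover have "(THE a. \<exists>c'. ?p c = ?p c' \<and> a = c' (?n - r)) = c (?n - r)"
    proof (rule the_equality)
      fix a assume "\<exists>c'. ?p c = ?p c' \<and> a = c' (?n - r)"
      then obtain c' where c': "?p c = ?p c'" "a = c' (?n - r)" by blast
      then have "?p (\<lambda>t. c t - c' t) \<in> {0}"
        by (simp add: W.scale_left_diff_distrib sum_subtractf)
      from W.layer_independent[OF layW this, of "?n - r"] have "c (?n - r) - c' (?n - r) = 0"
        by (simp only: diff_le_self)
      then show "a = c (?n - r)" using c'(2) by simp
    qed blast
    ultimately show ?thesis by (simp add: \<delta>_def)
  qed
  have coords: "\<exists>c. p = (\<Sum>t\<le>?n. scale W (c t) (W.f t v))" if p: "p \<in> space W" for p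
  proof -
    obtain c where "p - (\<Sum>t\<le>?n. scale W (c t) (W.f t v)) \<in> {0}"
      using W.layer_span[OF layW p] by (rule exE)
    from singletonD[OF this] have eq: "p = (\<Sum>t\<le>?n. scale W (c t) (W.f t v))"
      by (rule eq_iff_diff_eq_0[THEN iffD2])
    show ?thesis by (rule exI[of _ c]) (rule eq)
  qed
  have \<delta>_space: "\<delta> \<in> space (dual_module q W)"
  proof -
    have "\<delta> (p + p') = \<delta> p + \<delta> p'" if p: "p \<in> space W" "p' \<in> space W" for p p'
    proof -
      obtain c where c: "p = (\<Sum>t\<le>?n. scale W (c t) (W.f t v))"
        using coords[OF p(1)] by (rule exE)
      obtain c' where c': "p' = (\<Sum>t\<le>?n. scale W (c' t) (W.f t v))"
        using coords[OF p(2)] by (rule exE)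
      have "p + p' = (\<Sum>t\<le>?n. scale W (c t + c' t) (W.f t v))"
        unfolding c c' by (simp only: W.scale_left_distrib sum.distrib)
      moreover have "\<delta> p = c (?n - r)" "\<delta> p' = c' (?n - r)" unfolding c c' by (rule \<delta>_sum)+
      ultimately show ?thesis by (simp only: \<delta>_sum)
    qed
    moreover have "\<delta> (scale W a p) = a * \<delta> p" if p: "p \<in> space W" for a p
    proof -
      obtain c where c: "p = (\<Sum>t\<le>?n. scale W (c t) (W.f t v))"
        using coords[OF p] by (rule exE)
      have "scale W a p = (\<Sum>t\<le>?n. scale W (a * c t) (W.f t v))"
        unfolding c by (simp only: W.scale_sum_right W.scale_scale)
      moreover have "\<delta> p = c (?n - r)" unfolding c by (rule \<delta>_sum)
      ultimately show ?thesis by (simp only: \<delta>_sum)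
    qed
    moreover have "\<delta> p = 0" if "p \<notin> space W" for p
      using that by (simp only: \<delta>_def if_False)
    ultimately show ?thesis unfolding dual_module_def by simp
  qed
  have \<delta>_f: "\<delta> (W.f t v) = (if t = ?n - r then 1 else 0)" if "t \<le> ?n" for t
  proof -
    have "W.f t v = (\<Sum>s\<le>?n. if s = t then W.f t v else 0)" using that by simp
    also have "\<dots> = (\<Sum>s\<le>?n. scale W (if s = t then 1 else 0) (W.f s v))"
      by (intro sum.cong) auto
    finally have "\<delta> (W.f t v) = \<delta> (\<Sum>s\<le>?n. scale W (if s = t then 1 else 0) (W.f s v))"
      by (rule arg_cong)
    then show ?thesis unfolding \<delta>_sum by auto
  qed
  \<comment> \<open>For a preimage y of \<open>\<delta>\<close>, E^(r) y is a nonzero multiple of x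
    modulo \<open>G i\<close>: for t >= r its value at F^(t) v is \<open>\<delta>\<close> at a
    multiple of F^(t-r) v, nonzero only for t = n; for t < r it is zero.\<close>
  have "\<delta> \<in> \<psi> ` ?L" unfolding surj by (rule \<delta>_space)
  then obtain y where y: "\<delta> = \<psi> y" "y \<in> ?L" by (rule imageE)
  have ey: "e r y \<in> ?L" using submodD(3)[OF subs(1) UA.E_div y(2)] .
  have rn: "r \<le> ?n" using r nk by simp
  have val: "\<psi> (e r y) (W.f t v) = 0" if "t < ?n" for t
  proof -
    obtain c where "action q W (antipode (E_div r)) (W.f t v) =
      (if r \<le> t then scale W (c * B (int ?n + int r - int t) r) (W.f (t - r) v) else 0)"
      using ae[of r t] by blast
    moreover have "\<delta> (scale W b (W.f (t - r) v)) = 0" if "r \<le> t" for b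
      using \<delta>_f[of "t - r"] \<psi>_lin(2)[OF y(2) fvW fvW, of b "t - r"] \<open>t < ?n\<close> that y(1) by auto
    moreover have "\<delta> 0 = 0" using \<psi>_lin(2)[OF y(2) W.V_simps(1) W.V_simps(1), of 0] y(1) by simp
    ultimately show ?thesis
      using \<psi>_act[OF UA.E_div y(2), of r 1 "W.f t v"] fvW y(1) by simp
  qed
  obtain c\<^sub>0 where c0: "c\<^sub>0 \<noteq> 0" "\<psi> (e r y) (W.f ?n v) = c\<^sub>0"
  proof -
    obtain c where c: "c \<noteq> 0" "action q W (antipode (E_div r)) (W.f ?n v) =
      (if r \<le> ?n then scale W (c * B (int ?n + int r - int ?n) r) (W.f (?n - r) v) else 0)"
      using ae[of r ?n] by blast
    then have "action q W (antipode (E_div r)) (W.f ?n v) = scale W c (W.f (?n - r) v)"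
      using rn by (simp only: B_cancel if_True mult_1_right)
    then have "\<psi> (e r y) (W.f ?n v) = c"
      using \<psi>_act[OF UA.E_div y(2), of r 1 "W.f ?n v"] fvW \<psi>_lin(2)[OF y(2) fvW fvW, of c "?n - r"]
        \<delta>_f[of "?n - r"] y(1) by simp
    then show ?thesis using that c(1) by blast
  qed
  define c\<^sub>1 where "c\<^sub>1 = c\<^sub>0 / \<gamma>"
  have c1: "c\<^sub>1 \<noteq> 0" using c0 \<gamma> by (simp add: c\<^sub>1_def)
  have cx: "scale M c\<^sub>1 x \<in> ?L" using subspace_scale[OF sL i(2)] .
  have "\<psi> (e r y) = \<psi> (scale M c\<^sub>1 x)"
  proof (rule ext[OF \<psi>_space[OF ey] \<psi>_space[OF cx]])
    fix t assume "t \<le> ?n"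
    then show "\<psi> (e r y) (W.f t v) = \<psi> (scale M c\<^sub>1 x) (W.f t v)"
      using val[of t] \<psi>x[of t] c0 \<gamma> \<psi>_scale[OF i(2), of c\<^sub>1]
      by (cases "t = ?n") (auto simp: c\<^sub>1_def \<gamma>_def)
  qed
  then have "\<psi> (e r y - scale M c\<^sub>1 x) = 0" using \<psi>_diff[OF ey cx] by simp
  then have dG: "e r y - scale M c\<^sub>1 x \<in> G i" using ker subspace_diff[OF sL ey cx] by blast
  \<comment> \<open>The relation holds only modulo \<open>G i\<close>, and y need not be a weight
    vector. Passing to weight k removes the error: there every vector is a multiple of x, and x is
    not in \<open>G i\<close>.\<close>
  obtain J g where J: "finite J" "\<And>j. j \<in> J \<Longrightarrow> gw j (g j) \<and> g j \<in> ?L" "y = (\<Sum>j\<in>J. g j)"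
    using weight_decomposition[OF subs(1) y(2)] by metis
  obtain J' h where J': "finite J'" "\<And>j. j \<in> J' \<Longrightarrow> gw j (h j) \<and> h j \<in> G i" "e r y - scale M c\<^sub>1 x = (\<Sum>j\<in>J'. h j)"
    using weight_decomposition[OF subs(2) dG] by metis
  define g' where "g' j = (if j - 2 * int r \<in> J then e r (g (j - 2 * int r)) else 0)" for j
  define h' where "h' j = (if j \<in> J' then h j else 0)" for j
  define x' where "x' j = (if j = int k then scale M c\<^sub>1 x else 0)" for j
  let ?I = "(\<lambda>j. j + 2 * int r) ` J \<union> J' \<union> {int k}"
  have fin: "finite ?I" using J(1) J'(1) by simp
  have gw_g': "gw j (g' j)" for j
  proof (cases "j - 2 * int r \<in> J")
    case True
    then show ?thesis using gw_e[of "j - 2 * int r" "g (j - 2 * int r)" r] J(2) by (simp add: g'_def)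
  qed (simp add: g'_def gw_closed)
  have gw_h': "gw j (h' j)" and h'_G: "h' j \<in> G i" for j
    using J'(2) gw_closed(1) subspace_0[OF submodD(1)[OF subs(2)]] by (auto simp: h'_def)
  have gw_x': "gw j (x' j)" for j using x_gw gw_closed by (auto simp: x'_def)
  have sum_g': "(\<Sum>j\<in>?I. g' j) = e r y"
  proof -
    have "e r y = (\<Sum>j\<in>J. e r (g j))"
      unfolding J(3) using J(2) by (intro op_sum UA.E_div) (auto dest: gw_V)
    also have "\<dots> = (\<Sum>j\<in>(\<lambda>j. j + 2 * int r) ` J. g' j)"
      by (subst sum.reindex) (auto simp: g'_def inj_on_def)
    also have "\<dots> = (\<Sum>j\<in>?I. g' j)"
    proof -
      have "g' j = 0" if j: "j \<notin> (\<lambda>j. j + 2 * int r) ` J" for j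
      proof -
        have "j - 2 * int r \<notin> J"
        proof
          assume "j - 2 * int r \<in> J"
          then have "j - 2 * int r + 2 * int r \<in> (\<lambda>j. j + 2 * int r) ` J" by (rule imageI)
          then show False using j by simp
        qed
        then show ?thesis by (simp add: g'_def)
      qed
      then show ?thesis using fin by (intro sum.mono_neutral_left) auto
    qed
    finally show ?thesis by simp
  qed
  have sum_h': "(\<Sum>j\<in>?I. h' j) = (\<Sum>j\<in>J'. h j)"
    using fin by (intro sum.mono_neutral_cong_right) (auto simp: h'_def)
  have sum_x': "(\<Sum>j\<in>?I. x' j) = scale M c\<^sub>1 x"
    unfolding x'_def using fin by simp
  have "g' (int k) - x' (int k) - h' (int k) = 0"
  proof (rule gw_independent[OF fin])
    show "(\<Sum>j\<in>?I. g' j - x' j - h' j) = 0"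
      unfolding sum_subtractf sum_g' sum_h' sum_x' using J'(3) by simp
  qed (use gw_g' gw_h' gw_x' in \<open>auto intro!: gw_closed\<close>)
  then have gk: "g' (int k) - scale M c\<^sub>1 x = h' (int k)" by (simp add: x'_def)
  have "h' (int k) = 0"
  proof -
    obtain b where b: "h' (int k) = scale M b x" using gw_top[OF gw_h'] by blast
    have "b = 0"
    proof (rule ccontr)
      assume "b \<noteq> 0"
      then have "x = scale M (inverse b) (h' (int k))" by (simp add: b)
      then have "x \<in> G i" using subspace_scale[OF submodD(1)[OF subs(2)] h'_G] by simp
      then show False using i(3) by simp
    qed
    then show ?thesis using b by simp
  qed
  then have g'k: "g' (int k) = scale M c\<^sub>1 x" using gk by simp
  then have "int k - 2 * int r \<in> J" using c1 x_nonzero by (auto simp: g'_def split: if_splits)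
  then have gg: "gw (int k - 2 * int r) (g (int k - 2 * int r))"
    and eg: "e r (g (int k - 2 * int r)) = scale M c\<^sub>1 x"
    using J(2) g'k by (auto simp: g'_def)
  have "e r (scale M (inverse c\<^sub>1) (g (int k - 2 * int r))) = x"
    using c1 by (simp add: op_scale[OF UA.E_div gw_V[OF gg]] eg)
  moreover have "gw (int k - 2 * int r) (scale M (inverse c\<^sub>1) (g (int k - 2 * int r)))"
    using gg by (auto intro: gw_closed)
  ultimately show ?thesis by blast
qed

end

section \<open>The characters\<close>

lemma geometric_sum_symmetric:
  fixes X :: "'f::field"
  assumes "X \<noteq> 0"
  shows "(X - inverse X) * (\<Sum>t\<le>n. X powi (int n - 2 * int t)) = X powi (int n + 1) - X powi (- (int n + 1))"
proof -
  have "(X - inverse X) * X powi (int n - 2 * int t) = X powi (int n + 1 - 2 * int t) - X powi (int n + 1 - 2 * int (Suc t))" for t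
  proof -
    have "X * X powi (int n - 2 * int t) = X powi (int n + 1 - 2 * int t)"
      using assms power_int_add_1'[of X "int n - 2 * int t"] by (simp add: algebra_simps)
    moreover have "inverse X * X powi (int n - 2 * int t) = X powi (int n + 1 - 2 * int (Suc t))"
      using assms power_int_add[of X "- 1" "int n - 2 * int t"] by (simp add: algebra_simps power_int_minus)
    ultimately show ?thesis by (simp add: left_diff_distrib)
  qed
  then have "(X - inverse X) * (\<Sum>t<Suc n. X powi (int n - 2 * int t))
     = (\<Sum>t<Suc n. X powi (int n + 1 - 2 * int t) - X powi (int n + 1 - 2 * int (Suc t)))"
    unfolding sum_distrib_left by (intro sum.cong) auto
  also have "\<dots> = X powi (int n + 1) - X powi (int n + 1 - 2 * int (Suc n))"
    by (subst sum_lessThan_telescope') simp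
  also have "int n + 1 - 2 * int (Suc n) = - (int n + 1)" by simp
  finally show ?thesis by (simp only: lessThan_Suc_atMost)
qed

lemma indet_diff_inverse: "indet - inverse indet \<noteq> (0 :: Qv)"
  using qd_eq_0_iff[of 1] by (simp add: qd_def power_int_minus)

context root_of_unity
begin

lemma character_weight_basis:
  fixes M :: "('k, 'm::ab_group_add) uq_mod"
  assumes M: "uq_module q M"
    and "uq_rep.weight_basis q l (scale M) (space M) (action q M) I b wt"
  shows "character q l M X = (\<Sum>i\<in>I. X powi wt i)"
proof -
  interpret uq_rep q l "scale M" "space M" "action q M" by (rule uq_module_rep[OF M])
  have "weight_space q l M j = {y. tw j y}" for j
    by (auto simp: weight_space_def tw_def)
  then show ?thesis
    unfolding character_def using weight_basis_character[OF assms(2), of X] by simp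
qed

end

lemma count_list_1_index:
  assumes "count_list ns k = 1"
  obtains i where "i < length ns" "ns ! i = k" "\<And>j. j < length ns \<Longrightarrow> ns ! j = k \<Longrightarrow> j = i"
proof -
  have "card {i. i < length ns \<and> k = ns ! i} = 1"
    using assms by (simp add: count_list_eq_length_filter length_filter_conv_card)
  then obtain i where "{i. i < length ns \<and> k = ns ! i} = {i}"
    by (rule card_1_singletonE)
  then have *: "j < length ns \<and> k = ns ! j \<longleftrightarrow> j = i" for j by (simp add: set_eq_iff)
  show ?thesis
  proof (rule that)
    show "i < length ns" "ns ! i = k" using *[of i] by simp_all
    show "j = i" if "j < length ns" "ns ! j = k" for j using *[of j] that by simp
  qed
qed

context root_of_unity
begin

section \<open>Characters of the indecomposable tilting modules\<close>

text \<open>The bound k' stays open because it is used twice: with k - 1 to obtain linkage, and then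
  with the sharper bound that linkage provides.\<close>

lemma tilting_indec:
  fixes T :: "('k, 'm::ab_group_add) uq_mod"
  assumes T: "is_T q l k T"
  obtains F ns u i\<^sub>0 where
    "uq_wfilt q l (scale T) (space T) (action q T) F ns u"
    "i\<^sub>0 < length ns" "ns ! i\<^sub>0 = k" "\<And>i. i < length ns \<Longrightarrow> i \<noteq> i\<^sub>0 \<Longrightarrow> ns ! i < k"
    "\<And>k'. (\<And>i. i < length ns \<Longrightarrow> i \<noteq> i\<^sub>0 \<Longrightarrow> int (ns ! i) \<le> k') \<Longrightarrow> k' < int k \<Longrightarrow>
       uq_indec q l (scale T) (space T) (action q T) F ns u k i\<^sub>0 k'"
proof -
  have M: "uq_module q T" and ind: "indecomposable q T"
    using T by (simp_all add: is_T_def tilting_def)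
  obtain ns where ns: "weyl_filtration q l T ns" "count_list ns k = 1" "\<forall>k'>k. k' \<notin> set ns"
    using T unfolding is_T_def by blast
  obtain i\<^sub>0 where i0: "i\<^sub>0 < length ns" "ns ! i\<^sub>0 = k" "\<And>j. j < length ns \<Longrightarrow> ns ! j = k \<Longrightarrow> j = i\<^sub>0"
    using count_list_1_index[OF ns(2)] by blast
  obtain F u where wf: "uq_wfilt q l (scale T) (space T) (action q T) F ns u"
    using weyl_filtration_filt[OF M ns(1)] by blast
  interpret uq_wfilt q l "scale T" "space T" "action q T" F ns u by (rule wf)
  have indec: "L = {0} \<or> L' = {0}"
    if L: "submod L" "submod L'" "L \<inter> L' = {0}" and cover: "\<And>y. y \<in> space T \<Longrightarrow> \<exists>a\<in>L. \<exists>b\<in>L'. y = a + b"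
    for L L'
  proof -
    have "{x + y | x y. x \<in> L \<and> y \<in> L'} = space T"
      using cover L(1,2) V_simps(2) unfolding submod_def by blast
    then show ?thesis
      using ind L uq_submodule_iff[OF M] unfolding indecomposable_def by blast
  qed
  have less: "ns ! i < k" if "i < length ns" "i \<noteq> i\<^sub>0" for i
    using i0(3)[OF that(1)] that ns(3) nth_mem[OF that(1)] by (metis linorder_neqE_nat)
  have "uq_indec q l (scale T) (space T) (action q T) F ns u k i\<^sub>0 k'"
    if other: "\<And>i. i < length ns \<Longrightarrow> i \<noteq> i\<^sub>0 \<Longrightarrow> int (ns ! i) \<le> k'" and less: "k' < int k" for k'
  proof unfold_locales
    show "L = {0} \<or> L' = {0}"
      if "submod L" "submod L'" "L \<inter> L' = {0}" "\<And>y. y \<in> space T \<Longrightarrow> \<exists>a\<in>L. \<exists>b\<in>L'. y = a + b" for L L'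
      by (rule indec[OF that])
  qed (rule i0(1,2) other less; assumption)+
  from that[OF wf i0(1,2) less this] show ?thesis .
qed

lemma character_T_weyl:
  fixes T :: "('k, 'm::ab_group_add) uq_mod"
  assumes T: "is_T q l k T" and k: "k < l \<or> k mod l = l - 1"
  shows "character q l T X = (\<Sum>t\<le>k. X powi (int k - 2 * int t))"
proof -
  have M: "uq_module q T" using T by (simp add: is_T_def tilting_def)
  obtain F ns u i\<^sub>0 where *: "\<And>i. i < length ns \<Longrightarrow> i \<noteq> i\<^sub>0 \<Longrightarrow> ns ! i < k"
    "\<And>k'. (\<And>i. i < length ns \<Longrightarrow> i \<noteq> i\<^sub>0 \<Longrightarrow> int (ns ! i) \<le> k') \<Longrightarrow> k' < int k \<Longrightarrow>
       uq_indec q l (scale T) (space T) (action q T) F ns u k i\<^sub>0 k'"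
    using tilting_indec[OF T] by metis
  have "int (ns ! i) \<le> int k - 1" if "i < length ns" "i \<noteq> i\<^sub>0" for i
    using *(1)[OF that] by simp
  then interpret uq_indec q l "scale T" "space T" "action q T" F ns u k i\<^sub>0 "int k - 1"
    by (intro *(2)) auto
  \<comment> \<open>Either t <= k < l, so the residues are t and k themselves, or the last digit l -
    1 of k is the largest possible.\<close>
  have "B (int k) t \<noteq> 0" if "t \<le> k" for t
  proof (rule B_nonzero[OF that])
    have "t mod l < l" using l_ge by simp
    then show "t mod l \<le> k mod l" using k that by auto
  qed
  from character_weight_basis[OF M weyl_case[OF this]] show ?thesis .
qed

lemma character_T_proj:
  fixes T :: "('k, 'm::ab_group_add) uq_mod"
  assumes T: "is_T q l (k\<^sub>1 * l + k\<^sub>0) T" and k0: "k\<^sub>0 + 2 \<le> l" and k1: "1 \<le> k\<^sub>1"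
  shows "character q l T X = (\<Sum>t\<le>k\<^sub>1 * l + k\<^sub>0. X powi (int (k\<^sub>1 * l + k\<^sub>0) - 2 * int t)) +
     (\<Sum>s\<le>k\<^sub>1 * l - (k\<^sub>0 + 2). X powi (int (k\<^sub>1 * l - (k\<^sub>0 + 2)) - 2 * int s))"
proof -
  define k where "k = k\<^sub>1 * l + k\<^sub>0"
  define k' where "k' = int k\<^sub>1 * int l - 2 - int k\<^sub>0"
  have M: "uq_module q T" using T by (simp add: is_T_def tilting_def)
  obtain ms where dual: "dual_weyl_filtration q l T ms" using T by (auto simp: is_T_def tilting_def)
  obtain F ns u i\<^sub>0 where *: "i\<^sub>0 < length ns" "ns ! i\<^sub>0 = k" "\<And>i. i < length ns \<Longrightarrow> i \<noteq> i\<^sub>0 \<Longrightarrow> ns ! i < k"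
    "\<And>k'. (\<And>i. i < length ns \<Longrightarrow> i \<noteq> i\<^sub>0 \<Longrightarrow> int (ns ! i) \<le> k') \<Longrightarrow> k' < int k \<Longrightarrow>
       uq_indec q l (scale T) (space T) (action q T) F ns u k i\<^sub>0 k'"
    using tilting_indec[OF T[folded k_def]] by metis
  \<comment> \<open>Write n for the highest weight of the layer, n < k. Modulo 2l, n is congruent to
    k or to -k - 2, hence to k or to k', as k + k' + 2 = 2 \<open>k\<^sub>1 * l\<close>. Since k -
    k' = 2 \<open>k\<^sub>0\<close> + 2 is less than 2l, both cases give n <= k'.\<close>
  have link: "int (ns ! i) \<le> k'" if i: "i < length ns" "i \<noteq> i\<^sub>0" for i
  proof -
    have "int (ns ! i) \<le> int k - 1" if "i < length ns" "i \<noteq> i\<^sub>0" for i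
      using *(3)[OF that] by simp
    then interpret uq_indec q l "scale T" "space T" "action q T" F ns u k i\<^sub>0 "int k - 1"
      by (intro *(4)) auto
    have nk: "ns ! i < k" using *(3) i by blast
    have kk': "int k = k' + 2 * int k\<^sub>0 + 2" by (simp add: k_def k'_def)
    have "2 * int l dvd int (ns ! i) - int k \<or> 2 * int l dvd int (ns ! i) + int k + 2"
      using linkage[OF i(1)] by (intro casimir_value_eq) (simp add: cv_def)
    then show ?thesis
    proof
      assume "2 * int l dvd int (ns ! i) - int k"
      then have "2 * int l dvd int k - int (ns ! i)" by (simp add: dvd_diff_commute)
      then have "2 * int l \<le> int k - int (ns ! i)" using nk by (intro zdvd_imp_le) auto
      then show ?thesis using kk' k0 by linarith
    next
      assume "2 * int l dvd int (ns ! i) + int k + 2"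
      then have "2 * int l dvd int (ns ! i) + int k + 2 - 2 * int l * int k\<^sub>1" by (intro dvd_diff) auto
      also have "int (ns ! i) + int k + 2 - 2 * int l * int k\<^sub>1 = int (ns ! i) - k'"
        by (simp add: k_def k'_def)
      finally have dvd: "2 * int l dvd int (ns ! i) - k'" .
      show ?thesis
      proof (rule ccontr)
        assume "\<not> int (ns ! i) \<le> k'"
        then have "2 * int l \<le> int (ns ! i) - k'" using dvd by (intro zdvd_imp_le) auto
        then show False using nk kk' k0 by linarith
      qed
    qed
  qed
  have "k' < int k" by (simp add: k_def k'_def)
  then interpret uq_indec q l "scale T" "space T" "action q T" F ns u k i\<^sub>0 k'
    using link by (intro *(4)) auto
  have "Suc k\<^sub>0 \<le> k" using k0 k1 by (cases k\<^sub>1) (auto simp: k_def)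
  then obtain w where w: "gw (int k - 2 * int (Suc k\<^sub>0)) w" "e (Suc k\<^sub>0) w = x"
    using dual_weyl_filtration_lift[OF M dual uq_top_axioms] by blast
  have "int k - 2 * int (Suc k\<^sub>0) = k'" by (simp add: k_def k'_def)
  then interpret uq_proj q l "scale T" "space T" "action q T" F ns u k i\<^sub>0 k' k\<^sub>0 k\<^sub>1 w
    using w k0 k1 by unfold_locales (simp_all add: k_def k'_def)
  have "k\<^sub>0 + 2 \<le> k\<^sub>1 * l" using k0 k1 mult_le_mono1[OF k1, of l] by linarith
  then have nat: "k' = int (k\<^sub>1 * l - (k\<^sub>0 + 2))" by (simp add: k'_def of_nat_diff)
  have "character q l T X = (\<Sum>i\<in>{..k} <+> {..nat k'}. X powi case_sum (\<lambda>t. int k - 2 * int t) (\<lambda>s. k' - 2 * int s) i)"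
    by (rule character_weight_basis[OF M proj_case])
  then show ?thesis
    unfolding nat k_def by (simp add: sum.Plus)
qed

end

theorem lemma7p1:
  fixes l :: nat and a :: int
    and emb :: "'k::field \<Rightarrow> complex" and q :: 'k
    and k\<^sub>0 k\<^sub>1 :: nat and T :: "('k, 'm::ab_group_add) uq_mod"
  assumes "l \<ge> 3" and "odd l" and "coprime a (int l)"
    and "is_cyclotomic l a emb q"
    and "q ^ (2 * l) = 1" and "\<forall>m. 0 < m \<and> m < 2 * l \<longrightarrow> q ^ m \<noteq> 1"
    and "is_T q l (k\<^sub>1 * l + k\<^sub>0) T"
  shows "let x = indet in
     (k\<^sub>0 \<le> l - 1 \<and> k\<^sub>1 = 0 \<longrightarrow>
       character q l T x = (x powi (int k\<^sub>0 + 1) - x powi (- (int k\<^sub>0 + 1))) / (x - inverse x)) \<and>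
     (k\<^sub>0 = l - 1 \<and> k\<^sub>1 > 0 \<longrightarrow>
       character q l T x =
         (x powi ((int k\<^sub>1 + 1) * int l) - x powi (- ((int k\<^sub>1 + 1) * int l))) / (x - inverse x)) \<and>
     (k\<^sub>0 \<le> l - 2 \<and> k\<^sub>1 > 0 \<longrightarrow>
       character q l T x =
         (x powi (int k\<^sub>0 + 1) + x powi (- (int k\<^sub>0 + 1))) *
           ((x powi (int k\<^sub>1 * int l) - x powi (- (int k\<^sub>1 * int l))) / (x - inverse x)))"
proof -
  interpret root_of_unity q l
  proof
    have "q ^ l * q ^ l = 1" using assms(5) by (simp add: mult_2 power_add)
    moreover have "q ^ l \<noteq> 1" using assms(1,6) by auto
    ultimately show "q ^ l = - 1" by (metis square_eq_1_iff)
    have emb: "emb 1 = 1" "\<And>x y. emb (x + y) = emb x + emb y"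
      using assms(4) by (simp_all add: is_cyclotomic_def)
    then have "emb 0 = 0" using emb(2)[of 0 0] by simp
    then have "emb (of_nat n) = of_nat n" for n by (induction n) (simp_all add: emb)
    then show "n = 0" if "(of_nat n :: 'k) = 0" for n
      using that \<open>emb 0 = 0\<close> by (metis of_nat_eq_0_iff)
  qed (use assms in auto)
  let ?X = "indet"
  have geo: "(\<Sum>t\<le>n. ?X powi (int n - 2 * int t)) = (?X powi (int n + 1) - ?X powi (- (int n + 1))) / (?X - inverse ?X)" for n
    using geometric_sum_symmetric[OF indet_nonzero, of n] indet_diff_inverse by (simp add: field_simps)
  have 1: "character q l T ?X = (?X powi (int k\<^sub>0 + 1) - ?X powi (- (int k\<^sub>0 + 1))) / (?X - inverse ?X)"
    if "k\<^sub>0 \<le> l - 1" "k\<^sub>1 = 0"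
  proof -
    have "k\<^sub>0 < l" using that assms(1) by linarith
    then show ?thesis
      using character_T_weyl[OF assms(7), of ?X] that(2) geo[of k\<^sub>0] by simp
  qed
  have 2: "character q l T ?X =
         (?X powi ((int k\<^sub>1 + 1) * int l) - ?X powi (- ((int k\<^sub>1 + 1) * int l))) / (?X - inverse ?X)"
    if "k\<^sub>0 = l - 1"
  proof -
    have "k\<^sub>0 < l" using that assms(1) by linarith
    then have "(k\<^sub>1 * l + k\<^sub>0) mod l = k\<^sub>0" by simp
    then have "(k\<^sub>1 * l + k\<^sub>0) mod l = l - 1" by (simp only: that)
    moreover have "int (k\<^sub>1 * l + k\<^sub>0) + 1 = (int k\<^sub>1 + 1) * int l"
      using that assms(1) by (simp add: of_nat_diff algebra_simps)
    ultimately show ?thesis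
      using character_T_weyl[OF assms(7), of ?X] geo[of "k\<^sub>1 * l + k\<^sub>0"] by (simp only: simp_thms)
  qed
  have 3: "character q l T ?X = (?X powi (int k\<^sub>0 + 1) + ?X powi (- (int k\<^sub>0 + 1))) *
           ((?X powi (int k\<^sub>1 * int l) - ?X powi (- (int k\<^sub>1 * int l))) / (?X - inverse ?X))"
    if "k\<^sub>0 \<le> l - 2" "k\<^sub>1 > 0"
  proof -
    have k: "k\<^sub>0 + 2 \<le> l" "1 \<le> k\<^sub>1" using that assms(1) by linarith+
    have "k\<^sub>0 + 2 \<le> k\<^sub>1 * l" using k mult_le_mono1[OF k(2), of l] by linarith
    \<comment> \<open>k + 1 and k' + 1 are \<open>k\<^sub>1 * l\<close> plus and minus
      (\<open>k\<^sub>0\<close> + 1), so the numerators of the two Weyl characters add up to the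
      expanded product.\<close>
    then have e: "int (k\<^sub>1 * l + k\<^sub>0) + 1 = int k\<^sub>1 * int l + (int k\<^sub>0 + 1)"
      "int (k\<^sub>1 * l - (k\<^sub>0 + 2)) + 1 = int k\<^sub>1 * int l + - (int k\<^sub>0 + 1)"
      "- (int k\<^sub>1 * int l + (int k\<^sub>0 + 1)) = - (int k\<^sub>1 * int l) + - (int k\<^sub>0 + 1)"
      "- (int k\<^sub>1 * int l + - (int k\<^sub>0 + 1)) = - (int k\<^sub>1 * int l) + (int k\<^sub>0 + 1)"
      by (simp_all add: of_nat_diff)
    have "character q l T ?X =
      (?X powi (int k\<^sub>1 * int l + (int k\<^sub>0 + 1)) - ?X powi (- (int k\<^sub>1 * int l) + - (int k\<^sub>0 + 1))) / (?X - inverse ?X) +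
      (?X powi (int k\<^sub>1 * int l + - (int k\<^sub>0 + 1)) - ?X powi (- (int k\<^sub>1 * int l) + (int k\<^sub>0 + 1))) / (?X - inverse ?X)"
      unfolding character_T_proj[OF assms(7) k] geo e ..
    also have "\<dots> = (?X powi (int k\<^sub>0 + 1) + ?X powi (- (int k\<^sub>0 + 1))) *
           ((?X powi (int k\<^sub>1 * int l) - ?X powi (- (int k\<^sub>1 * int l))) / (?X - inverse ?X))"
      unfolding power_int_add[OF disjI1[OF indet_nonzero]] add_divide_distrib[symmetric] times_divide_eq_right
      by (rule arg_cong[of _ _ "\<lambda>y. y / (?X - inverse ?X)"]) (simp only: distrib_right left_diff_distrib right_diff_distrib ac_simps, simp add: algebra_simps)
    finally show ?thesis .
  qed
  show ?thesis
    unfolding Let_def using 1 2 3 by blast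
qed

end
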